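(* Let $X$ be a Lévy process satisfying (CD), $t>0$, $C$ the convex minorant of $X$ on $[0,t]$, and let $(g_i,d_i)_{i\ge1}$, $(L_i)_{i\ge1}$, $(S_i)_{i\ge0}$ be as in the context (with the stick-breaking sequence independent of $X$). For each excursion interval $(g,d)$ let $e^{(g,d)}(s)=X_{g+s}-C_{g+s}$ for $s\in[0,d-g]$, and for each $i$ let $K^i$ be the Knight bridge $$K^i_s=X_{S_{i-1}+s}-X_{S_{i-1}}-s\,\frac{X_{S_i}-X_{S_{i-1}}}{L_i},\qquad s\in[0,L_i].$$ Then $$\Big(\big(d_i-g_i,\;C_{d_i}-C_{g_i},\;e^{(g_i,d_i)}\big),\ i\ge1\Big)\stackrel{d}{=}\Big(\big(L_i,\;X_{S_i}-X_{S_{i-1}},\;V_{L_i}(K^i)\big),\ i\ge1\Big).$$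
   Context: Hypothesis (CD): for all $t>0$ and $x\in\mathbb{R}$, $\mathbb{P}(X_t=x)=0$. Convex minorant: greatest convex function $C\le X$ on $[0,t]$. Excursion intervals: connected components of $\{s\in(0,t):C_s<X_s\wedge X_{s-}\}$. Given i.i.d. uniform$(0,t)$ variables $(U_i)$ independent of $X$, $(g_1,d_1)$ is the excursion interval containing $U_1$, and $(g_{k+1},d_{k+1})$ is the one containing $U_j$ for the least $j$ with $U_j\notin\bigcup_{m\le k}(g_m,d_m)$. Uniform stick-breaking: $(V_i)$ i.i.d. uniform$(0,1)$ independent of $X$, $L_1=tV_1$, $L_{i+1}=V_{i+1}(t-S_i)$, $S_0=0$, $S_i=L_1+\dots+L_i$. Vervaat transform: for $t>0$ and a càdlàg $f$ on $[0,t]$, let $\underline f(t)$ be the minimum of $f\wedge f_-$ on $[0,t]$, $\rho_t$ the location of the last minimum, and $V_tf(s)=f(\rho_t+s \bmod t)-\underline f(t)$ for $s\in[0,t]$.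
   Formalization: Paths are compared in law through their values at fixed times (0 beyond the length), so the value at the right end point s = d−g is not compared; there the literal claim fails, e.g. for a gamma subordinator, since the Vervaat transform has equal end values while the excursion need not. *)

theory Defs
  imports "HOL-Probability.Probability"
begin

text \<open>Left limit of a path, with the convention f(0-) = f(0) (paths live on [0,infinity)).\<close>
definition lft :: "(real \<Rightarrow> real) \<Rightarrow> real \<Rightarrow> real" where
  "lft f s = (if s \<le> 0 then f s else Lim (at_left s) f)"

definition cadlag :: "(real \<Rightarrow> real) \<Rightarrow> bool" where
  "cadlag f \<longleftrightarrow> (\<forall>s\<ge>0. continuous (at_right s) f) \<and>
                 (\<forall>s>0. \<exists>l. (f \<longlongrightarrow> l) (at_left s))"

definition levy_process :: "'a measure \<Rightarrow> (real \<Rightarrow> 'a \<Rightarrow> real) \<Rightarrow> bool" where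
  "levy_process M X \<longleftrightarrow>
     prob_space M \<and>
     (\<forall>s. X s \<in> borel_measurable M) \<and>
     (\<forall>\<omega>\<in>space M. X 0 \<omega> = 0) \<and>
     (\<forall>\<omega>\<in>space M. cadlag (\<lambda>s. X s \<omega>)) \<and>
     (\<forall>(n::nat) (ts::nat \<Rightarrow> real). 0 \<le> ts 0 \<and> (\<forall>i<n. ts i \<le> ts (Suc i)) \<longrightarrow>
        prob_space.indep_vars M (\<lambda>_. borel) (\<lambda>i \<omega>. X (ts (Suc i)) \<omega> - X (ts i) \<omega>) {..<n}) \<and>
     (\<forall>s h. 0 \<le> s \<and> 0 \<le> h \<longrightarrow>
        distr M borel (\<lambda>\<omega>. X (s + h) \<omega> - X s \<omega>) = distr M borel (X h)) \<and>
     (\<forall>e>0. ((\<lambda>h. measure M {\<omega>\<in>space M. \<bar>X h \<omega>\<bar> > e}) \<longlongrightarrow> 0) (at_right 0))"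

definition hyp_CD :: "'a measure \<Rightarrow> (real \<Rightarrow> 'a \<Rightarrow> real) \<Rightarrow> bool" where
  "hyp_CD M X \<longleftrightarrow> (\<forall>t>0. \<forall>x. measure M {\<omega>\<in>space M. X t \<omega> = x} = 0)"

definition conv_minorant :: "(real \<Rightarrow> real) \<Rightarrow> real \<Rightarrow> real \<Rightarrow> real" where
  "conv_minorant f t s =
     Sup {c s | c. convex_on {0..t} c \<and> (\<forall>u\<in>{0..t}. c u \<le> f u)}"

text \<open>The open set whose connected components are the excursion intervals.\<close>
definition exc_set :: "(real \<Rightarrow> real) \<Rightarrow> real \<Rightarrow> real set" where
  "exc_set f t = {s \<in> {0<..<t}. conv_minorant f t s < min (f s) (lft f s)}"

text \<open>Excursion interval containing u (empty if u lies in none).\<close>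
definition exc_int :: "(real \<Rightarrow> real) \<Rightarrow> real \<Rightarrow> real \<Rightarrow> real set" where
  "exc_int f t u = connected_component_set (exc_set f t) u"

primrec covered :: "(real \<Rightarrow> real) \<Rightarrow> real \<Rightarrow> (nat \<Rightarrow> real) \<Rightarrow> nat \<Rightarrow> real set" where
  "covered f t U 0 = {}"
| "covered f t U (Suc k) =
     covered f t U k \<union> exc_int f t (U (LEAST j. U j \<notin> covered f t U k))"

text \<open>The k-th selected excursion interval (k = 0 is the paper's (g_1,d_1)).\<close>
definition sel_int :: "(real \<Rightarrow> real) \<Rightarrow> real \<Rightarrow> (nat \<Rightarrow> real) \<Rightarrow> nat \<Rightarrow> real set" where
  "sel_int f t U k = exc_int f t (U (LEAST j. U j \<notin> covered f t U k))"

definition sel_g :: "(real \<Rightarrow> real) \<Rightarrow> real \<Rightarrow> (nat \<Rightarrow> real) \<Rightarrow> nat \<Rightarrow> real" where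
  "sel_g f t U k = Inf (sel_int f t U k)"

definition sel_d :: "(real \<Rightarrow> real) \<Rightarrow> real \<Rightarrow> (nat \<Rightarrow> real) \<Rightarrow> nat \<Rightarrow> real" where
  "sel_d f t U k = Sup (sel_int f t U k)"

definition excursion :: "(real \<Rightarrow> real) \<Rightarrow> real \<Rightarrow> real \<Rightarrow> real \<Rightarrow> real \<Rightarrow> real" where
  "excursion f t g d s =
     (if 0 \<le> s \<and> s \<le> d - g then f (g + s) - conv_minorant f t (g + s) else 0)"

text \<open>Uniform stick-breaking (0-based): stick_S t V n = S_n, stick_L t V n = L_(n+1).\<close>
fun stick_S :: "real \<Rightarrow> (nat \<Rightarrow> real) \<Rightarrow> nat \<Rightarrow> real"
and stick_L :: "real \<Rightarrow> (nat \<Rightarrow> real) \<Rightarrow> nat \<Rightarrow> real" where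
  "stick_S t V 0 = 0"
| "stick_S t V (Suc n) = stick_S t V n + stick_L t V n"
| "stick_L t V n = V n * (t - stick_S t V n)"

definition rmod :: "real \<Rightarrow> real \<Rightarrow> real" where
  "rmod x t = x - t * of_int \<lfloor>x / t\<rfloor>"

definition vervaat :: "real \<Rightarrow> (real \<Rightarrow> real) \<Rightarrow> real \<Rightarrow> real" where
  "vervaat t f s =
     (let m = Inf ((\<lambda>u. min (f u) (lft f u)) ` {0..t});
          \<rho> = Sup {u \<in> {0..t}. min (f u) (lft f u) = m}
      in if 0 \<le> s \<and> s \<le> t then f (rmod (\<rho> + s) t) - m else 0)"

definition knight :: "(real \<Rightarrow> real) \<Rightarrow> real \<Rightarrow> real \<Rightarrow> real \<Rightarrow> real" where
  "knight f a l s = f (a + s) - f a - s * (f (a + l) - f a) / l"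

end

(*
The path is sampled on the grid of mesh t / n. For the walk with exchangeable increments obtained in
this way the statement is an exact identity: moving a block of increments to the front preserves the
law, an excursion block can be inserted as a face of the convex minorant of the remaining walk at
exactly one place, and by the cycle lemma exactly one rotation of a block is an excursion. Hence
sampling faces proportionally to their length, removing them one by one, gives the same law as cutting
blocks of uniform length off the walk and rotating each into an excursion.

As n grows, the face containing a uniform point stays macroscopic with high probability, because the
expected number of faces of length k is at most 1 / k; so its limit is a line below the path touching
it at two points. By (CD), almost surely no line below the path touches it at three points: an
increment over a rational gap is diffuse and independent of the path outside the gap. This makes the
limit a true excursion interval, and the same argument shows that a Knight bridge attains its minimum
at a single point, or at both of its end points. Path coordinates do not pass to the limit pointwise
at jumps, so excursions are averaged over [s, s + epsilon] first and epsilon tends to 0 at the end;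
the right end point is irrelevant since the lengths have diffuse laws. That the selection never runs
out of points follows by induction, as the first m lengths have the law of the first m sticks and
thus have sum less than t.
*)

theory Submission
  imports Defs "HOL-Probability.Probability"
begin

text \<open>Tests are products of continuous [0,1]-valued functions of finitely many block
  coordinates: they factor over blocks, as the exact identity requires, and by dominated convergence
  almost sure convergence of the coordinates is enough. Faces are defined by strict inequalities, so
  that ties yield no face instead of a choice; that the faces still fill the grid comes from an
  expectation count. Stick positions are rounded up to the grid, since a cadlag path converges along
  sequences from the right. The two limit variables are not shown to be measurable directly; they
  are almost sure limits of measurable discrete variables, hence the completion of the measure.
  Exceptional events must be measurable in a path seen as a point of an uncountable product, so
  exact contacts are replaced by approximate ones at countably many times and for countably many
  lines. For a Knight bridge the slope itself contains the removed increment, which is why it needs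
  other events than a supporting line.\<close>

abbreviation (input) unif :: "real => real measure" where "unif t \<equiv> uniform_measure lborel {0<..<t}"

abbreviation (input) PiB :: "('i => real) measure" where "PiB \<equiv> PiM UNIV (\<lambda>_. borel)"

abbreviation (input) gp :: "real => nat => nat => real" where "gp t N i \<equiv> real i * t / real N"

section \<open>Faces of the convex minorant of a walk\<close>

definition walk :: "(nat => real) => nat => real" where
  "walk y l = (\<Sum>m<l. y m)"

definition shift_seq :: "nat => (nat => 'a) => nat => 'a" where
  "shift_seq i y m = y (i + m)"

definition skip :: "nat => nat => (nat => 'a) => nat => 'a" where
  "skip i k y m = (if m < i then y m else y (m + k))"

text \<open>A pair is the start and the length of a face. The inequality is strict at every other
  point and cleared of denominators; three collinear contacts therefore produce no face among them,
  and distinct faces have disjoint index ranges.\<close>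

definition faces :: "(nat => real) => nat => (nat \<times> nat) set" where
  "faces w n = {(i, k). 0 < k \<and> i + k \<le> n \<and>
     (\<forall>l\<le>n. l \<noteq> i --> l \<noteq> i + k -->
        (w (i + k) - w i) * (real l - real i) < (w l - w i) * real k)}"

lemma facesD:
  assumes "(i, k) \<in> faces w n"
  obtains \<beta> where "0 < k" "i + k \<le> n" "w (i + k) = w i + \<beta> * real k"
    "\<And>l. l \<le> n ==> l \<noteq> i ==> l \<noteq> i + k ==> w i + \<beta> * (real l - real i) < w l"
proof -
  define \<beta> where "\<beta> = (w (i + k) - w i) / real k"
  have k: "0 < k" "i + k \<le> n" using assms by (auto simp: faces_def)
  have "w i + \<beta> * (real l - real i) < w l" if "l \<le> n" "l \<noteq> i" "l \<noteq> i + k" for l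
  proof -
    have "(w (i + k) - w i) * (real l - real i) < (w l - w i) * real k"
      using assms that by (auto simp: faces_def)
    then show ?thesis using k by (simp add: \<beta>_def field_simps)
  qed
  moreover have "w (i + k) = w i + \<beta> * real k" using k by (simp add: \<beta>_def)
  ultimately show ?thesis using that k by blast
qed

lemma facesI:
  assumes "0 < k" "i + k \<le> n" "w (i + k) = w i + \<beta> * real k"
    "\<And>l. l \<le> n ==> l \<noteq> i ==> l \<noteq> i + k ==> w i + \<beta> * (real l - real i) < w l"
  shows "(i, k) \<in> faces w n"
proof -
  have "(w (i + k) - w i) * (real l - real i) < (w l - w i) * real k"
    if "l \<le> n" "l \<noteq> i" "l \<noteq> i + k" for l
  proof -
    have "real k * (\<beta> * (real l - real i)) < real k * (w l - w i)"
      using assms(4)[OF that] assms(1) by (intro mult_strict_left_mono) auto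
    then show ?thesis using assms(3) by (simp add: algebra_simps)
  qed
  then show ?thesis using assms by (auto simp: faces_def)
qed



text \<open>Compare the two supporting lines through their difference \<open>A\<close>, second minus
  first. It is negative at an end of the first face and positive at an end of the second, unless the
  end is shared. When the ranges overlap, an affine function cannot take these signs in that
  order.\<close>

lemma faces_overlap_aux:
  assumes p: "(i, k) \<in> faces w n" and q: "(i', k') \<in> faces w n"
    and ov: "i < i' + k'" "i' < i + k" and le: "i \<le> i'"
  shows "i = i' \<and> k = k'"
proof -
  obtain \<beta> where b: "0 < k" "i + k \<le> n" "w (i + k) = w i + \<beta> * real k"
    "\<And>l. l \<le> n ==> l \<noteq> i ==> l \<noteq> i + k ==> w i + \<beta> * (real l - real i) < w l"
    using facesD[OF p] by blast
  obtain \<beta>' where b': "0 < k'" "i' + k' \<le> n" "w (i' + k') = w i' + \<beta>' * real k'"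
    "\<And>l. l \<le> n ==> l \<noteq> i' ==> l \<noteq> i' + k' ==> w i' + \<beta>' * (real l - real i') < w l"
    using facesD[OF q] by blast
  define c where "c = (w i' - \<beta>' * real i') - (w i - \<beta> * real i)"
  define s where "s = \<beta>' - \<beta>"
  define A where "A x = c + s * x" for x :: real
  have Ad: "A x = (w i' + \<beta>' * (x - real i')) - (w i + \<beta> * (x - real i))" for x
    by (simp add: A_def c_def s_def algebra_simps)
  have n1: "A (real l) < 0" if "l = i \<or> l = i + k" "l \<noteq> i'" "l \<noteq> i' + k'" for l
    using b'(4)[of l] that b by (auto simp: Ad)
  have n2: "A (real l) > 0" if "l = i' \<or> l = i' + k'" "l \<noteq> i" "l \<noteq> i + k" for l
    using b(4)[of l] that b' by (auto simp: Ad)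

  show ?thesis
  proof (cases "i = i'")
    case True
    show ?thesis
    proof (rule ccontr)
      assume "\<not> ?thesis"
      then have "k \<noteq> k'" using True by auto
      then have "A (real (i + k)) < 0" "A (real (i + k')) > 0"
        using n1[of "i+k"] n2[of "i+k'"] True b b' by auto
      moreover have "A (real i) = 0" using True by (simp add: Ad)
      moreover have "real k * A (real (i + k')) = real k' * (A (real (i + k)) - A (real i)) + real k * A (real i)"
        by (simp add: A_def algebra_simps)
      ultimately have "real k * A (real (i + k')) < 0" using b b' by (simp add: mult_pos_neg)
      with \<open>A (real (i + k')) > 0\<close> show False using b by (simp add: mult_less_0_iff)
    qed
  next
    case False
    then have lt: "i < i'" using le by simp
    have a1: "A (real i) < 0" using n1[of i] lt ov by auto
    have a2: "A (real i') > 0" using n2[of i'] lt ov by auto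
    have s: "s > 0"
    proof (rule ccontr)
      assume "\<not> s > 0"
      then have "s * real i' \<le> s * real i" using lt by (intro mult_left_mono_neg) auto
      then show False using a1 a2 by (simp add: A_def)
    qed
    have "A (real i') < A (real (i + k))" using s ov by (simp add: A_def)
    moreover have "A (real (i + k)) \<le> 0"
    proof (cases "i + k = i' + k'")
      case True
      then have "A (real (i + k)) = w (i' + k') - w (i + k)"
        using Ad[of "real (i + k)"] b(3) b'(3) by (metis add_diff_cancel_left' of_nat_add)
      then show ?thesis using True by simp
    next
      case False
      then show ?thesis using n1[of "i+k"] ov by auto
    qed
    ultimately show ?thesis using a2 by simp
  qed
qed

lemma faces_overlap:
  assumes "(i, k) \<in> faces w n" "(i', k') \<in> faces w n" "i < i' + k'" "i' < i + k"
  shows "i = i' \<and> k = k'"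
  using faces_overlap_aux[OF assms] faces_overlap_aux[OF assms(2,1,4,3)]
  by (cases "i \<le> i'") auto

lemma finite_faces [simp]: "finite (faces w n)"
  by (rule finite_subset[of _ "{..n} \<times> {..n}"]) (auto simp: faces_def)

lemma faces_disjoint: "disjoint_family_on (\<lambda>(i, k). {i..<i + k}) (faces w n)"
proof -
  have "{i..<i + k} \<inter> {i'..<i' + k'} = {}"
    if "(i, k) \<in> faces w n" "(i', k') \<in> faces w n" "(i, k) \<noteq> (i', k')" for i k i' k'
  proof (rule ccontr)
    assume "\<not> ?thesis"
    then have "i < i' + k'" "i' < i + k" by auto
    from faces_overlap[OF that(1,2) this] that(3) show False by simp
  qed
  then show ?thesis unfolding disjoint_family_on_def by (force simp: split_beta)
qed

lemma card_Union_faces: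
  assumes "S \<subseteq> faces w n"
  shows "card (\<Union>(i, k)\<in>S. {i..<i + k}) = sum snd S"
proof -
  have "card (\<Union>p\<in>S. (case p of (i, k) => {i..<i + k})) = (\<Sum>p\<in>S. card (case p of (i, k) => {i..<i + k}))"
    using disjoint_family_on_mono[OF assms faces_disjoint] finite_subset[OF assms finite_faces]
    by (intro card_UN_disjoint) (auto simp: disjoint_family_on_def)
  also have "\<dots> = sum snd S" by (intro sum.cong) auto
  finally show ?thesis .
qed

lemma sum_faces_le: "sum snd (faces w n) \<le> n"
proof -
  have "sum snd (faces w n) = card (\<Union>(i, k)\<in>faces w n. {i..<i + k})"
    using card_Union_faces[of "faces w n" w n] by simp
  also have "\<dots> \<le> card {..<n}" by (intro card_mono) (auto simp: faces_def)
  finally show ?thesis by simp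
qed

text \<open>Since faces are disjoint, equality of lengths already says that they tile the grid. In
  this form the property holds almost surely by computing one expectation, without constructing the
  convex minorant.\<close>

definition full :: "(nat => real) => nat => bool" where
  "full w n \<longleftrightarrow> sum snd (faces w n) = n"

lemma full_cover:
  assumes "full w n"
  shows "(\<Union>(i, k)\<in>faces w n. {i..<i + k}) = {..<n}"
proof (rule card_subset_eq)
  show "card (\<Union>(i, k)\<in>faces w n. {i..<i + k}) = card {..<n}"
    using card_Union_faces[of "faces w n" w n] assms by (simp add: full_def)
qed (auto simp: faces_def)

lemma walk_skip:
  "walk (skip i k y) l = (if l \<le> i then walk y l else walk y (l + k) - (walk y (i + k) - walk y i))"
proof (induction l)
  case (Suc l)
  show ?case
  proof (cases "Suc l \<le> i")
    case True
    then show ?thesis using Suc by (simp add: walk_def skip_def)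
  next
    case False
    then show ?thesis using Suc by (cases "l = i") (auto simp: walk_def skip_def add.commute)
  qed
qed (simp add: walk_def)

definition relabel :: "nat => nat => nat \<times> nat => nat \<times> nat" where
  "relabel i k = (\<lambda>(j, l). (if j < i then j else j - k, l))"

text \<open>Slopes increase strictly from left to right along the faces. Cutting out a face moves
  the part beyond it along a line of that slope, so this part stays on the correct side of the
  supporting line of any other face.\<close>

lemma faces_skip_sub:
  assumes p: "(i, k) \<in> faces (walk y) n" and q: "(i', k') \<in> faces (walk y) n"
    and ne: "(i', k') \<noteq> (i, k)"
  shows "relabel i k (i', k') \<in> faces (walk (skip i k y)) (n - k)"
proof -
  define w where "w = walk y"
  obtain \<beta> where b: "0 < k" "i + k \<le> n" "w (i + k) = w i + \<beta> * real k"
    "\<And>l. l \<le> n ==> l \<noteq> i ==> l \<noteq> i + k ==> w i + \<beta> * (real l - real i) < w l"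
    using facesD[OF p] unfolding w_def by blast
  obtain \<beta>' where b': "0 < k'" "i' + k' \<le> n" "w (i' + k') = w i' + \<beta>' * real k'"
    "\<And>l. l \<le> n ==> l \<noteq> i' ==> l \<noteq> i' + k' ==> w i' + \<beta>' * (real l - real i') < w l"
    using facesD[OF q] unfolding w_def by blast
  have bw: "w i + \<beta> * (real l - real i) \<le> w l" if "l \<le> n" for l
    using b(3) b(4)[OF that] by (cases "l = i \<or> l = i + k") auto
  have bw': "w i' + \<beta>' * (real l - real i') \<le> w l" if "l \<le> n" for l
    using b'(3) b'(4)[OF that] by (cases "l = i' \<or> l = i' + k'") auto
  have ws: "walk (skip i k y) l = (if l \<le> i then w l else w (l + k) - \<beta> * real k)" for l
    using b(3) by (simp add: walk_skip w_def)
  have dis: "i' + k' \<le> i \<or> i + k \<le> i'"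
    using faces_overlap[OF p q] ne by force
  show ?thesis
  proof (cases "i' < i")
    case True
    then have le: "i' + k' \<le> i" using dis by auto
    have "(i', k') \<in> faces (walk (skip i k y)) (n - k)"
    proof (rule facesI[where \<beta> = \<beta>'])
      show "0 < k'" "i' + k' \<le> n - k" using b b' le by auto
      show "walk (skip i k y) (i' + k') = walk (skip i k y) i' + \<beta>' * real k'"
        using le b' by (simp add: ws)
      fix l assume l: "l \<le> n - k" "l \<noteq> i'" "l \<noteq> i' + k'"
      have "w i' + \<beta>' * (real l - real i') < w (l + k) - \<beta> * real k" if "i < l"
      proof -
        have g: "w i' + \<beta>' * (real i - real i') \<le> w i" using bw'[of i] b by simp
        have h: "w i + \<beta> * (real i' - real i) < w i'" using b(4)[of i'] True b b' by simp
        have "(\<beta>' - \<beta>) * (real i - real i') < 0" using g h by (simp add: algebra_simps)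
        then have "\<beta>' < \<beta>" using True by (simp add: mult_less_0_iff)
        then have "\<beta>' * (real l - real i) < \<beta> * (real l - real i)"
          using that by (intro mult_strict_right_mono) auto
        moreover have "w i + \<beta> * (real (l + k) - real i) \<le> w (l + k)"
          using bw[of "l + k"] l that b by simp
        ultimately show ?thesis using g by (simp add: algebra_simps)
      qed
      moreover have "w i' + \<beta>' * (real l - real i') < w l" using b'(4)[of l] l by simp
      ultimately show "walk (skip i k y) i' + \<beta>' * (real l - real i') < walk (skip i k y) l"
        using True by (simp add: ws)
    qed
    then show ?thesis using True by (simp add: relabel_def)
  next
    case False
    then have le: "i + k \<le> i'" using dis b' by auto
    have wi: "walk (skip i k y) (i' - k) = w i' - \<beta> * real k"
      using le b(3) by (cases "i + k = i'") (auto simp: ws)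
    have "(i' - k, k') \<in> faces (walk (skip i k y)) (n - k)"
    proof (rule facesI[where \<beta> = \<beta>'])
      show "0 < k'" "i' - k + k' \<le> n - k" using b b' le by auto
      show "walk (skip i k y) (i' - k + k') = walk (skip i k y) (i' - k) + \<beta>' * real k'"
        using le b' b(1) unfolding wi by (auto simp: ws)
      fix l assume l: "l \<le> n - k" "l \<noteq> i' - k" "l \<noteq> i' - k + k'"
      have "w i' + \<beta>' * (real (l + k) - real i') < w l + \<beta> * real k" if "l \<le> i"
      proof -
        have g: "w i' + \<beta>' * (real (i + k) - real i') \<le> w (i + k)" using bw'[of "i+k"] b by simp
        have h: "w i + \<beta> * (real (i' + k') - real i) < w (i' + k')"
          using b(4)[of "i'+k'"] le b b' by simp
        have "(\<beta> - \<beta>') * (real (i' + k') - real (i + k)) < 0"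
          using g h b(3) b'(3) by (simp add: algebra_simps)
        then have bb: "\<beta> < \<beta>'" using le b' by (simp add: mult_less_0_iff)
        have w1: "w i + \<beta> * (real l - real i) \<le> w l" using bw[of l] that b by simp
        show ?thesis
        proof (cases "l = i")
          case True
          then have "i + k \<noteq> i'" using l le by auto
          then have "w i' + \<beta>' * (real (i + k) - real i') < w (i + k)" using b'(4)[of "i+k"] b le b' by simp
          then show ?thesis using True b(3) by simp
        next
          case False
          then have "\<beta>' * (real l - real i) < \<beta> * (real l - real i)"
            using that bb by (intro mult_strict_right_mono_neg) auto
          then show ?thesis using g w1 b(3) by (simp add: algebra_simps)
        qed
      qed
      moreover have "w i' + \<beta>' * (real (l + k) - real i') < w (l + k)" using b'(4)[of "l+k"] l b le by auto
      moreover have "real (i' - k) = real i' - real k" using le by simp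
      ultimately show "walk (skip i k y) (i' - k) + \<beta>' * (real l - real (i' - k)) < walk (skip i k y) l"
        unfolding wi by (auto simp: ws algebra_simps)
    qed
    then show ?thesis using False by (simp add: relabel_def)
  qed
qed

lemma inj_on_relabel:
  assumes "(i, k) \<in> faces w n"
  shows "inj_on (relabel i k) (faces w n - {(i, k)})"
proof -
  have d: "i' + k' \<le> i \<or> i + k \<le> i'" "k' > 0" if "(i', k') \<in> faces w n - {(i, k)}" for i' k'
    using faces_overlap[OF assms, of i' k'] that by (force simp: faces_def)+
  show ?thesis
  proof (rule inj_onI)
    fix p q assume p: "p \<in> faces w n - {(i, k)}" and q: "q \<in> faces w n - {(i, k)}"
      and e: "relabel i k p = relabel i k q"
    obtain a b a' b' where [simp]: "p = (a, b)" "q = (a', b')" by (cases p, cases q) blast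
    show "p = q" using d[of a b] d[of a' b'] p q e by (auto simp: relabel_def split: if_splits)
  qed
qed

text \<open>Only one inclusion is proved directly. For a full walk the relabelled faces have total
  length \<open>n - k\<close>, the most that \<open>n - k\<close> steps can hold, so no further face
  fits.\<close>

lemma faces_skip:
  assumes p: "(i, k) \<in> faces (walk y) n" and full: "full (walk y) n"
  shows "faces (walk (skip i k y)) (n - k) = relabel i k ` (faces (walk y) n - {(i, k)})"
    and "full (walk (skip i k y)) (n - k)"
proof -
  let ?F = "faces (walk y) n" and ?G = "faces (walk (skip i k y)) (n - k)"
  have sub: "relabel i k ` (?F - {(i, k)}) \<subseteq> ?G"
  proof
    fix q assume "q \<in> relabel i k ` (?F - {(i, k)})"
    then obtain i' k' where "q = relabel i k (i', k')" "(i', k') \<in> ?F" "(i', k') \<noteq> (i, k)" by auto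
    then show "q \<in> ?G" using faces_skip_sub[OF p] by simp
  qed
  have "sum snd (relabel i k ` (?F - {(i, k)})) = sum snd (?F - {(i, k)})"
    by (subst sum.reindex[OF inj_on_relabel[OF p]]) (auto simp: relabel_def intro!: sum.cong)
  also have "\<dots> = n - k"
    using p full by (simp add: full_def sum_diff1_nat)
  finally have s: "sum snd (relabel i k ` (?F - {(i, k)})) = n - k" .
  have "sum snd ?G = sum snd (relabel i k ` (?F - {(i, k)})) + sum snd (?G - relabel i k ` (?F - {(i, k)}))"
    using sub by (metis add.commute finite_faces sum.subset_diff)
  with s sum_faces_le[of "walk (skip i k y)" "n - k"]
  have z: "sum snd (?G - relabel i k ` (?F - {(i, k)})) = 0" and f: "sum snd ?G = n - k" by auto
  have "?G - relabel i k ` (?F - {(i, k)}) = {}"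
  proof (rule ccontr)
    assume "\<not> ?thesis"
    then obtain q where q: "q \<in> ?G - relabel i k ` (?F - {(i, k)})" by blast
    then have "snd q = 0" using z by (subst (asm) sum_eq_0_iff) auto
    moreover have "snd q > 0" using q by (auto simp: faces_def)
    ultimately show False by simp
  qed
  then show "?G = relabel i k ` (?F - {(i, k)})" using sub by blast
  show "full (walk (skip i k y)) (n - k)" using f by (simp add: full_def)
qed

lemma shift_relabel:
  assumes "(i, k) \<in> faces w n" "(i', k') \<in> faces w n" "(i', k') \<noteq> (i, k)" "m < k'"
  shows "shift_seq (fst (relabel i k (i', k'))) (skip i k y) m = shift_seq i' y m"
proof -
  have "i' + k' \<le> i \<or> i + k \<le> i'" using faces_overlap[OF assms(1,2)] assms(3) by force
  then show ?thesis using assms(4) by (auto simp: relabel_def shift_seq_def skip_def)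
qed

section \<open>Exchangeability of the increments\<close>

text \<open>The inverse of moving a block to the front. It is a finite permutation of the indices,
  hence preserves the law of an i.i.d. sequence; entries beyond \<open>g + k\<close> stay in
  place.\<close>

definition ins :: "nat => nat => (nat => 'a) => nat => 'a" where
  "ins g k u m = u (if m < g then k + m else if m < g + k then m - g else m)"

definition rot :: "nat => nat => (nat => 'a) => nat => 'a" where
  "rot r k u m = u (if m < k then (m + r) mod k else m)"

text \<open>The discrete excursion: the block, taken as a walk of its own, consists of a single
  face.\<close>

definition exc :: "nat => (nat => real) => bool" where
  "exc k u \<longleftrightarrow> (\<forall>j. 0 < j --> j < k --> walk u k * real j < walk u j * real k)"

text \<open>Almost surely exactly one rotation is an excursion, so this is \<open>\<phi>\<close> of
  the discrete Vervaat transform. Writing it as a sum over rotations avoids a choice and makes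
  measurability immediate.\<close>

definition xrot :: "nat => (nat => (nat => real) => ennreal) => (nat => real) => ennreal" where
  "xrot k \<phi> u = (\<Sum>r<k. if exc k (rot r k u) then \<phi> k (rot r k u) else 0)"

definition dep :: "nat => ((nat => 'a) => 'b) => bool" where
  "dep k f \<longleftrightarrow> (\<forall>u u'. (\<forall>m<k. u m = u' m) --> f u = f u')"

lemma walk_cong: "(\<And>m. m < l ==> u m = u' m) ==> walk u l = walk u' l"
  by (simp add: walk_def)

lemma walk_0 [simp]: "walk u 0 = 0"
  by (simp add: walk_def)

lemma walk_Suc: "walk u (Suc l) = walk u l + u l"
  by (simp add: walk_def)

lemma walk_shift: "walk (shift_seq k u) l = walk u (k + l) - walk u k"
  by (induction l) (auto simp: walk_Suc shift_seq_def)

lemma dep_exc: "dep k (exc k)"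
proof -
  have "exc k u = exc k u'" if "\<forall>m<k. u m = u' m" for u u' :: "nat => real"
  proof -
    have "walk u l = walk u' l" if "l \<le> k" for l
      using that \<open>\<forall>m<k. u m = u' m\<close> by (intro walk_cong) auto
    then show ?thesis by (auto simp: exc_def)
  qed
  then show ?thesis by (auto simp: dep_def)
qed

lemma walk_ins:
  "walk (ins g k u) l = (if l \<le> g then walk (shift_seq k u) l
     else if l \<le> g + k then walk (shift_seq k u) g + walk u (l - g) else walk u l)"
proof (induction l)
  case (Suc l)
  consider "l < g" | "l = g" "k > 0" | "l = g" "k = 0" | "g < l" "l < g + k" | "g < l" "l = g + k" | "g + k < l" by linarith
  then show ?case
  proof cases
    case 4
    then have "Suc l - g = Suc (l - g)" by auto
    then show ?thesis using 4 Suc by (simp add: walk_Suc ins_def)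
  next
    case 5
    then show ?thesis using Suc by (simp add: walk_Suc ins_def walk_shift add.commute)
  qed (use Suc in \<open>auto simp: walk_Suc ins_def walk_shift shift_seq_def\<close>)
qed simp

text \<open>Being a face after insertion splits into a condition on the block alone and one on its
  slope and the remaining walk. The latter says that \<open>g\<close> is the strict argmin of the
  remaining walk tilted by that slope, so it selects a single place.\<close>

lemma ins_face_iff:
  assumes k: "0 < k" and g: "g + k \<le> n"
  shows "(g, k) \<in> faces (walk (ins g k u)) n \<longleftrightarrow> exc k u \<and>
    (\<forall>l\<le>n - k. l \<noteq> g --> walk u k * (real l - real g)
        < (walk (shift_seq k u) l - walk (shift_seq k u) g) * real k)" (is "?L \<longleftrightarrow> ?E \<and> ?R")
proof -
  define w where "w = walk (ins g k u)"
  have inc: "w (g + k) - w g = walk u k" using k by (simp add: w_def walk_ins)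
  have L: "?L \<longleftrightarrow> (\<forall>l\<le>n. l \<noteq> g --> l \<noteq> g + k -->
        walk u k * (real l - real g) < (w l - w g) * real k)"
    using k g by (simp add: faces_def inc flip: w_def)
  have w1: "w l - w g = walk (shift_seq k u) l - walk (shift_seq k u) g" if "l \<le> g" for l
    using that by (simp add: w_def walk_ins)
  have w2: "w (g + j) - w g = walk u j" if "j < k" for j
    using that by (simp add: w_def walk_ins)
  have w3: "w (l + k) - w g = walk u k + (walk (shift_seq k u) l - walk (shift_seq k u) g)" if "g < l" for l
    using that by (simp add: w_def walk_ins walk_shift add.commute)
  show ?thesis
  proof
    assume L0: ?L
    have "walk u k * real j < walk u j * real k" if "0 < j" "j < k" for j
      using L0[unfolded L, rule_format, of "g + j"] that g w2[of j] by simp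
    moreover have "walk u k * (real l - real g) < (walk (shift_seq k u) l - walk (shift_seq k u) g) * real k"
      if l: "l \<le> n - k" "l \<noteq> g" for l
    proof (cases "l < g")
      case True
      then show ?thesis using L0[unfolded L, rule_format, of l] w1[of l] g by simp
    next
      case False
      then have gl: "g < l" using l by simp
      have "walk u k * (real (l + k) - real g) < (w (l + k) - w g) * real k"
        using L0[unfolded L, rule_format, of "l + k"] g l gl by simp
      then show ?thesis unfolding w3[OF gl] by (simp add: algebra_simps)
    qed
    ultimately show "?E \<and> ?R" by (auto simp: exc_def)
  next
    assume ER: "?E \<and> ?R"
    have "walk u k * (real l - real g) < (w l - w g) * real k" if l: "l \<le> n" "l \<noteq> g" "l \<noteq> g + k" for l
    proof -
      consider "l < g" | "g < l" "l < g + k" | "g + k < l" using l by linarith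
      then show ?thesis
      proof cases
        case 1
        then show ?thesis using ER w1[of l] g by simp
      next
        case 2
        then obtain j where j: "l = g + j" "0 < j" "j < k" by (metis less_imp_add_positive nat_add_left_cancel_less)
        then show ?thesis using ER w2[of j] by (simp add: exc_def)
      next
        case 3
        define l' where "l' = l - k"
        have l': "l = l' + k" "g < l'" "l' \<le> n - k" using 3 l by (auto simp: l'_def)
        then have "walk u k * (real l' - real g) < (walk (shift_seq k u) l' - walk (shift_seq k u) g) * real k"
          using ER by simp
        then have "walk u k * (real (l' + k) - real g) < (w (l' + k) - w g) * real k"
          unfolding w3[OF l'(2)] by (simp add: algebra_simps)
        then show ?thesis by (simp only: l'(1))
      qed
    qed
    then show ?L unfolding L by blast
  qed
qed

lemma skip_ins: "skip g k (ins g k u) = shift_seq k u"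
  by (auto simp: skip_def ins_def shift_seq_def fun_eq_iff add.commute)

lemma shift_ins: "m < k ==> shift_seq g (ins g k u) m = u m"
  by (auto simp: ins_def shift_seq_def)

lemma walk_rot:
  assumes "r < k" "j \<le> k"
  shows "walk (rot r k u) j = (if r + j \<le> k then walk u (r + j) - walk u r
     else walk u k - walk u r + walk u (r + j - k))"
  using assms(2)
proof (induction j)
  case (Suc j)
  consider "r + j < k" | "r + j = k" | "k < r + j" by linarith
  then show ?case
  proof cases
    case 1
    then show ?thesis using Suc by (simp add: walk_Suc rot_def add.commute)
  next
    case 2
    then show ?thesis using Suc by (simp add: walk_Suc rot_def add.commute)
  next
    case 3
    then have "Suc (r + j) - k = Suc (r + j - k)" "(j + r) mod k = r + j - k"
      using assms Suc.prems by (auto simp: mod_if)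
    then show ?thesis using 3 Suc by (simp add: walk_Suc rot_def add.commute)
  qed
qed (use assms in simp)

text \<open>The deterministic half of the cycle lemma: the rotations that are excursions are those
  starting at a strict minimum of the walk minus its chord.\<close>

lemma exc_rot_iff:
  assumes r: "r < k"
  shows "exc k (rot r k u) \<longleftrightarrow>
    (\<forall>l<k. l \<noteq> r --> walk u k * (real l - real r) < (walk u l - walk u r) * real k)" (is "?L \<longleftrightarrow> ?R")
proof -
  have wk: "walk (rot r k u) k = walk u k" using walk_rot[OF r, of k] r by (cases "r = 0") auto
  show ?thesis
  proof
    assume L: ?L
    show ?R
    proof (intro allI impI)
      fix l assume l: "l < k" "l \<noteq> r"
      show "walk u k * (real l - real r) < (walk u l - walk u r) * real k"
      proof (cases "r < l")
        case True
        then show ?thesis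
          using L[unfolded exc_def, rule_format, of "l - r"] l walk_rot[OF r, of "l - r"] wk by (simp add: of_nat_diff)
      next
        case False
        then have e: "walk (rot r k u) (l + k - r) = walk u k - walk u r + walk u l"
          using l r by (subst walk_rot[OF r]) (auto split: if_splits)
        have "walk u k * real (l + k - r) < walk (rot r k u) (l + k - r) * real k"
          using L[unfolded exc_def, rule_format, of "l + k - r"] l False wk r by simp
        then show ?thesis unfolding e using False r by (simp add: of_nat_diff algebra_simps)
      qed
    qed
  next
    assume R: ?R
    show ?L unfolding exc_def
    proof (intro allI impI)
      fix j assume j: "0 < j" "j < k"
      show "walk (rot r k u) k * real j < walk (rot r k u) j * real k"
      proof (cases "r + j < k")
        case True
        then show ?thesis using R[rule_format, of "r + j"] j walk_rot[OF r, of j] wk by simp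
      next
        case False
        then have e: "walk (rot r k u) j = walk u k - walk u r + walk u (r + j - k)"
          using j r by (subst walk_rot[OF r]) (auto split: if_splits)
        have "walk u k * (real (r + j - k) - real r) < (walk u (r + j - k) - walk u r) * real k"
          using R[rule_format, of "r + j - k"] j False r by simp
        then show ?thesis unfolding e wk using False by (simp add: of_nat_diff algebra_simps)
      qed
    qed
  qed
qed

lemma strict_argmin_ex1:
  fixes f :: "nat => real"
  assumes "inj_on f A" "finite A" "A \<noteq> {}"
  shows "\<exists>!i. i \<in> A \<and> (\<forall>l\<in>A. l \<noteq> i --> f i < f l)"
proof -
  define i where "i = arg_min_on f A"
  have i: "i \<in> A" "\<And>l. l \<in> A ==> f i \<le> f l"
    using assms arg_min_least[of A _ f] arg_min_if_finite(1)[of A f] by (auto simp: i_def)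
  show ?thesis
  proof (rule ex1I[of _ i])
    have "f i < f l" if "l \<in> A" "l \<noteq> i" for l
      using i(2)[OF that(1)] inj_onD[OF assms(1) _ i(1) that(1)] that(2) by fastforce
    then show "i \<in> A \<and> (\<forall>l\<in>A. l \<noteq> i --> f i < f l)" using i(1) by blast
    fix j assume "j \<in> A \<and> (\<forall>l\<in>A. l \<noteq> j --> f j < f l)"
    then show "j = i" using i(1) i(2)[of j] by (cases "j = i") force+
  qed
qed

locale diffuse_law = prob_space \<nu> for \<nu> :: "real measure" +
  assumes sets_nu [measurable_cong]: "sets \<nu> = sets borel"
    and diffuse: "emeasure \<nu> {x} = 0"
begin

sublocale seq: sequence_space \<nu> ..

abbreviation "\<mu> \<equiv> PiM (UNIV :: nat set) (\<lambda>_. \<nu>)"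

lemma sets_mu [measurable_cong]: "sets \<mu> = sets PiB"
  by (intro sets_PiM_cong refl sets_nu)

lemma coord_measurable [measurable]: "(\<lambda>u. u m) \<in> borel_measurable \<mu>"
  by measurable

lemma space_mu [simp]: "space \<mu> = UNIV"
  using sets_eq_imp_space_eq[OF sets_nu] by (simp add: space_PiM)

lemma emeasure_mu [simp]: "emeasure \<mu> UNIV = 1"
  using seq.emeasure_space_1 by simp

lemma walk_measurable [measurable]: "(\<lambda>u. walk u l) \<in> borel_measurable \<mu>"
  unfolding walk_def by measurable

lemma reindex_measurable: "(\<lambda>u m. u (p m)) \<in> measurable \<mu> \<mu>"
  by (rule measurable_PiM_single') (auto simp: space_PiM sets_eq_imp_space_eq[OF sets_nu])

lemma nn_integral_reindex:
  assumes p: "inj p" and [measurable]: "f \<in> borel_measurable \<mu>"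
  shows "(\<integral>\<^sup>+u. f (\<lambda>m. u (p m)) \<partial>\<mu>) = (\<integral>\<^sup>+u. f u \<partial>\<mu>)"
proof -
  have "distr \<mu> \<mu> (\<lambda>u m. u (p m)) = \<mu>"
    using distr_PiM_reindex[of UNIV "\<lambda>_. \<nu>" p UNIV] p prob_space_axioms by (simp add: restrict_UNIV)
  then show ?thesis
    by (metis assms(2) nn_integral_distr reindex_measurable)
qed

lemma shift_measurable [measurable]: "shift_seq k \<in> measurable \<mu> \<mu>"
  using reindex_measurable[of "\<lambda>m. k + m"] by (simp add: shift_seq_def[abs_def])

lemma skip_measurable [measurable]: "skip i k \<in> measurable \<mu> \<mu>"
  using reindex_measurable[of "\<lambda>m. if m < i then m else m + k"]
  by (simp add: skip_def[abs_def] if_distrib cong: if_cong)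

lemma ins_measurable [measurable]: "ins g k \<in> measurable \<mu> \<mu>"
  using reindex_measurable by (simp add: ins_def[abs_def])

lemma rot_measurable [measurable]: "rot r k \<in> measurable \<mu> \<mu>"
  using reindex_measurable by (simp add: rot_def[abs_def])

lemma inj_ins: "inj (\<lambda>m::nat. if m < g then k + m else if m < g + k then m - g else m)"
  by (rule injI, simp split: if_splits; arith)

lemma inj_rot: "inj (\<lambda>m::nat. if m < k then (m + r) mod k else m)"
proof -
  have "inj_on (\<lambda>m. (m + r) mod k) {..<k}"
  proof (rule inj_onI)
    fix x y :: nat assume "x \<in> {..<k}" "y \<in> {..<k}" "(x + r) mod k = (y + r) mod k"
    then have e: "(x + r) mod k = (y + r) mod k" and lt: "x < k" "y < k" by auto
    have "x \<le> y ==> k dvd y - x" using mod_eq_dvd_iff_nat[of "x + r" "y + r" k] e by simp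
    moreover have "y \<le> x ==> k dvd x - y" using mod_eq_dvd_iff_nat[of "y + r" "x + r" k] e by simp
    ultimately show "x = y" using lt nat_dvd_not_less[of "x - y" k] nat_dvd_not_less[of "y - x" k]
      by (cases x y rule: linorder_cases) auto
  qed
  moreover have "(m + r) mod k < k" if "m < k" for m using that by simp
  ultimately have i: "inj_on (\<lambda>m. (m + r) mod k) {..<k}" and h2: "\<And>m. m < k ==> (m + r) mod k < k"
    by blast+
  have h1: "x = y" if "x < k" "y < k" "(x + r) mod k = (y + r) mod k" for x y
    using inj_onD[OF i that(3)] that(1,2) by blast

  show ?thesis
  proof (rule injI)
    fix x y assume e: "(if x < k then (x + r) mod k else x) = (if y < k then (y + r) mod k else y)"
    show "x = y"
    proof (cases "x < k"; cases "y < k")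
      assume "x < k" "y < k" then show ?thesis using e h1[of x y] by argo
    next
      assume "x < k" "\<not> y < k" then show ?thesis using e h2[of x] by argo
    next
      assume "\<not> x < k" "y < k" then show ?thesis using e h2[of y] by argo
    next
      assume "\<not> x < k" "\<not> y < k" then show ?thesis using e by argo
    qed
  qed
qed

lemma nn_integral_ins: "f \<in> borel_measurable \<mu> ==> (\<integral>\<^sup>+u. f (ins g k u) \<partial>\<mu>) = (\<integral>\<^sup>+u. f u \<partial>\<mu>)"
  using nn_integral_reindex[OF inj_ins] by (simp add: ins_def[abs_def])

lemma nn_integral_rot: "f \<in> borel_measurable \<mu> ==> (\<integral>\<^sup>+u. f (rot r k u) \<partial>\<mu>) = (\<integral>\<^sup>+u. f u \<partial>\<mu>)"
  using nn_integral_reindex[OF inj_rot] by (simp add: rot_def[abs_def])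

lemma faces_measurable [measurable]: "Measurable.pred \<mu> (\<lambda>u. (i, k) \<in> faces (walk u) n)"
  unfolding faces_def by measurable

lemma exc_measurable [measurable]: "Measurable.pred \<mu> (exc k)"
  unfolding exc_def[abs_def] by measurable

lemma nn_integral_split:
  assumes f [measurable]: "f \<in> borel_measurable \<mu>" and g [measurable]: "g \<in> borel_measurable \<mu>" and d: "dep k f"
  shows "(\<integral>\<^sup>+u. f u * g (shift_seq k u) \<partial>\<mu>) = (\<integral>\<^sup>+u. f u \<partial>\<mu>) * (\<integral>\<^sup>+u. g u \<partial>\<mu>)"
proof -
  have sf: "sigma_finite_measure \<mu>" by unfold_locales
  have fc: "f (comb_seq k a b) = f a" for a b
    using d by (auto simp: dep_def comb_seq_less)
  have gc: "shift_seq k (comb_seq k a b) = b" for a b :: "nat => real"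
    by (auto simp: shift_seq_def fun_eq_iff comb_seq_add add.commute)
  have [measurable]: "(\<lambda>u. f u * g (shift_seq k u)) \<in> borel_measurable \<mu>" by measurable
  have "(\<integral>\<^sup>+u. f u * g (shift_seq k u) \<partial>\<mu>) =
    (\<integral>\<^sup>+u. f u * g (shift_seq k u) \<partial>distr (\<mu> \<Otimes>\<^sub>M \<mu>) \<mu> (\<lambda>(a, b). comb_seq k a b))"
    by (simp only: seq.PiM_comb_seq)
  also have "\<dots> = (\<integral>\<^sup>+x. f (fst x) * g (snd x) \<partial>(\<mu> \<Otimes>\<^sub>M \<mu>))"
    by (subst nn_integral_distr) (auto simp: fc gc split_beta intro!: nn_integral_cong)
  also have "\<dots> = (\<integral>\<^sup>+a. \<integral>\<^sup>+b. f a * g b \<partial>\<mu> \<partial>\<mu>)"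
    by (subst sigma_finite_measure.nn_integral_fst[OF sf, symmetric]) auto
  finally show ?thesis by (simp add: nn_integral_cmult nn_integral_multc)
qed

text \<open>Given all coordinates except \<open>m0\<close>, the sum vanishes for one value of that
  coordinate, and a single value has mass zero.\<close>

lemma AE_linear_ne_0:
  assumes m: "m0 < N" "c m0 \<noteq> 0"
  shows "AE u in \<mu>. (\<Sum>m<N. c m * u m) \<noteq> 0"
proof -
  define I where "I = UNIV - {m0}"
  let ?R = "PiM I (\<lambda>_. \<nu>)"
  interpret R: prob_space ?R by (intro prob_space_PiM prob_space_axioms)
  interpret P: pair_sigma_finite \<nu> ?R ..
  have eq: "distr (\<nu> \<Otimes>\<^sub>M ?R) \<mu> (\<lambda>(x, X). X(m0 := x)) = \<mu>"
    using distr_pair_PiM_eq_PiM[of I "\<lambda>_. \<nu>" m0] prob_space_axioms by (simp add: I_def insert_absorb insert_UNIV)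
  have [measurable]: "(\<lambda>(x, X). X(m0 := x)) \<in> measurable (\<nu> \<Otimes>\<^sub>M ?R) \<mu>"
  proof -
    have "(\<lambda>(x, X). X(m0 := x)) \<in> measurable (\<nu> \<Otimes>\<^sub>M ?R) (PiM (insert m0 I) (\<lambda>_. \<nu>))"
      by measurable
    moreover have "insert m0 I = UNIV" by (auto simp: I_def)
    ultimately show ?thesis by simp
  qed
  have pt: "AE x in \<nu>. x \<noteq> a" for a
    using diffuse[of a] by (intro AE_I[of _ _ "{a}"]) (auto simp: sets_nu)
  have "AE X in ?R. AE x in \<nu>. (\<Sum>m<N. c m * (X(m0 := x)) m) \<noteq> 0"
  proof (rule AE_I2)
    fix X
    have "(\<Sum>m<N. c m * (X(m0 := x)) m) = c m0 * x + (\<Sum>m\<in>{..<N} - {m0}. c m * X m)" for x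
      using m by (subst sum.remove[of _ m0]) (auto intro!: sum.cong)
    moreover have "AE x in \<nu>. x \<noteq> - (\<Sum>m\<in>{..<N} - {m0}. c m * X m) / c m0" by (rule pt)
    ultimately show "AE x in \<nu>. (\<Sum>m<N. c m * (X(m0 := x)) m) \<noteq> 0"
      using m by (auto elim!: eventually_mono simp: field_simps add_eq_0_iff)
  qed
  moreover have [measurable]: "(\<lambda>p. \<Sum>m<N. c m * ((snd p)(m0 := fst p)) m) \<in> borel_measurable (\<nu> \<Otimes>\<^sub>M ?R)"
    using measurable_compose[OF \<open>(\<lambda>(x, X). X(m0 := x)) \<in> measurable (\<nu> \<Otimes>\<^sub>M ?R) \<mu>\<close>,
        of "\<lambda>u. \<Sum>m<N. c m * u m" borel] by (auto simp: split_beta)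
  ultimately have "AE x in \<nu>. AE X in ?R. (\<Sum>m<N. c m * (X(m0 := x)) m) \<noteq> 0"
    by (subst P.AE_commute) auto
  then have "AE p in \<nu> \<Otimes>\<^sub>M ?R. (\<Sum>m<N. c m * ((snd p)(m0 := fst p)) m) \<noteq> 0"
  proof (intro P.AE_pair_measure)
    show "{p \<in> space (\<nu> \<Otimes>\<^sub>M ?R). (\<Sum>m<N. c m * ((snd p)(m0 := fst p)) m) \<noteq> 0} \<in> sets (\<nu> \<Otimes>\<^sub>M ?R)"
      by measurable
  qed simp
  then have "AE u in distr (\<nu> \<Otimes>\<^sub>M ?R) \<mu> (\<lambda>(x, X). X(m0 := x)). (\<Sum>m<N. c m * u m) \<noteq> 0"
  proof (subst AE_distr_iff)
    have [measurable]: "(\<lambda>u. \<Sum>m<N. c m * u m) \<in> borel_measurable \<mu>" by measurable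
    show "{u \<in> space \<mu>. (\<Sum>m<N. c m * u m) \<noteq> 0} \<in> sets \<mu>" by measurable
  qed (auto simp: split_beta)
  then show ?thesis by (simp only: eq)
qed

end

text \<open>The mean of the product of tests under size-biased picking without replacement: a face
  is drawn with probability proportional to its length and then cut out of the walk.\<close>

fun Q :: "(nat => (nat => real) => ennreal) list => nat => (nat => real) => ennreal" where
  "Q [] n y = 1"
| "Q (\<phi> # \<phi>s) n y = (\<Sum>(i, k)\<in>faces (walk y) n.
     ennreal (real k / real n) * \<phi> k (shift_seq i y) * Q \<phi>s (n - k) (skip i k y))"

text \<open>Replaces the random index set by a deterministic one with indicators, so that
  measurability and integrals can be treated term by term.\<close>

lemma sum_faces:
  fixes T :: "nat => nat => 'a::comm_monoid_add"
  shows "(\<Sum>(i, k)\<in>faces w n. T i k) = (\<Sum>k=1..n. \<Sum>i\<le>n - k. if (i, k) \<in> faces w n then T i k else 0)"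
proof -
  let ?B = "SIGMA k:{1..n}. {..n - k}"
  have "(\<Sum>k=1..n. \<Sum>i\<le>n - k. if (i, k) \<in> faces w n then T i k else 0)
      = (\<Sum>(k, i)\<in>?B. if (i, k) \<in> faces w n then T i k else 0)"
    by (subst sum.Sigma) auto
  also have "\<dots> = (\<Sum>(k, i)\<in>{p\<in>?B. (snd p, fst p) \<in> faces w n}. T i k)"
    by (subst sum.inter_filter) (auto simp: split_beta intro!: sum.cong)
  also have "\<dots> = (\<Sum>(i, k)\<in>faces w n. T i k)"
    by (rule sum.reindex_bij_witness[of _ prod.swap prod.swap]) (auto simp: faces_def)
  finally show ?thesis by simp
qed

context diffuse_law begin

text \<open>The common value of both sides of the discrete identity: a block length uniform in
  {1..n}, the test on the excursion made from the block, and an independent remainder of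
  \<open>n - k\<close> steps.\<close>

fun R :: "(nat => (nat => real) => ennreal) list => nat => ennreal" where
  "R [] n = 1"
| "R (\<phi> # \<phi>s) n = (\<Sum>k=1..n. ennreal (1 / real n) * (\<integral>\<^sup>+y. xrot k \<phi> y \<partial>\<mu>) * R \<phi>s (n - k))"

definition block_fun :: "(nat => (nat => real) => ennreal) => bool" where
  "block_fun \<phi> \<longleftrightarrow> (\<forall>k. \<phi> k \<in> borel_measurable \<mu> \<and> dep k (\<phi> k))"

lemma block_fun_measurable: "block_fun \<phi> ==> \<phi> k \<in> borel_measurable \<mu>"
  by (simp add: block_fun_def)

lemma xrot_measurable [measurable]:
  assumes "block_fun \<phi>" shows "xrot k \<phi> \<in> borel_measurable \<mu>"
proof -
  note [measurable] = block_fun_measurable[OF assms]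
  show ?thesis unfolding xrot_def[abs_def] by measurable
qed

text \<open>The displayed expression in the assumption is the coefficient of \<open>y m0\<close> in
  the linear form; one nonzero coefficient is enough.\<close>

lemma AE_walk_ne:
  assumes "m0 < N" "a \<le> N" "b \<le> N" "k \<le> N"
    and "(if m0 < b then p else 0) - (if m0 < a then p else 0) + (if m0 < k then q else 0) \<noteq> (0::real)"
  shows "AE y in \<mu>. (walk y b - walk y a) * p + walk y k * q \<noteq> 0"
proof -
  have w: "walk y l = (\<Sum>m<N. if m < l then y m else 0)" if "l \<le> N" for y l
  proof -
    have "walk y l = (\<Sum>m\<in>{m\<in>{..<N}. m < l}. y m)"
      unfolding walk_def using that by (intro sum.cong) auto
    then show ?thesis using sum.inter_filter[of "{..<N}" y "\<lambda>m. m < l"] by simp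
  qed
  have "(walk y b - walk y a) * p + walk y k * q = (\<Sum>m<N. ((if m < b then p else 0)
      - (if m < a then p else 0) + (if m < k then q else 0)) * y m)" for y
    unfolding w[OF assms(2)] w[OF assms(3)] w[OF assms(4)] sum_distrib_right sum_subtractf[symmetric] sum.distrib[symmetric]
    by (intro sum.cong) (auto simp: algebra_simps)
  then show ?thesis
    using AE_linear_ne_0[of m0 N "\<lambda>m. (if m < b then p else 0) - (if m < a then p else 0) + (if m < k then q else 0)"] assms
    by simp
qed

lemma AE_inj_tilted_shift:
  assumes "0 < k"
  shows "AE y in \<mu>. inj_on (\<lambda>l. walk (shift_seq k y) l * real k - walk y k * real l) {..N}"
proof -
  \<comment> \<open>Coordinate \<open>k + i\<close> belongs to the increment from
    \<open>k + i\<close> to \<open>k + j\<close> but not to the first \<open>k\<close> steps, so its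
    coefficient is \<open>k\<close>.\<close>
  have "AE y in \<mu>. (walk y (k + j) - walk y (k + i)) * real k + walk y k * (real i - real j) \<noteq> 0"
    if "i < j" for i j
    using that assms by (intro AE_walk_ne[of "k + i" "k + j"]) auto
  then have "AE y in \<mu>. \<forall>i j. i < j -->
      (walk y (k + j) - walk y (k + i)) * real k + walk y k * (real i - real j) \<noteq> 0"
    by (auto simp: AE_all_countable)
  then show ?thesis
  proof eventually_elim
    case (elim y)
    have "i = j" if "walk (shift_seq k y) i * real k - walk y k * real i
        = walk (shift_seq k y) j * real k - walk y k * real j" for i j
      using elim[rule_format, of i j] elim[rule_format, of j i] that
      by (cases i j rule: linorder_cases) (auto simp: walk_shift algebra_simps)
    then show ?case by (auto intro!: inj_onI)
  qed
qed

lemma AE_inj_tilted: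
  "AE y in \<mu>. inj_on (\<lambda>l. walk y l * real k - walk y k * real l) {..<k}"
proof -
  \<comment> \<open>Coordinate \<open>k - 1\<close> occurs only in \<open>walk y k\<close>, hence
    with the nonzero coefficient \<open>i - j\<close>.\<close>
  have "AE y in \<mu>. (walk y j - walk y i) * real k + walk y k * (real i - real j) \<noteq> 0"
    if "i < j" "j < k" for i j
    using that by (intro AE_walk_ne[of "k - 1" k]) auto
  then have "AE y in \<mu>. \<forall>i j. i < j --> j < k -->
      (walk y j - walk y i) * real k + walk y k * (real i - real j) \<noteq> 0"
    by (auto simp: AE_all_countable)
  then show ?thesis
  proof eventually_elim
    case (elim y)
    have "i = j" if "walk y i * real k - walk y k * real i
        = walk y j * real k - walk y k * real j" "i < k" "j < k" for i j
      using elim[rule_format, of i j] elim[rule_format, of j i] that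
      by (cases i j rule: linorder_cases) (auto simp: algebra_simps)
    then show ?case by (auto intro!: inj_onI)
  qed
qed

text \<open>The probabilistic half of the cycle lemma: the values of the walk minus its chord are
  almost surely distinct, so their strict argmin exists and is unique.\<close>

lemma AE_unique_rot:
  assumes "0 < k"
  shows "AE y in \<mu>. \<exists>!r. r < k \<and> exc k (rot r k y)"
  using AE_inj_tilted[of k]
proof eventually_elim
  case (elim y)
  have "\<exists>!i. i \<in> {..<k} \<and> (\<forall>l\<in>{..<k}. l \<noteq> i -->
      walk y i * real k - walk y k * real i < walk y l * real k - walk y k * real l)"
    using elim assms by (intro strict_argmin_ex1) auto
  moreover have "(i \<in> {..<k} \<and> (\<forall>l\<in>{..<k}. l \<noteq> i -->
      walk y i * real k - walk y k * real i < walk y l * real k - walk y k * real l)) \<longleftrightarrow> i < k \<and> exc k (rot i k y)" for i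
    by (auto simp: exc_rot_iff algebra_simps)
  ultimately show ?case by simp
qed

lemma AE_unique_slot:
  assumes "0 < k"
  shows "AE y in \<mu>. \<exists>!i. i \<le> N \<and> (\<forall>l\<le>N. l \<noteq> i --> walk y k * (real l - real i)
     < (walk (shift_seq k y) l - walk (shift_seq k y) i) * real k)"
  using AE_inj_tilted_shift[OF assms, of N]
proof eventually_elim
  case (elim y)
  have "\<exists>!i. i \<in> {..N} \<and> (\<forall>l\<in>{..N}. l \<noteq> i -->
      walk (shift_seq k y) i * real k - walk y k * real i < walk (shift_seq k y) l * real k - walk y k * real l)"
    using elim by (intro strict_argmin_ex1) auto
  moreover have "(i \<in> {..N} \<and> (\<forall>l\<in>{..N}. l \<noteq> i -->
      walk (shift_seq k y) i * real k - walk y k * real i < walk (shift_seq k y) l * real k - walk y k * real l))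
     \<longleftrightarrow> i \<le> N \<and> (\<forall>l\<le>N. l \<noteq> i --> walk y k * (real l - real i)
     < (walk (shift_seq k y) l - walk (shift_seq k y) i) * real k)" for i
    by (auto simp: algebra_simps)
  ultimately show ?case by simp
qed

lemma sum_unique:
  fixes N :: nat
  assumes "\<exists>!i. i \<le> N \<and> P i"
  shows "(\<Sum>i\<le>N. if P i then c else 0) = (c::ennreal)"
proof -
  obtain i where "i \<le> N" "P i" "\<And>j. j \<le> N ==> P j ==> j = i" using assms by blast
  then have "P j \<longleftrightarrow> j = i" if "j \<le> N" for j using that by blast
  then have "(\<Sum>j\<le>N. if P j then c else 0) = (\<Sum>j\<le>N. if j = i then c else 0)"
    by (intro sum.cong) simp_all
  also have "\<dots> = c" using sum.delta[of "{..N}" i "\<lambda>_. c"] \<open>i \<le> N\<close> by simp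
  finally show ?thesis .
qed

text \<open>Every rotation preserves the law, so all \<open>k\<close> summands have the same
  integral. This is how the size-biasing weight of a face becomes the sum over the rotations of a
  block.\<close>

lemma nn_integral_xrot:
  assumes "block_fun \<phi>"
  shows "(\<integral>\<^sup>+y. xrot k \<phi> y \<partial>\<mu>) = of_nat k * (\<integral>\<^sup>+y. (if exc k y then \<phi> k y else 0) \<partial>\<mu>)"
proof -
  note [measurable] = block_fun_measurable[OF assms]
  have "(\<integral>\<^sup>+y. xrot k \<phi> y \<partial>\<mu>) =
      (\<Sum>r<k. \<integral>\<^sup>+y. (if exc k (rot r k y) then \<phi> k (rot r k y) else 0) \<partial>\<mu>)"
    unfolding xrot_def by (rule nn_integral_sum) measurable
  also have "\<dots> = (\<Sum>r<k. \<integral>\<^sup>+y. (if exc k y then \<phi> k y else 0) \<partial>\<mu>)"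
    by (intro sum.cong refl nn_integral_rot) measurable
  finally show ?thesis by simp
qed

text \<open>Moving the block in positions \<open>[i, i + k)\<close> to the front preserves the law, and almost surely a
  given excursion can be inserted into a given walk as a face at exactly one place.\<close>
lemma nn_integral_faces:
  assumes \<phi>: "block_fun \<phi>" and [measurable]: "\<And>k. \<psi> k \<in> borel_measurable \<mu>"
  shows "(\<integral>\<^sup>+y. (\<Sum>(i, k)\<in>faces (walk y) n. of_nat k * \<phi> k (shift_seq i y) * \<psi> k (skip i k y)) \<partial>\<mu>)
    = (\<Sum>k=1..n. (\<integral>\<^sup>+y. xrot k \<phi> y \<partial>\<mu>) * (\<integral>\<^sup>+y. \<psi> k y \<partial>\<mu>))"
proof -
  note [measurable] = block_fun_measurable[OF \<phi>]
  define T where "T i k y = of_nat k * \<phi> k (shift_seq i y) * \<psi> k (skip i k y)" for i k y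
  have [measurable]: "T i k \<in> borel_measurable \<mu>" for i k
    unfolding T_def[abs_def] by measurable
  have tm: "(\<integral>\<^sup>+y. (\<Sum>i\<le>n - k. if (i, k) \<in> faces (walk y) n then T i k y else 0) \<partial>\<mu>)
      = (\<integral>\<^sup>+y. xrot k \<phi> y \<partial>\<mu>) * (\<integral>\<^sup>+y. \<psi> k y \<partial>\<mu>)" if k: "k \<in> {1..n}" for k
  proof -
    define U where "U i y \<longleftrightarrow> (\<forall>l\<le>n - k. l \<noteq> i --> walk y k * (real l - real i)
     < (walk (shift_seq k y) l - walk (shift_seq k y) i) * real k)" for i y
    define E where "E y = (if exc k y then of_nat k * \<phi> k y * \<psi> k (shift_seq k y) else 0)" for y
    have [measurable]: "Measurable.pred \<mu> (U i)" "E \<in> borel_measurable \<mu>" for i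
      unfolding U_def[abs_def] E_def[abs_def] by measurable
    have ins: "(if (i, k) \<in> faces (walk (ins i k y)) n then T i k (ins i k y) else 0)
        = (if U i y then E y else 0)" if "i \<le> n - k" for i y
    proof -
      have "\<phi> k (shift_seq i (ins i k y)) = \<phi> k y"
        using \<phi> shift_ins[of _ k i y] by (auto simp: block_fun_def dep_def)
      moreover have "(i, k) \<in> faces (walk (ins i k y)) n \<longleftrightarrow> exc k y \<and> U i y"
        unfolding U_def using that k by (intro ins_face_iff) auto
      ultimately show ?thesis by (simp add: T_def skip_ins E_def)
    qed
    have "(\<integral>\<^sup>+y. (\<Sum>i\<le>n - k. if (i, k) \<in> faces (walk y) n then T i k y else 0) \<partial>\<mu>)
      = (\<Sum>i\<le>n - k. \<integral>\<^sup>+y. (if (i, k) \<in> faces (walk y) n then T i k y else 0) \<partial>\<mu>)"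
      by (rule nn_integral_sum) measurable
    also have "\<dots> = (\<Sum>i\<le>n - k. \<integral>\<^sup>+y. (if (i, k) \<in> faces (walk (ins i k y)) n then T i k (ins i k y) else 0) \<partial>\<mu>)"
      by (intro sum.cong refl nn_integral_ins[symmetric]) measurable
    also have "\<dots> = (\<Sum>i\<le>n - k. \<integral>\<^sup>+y. (if U i y then E y else 0) \<partial>\<mu>)"
      by (intro sum.cong refl nn_integral_cong ins) auto
    also have "\<dots> = (\<integral>\<^sup>+y. (\<Sum>i\<le>n - k. if U i y then E y else 0) \<partial>\<mu>)"
      by (rule nn_integral_sum[symmetric]) measurable
    also have "\<dots> = (\<integral>\<^sup>+y. E y \<partial>\<mu>)"
    proof (rule nn_integral_cong_AE)
      show "AE y in \<mu>. (\<Sum>i\<le>n - k. if U i y then E y else 0) = E y"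
        using AE_unique_slot[of k "n - k"] k unfolding U_def
        by (auto elim!: eventually_mono intro!: sum_unique)
    qed
    also have "\<dots> = (\<integral>\<^sup>+y. (of_nat k * (if exc k y then \<phi> k y else 0)) * \<psi> k (shift_seq k y) \<partial>\<mu>)"
      by (intro nn_integral_cong) (simp add: E_def)
    also have "\<dots> = (\<integral>\<^sup>+y. of_nat k * (if exc k y then \<phi> k y else 0) \<partial>\<mu>) * (\<integral>\<^sup>+y. \<psi> k y \<partial>\<mu>)"
    proof (rule nn_integral_split)
      have "dep k (\<phi> k)" using \<phi> by (simp add: block_fun_def)
      with dep_exc[of k] show "dep k (\<lambda>y. of_nat k * (if exc k y then \<phi> k y else 0))"
        unfolding dep_def by metis
    qed measurable
    also have "\<dots> = (\<integral>\<^sup>+y. xrot k \<phi> y \<partial>\<mu>) * (\<integral>\<^sup>+y. \<psi> k y \<partial>\<mu>)"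
      by (simp add: nn_integral_xrot[OF \<phi>] nn_integral_cmult)
    finally show ?thesis .
  qed
  have "(\<integral>\<^sup>+y. (\<Sum>(i, k)\<in>faces (walk y) n. of_nat k * \<phi> k (shift_seq i y) * \<psi> k (skip i k y)) \<partial>\<mu>)
     = (\<integral>\<^sup>+y. (\<Sum>k=1..n. \<Sum>i\<le>n - k. if (i, k) \<in> faces (walk y) n then T i k y else 0) \<partial>\<mu>)"
    unfolding T_def by (intro nn_integral_cong sum_faces)
  also have "\<dots> = (\<Sum>k=1..n. \<integral>\<^sup>+y. (\<Sum>i\<le>n - k. if (i, k) \<in> faces (walk y) n then T i k y else 0) \<partial>\<mu>)"
    by (rule nn_integral_sum) measurable
  also have "\<dots> = (\<Sum>k=1..n. (\<integral>\<^sup>+y. xrot k \<phi> y \<partial>\<mu>) * (\<integral>\<^sup>+y. \<psi> k y \<partial>\<mu>))"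
    by (intro sum.cong refl tm)
  finally show ?thesis .
qed

lemma Q_measurable [measurable]:
  assumes "\<forall>\<phi>\<in>set \<phi>s. block_fun \<phi>"
  shows "Q \<phi>s n \<in> borel_measurable \<mu>"
  using assms
proof (induction \<phi>s arbitrary: n)
  case (Cons \<phi> \<phi>s)
  have [measurable]: "\<phi> k \<in> borel_measurable \<mu>" "Q \<phi>s n \<in> borel_measurable \<mu>" for k n
    using Cons block_fun_measurable[of \<phi>] by auto
  have "(\<lambda>y. Q (\<phi> # \<phi>s) n y) \<in> borel_measurable \<mu>"
    unfolding Q.simps sum_faces by measurable
  then show ?case by simp
next
  case Nil
  have "(\<lambda>y. Q [] n y) \<in> borel_measurable \<mu>" by simp
  then show ?case by simp
qed

lemma nn_integral_Q:
  assumes "\<forall>\<phi>\<in>set \<phi>s. block_fun \<phi>"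
  shows "(\<integral>\<^sup>+y. Q \<phi>s n y \<partial>\<mu>) = R \<phi>s n"
  using assms
proof (induction \<phi>s arbitrary: n)
  case (Cons \<phi> \<phi>s)
  have [measurable]: "Q \<phi>s n \<in> borel_measurable \<mu>" for n
    using Cons.prems by (intro Q_measurable) auto
  have \<phi>: "block_fun \<phi>" using Cons by simp
  have "(\<integral>\<^sup>+y. Q (\<phi> # \<phi>s) n y \<partial>\<mu>) = (\<integral>\<^sup>+y. (\<Sum>(i, k)\<in>faces (walk y) n.
     of_nat k * \<phi> k (shift_seq i y) * (ennreal (1 / real n) * Q \<phi>s (n - k) (skip i k y))) \<partial>\<mu>)"
  proof (intro nn_integral_cong, simp only: Q.simps, intro sum.cong refl, clarify)
    fix y i k
    have "ennreal (real k / real n) = of_nat k * ennreal (1 / real n)"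
      by (simp add: ennreal_of_nat_eq_real_of_nat flip: ennreal_mult)
    then show "ennreal (real k / real n) * \<phi> k (shift_seq i y) * Q \<phi>s (n - k) (skip i k y) =
       of_nat k * \<phi> k (shift_seq i y) * (ennreal (1 / real n) * Q \<phi>s (n - k) (skip i k y))"
      by (simp add: ac_simps)
  qed
  also have "\<dots> = (\<Sum>k=1..n. (\<integral>\<^sup>+y. xrot k \<phi> y \<partial>\<mu>) * (\<integral>\<^sup>+y. ennreal (1 / real n) * Q \<phi>s (n - k) y \<partial>\<mu>))"
    by (rule nn_integral_faces[OF \<phi>]) measurable
  also have "\<dots> = R (\<phi> # \<phi>s) n"
    using Cons by (simp add: nn_integral_cmult ac_simps)
  finally show ?case .
next
  case Nil
  have "Q [] n = (\<lambda>_. 1)" by auto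
  then show ?case by (simp add: emeasure_mu)
qed

lemma block_fun_const: "block_fun (\<lambda>_ _. c)"
  by (simp add: block_fun_def dep_def)

text \<open>With constant tests \<open>nn_integral_faces\<close> gives the expected total length of
  the faces: each \<open>k\<close> contributes 1 by the cycle lemma, so it is \<open>n\<close>. The
  total length never exceeds \<open>n\<close>, hence equals it almost surely.\<close>

lemma AE_full: "AE y in \<mu>. full (walk y) n"
proof -
  have x1: "(\<integral>\<^sup>+y. xrot k (\<lambda>_ _. 1) y \<partial>\<mu>) = 1" if "k \<in> {1..n}" for k
  proof -
    have k0: "0 < k" using that by simp
    have "(\<integral>\<^sup>+y. xrot k (\<lambda>_ _. 1) y \<partial>\<mu>) = (\<integral>\<^sup>+y. 1 \<partial>\<mu>)"
    proof (rule nn_integral_cong_AE)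
      show "AE y in \<mu>. xrot k (\<lambda>_ _. 1) y = 1"
        using AE_unique_rot[OF k0]
      proof eventually_elim
        case (elim y)
        have "{..<k} = {..k - 1}" using that by (cases k) auto
        moreover have "(r < k \<and> exc k (rot r k y)) = (r \<le> k - 1 \<and> exc k (rot r k y))" for r
          using that by auto
        then have "\<exists>!r. r \<le> k - 1 \<and> exc k (rot r k y)" using elim that by simp
        ultimately show ?case unfolding xrot_def by (simp add: sum_unique)
      qed
    qed
    then show ?thesis by (simp add: emeasure_mu)
  qed
  define s where "s y = sum snd (faces (walk y) n)" for y
  have s: "(of_nat (s y) :: ennreal) = (\<Sum>(i, k)\<in>faces (walk y) n. of_nat k)" for y
    by (simp add: s_def split_beta)
  have sn: "s y \<le> n" for y unfolding s_def by (rule sum_faces_le)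
  have [measurable]: "(\<lambda>y. of_nat (s y) :: ennreal) \<in> borel_measurable \<mu>"
    unfolding s sum_faces by measurable
  have "(\<integral>\<^sup>+y. of_nat (s y) \<partial>\<mu>) = (\<integral>\<^sup>+y. (\<Sum>(i, k)\<in>faces (walk y) n. of_nat k * 1 * 1) \<partial>\<mu>)"
    by (intro nn_integral_cong) (simp add: s)
  also have "\<dots> = (\<Sum>k=1..n. 1)"
    by (subst nn_integral_faces[OF block_fun_const[of 1], of "\<lambda>_ _. 1" n]) (auto simp: x1)
  finally have i: "(\<integral>\<^sup>+y. of_nat (s y) \<partial>\<mu>) = of_nat n" by simp
  have "(\<integral>\<^sup>+y. of_nat n - of_nat (s y) \<partial>\<mu>) = (\<integral>\<^sup>+y. of_nat n \<partial>\<mu>) - (\<integral>\<^sup>+y. of_nat (s y) \<partial>\<mu>)"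
    by (rule nn_integral_diff) (use i sn in auto)
  also have "\<dots> = 0" using i by simp
  finally have "AE y in \<mu>. of_nat n - of_nat (s y) = (0 :: ennreal)"
    by (subst (asm) nn_integral_0_iff_AE) auto
  then show ?thesis
  proof eventually_elim
    case (elim y)
    then have "(of_nat n :: ennreal) \<le> of_nat (s y)"
      by (metis diff_eq_0_iff_ennreal not_le order_less_imp_le)
    then have "n \<le> s y" by simp
    then show ?case using sn[of y] by (simp add: full_def s_def)
  qed
qed

end

section \<open>Size-biased sampling of faces\<close>

lemma suminf_ennreal_Suc: "(\<Sum>j. f j) = f 0 + (\<Sum>j. f (Suc j))" for f :: "nat => ennreal"
proof -
  have "(\<lambda>j. f (Suc j)) sums (\<Sum>j. f (Suc j))" by (intro summable_sums) simp
  then have "f sums ((\<Sum>j. f (Suc j)) + f 0)" by (rule sums_Suc)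
  then show ?thesis by (simp add: sums_iff add.commute)
qed

text \<open>The points \<open>u 0, u 1, \<dots>\<close> successively select members of \<open>S\<close>: each step takes the member \<open>p\<close> whose
  region contains the first point lying in a region not selected before, and contributes the factor \<open>f p\<close>.
  The value is \<open>0\<close> when no such point exists.\<close>
fun sval :: "('p => real set) => ('p => ennreal) list => 'p set => (nat => real) => ennreal" where
  "sval Rg [] S u = 1"
| "sval Rg (f # fs) S u = (\<Sum>j. \<Sum>p\<in>S. indicator (Rg p) (u j) *
     (\<Prod>j'<j. indicator (- (\<Union>q\<in>S. Rg q)) (u j')) * f p * sval Rg fs (S - {p}) u)"

lemma sval_case_nat_aux:
  "sval Rg (f # fs) S (case_nat s u) =
    (\<Sum>p\<in>S. indicator (Rg p) s * f p * sval Rg fs (S - {p}) (case_nat s u)) +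
    indicator (- (\<Union>q\<in>S. Rg q)) s * (\<Sum>j. \<Sum>p\<in>S. indicator (Rg p) (u j) *
     (\<Prod>j'<j. indicator (- (\<Union>q\<in>S. Rg q)) (u j')) * f p * sval Rg fs (S - {p}) (case_nat s u))"
  unfolding sval.simps
  by (subst suminf_ennreal_Suc)
     (simp add: prod.lessThan_Suc_shift ennreal_suminf_cmult[symmetric] sum_distrib_left ac_simps del: prod.lessThan_Suc)

text \<open>The set of available regions only shrinks, so a point outside all of them is passed over
  in every later step too.\<close>

lemma sval_skip:
  assumes "s \<notin> (\<Union>q\<in>S. Rg q)"
  shows "sval Rg fs S (case_nat s u) = sval Rg fs S u"
  using assms
proof (induction fs arbitrary: S)
  case (Cons f fs)
  have e: "sval Rg fs (S - {p}) (case_nat s u) = sval Rg fs (S - {p}) u" for p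
    by (rule Cons.IH) (use Cons.prems in auto)
  have "(\<Sum>p\<in>S. indicator (Rg p) s * f p * sval Rg fs (S - {p}) u) = 0"
    using Cons.prems by (intro sum.neutral) auto
  then show ?case unfolding sval_case_nat_aux e using Cons.prems by simp
qed simp

lemma sval_case_nat:
  assumes "disjoint_family_on Rg S"
  shows "sval Rg (f # fs) S (case_nat s u) =
    (\<Sum>p\<in>S. indicator (Rg p) s * f p * sval Rg fs (S - {p}) u) +
    indicator (- (\<Union>q\<in>S. Rg q)) s * sval Rg (f # fs) S u"
proof (cases "s \<in> (\<Union>q\<in>S. Rg q)")
  case True
  have "indicator (Rg p) s * f p * sval Rg fs (S - {p}) (case_nat s u)
      = indicator (Rg p) s * f p * sval Rg fs (S - {p}) u" if "p \<in> S" for p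
  proof (cases "s \<in> Rg p")
    case True
    then have "s \<notin> (\<Union>q\<in>S - {p}. Rg q)"
      using assms that unfolding disjoint_family_on_def by blast
    then show ?thesis by (simp add: sval_skip)
  qed simp
  then have "(\<Sum>p\<in>S. indicator (Rg p) s * f p * sval Rg fs (S - {p}) (case_nat s u))
      = (\<Sum>p\<in>S. indicator (Rg p) s * f p * sval Rg fs (S - {p}) u)" by (rule sum.cong[OF refl])
  moreover have "indicator (- (\<Union>q\<in>S. Rg q)) s = (0::ennreal)" using True by simp
  ultimately show ?thesis unfolding sval_case_nat_aux by simp
next
  case False
  then have "(\<Sum>p\<in>S. indicator (Rg p) s * f p * sval Rg fs (S - {p}) u) = 0"
    by (intro sum.neutral) auto
  moreover have "indicator (- (\<Union>q\<in>S. Rg q)) s = (1::ennreal)" using False by simp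
  ultimately show ?thesis using sval_skip[OF False, of "f # fs" u] by simp
qed

lemma sval_le_1:
  assumes "finite S" "disjoint_family_on Rg S" "\<And>f p. f \<in> set fs ==> f p \<le> 1"
  shows "sval Rg fs S u \<le> 1"
  using assms
proof (induction fs arbitrary: S)
  case (Cons f fs)
  let ?B = "\<Union>q\<in>S. Rg q"
  define P where "P j = (\<Prod>j'<j. indicator (- ?B) (u j') :: ennreal)" for j
  have ind: "(\<Sum>p\<in>S. indicator (Rg p) x) = (indicator ?B x :: ennreal)" for x
    using Cons.prems by (simp add: indicator_UN_disjoint)
  have t: "(\<Sum>p\<in>S. indicator (Rg p) (u j) * P j * f p * sval Rg fs (S - {p}) u) \<le> indicator ?B (u j) * P j" for j
  proof -
    have "f p * sval Rg fs (S - {p}) u \<le> 1" if "p \<in> S" for p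
    proof -
      have "sval Rg fs (S - {p}) u \<le> 1"
        using Cons.prems by (intro Cons.IH) (auto intro: disjoint_family_on_mono[of _ S])
      moreover have "f p \<le> 1" using Cons.prems by simp
      ultimately show ?thesis using mult_mono[of "f p" 1 "sval Rg fs (S - {p}) u" 1] by simp
    qed
    then have "(\<Sum>p\<in>S. indicator (Rg p) (u j) * P j * (f p * sval Rg fs (S - {p}) u)) \<le> (\<Sum>p\<in>S. indicator (Rg p) (u j) * P j * 1)"
      by (intro sum_mono mult_left_mono) auto
    also have "\<dots> = indicator ?B (u j) * P j" by (simp add: sum_distrib_right[symmetric] ind)
    finally show ?thesis by (simp add: mult.assoc)
  qed
  \<comment> \<open>The \<open>j\<close>-th term indicates that the first hit occurs at
    \<open>j\<close>, and \<open>P N\<close> that no hit occurs before \<open>N\<close>; these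
    events exclude one another.\<close>
  have part: "(\<Sum>j<N. indicator ?B (u j) * P j) + P N \<le> 1" for N
  proof (induction N)
    case (Suc N)
    have "indicator ?B (u N) * P N + P (Suc N) = P N"
      by (cases "u N \<in> ?B") (auto simp: P_def)
    then show ?case using Suc by (simp add: add.assoc)
  qed (simp add: P_def)
  have "sval Rg (f # fs) S u \<le> (\<Sum>j. indicator ?B (u j) * P j)"
    unfolding sval.simps P_def[symmetric] by (intro suminf_le t) auto
  also have "\<dots> \<le> 1"
  proof (rule suminf_le_const)
    fix N show "(\<Sum>j<N. indicator ?B (u j) * P j) \<le> 1"
      using part[of N] by (metis add_increasing2 le_iff_add order_trans zero_le)
  qed simp
  finally show ?case .
qed simp

text \<open>Size-biased picking without replacement from a finite set with weights
  \<open>wn\<close>, now with the walk kept fixed.\<close>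

fun Pk :: "('p => nat) => ('p => ennreal) list => 'p set => ennreal" where
  "Pk wn [] S = 1"
| "Pk wn (f # fs) S = (\<Sum>p\<in>S. ennreal (real (wn p) / real (sum wn S)) * f p * Pk wn fs (S - {p}))"

lemma Pk_reindex:
  assumes "list_all2 (\<lambda>f' f. \<forall>p\<in>T. f' (h p) = f p) fs' fs" "S \<subseteq> T" "inj_on h S" "\<forall>p\<in>S. wn (h p) = wn p"
  shows "Pk wn fs' (h ` S) = Pk wn fs S"
  using assms
proof (induction fs' fs arbitrary: S rule: list_all2_induct)
  case (Cons f' fs' f fs)
  have s: "sum wn (h ` S) = sum wn S" using Cons.prems by (simp add: sum.reindex)
  have i: "Pk wn fs' (h ` S - {h p}) = Pk wn fs (S - {p})" if "p \<in> S" for p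
  proof -
    have "h ` S - {h p} = h ` (S - {p})" using Cons.prems that by (auto dest: inj_onD)
    moreover have "Pk wn fs' (h ` (S - {p})) = Pk wn fs (S - {p})"
      using Cons by (intro Cons.IH) (auto intro: inj_on_subset)
    ultimately show ?thesis by simp
  qed
  have f: "f' (h p) = f p" "wn (h p) = wn p" if "p \<in> S" for p
    using Cons.prems Cons.hyps that by auto
  have "Pk wn (f' # fs') (h ` S) = (\<Sum>p\<in>S. ennreal (real (wn (h p)) / real (sum wn S)) * f' (h p) * Pk wn fs' (h ` S - {h p}))"
    unfolding Pk.simps s using Cons.prems by (subst sum.reindex) auto
  also have "\<dots> = Pk wn (f # fs) S"
    unfolding Pk.simps by (intro sum.cong refl) (simp only: f i)
  finally show ?case .
qed simp

lemma iter_nn_integral: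
  assumes "prob_space \<rho>" and f: "f \<in> borel_measurable (PiM (UNIV :: nat set) (\<lambda>_. \<rho>))"
  shows "(\<integral>\<^sup>+u. f u \<partial>PiM UNIV (\<lambda>_. \<rho>)) = (\<integral>\<^sup>+s. \<integral>\<^sup>+u. f (case_nat s u) \<partial>PiM UNIV (\<lambda>_. \<rho>) \<partial>\<rho>)"
proof -
  interpret \<rho>: prob_space \<rho> by fact
  interpret sequence_space \<rho> ..
  let ?S = "PiM (UNIV :: nat set) (\<lambda>_. \<rho>)"
  note f [measurable]
  have sf: "sigma_finite_measure ?S" by unfold_locales
  have "(\<integral>\<^sup>+u. f u \<partial>?S) = (\<integral>\<^sup>+u. f u \<partial>distr (\<rho> \<Otimes>\<^sub>M ?S) ?S (\<lambda>(s, y). case_nat s y))"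
    by (simp only: PiM_iter)
  also have "\<dots> = (\<integral>\<^sup>+x. f (case_nat (fst x) (snd x)) \<partial>(\<rho> \<Otimes>\<^sub>M ?S))"
    by (subst nn_integral_distr) (auto simp: split_beta)
  also have "\<dots> = (\<integral>\<^sup>+s. \<integral>\<^sup>+u. f (case_nat s u) \<partial>?S \<partial>\<rho>)"
    by (subst sigma_finite_measure.nn_integral_fst[OF sf, symmetric]) auto
  finally show ?thesis .
qed

lemma sval_measurable:
  assumes "finite S" "\<And>p. p \<in> S ==> Rg p \<in> sets borel" "u \<in> measurable N PiB"
    and "\<And>F p. F \<in> set Fs ==> (\<lambda>x. F x p) \<in> borel_measurable N"
  shows "(\<lambda>x. sval Rg (map (\<lambda>F. F x) Fs) S (u x)) \<in> borel_measurable N"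
  using assms
proof (induction Fs arbitrary: S)
  case (Cons F Fs)
  note [measurable] = Cons.prems(3)
  have [measurable]: "(\<lambda>x. F x p) \<in> borel_measurable N"
    "(\<lambda>x. sval Rg (map (\<lambda>F. F x) Fs) (S - {p}) (u x)) \<in> borel_measurable N" for p
    using Cons by auto
  have [measurable]: "(\<Union>q\<in>S. Rg q) \<in> sets borel" using Cons.prems by auto
  have [measurable]: "(\<lambda>x. indicator (Rg p) (u x j) :: ennreal) \<in> borel_measurable N" if "p \<in> S" for p j
    using Cons.prems(2)[OF that] by measurable
  show ?case unfolding list.map sval.simps
    by (intro borel_measurable_suminf_order borel_measurable_sum) measurable
qed simp

text \<open>Conditioning on the first point gives \<open>J = A + (1 - b) * J\<close>, where
  \<open>b\<close> is the mass of the union of the regions. As \<open>J\<close> is finite it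
  cancels, leaving \<open>b * J = A\<close>: dividing by \<open>b\<close> conditions the first pick
  on hitting some region, which gives weights proportional to \<open>wn\<close>.\<close>

lemma nn_integral_sval:
  assumes \<rho>: "prob_space \<rho>" "sets \<rho> = sets borel"
    and S: "finite S" "disjoint_family_on Rg S" "\<And>p. p \<in> S ==> Rg p \<in> sets borel"
    and n: "0 < n" and w: "\<And>p. p \<in> S ==> emeasure \<rho> (Rg p) = ennreal (real (wn p) / real n)" "\<And>p. p \<in> S ==> 0 < wn p"
    and f: "\<And>f p. f \<in> set fs ==> f p \<le> 1"
  shows "(\<integral>\<^sup>+u. sval Rg fs S u \<partial>PiM UNIV (\<lambda>_. \<rho>)) = Pk wn fs S"
  using S w f
proof (induction fs arbitrary: S)
  case Nil
  interpret \<rho>: prob_space \<rho> by (rule \<rho>)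
  interpret sequence_space \<rho> ..
  have "sval Rg [] S = (\<lambda>_. 1)" by auto
  then show ?case using P.emeasure_space_1 by (simp add: space_PiM)
next
  case (Cons f fs)
  interpret \<rho>: prob_space \<rho> by (rule \<rho>)
  interpret sequence_space \<rho> ..
  let ?S = "PiM (UNIV :: nat set) (\<lambda>_. \<rho>)"
  let ?B = "\<Union>q\<in>S. Rg q"
  note [measurable_cong] = \<rho>(2)
  have Rm: "Rg p \<in> sets \<rho>" if "p \<in> S" for p using Cons.prems(3)[OF that] \<rho> by simp
  have B [measurable]: "?B \<in> sets \<rho>" using Cons.prems(1) Rm by auto
  have spu: "space \<rho> = UNIV" using sets_eq_imp_space_eq[OF \<rho>(2)] by simp
  have idm: "(\<lambda>u. u) \<in> measurable ?S PiB"
    by (intro measurable_PiM_single') (auto simp: space_PiM spu measurable_cong_sets[OF refl \<rho>(2)])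
  have meas: "sval Rg fs' S' \<in> borel_measurable ?S" if "S' \<subseteq> S" for fs' S'
  proof -
    have "(\<lambda>u. sval Rg (map (\<lambda>F. F u) (map (\<lambda>f _. f) fs')) S' u) \<in> borel_measurable ?S"
      using that Cons.prems(1,3) by (intro sval_measurable idm) (auto intro: finite_subset)
    then show ?thesis by (simp add: comp_def)
  qed
  have m1 [measurable]: "sval Rg fs (S - {p}) \<in> borel_measurable ?S" for p by (rule meas) auto
  have m2 [measurable]: "sval Rg (f # fs) S \<in> borel_measurable ?S" by (rule meas) auto
  have IH: "(\<integral>\<^sup>+u. sval Rg fs (S - {p}) u \<partial>?S) = Pk wn fs (S - {p})" for p
    using Cons.prems by (intro Cons.IH) (auto intro: disjoint_family_on_mono[of _ S])
  define J where "J = (\<integral>\<^sup>+u. sval Rg (f # fs) S u \<partial>?S)"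
  define A where "A = (\<Sum>p\<in>S. emeasure \<rho> (Rg p) * f p * Pk wn fs (S - {p}))"
  have fin: "J \<noteq> \<top>"
  proof -
    have "J \<le> (\<integral>\<^sup>+u. 1 \<partial>?S)"
      unfolding J_def using Cons.prems by (intro nn_integral_mono sval_le_1) auto
    also have "\<dots> = 1" using P.emeasure_space_1 by simp
    finally show ?thesis by (auto simp: top_unique)
  qed
  have "J = (\<integral>\<^sup>+s. \<integral>\<^sup>+u. sval Rg (f # fs) S (case_nat s u) \<partial>?S \<partial>\<rho>)"
    unfolding J_def by (rule iter_nn_integral[OF \<rho>(1) meas]) simp
  also have "\<dots> = (\<integral>\<^sup>+s. (\<Sum>p\<in>S. indicator (Rg p) s * (f p * Pk wn fs (S - {p}))) + indicator (- ?B) s * J \<partial>\<rho>)"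
  proof (intro nn_integral_cong)
    fix s
    have "(\<integral>\<^sup>+u. sval Rg (f # fs) S (case_nat s u) \<partial>?S) = (\<integral>\<^sup>+u. (\<Sum>p\<in>S. indicator (Rg p) s * f p * sval Rg fs (S - {p}) u) +
        indicator (- ?B) s * sval Rg (f # fs) S u \<partial>?S)"
      by (simp only: sval_case_nat[OF Cons.prems(2)])
    also have "\<dots> = (\<integral>\<^sup>+u. (\<Sum>p\<in>S. indicator (Rg p) s * f p * sval Rg fs (S - {p}) u) \<partial>?S) + (\<integral>\<^sup>+u. indicator (- ?B) s * sval Rg (f # fs) S u \<partial>?S)"
      by (rule nn_integral_add) measurable
    also have "(\<integral>\<^sup>+u. (\<Sum>p\<in>S. indicator (Rg p) s * f p * sval Rg fs (S - {p}) u) \<partial>?S)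
        = (\<Sum>p\<in>S. (\<integral>\<^sup>+u. indicator (Rg p) s * f p * sval Rg fs (S - {p}) u \<partial>?S))"
      by (rule nn_integral_sum) measurable
    also have "\<dots> = (\<Sum>p\<in>S. indicator (Rg p) s * (f p * Pk wn fs (S - {p})))"
      by (intro sum.cong refl) (simp add: nn_integral_cmult m1 IH mult.assoc)
    also have "(\<integral>\<^sup>+u. indicator (- ?B) s * sval Rg (f # fs) S u \<partial>?S) = indicator (- ?B) s * J"
      unfolding J_def by (rule nn_integral_cmult[OF m2])
    finally show "(\<integral>\<^sup>+u. sval Rg (f # fs) S (case_nat s u) \<partial>?S) = (\<Sum>p\<in>S. indicator (Rg p) s * (f p * Pk wn fs (S - {p}))) + indicator (- ?B) s * J" .
  qed
  also have "\<dots> = (\<integral>\<^sup>+s. (\<Sum>p\<in>S. indicator (Rg p) s * (f p * Pk wn fs (S - {p}))) \<partial>\<rho>) + (\<integral>\<^sup>+s. indicator (- ?B) s * J \<partial>\<rho>)"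
    using Rm B by (intro nn_integral_add borel_measurable_sum borel_measurable_times borel_measurable_indicator) (auto simp: Compl_eq_Diff_UNIV simp flip: spu)
  also have "(\<integral>\<^sup>+s. (\<Sum>p\<in>S. indicator (Rg p) s * (f p * Pk wn fs (S - {p}))) \<partial>\<rho>) = A"
    unfolding A_def using Rm
    by (subst nn_integral_sum) (auto simp: nn_integral_multc mult.assoc intro!: sum.cong)
  also have "(\<integral>\<^sup>+s. indicator (- ?B) s * J \<partial>\<rho>) = emeasure \<rho> (- ?B) * J"
    using B by (subst nn_integral_multc) (auto simp: Compl_eq_Diff_UNIV simp flip: spu)
  finally have J: "J = A + emeasure \<rho> (- ?B) * J" .
  define W where "W = sum wn S"
  have eB: "emeasure \<rho> ?B = ennreal (real W / real n)"
  proof -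
    have "emeasure \<rho> ?B = (\<Sum>p\<in>S. emeasure \<rho> (Rg p))"
      using Cons.prems Rm by (intro sum_emeasure[symmetric]) auto
    also have "\<dots> = (\<Sum>p\<in>S. ennreal (real (wn p) / real n))" using Cons.prems by simp
    also have "\<dots> = ennreal (real W / real n)"
      by (subst sum_ennreal) (auto simp: W_def sum_divide_distrib)
    finally show ?thesis .
  qed
  have J2: "J = emeasure \<rho> ?B * J + emeasure \<rho> (- ?B) * J"
  proof -
    have "emeasure \<rho> ?B + emeasure \<rho> (- ?B) = 1"
      using B \<rho>.emeasure_space_1 spu plus_emeasure[of ?B \<rho> "- ?B"] by (simp add: Compl_eq_Diff_UNIV sets.compl_sets[OF B, unfolded spu])
    then show ?thesis by (simp add: distrib_right[symmetric])
  qed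
  have "emeasure \<rho> (- ?B) * J \<noteq> \<top>"
    using fin \<rho>.emeasure_finite by (simp add: ennreal_mult_eq_top_iff)
  moreover have "emeasure \<rho> ?B * J + emeasure \<rho> (- ?B) * J = A + emeasure \<rho> (- ?B) * J"
    by (rule trans[OF J2[symmetric] J])
  ultimately have A: "emeasure \<rho> ?B * J = A"
    by (simp add: add.commute[of _ "emeasure \<rho> (- ?B) * J"] ennreal_add_left_cancel)
  show ?case
  proof (cases "S = {}")
    case False
    then have W: "W > 0" using Cons.prems by (auto simp: W_def intro!: sum_pos)
    then have r: "ennreal (real n / real W) * ennreal (real W / real n) = 1" using n by (simp flip: ennreal_mult)
    have "J = ennreal (real n / real W) * (ennreal (real W / real n) * J)" using r by (simp add: mult.assoc[symmetric])
    also have "\<dots> = ennreal (real n / real W) * A" using A eB by simp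
    also have "\<dots> = (\<Sum>p\<in>S. ennreal (real (wn p) / real W) * f p * Pk wn fs (S - {p}))"
      unfolding A_def sum_distrib_left
    proof (intro sum.cong refl)
      fix p assume p: "p \<in> S"
      have "ennreal (real n / real W) * ennreal (real (wn p) / real n) = ennreal (real (wn p) / real W)"
        using n W by (simp flip: ennreal_mult)
      then show "ennreal (real n / real W) * (emeasure \<rho> (Rg p) * f p * Pk wn fs (S - {p})) =
         ennreal (real (wn p) / real W) * f p * Pk wn fs (S - {p})"
        using Cons.prems p by (simp add: mult.assoc[symmetric])
    qed
    finally show ?thesis by (simp add: J_def W_def)
  qed simp
qed

text \<open>\<open>Q\<close> cuts the walk after every pick, \<open>Pk\<close> removes faces of one
  fixed walk. The two agree because cutting out a face leaves the other faces and their increments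
  unchanged up to relabelling.\<close>

lemma Q_eq_Pk:
  assumes "full (walk y) n" "\<And>\<phi> k. \<phi> \<in> set \<phi>s ==> dep k (\<phi> k)"
  shows "Q \<phi>s n y = Pk snd (map (\<lambda>\<phi> p. \<phi> (snd p) (shift_seq (fst p) y)) \<phi>s) (faces (walk y) n)"
  using assms
proof (induction \<phi>s arbitrary: n y)
  case (Cons \<phi> \<phi>s)
  let ?F = "faces (walk y) n"
  have "Q \<phi>s (n - k) (skip i k y) = Pk snd (map (\<lambda>\<phi> p. \<phi> (snd p) (shift_seq (fst p) y)) \<phi>s) (?F - {(i, k)})"
    if p: "(i, k) \<in> ?F" for i k
  proof -
    have "Q \<phi>s (n - k) (skip i k y) = Pk snd (map (\<lambda>\<phi> p. \<phi> (snd p) (shift_seq (fst p) (skip i k y))) \<phi>s)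
        (relabel i k ` (?F - {(i, k)}))"
      using Cons.IH[OF faces_skip(2)[OF p Cons.prems(1)]] Cons.prems(2) by (simp add: faces_skip(1)[OF p Cons.prems(1)])
    also have "\<dots> = Pk snd (map (\<lambda>\<phi> p. \<phi> (snd p) (shift_seq (fst p) y)) \<phi>s) (?F - {(i, k)})"
    proof (rule Pk_reindex[where T = "?F - {(i, k)}"])
      show "inj_on (relabel i k) (?F - {(i, k)})" by (rule inj_on_relabel[OF p])
      show "?F - {(i, k)} \<subseteq> ?F - {(i, k)}" ..
      show "\<forall>q\<in>?F - {(i, k)}. snd (relabel i k q) = snd q" by (auto simp: relabel_def)
      have "\<phi> (snd (relabel i k q)) (shift_seq (fst (relabel i k q)) (skip i k y)) = \<phi> (snd q) (shift_seq (fst q) y)"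
        if "\<phi> \<in> set \<phi>s" "q \<in> ?F - {(i, k)}" for \<phi> q
      proof -
        obtain i' k' where q: "q = (i', k')" by fastforce
        have "dep k' (\<phi> k')" using that Cons.prems(2) by simp
        moreover have "shift_seq (fst (relabel i k (i', k'))) (skip i k y) m = shift_seq i' y m" if "m < k'" for m
          using shift_relabel[OF p _ _ that] \<open>q \<in> _\<close> q by blast
        ultimately have "\<phi> k' (shift_seq (fst (relabel i k (i', k'))) (skip i k y)) = \<phi> k' (shift_seq i' y)"
          unfolding dep_def by blast
        then show ?thesis by (simp add: q relabel_def)
      qed
      then show "list_all2 (\<lambda>f' f. \<forall>p\<in>?F - {(i, k)}. f' (relabel i k p) = f p)
         (map (\<lambda>\<phi> p. \<phi> (snd p) (shift_seq (fst p) (skip i k y))) \<phi>s) (map (\<lambda>\<phi> p. \<phi> (snd p) (shift_seq (fst p) y)) \<phi>s)"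
        by (simp add: list_all2_map1 list_all2_map2 list.rel_refl_strong)
    qed
    finally show ?thesis .
  qed
  then show ?case using Cons.prems(1) unfolding full_def
    by (auto simp: split_beta intro!: sum.cong)
qed simp

text \<open>Half open, so that for a full walk every point of [0, t) lies in exactly one
  region.\<close>

definition reg :: "real => nat => nat \<times> nat => real set" where
  "reg t n p = {gp t n (fst p) ..< gp t n (fst p + snd p)}"

definition Sv :: "real => (nat => (nat => real) => ennreal) list => nat => (nat => real) => (nat => real) => ennreal" where
  "Sv t \<phi>s n y u = sval (reg t n) (map (\<lambda>\<phi> p. \<phi> (snd p) (shift_seq (fst p) y)) \<phi>s) (faces (walk y) n) u"

text \<open>Stick breaking on the grid. With the ceiling, the block length is uniform in {1..n} when
  \<open>v 0\<close> is uniform, which is the weight in \<open>R\<close>.\<close>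

fun St :: "(nat => (nat => real) => ennreal) list => nat => (nat => real) => (nat => real) => ennreal" where
  "St [] n y v = 1"
| "St (\<phi> # \<phi>s) n y v = (let k = nat \<lceil>v 0 * real n\<rceil> in
     xrot k \<phi> y * St \<phi>s (n - k) (shift_seq k y) (shift_seq 1 v))"

lemma shift_seq_measurable [measurable]:
  "shift_seq k \<in> measurable (PiM UNIV (\<lambda>_. M)) (PiM UNIV (\<lambda>_. M))"
  unfolding shift_seq_def[abs_def] by (rule measurable_PiM_single') (auto simp: space_PiM PiE_iff)

lemma emeasure_lborel_between:
  fixes a b :: real
  assumes "a \<le> b" "{a<..<b} \<subseteq> A" "A \<subseteq> {a..b}" "A \<in> sets borel"
  shows "emeasure lborel A = ennreal (b - a)"
proof (rule antisym)
  show "emeasure lborel A \<le> ennreal (b - a)"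
    using emeasure_mono[OF assms(3), of lborel] assms by simp
  show "ennreal (b - a) \<le> emeasure lborel A"
    using emeasure_mono[OF assms(2), of lborel] assms by simp
qed

lemma emeasure_uniform_reg:
  assumes "0 < t" "0 < n" "i + k \<le> n"
  shows "emeasure (unif t) (reg t n (i, k)) = ennreal (real k / real n)"
proof -
  have "real (i + k) * t \<le> real n * t" using assms by (intro mult_right_mono) auto
  then have le: "gp t n (i + k) \<le> t" using assms by (simp add: field_simps)
  have ge: "0 \<le> gp t n i" using assms by simp
  have "emeasure lborel ({0<..<t} \<inter> reg t n (i, k)) = ennreal (gp t n (i + k) - gp t n i)"
  proof (rule emeasure_lborel_between)
    show "gp t n i \<le> gp t n (i + k)"
      using assms by (simp add: divide_right_mono)
    show "{gp t n i<..<gp t n (i + k)} \<subseteq> {0<..<t} \<inter> reg t n (i, k)"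
      using le ge by (auto simp: reg_def simp del: of_nat_add)
    show "{0<..<t} \<inter> reg t n (i, k) \<subseteq> {gp t n i..real (i + k) * t / real n}"
      by (auto simp: reg_def)
  qed (simp add: reg_def)
  also have "gp t n (i + k) - gp t n i = gp t n k"
    by (simp add: algebra_simps add_divide_distrib)
  finally have "emeasure (unif t) (reg t n (i, k)) = ennreal (gp t n k) / ennreal t"
    using assms by (subst emeasure_uniform_measure) (auto simp: reg_def)
  also have "\<dots> = ennreal (real k / real n)"
    using assms by (simp add: divide_ennreal)
  finally show ?thesis .
qed

lemma reg_disjoint:
  assumes "0 < t" "0 < n"
  shows "disjoint_family_on (reg t n) (faces w n)"
proof -
  have "reg t n p \<inter> reg t n q = {}" if pq: "p \<in> faces w n" "q \<in> faces w n" "p \<noteq> q" for p q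
  proof -
    obtain i k i' k' where [simp]: "p = (i, k)" "q = (i', k')" by (cases p, cases q) blast
    have "i + k \<le> i' \<or> i' + k' \<le> i"
      using faces_overlap[of i k w n i' k'] pq by force
    then have "gp t n (i + k) \<le> gp t n i' \<or> gp t n (i' + k') \<le> gp t n i"
      using assms by (metis divide_right_mono mult_right_mono of_nat_0_le_iff of_nat_mono less_imp_le)
    then show ?thesis by (auto simp: reg_def simp del: of_nat_add)
  qed
  then show ?thesis by (auto simp: disjoint_family_on_def)
qed

lemma nn_integral_ceiling:
  assumes n: "0 < n"
  shows "(\<integral>\<^sup>+s. g (nat \<lceil>s * real n\<rceil>) \<partial>unif 1) = (\<Sum>k=1..n. ennreal (1 / real n) * g k)"
proof -
  let ?I = "\<lambda>k. {(real k - 1) / real n <.. real k / real n}"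
  have gm: "(\<lambda>s. g (nat \<lceil>s * real n\<rceil>)) \<in> borel_measurable borel"
    by measurable
  have "(\<integral>\<^sup>+s. g (nat \<lceil>s * real n\<rceil>) \<partial>unif 1) = (\<integral>\<^sup>+s. g (nat \<lceil>s * real n\<rceil>) * indicator {0<..<1} s \<partial>lborel)"
    using gm by (subst nn_integral_uniform_measure) (auto simp: divide_ennreal_def)
  also have "\<dots> = (\<integral>\<^sup>+s. (\<Sum>k=1..n. g k * indicator (?I k) s) \<partial>lborel)"
  proof (rule nn_integral_cong_AE)
    \<comment> \<open>The point 1 belongs to the last half-open cell but not to the open unit
      interval.\<close>
    show "AE s in lborel. g (nat \<lceil>s * real n\<rceil>) * indicator {0<..<1} s = (\<Sum>k=1..n. g k * indicator (?I k) s)"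
      using AE_lborel_singleton[of 1]
    proof eventually_elim
      case (elim s)
      show ?case
      proof (cases "0 < s \<and> s < 1")
        case True
        define K where "K = nat \<lceil>s * real n\<rceil>"
        have c: "0 < \<lceil>s * real n\<rceil>" "\<lceil>s * real n\<rceil> \<le> int n"
          using True n by (auto simp: ceiling_le_iff)
        then have K: "K \<in> {1..n}" unfolding K_def atLeastAtMost_iff by linarith
        have "s \<in> ?I k \<longleftrightarrow> k = K" if "k \<in> {1..n}" for k
        proof -
          have "s \<in> ?I k \<longleftrightarrow> real k - 1 < s * real n \<and> s * real n \<le> real k"
            using n by (simp add: field_simps)
          also have "\<dots> \<longleftrightarrow> \<lceil>s * real n\<rceil> = int k" by (simp add: ceiling_eq_iff)
          also have "\<dots> \<longleftrightarrow> k = K" using c by (auto simp: K_def)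
          finally show ?thesis .
        qed
        then have "(\<Sum>k=1..n. g k * indicator (?I k) s) = (\<Sum>k=1..n. if k = K then g k else 0)"
          by (intro sum.cong refl) (auto simp: indicator_def)
        also have "\<dots> = g K" using K by (subst sum.delta) auto
        finally show ?thesis using True by (simp add: K_def)
      next
        case False
        have "s \<notin> ?I k" if "k \<in> {1..n}" for k
        proof
          assume s: "s \<in> ?I k"
          have "0 \<le> (real k - 1) / real n" using that n by simp
          moreover have "real k / real n \<le> 1" using that n by simp
          ultimately have "0 < s \<and> s \<le> 1"
            using s by (meson greaterThanAtMost_iff order_le_less_trans order_trans)
          then show False using elim False by auto
        qed
        then have "(\<Sum>k=1..n. g k * indicator (?I k) s) = 0" by (intro sum.neutral) auto
        then show ?thesis using False by auto
      qed
    qed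
  qed
  also have "\<dots> = (\<Sum>k=1..n. g k * emeasure lborel (?I k))"
    by (subst nn_integral_sum) (auto intro!: sum.cong simp: nn_integral_cmult_indicator)
  also have "\<dots> = (\<Sum>k=1..n. ennreal (1 / real n) * g k)"
  proof (intro sum.cong refl)
    fix k
    have "real k / real n - (real k - 1) / real n = 1 / real n" using n by (simp add: field_simps)
    then show "g k * emeasure lborel (?I k) = ennreal (1 / real n) * g k"
      using n by (simp add: divide_right_mono mult.commute)
  qed
  finally show ?thesis .
qed

lemma dep_xrot:
  assumes "dep k (\<phi> k)"
  shows "dep k (xrot k \<phi>)"
  unfolding dep_def
proof (intro allI impI)
  fix y y' :: "nat => real" assume e: "\<forall>m<k. y m = y' m"
  have "\<forall>m<k. rot r k y m = rot r k y' m" for r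
    using e by (auto simp: rot_def)
  then have "exc k (rot r k y) = exc k (rot r k y')" "\<phi> k (rot r k y) = \<phi> k (rot r k y')" for r
    using dep_exc[of k] assms unfolding dep_def by blast+
  then show "xrot k \<phi> y = xrot k \<phi> y'" by (simp add: xrot_def cong: if_cong)
qed

context diffuse_law begin

lemma faces_count_measurable:
  "(\<lambda>y. faces (walk y) n) \<in> measurable \<mu> (count_space (Pow ({..n} \<times> {..n})))"
proof -
  have sub: "faces w n \<subseteq> {..n} \<times> {..n}" for w by (auto simp: faces_def)
  have "(\<lambda>y. faces (walk y) n) -` {S} \<inter> space \<mu> \<in> sets \<mu>" if "S \<in> Pow ({..n} \<times> {..n})" for S
  proof -
    have "(\<lambda>y. faces (walk y) n) -` {S} \<inter> space \<mu> =
       {y\<in>space \<mu>. \<forall>i\<in>{..n}. \<forall>k\<in>{..n}. ((i, k) \<in> faces (walk y) n) = ((i, k) \<in> S)}"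
      using that sub by fastforce
    also have "\<dots> \<in> sets \<mu>" by measurable
    finally show ?thesis .
  qed
  then show ?thesis using sub by (subst measurable_count_space_eq2) auto
qed

lemma Sv_measurable:
  assumes x: "x \<in> measurable N \<mu>" and u: "u \<in> measurable N PiB"
    and \<phi>: "\<forall>\<phi>\<in>set \<phi>s. block_fun \<phi>"
  shows "(\<lambda>z. Sv t \<phi>s n (x z) (u z)) \<in> borel_measurable N"
proof -
  let ?F = "\<lambda>z S. sval (reg t n) (map (\<lambda>F. F z) (map (\<lambda>\<phi> z p. \<phi> (snd p) (shift_seq (fst p) (x z))) \<phi>s)) S (u z)"
  have "(\<lambda>z. ?F z (faces (walk (x z)) n)) \<in> borel_measurable N"
  proof (rule measurable_compose_countable'[where I = "Pow ({..n} \<times> {..n})" and f = "\<lambda>S z. ?F z S"])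
    fix S assume "S \<in> Pow ({..n} \<times> {..n})"
    show "(\<lambda>z. ?F z S) \<in> borel_measurable N"
    proof (rule sval_measurable[OF _ _ u])
      show "finite S" using \<open>S \<in> _\<close> by (auto intro: finite_subset)
      fix F p assume "F \<in> set (map (\<lambda>\<phi> z p. \<phi> (snd p) (shift_seq (fst p) (x z))) \<phi>s)"
      then obtain \<phi> where "\<phi> \<in> set \<phi>s" and F: "F = (\<lambda>z p. \<phi> (snd p) (shift_seq (fst p) (x z)))" by auto
      then have [measurable]: "\<phi> k \<in> borel_measurable \<mu>" for k using \<phi> block_fun_measurable by blast
      note x [measurable]
      show "(\<lambda>z. F z p) \<in> borel_measurable N" unfolding F by measurable
    qed (simp add: reg_def)
  next
    show "(\<lambda>z. faces (walk (x z)) n) \<in> measurable N (count_space (Pow ({..n} \<times> {..n})))"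
      using measurable_compose[OF x faces_count_measurable] by simp
  qed (simp add: countable_finite)
  then show ?thesis by (simp add: Sv_def comp_def)
qed

lemma nn_integral_Sv:
  assumes t: "0 < t" and n: "0 < n" and \<phi>: "\<forall>\<phi>\<in>set \<phi>s. block_fun \<phi>" "\<And>\<phi> k y. \<phi> \<in> set \<phi>s ==> \<phi> k y \<le> 1"
  shows "(\<integral>\<^sup>+y. \<integral>\<^sup>+u. Sv t \<phi>s n y u \<partial>PiM UNIV (\<lambda>_. unif t) \<partial>\<mu>) = R \<phi>s n"
proof -
  let ?\<rho> = "unif t"
  have \<rho>: "prob_space ?\<rho>" using t by (intro prob_space_uniform_measure) auto
  have "(\<integral>\<^sup>+y. \<integral>\<^sup>+u. Sv t \<phi>s n y u \<partial>PiM UNIV (\<lambda>_. ?\<rho>) \<partial>\<mu>) = (\<integral>\<^sup>+y. Q \<phi>s n y \<partial>\<mu>)"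
  proof (rule nn_integral_cong_AE, use AE_full[of n] in eventually_elim)
    case (elim y)
    have "(\<integral>\<^sup>+u. Sv t \<phi>s n y u \<partial>PiM UNIV (\<lambda>_. ?\<rho>)) =
       Pk snd (map (\<lambda>\<phi> p. \<phi> (snd p) (shift_seq (fst p) y)) \<phi>s) (faces (walk y) n)"
      unfolding Sv_def
    proof (rule nn_integral_sval[OF \<rho> _ _ _ _ n])
      fix p assume "p \<in> faces (walk y) n"
      then show "emeasure ?\<rho> (reg t n p) = ennreal (real (snd p) / real n)" "0 < snd p"
        using emeasure_uniform_reg[OF t n, of "fst p" "snd p"] by (auto simp: faces_def)
    qed (use reg_disjoint[OF t n] \<phi> in \<open>auto simp: reg_def\<close>)
    also have "\<dots> = Q \<phi>s n y"
      using \<phi> by (intro Q_eq_Pk[symmetric] elim) (auto simp: block_fun_def)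
    finally show ?case .
  qed
  also have "\<dots> = R \<phi>s n" by (rule nn_integral_Q[OF \<phi>(1)])
  finally show ?thesis .
qed

lemma St_measurable:
  assumes "x \<in> measurable N \<mu>" "v \<in> measurable N PiB" "\<forall>\<phi>\<in>set \<phi>s. block_fun \<phi>"
  shows "(\<lambda>z. St \<phi>s n (x z) (v z)) \<in> borel_measurable N"
  using assms
proof (induction \<phi>s arbitrary: n x v)
  case (Cons \<phi> \<phi>s)
  note [measurable] = Cons.prems(1,2)
  have \<phi> [measurable]: "xrot k \<phi> \<in> borel_measurable \<mu>" for k using Cons.prems by (intro xrot_measurable) auto
  let ?f = "\<lambda>k z. xrot k \<phi> (x z) * St \<phi>s (n - k) (shift_seq k (x z)) (shift_seq 1 (v z))"
  have [measurable]: "(\<lambda>z. St \<phi>s (n - k) (shift_seq k (x z)) (shift_seq 1 (v z))) \<in> borel_measurable N" for k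
    using Cons.prems by (intro Cons.IH) (auto intro: measurable_compose[OF _ shift_seq_measurable])
  have "(\<lambda>z. ?f (nat \<lceil>v z 0 * real n\<rceil>) z) \<in> borel_measurable N"
  proof (rule measurable_compose_countable[where f = ?f and g = "\<lambda>z. nat \<lceil>v z 0 * real n\<rceil>"])
    show "(\<lambda>z. nat \<lceil>v z 0 * real n\<rceil>) \<in> measurable N (count_space UNIV)" by measurable
  qed measurable
  then show ?case by (simp add: Let_def)
qed simp

lemma nn_integral_St:
  assumes \<phi>: "\<forall>\<phi>\<in>set \<phi>s. block_fun \<phi>"
  shows "(\<integral>\<^sup>+v. \<integral>\<^sup>+y. St \<phi>s n y v \<partial>\<mu> \<partial>PiM UNIV (\<lambda>_. unif 1)) = R \<phi>s n"
  using \<phi>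
proof (induction \<phi>s arbitrary: n)
  case Nil
  have "prob_space (PiM (UNIV :: nat set) (\<lambda>_. uniform_measure lborel {0<..<1::real}))"
    by (intro prob_space_PiM prob_space_uniform_measure) auto
  from prob_space.emeasure_space_1[OF this] show ?case by simp
next
  case (Cons \<phi> \<phi>s)
  let ?\<sigma> = "uniform_measure lborel {0<..<1::real}"
  let ?S = "PiM (UNIV :: nat set) (\<lambda>_. ?\<sigma>)"
  have \<sigma>: "prob_space ?\<sigma>" by (intro prob_space_uniform_measure) auto
  have sS: "sets ?S = sets PiB" by (intro sets_PiM_cong) auto
  have sf: "sigma_finite_measure \<mu>" by unfold_locales
  have bm: "(\<lambda>v. \<integral>\<^sup>+y. St \<phi>s n y v \<partial>\<mu>) \<in> borel_measurable ?S" if "\<forall>\<phi>\<in>set \<phi>s. block_fun \<phi>" for \<phi>s n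
  proof -
    have "(\<lambda>z. St \<phi>s n (snd z) (fst z)) \<in> borel_measurable (?S \<Otimes>\<^sub>M \<mu>)"
      using that by (intro St_measurable) (auto simp: measurable_cong_sets[OF refl sS, symmetric])
    then show ?thesis using sigma_finite_measure.borel_measurable_nn_integral_fst[OF sf] by simp
  qed
  define X where "X k = (\<integral>\<^sup>+y. xrot k \<phi> y \<partial>\<mu>)" for k
  have \<phi>m [measurable]: "xrot k \<phi> \<in> borel_measurable \<mu>" for k using Cons.prems by (intro xrot_measurable) auto
  have in1: "(\<integral>\<^sup>+y. St (\<phi> # \<phi>s) n y v \<partial>\<mu>) = X (nat \<lceil>v 0 * real n\<rceil>) *
      (\<integral>\<^sup>+y. St \<phi>s (n - nat \<lceil>v 0 * real n\<rceil>) y (shift_seq 1 v) \<partial>\<mu>)" for v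
  proof -
    have "(\<lambda>y. St \<phi>s (n - nat \<lceil>v 0 * real n\<rceil>) y (shift_seq 1 v)) \<in> borel_measurable \<mu>"
      using Cons.prems by (intro St_measurable) (auto simp: space_PiM)
    moreover have "dep k (xrot k \<phi>)" for k
      using Cons.prems by (intro dep_xrot) (simp add: block_fun_def)
    ultimately show ?thesis
      unfolding X_def St.simps Let_def by (subst nn_integral_split) auto
  qed
  have "(\<integral>\<^sup>+v. \<integral>\<^sup>+y. St (\<phi> # \<phi>s) n y v \<partial>\<mu> \<partial>?S) =
     (\<integral>\<^sup>+s. \<integral>\<^sup>+v. (\<integral>\<^sup>+y. St (\<phi> # \<phi>s) n y (case_nat s v) \<partial>\<mu>) \<partial>?S \<partial>?\<sigma>)"
    by (rule iter_nn_integral[OF \<sigma> bm[OF Cons.prems]])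
  also have "\<dots> = (\<integral>\<^sup>+s. X (nat \<lceil>s * real n\<rceil>) * R \<phi>s (n - nat \<lceil>s * real n\<rceil>) \<partial>?\<sigma>)"
  proof (intro nn_integral_cong)
    fix s
    have sh: "shift_seq 1 (case_nat s v) = v" for v :: "nat => real" by (auto simp: shift_seq_def)
    have "(\<integral>\<^sup>+v. (\<integral>\<^sup>+y. St (\<phi> # \<phi>s) n y (case_nat s v) \<partial>\<mu>) \<partial>?S)
      = (\<integral>\<^sup>+v. X (nat \<lceil>s * real n\<rceil>) * (\<integral>\<^sup>+y. St \<phi>s (n - nat \<lceil>s * real n\<rceil>) y v \<partial>\<mu>) \<partial>?S)"
      unfolding in1 sh by simp
    also have "\<dots> = X (nat \<lceil>s * real n\<rceil>) * R \<phi>s (n - nat \<lceil>s * real n\<rceil>)"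
      using Cons by (subst nn_integral_cmult) (auto intro: bm)
    finally show "(\<integral>\<^sup>+v. (\<integral>\<^sup>+y. St (\<phi> # \<phi>s) n y (case_nat s v) \<partial>\<mu>) \<partial>?S) =
      X (nat \<lceil>s * real n\<rceil>) * R \<phi>s (n - nat \<lceil>s * real n\<rceil>)" .
  qed
  also have "\<dots> = R (\<phi> # \<phi>s) n"
  proof (cases "n = 0")
    case True
    have "X 0 = 0" by (simp add: X_def xrot_def)
    then show ?thesis using True by simp
  next
    case False
    then show ?thesis
      using nn_integral_ceiling[of n "\<lambda>k. X k * R \<phi>s (n - k)"] by (simp add: X_def mult.assoc)
  qed
  finally show ?case .
qed

text \<open>Both sides equal \<open>R\<close>: one by integrating the sampling points first with the
  walk fixed, the other by integrating the walk first with the sticks fixed.\<close>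

theorem discrete_identity:
  assumes t: "0 < t" and n: "0 < n" and \<phi>: "\<forall>\<phi>\<in>set \<phi>s. block_fun \<phi>" "\<And>\<phi> k y. \<phi> \<in> set \<phi>s ==> \<phi> k y \<le> 1"
  shows "(\<integral>\<^sup>+z. Sv t \<phi>s n (fst z) (snd z) \<partial>(\<mu> \<Otimes>\<^sub>M PiM UNIV (\<lambda>_. unif t)))
    = (\<integral>\<^sup>+z. St \<phi>s n (fst z) (snd z) \<partial>(\<mu> \<Otimes>\<^sub>M PiM UNIV (\<lambda>_. unif 1)))"
proof -
  let ?U = "PiM (UNIV :: nat set) (\<lambda>_. unif t)"
  let ?V = "PiM (UNIV :: nat set) (\<lambda>_. uniform_measure lborel {0<..<1::real})"
  interpret U: prob_space ?U using t by (intro prob_space_PiM prob_space_uniform_measure) auto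
  interpret V: prob_space ?V by (intro prob_space_PiM prob_space_uniform_measure) auto
  interpret PV: pair_sigma_finite \<mu> ?V ..
  have sU: "sets ?U = sets PiB" "sets ?V = sets PiB"
    by (intro sets_PiM_cong; simp)+
  have "(\<lambda>z. Sv t \<phi>s n (fst z) (snd z)) \<in> borel_measurable (\<mu> \<Otimes>\<^sub>M ?U)"
    using \<phi> by (intro Sv_measurable) (auto simp: measurable_cong_sets[OF refl sU(1), symmetric])
  then have "(\<integral>\<^sup>+z. Sv t \<phi>s n (fst z) (snd z) \<partial>(\<mu> \<Otimes>\<^sub>M ?U)) = R \<phi>s n"
    using nn_integral_Sv[OF t n \<phi>(1)] \<phi>(2) by (subst U.nn_integral_fst[symmetric]) auto
  moreover have "(\<lambda>z. St \<phi>s n (fst z) (snd z)) \<in> borel_measurable (\<mu> \<Otimes>\<^sub>M ?V)"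
    using \<phi> by (intro St_measurable) (auto simp: measurable_cong_sets[OF refl sU(2), symmetric])
  then have "(\<integral>\<^sup>+z. St \<phi>s n (fst z) (snd z) \<partial>(\<mu> \<Otimes>\<^sub>M ?V)) = R \<phi>s n"
    using nn_integral_St[OF \<phi>(1)] by (subst PV.nn_integral_snd[symmetric]) (auto simp: split_beta')
  ultimately show ?thesis by simp
qed

end

section \<open>Cadlag paths and their supporting lines\<close>

lemma cadlag_tendsto_right: "cadlag f ==> 0 \<le> s ==> (f \<longlongrightarrow> f s) (at_right s)"
  by (simp add: cadlag_def continuous_within)

lemma cadlag_tendsto_left: "cadlag f ==> 0 < s ==> (f \<longlongrightarrow> lft f s) (at_left s)"
proof -
  assume "cadlag f" "0 < s"
  then obtain l where l: "(f \<longlongrightarrow> l) (at_left s)" by (auto simp: cadlag_def)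
  then have "Lim (at_left s) f = l" by (intro tendsto_Lim) auto
  with l \<open>0 < s\<close> show ?thesis by (simp add: lft_def)
qed

lemma lft_0 [simp]: "lft f 0 = f 0"
  by (simp add: lft_def)

text \<open>The lower semicontinuous version of a cadlag path. Minima and contacts with a supporting
  line are attained for it, whereas \<open>f\<close> itself may reach them only as a left
  limit.\<close>

definition fm :: "(real => real) => real => real" where
  "fm f s = min (f s) (lft f s)"

lemma fm_0 [simp]: "fm f 0 = f 0"
  by (simp add: fm_def)

lemma cadlag_near:
  assumes f: "cadlag f" and \<tau>: "0 \<le> \<tau>" and e: "0 < e"
  obtains \<eta> where "0 < \<eta>"
    "\<And>s. \<tau> \<le> s ==> s < \<tau> + \<eta> ==> \<bar>f s - f \<tau>\<bar> < e"
    "\<And>s. 0 \<le> s ==> \<tau> - \<eta> < s ==> s < \<tau> ==> \<bar>f s - lft f \<tau>\<bar> < e"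
proof -
  have "eventually (\<lambda>s. dist (f s) (f \<tau>) < e) (at_right \<tau>)"
    using cadlag_tendsto_right[OF f \<tau>] e by (rule tendstoD)
  then obtain b where b: "\<tau> < b" "\<And>s. \<tau> < s ==> s < b ==> \<bar>f s - f \<tau>\<bar> < e"
    by (auto simp: eventually_at_right_field dist_real_def)
  show ?thesis
  proof (cases "\<tau> = 0")
    case True
    show ?thesis
      by (rule that[of "b - \<tau>"]) (use b True e in \<open>force simp: le_less\<close>)+
  next
    case False
    then have "eventually (\<lambda>s. dist (f s) (lft f \<tau>) < e) (at_left \<tau>)"
      using cadlag_tendsto_left[OF f, of \<tau>] e \<tau> by (intro tendstoD) auto
    then obtain a where a: "a < \<tau>" "\<And>s. a < s ==> s < \<tau> ==> \<bar>f s - lft f \<tau>\<bar> < e"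
      by (auto simp: eventually_at_left_field dist_real_def)
    have r: "\<bar>f s - f \<tau>\<bar> < e" if "\<tau> \<le> s" "s < b" for s
      using b(2)[of s] that e by (cases "s = \<tau>") auto
    show ?thesis
      by (rule that[of "min (b - \<tau>) (\<tau> - a)"]) (use a b(1) r in auto)
  qed
qed

lemma cadlag_seq_right:
  assumes f: "cadlag f" and \<tau>: "0 \<le> \<tau>" and s: "\<sigma> \<longlonglongrightarrow> \<tau>" and ge: "eventually (\<lambda>n. \<tau> \<le> \<sigma> n) sequentially"
  shows "(\<lambda>n. f (\<sigma> n)) \<longlonglongrightarrow> f \<tau>"
proof (rule tendstoI)
  fix e :: real assume "0 < e"
  then obtain \<eta> where h: "0 < \<eta>" "\<And>s. \<tau> \<le> s ==> s < \<tau> + \<eta> ==> \<bar>f s - f \<tau>\<bar> < e"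
    using cadlag_near[OF f \<tau>] by metis
  have "eventually (\<lambda>n. \<sigma> n < \<tau> + \<eta>) sequentially" using s h(1) by (intro order_tendstoD) auto
  with ge show "eventually (\<lambda>n. dist (f (\<sigma> n)) (f \<tau>) < e) sequentially"
    by eventually_elim (use h in \<open>auto simp: dist_real_def\<close>)
qed

lemma cadlag_seq_left:
  assumes f: "cadlag f" and \<tau>: "0 < \<tau>" and s: "\<sigma> \<longlonglongrightarrow> \<tau>" and lt: "eventually (\<lambda>n. \<sigma> n < \<tau>) sequentially"
  shows "(\<lambda>n. f (\<sigma> n)) \<longlonglongrightarrow> lft f \<tau>"
proof -
  have "filterlim \<sigma> (at_left \<tau>) sequentially"
    using s lt by (auto simp: filterlim_at elim: eventually_mono)
  with cadlag_tendsto_left[OF f \<tau>] show ?thesis by (rule filterlim_compose)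
qed

text \<open>The sequence may alternate between the two sides of \<open>\<tau>\<close>, so only the
  smaller of the two one-sided values can serve as a bound.\<close>

lemma cadlag_seq_lower:
  assumes f: "cadlag f" and \<tau>: "0 \<le> \<tau>" and s: "\<sigma> \<longlonglongrightarrow> \<tau>" and ge: "\<And>n. 0 \<le> \<sigma> n" and e: "0 < e"
  shows "eventually (\<lambda>n. fm f \<tau> - e < f (\<sigma> n)) sequentially"
proof -
  obtain \<eta> where h: "0 < \<eta>" "\<And>s. \<tau> \<le> s ==> s < \<tau> + \<eta> ==> \<bar>f s - f \<tau>\<bar> < e"
    "\<And>s. 0 \<le> s ==> \<tau> - \<eta> < s ==> s < \<tau> ==> \<bar>f s - lft f \<tau>\<bar> < e"
    using cadlag_near[OF f \<tau> e] by metis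
  have "eventually (\<lambda>n. \<sigma> n < \<tau> + \<eta>) sequentially" "eventually (\<lambda>n. \<tau> - \<eta> < \<sigma> n) sequentially"
    using s h(1) by (auto intro!: order_tendstoD)
  then show ?thesis
  proof eventually_elim
    case (elim n)
    then show ?case using h(2)[of "\<sigma> n"] h(3)[of "\<sigma> n"] ge[of n] by (cases "\<tau> \<le> \<sigma> n") (auto simp: fm_def)
  qed
qed

lemma cadlag_seq_cont:
  assumes f: "cadlag f" and \<tau>: "0 < \<tau>" and c: "lft f \<tau> = f \<tau>" and s: "\<sigma> \<longlonglongrightarrow> \<tau>"
  shows "(\<lambda>n. f (\<sigma> n)) \<longlonglongrightarrow> f \<tau>"
proof (rule tendstoI)
  fix e :: real assume "0 < e"
  then obtain \<eta> where h: "0 < \<eta>" "\<And>s. \<tau> \<le> s ==> s < \<tau> + \<eta> ==> \<bar>f s - f \<tau>\<bar> < e"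
    "\<And>s. 0 \<le> s ==> \<tau> - \<eta> < s ==> s < \<tau> ==> \<bar>f s - lft f \<tau>\<bar> < e"
    using cadlag_near[OF f, of \<tau>] \<tau> by (metis less_imp_le)
  have "eventually (\<lambda>n. \<sigma> n < \<tau> + \<eta>) sequentially" using s h(1) by (intro order_tendstoD) auto
  moreover have "eventually (\<lambda>n. max 0 (\<tau> - \<eta>) < \<sigma> n) sequentially" using s h(1) \<tau> by (intro order_tendstoD) auto
  ultimately show "eventually (\<lambda>n. dist (f (\<sigma> n)) (f \<tau>) < e) sequentially"
  proof eventually_elim
    case (elim n)
    then show ?case using h(2)[of "\<sigma> n"] h(3)[of "\<sigma> n"] c by (cases "\<tau> \<le> \<sigma> n") (auto simp: dist_real_def)
  qed
qed

lemma cadlag_bounded: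
  assumes f: "cadlag f"
  obtains B where "0 < B" "\<And>s. s \<in> {0..T} ==> \<bar>f s\<bar> \<le> B"
proof -
  have "\<exists>B. \<forall>s\<in>{0..T}. \<bar>f s\<bar> \<le> B"
  proof (rule ccontr)
    assume "\<not> ?thesis"
    then have "\<forall>n. \<exists>s\<in>{0..T}. real n < \<bar>f s\<bar>" by (meson not_le)
    then obtain \<sigma> where \<sigma>: "\<And>n. \<sigma> n \<in> {0..T}" "\<And>n. real n < \<bar>f (\<sigma> n)\<bar>" by metis
    have sc: "seq_compact {0..T}" using compact_imp_seq_compact compact_Icc by blast
    then obtain \<tau> r where r: "\<tau> \<in> {0..T}" "strict_mono r" "(\<sigma> \<circ> r) \<longlonglongrightarrow> \<tau>"
      using sc \<sigma>(1) unfolding seq_compact_def by blast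
    have \<tau>: "0 \<le> \<tau>" using r by simp
    obtain \<eta> where h: "0 < \<eta>" "\<And>s. \<tau> \<le> s ==> s < \<tau> + \<eta> ==> \<bar>f s - f \<tau>\<bar> < 1"
      "\<And>s. 0 \<le> s ==> \<tau> - \<eta> < s ==> s < \<tau> ==> \<bar>f s - lft f \<tau>\<bar> < 1"
      using cadlag_near[OF f \<tau>, of 1] by (metis zero_less_one)
    obtain N where N: "real N > \<bar>f \<tau>\<bar> + \<bar>lft f \<tau>\<bar> + 1" using reals_Archimedean2 by blast
    have "eventually (\<lambda>n. (\<sigma> \<circ> r) n < \<tau> + \<eta>) sequentially" using h(1) by (intro order_tendstoD[OF r(3)]) auto
    moreover have "eventually (\<lambda>n. \<tau> - \<eta> < (\<sigma> \<circ> r) n) sequentially" using h(1) by (intro order_tendstoD[OF r(3)]) auto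
    moreover have "eventually (\<lambda>n. N \<le> n) sequentially" by (rule eventually_ge_at_top)
    ultimately have "eventually (\<lambda>n. False) sequentially"
    proof eventually_elim
      case (elim n)
      let ?s = "\<sigma> (r n)"
      have "\<bar>f ?s\<bar> \<le> \<bar>f \<tau>\<bar> + \<bar>lft f \<tau>\<bar> + 1"
        using h(2)[of ?s] h(3)[of ?s] elim \<sigma>(1)[of "r n"] by (cases "\<tau> \<le> ?s") auto
      moreover have "real N \<le> real (r n)" using elim seq_suble[OF r(2), of n] by simp
      ultimately show False using \<sigma>(2)[of "r n"] N by linarith
    qed
    then show False by simp
  qed
  then obtain B where B: "\<forall>s\<in>{0..T}. \<bar>f s\<bar> \<le> B" by blast
  show ?thesis by (rule that[of "max B 1"]) (use B in \<open>auto simp: le_max_iff_disj\<close>)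
qed

text \<open>Jumps larger than a fixed \<open>e\<close> cannot accumulate in a bounded interval: on
  either side of a limit point the path, and hence its left limits, stays within
  \<open>e / 2\<close> of a constant.\<close>

lemma countable_cadlag_jumps:
  assumes f: "cadlag f"
  shows "countable {s. 0 < s \<and> lft f s \<noteq> f s}"
proof -
  define D where "D e N = {s. 0 < s \<and> s \<le> real N \<and> e < \<bar>lft f s - f s\<bar>}" for e N
  have fin: "finite (D e N)" if e: "0 < e" for e N
  proof (rule ccontr)
    assume "infinite (D e N)"
    moreover have "D e N \<subseteq> {0..real N}" by (auto simp: D_def)
    ultimately obtain \<tau> where \<tau>: "\<tau> \<in> {0..real N}" "\<tau> islimpt D e N"
      using compact_Icc[of 0 "real N"] unfolding compact_eq_Bolzano_Weierstrass by blast
    have \<tau>0: "0 \<le> \<tau>" using \<tau> by simp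
    obtain \<eta> where h: "0 < \<eta>" "\<And>s. \<tau> \<le> s ==> s < \<tau> + \<eta> ==> \<bar>f s - f \<tau>\<bar> < e/2"
      "\<And>s. 0 \<le> s ==> \<tau> - \<eta> < s ==> s < \<tau> ==> \<bar>f s - lft f \<tau>\<bar> < e/2"
      using cadlag_near[OF f \<tau>0, of "e/2"] e by (metis half_gt_zero)
    obtain s where s: "s \<in> D e N" "s \<noteq> \<tau>" "dist s \<tau> < \<eta>"
      using \<tau>(2) h(1) unfolding islimpt_approachable by blast
    have s0: "0 < s" "e < \<bar>lft f s - f s\<bar>" using s by (auto simp: D_def)
    define c where "c = (if \<tau> < s then f \<tau> else lft f \<tau>)"
    have near: "\<bar>f s' - c\<bar> < e/2" if "(if \<tau> < s then \<tau> else max 0 (\<tau> - \<eta>)) < s'" "s' \<le> s" for s'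
      using h(2)[of s'] h(3)[of s'] that s by (auto simp: c_def dist_real_def split: if_splits)
    have "\<bar>lft f s - c\<bar> \<le> e/2"
    proof (rule tendsto_upperbound)
      show "((\<lambda>s. \<bar>f s - c\<bar>) \<longlongrightarrow> \<bar>lft f s - c\<bar>) (at_left s)"
        by (intro tendsto_intros cadlag_tendsto_left f s0)
      have "(if \<tau> < s then \<tau> else max 0 (\<tau> - \<eta>)) < s" using s s0 by (auto simp: dist_real_def)
      then have "eventually (\<lambda>s'. (if \<tau> < s then \<tau> else max 0 (\<tau> - \<eta>)) < s' \<and> s' < s) (at_left s)"
        by (auto simp: eventually_at_left_field)
      then show "eventually (\<lambda>s'. \<bar>f s' - c\<bar> \<le> e/2) (at_left s)"
        by eventually_elim (use near in force)
    qed simp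
    moreover have "\<bar>f s - c\<bar> < e/2" using s s0 by (intro near) (auto simp: dist_real_def)
    ultimately show False using s0(2) by linarith
  qed
  have "{s. 0 < s \<and> lft f s \<noteq> f s} \<subseteq> (\<Union>p. \<Union>N. D (1 / real (Suc p)) N)"
  proof
    fix s assume s: "s \<in> {s. 0 < s \<and> lft f s \<noteq> f s}"
    then have "0 < \<bar>lft f s - f s\<bar>" by auto
    then obtain p where "1 / real (Suc p) < \<bar>lft f s - f s\<bar>" using nat_approx_posE by blast
    moreover obtain N where "s \<le> real N" using real_arch_simple by blast
    ultimately show "s \<in> (\<Union>p. \<Union>N. D (1 / real (Suc p)) N)" using s by (auto simp: D_def)
  qed
  moreover have "countable (\<Union>p. \<Union>N. D (1 / real (Suc p)) N)"
    by (simp add: countable_finite fin)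
  ultimately show ?thesis by (rule countable_subset)
qed

lemma tendsto_subsubseq:
  fixes x :: "nat => 'a::metric_space"
  assumes "\<And>\<sigma>. strict_mono (\<sigma> :: nat => nat) ==> \<exists>r. strict_mono (r :: nat => nat) \<and> (\<lambda>n. x (\<sigma> (r n))) \<longlonglongrightarrow> L"
  shows "x \<longlonglongrightarrow> L"
proof (rule ccontr)
  assume "\<not> ?thesis"
  then obtain e where e: "0 < e" "\<not> eventually (\<lambda>n. dist (x n) L < e) sequentially"
    by (auto simp: tendsto_iff)
  then have "infinite {n. \<not> dist (x n) L < e}"
    by (simp add: not_eventually frequently_cofinite flip: cofinite_eq_sequentially)
  then obtain \<sigma> :: "nat => nat" where \<sigma>: "strict_mono \<sigma>" "\<And>n. \<sigma> n \<in> {n. \<not> dist (x n) L < e}"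
    using infinite_enumerate by blast
  obtain r where r: "strict_mono r" "(\<lambda>n. x (\<sigma> (r n))) \<longlonglongrightarrow> L" using assms[OF \<sigma>(1)] by blast
  have "eventually (\<lambda>n. dist (x (\<sigma> (r n))) L < e) sequentially" using r(2) e(1) by (rule tendstoD)
  then show False using \<sigma>(2) by (auto simp: eventually_sequentially)
qed

text \<open>A line below the path with exactly two contacts. Contacts are those of
  \<open>fm\<close>, so that one made by a left limit counts.\<close>

definition touch :: "(real => real) => real => real => real => real => real => bool" where
  "touch f t a b g d \<longleftrightarrow> 0 \<le> g \<and> g < d \<and> d \<le> t \<and> (\<forall>s\<in>{0..t}. a * s + b \<le> fm f s) \<and>
     (\<forall>s\<in>{0..t}. fm f s = a * s + b \<longleftrightarrow> s = g \<or> s = d)"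

text \<open>A convex function is continuous inside the interval, so its bound by \<open>f\<close>
  passes to left limits there. At the end points it may jump, and they are left out.\<close>

lemma convex_le_fm:
  assumes f: "cadlag f" and c: "convex_on {0..t} c" "\<And>u. u \<in> {0..t} ==> c u \<le> f u" and s: "0 < s" "s < t"
  shows "c s \<le> fm f s"
proof -
  have "convex_on {0<..<t} c" using c(1) by (rule convex_on_subset) auto
  then have "continuous_on {0<..<t} c" by (intro convex_on_continuous) auto
  then have "isCont c s" using s by (simp add: continuous_on_eq_continuous_at)
  then have cl: "(c \<longlongrightarrow> c s) (at_left s)"
    using filterlim_at_split isCont_def by blast
  have "eventually (\<lambda>s'. 0 < s' \<and> s' < s) (at_left s)"
    using s by (auto simp: eventually_at_left_field)
  then have "eventually (\<lambda>s'. c s' \<le> f s') (at_left s)"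
    by eventually_elim (use c s in auto)
  then have "c s \<le> lft f s"
    using tendsto_le[OF _ cadlag_tendsto_left[OF f s(1)] cl] by simp
  then show ?thesis using c(2)[of s] s by (simp add: fm_def)
qed

text \<open>The line is itself admissible. Conversely an admissible convex function lies below the
  line at both contacts, hence between them. For \<open>d = t\<close> the assumption on
  \<open>f t\<close> matters: otherwise a convex function could jump up to \<open>f t\<close>, above
  a contact made by the left limit.\<close>

lemma conv_minorant_touch:
  assumes f: "cadlag f" and ft: "f t \<le> lft f t" and T: "touch f t a b g d" and s: "s \<in> {g..d}"
  shows "conv_minorant f t s = a * s + b"
  unfolding conv_minorant_def
proof (rule cSup_eq_maximum)
  have "convex_on {0..t} (\<lambda>s. a * s + b)"
    by (intro convex_onI) (auto simp: algebra_simps convex_real_interval)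
  moreover have "\<forall>u\<in>{0..t}. a * u + b \<le> f u" using T by (force simp: touch_def fm_def)
  ultimately show "a * s + b \<in> {c s | c. convex_on {0..t} c \<and> (\<forall>u\<in>{0..t}. c u \<le> f u)}"
    by (intro CollectI exI[of _ "\<lambda>s. a * s + b"]) simp
next
  fix x assume "x \<in> {c s | c. convex_on {0..t} c \<and> (\<forall>u\<in>{0..t}. c u \<le> f u)}"
  then obtain c where c: "convex_on {0..t} c" "\<And>u. u \<in> {0..t} ==> c u \<le> f u" and x: "x = c s" by blast
  have le: "c r \<le> fm f r" if "r \<in> {0..t}" for r
  proof -
    consider "r = 0" | "r = t" | "0 < r" "r < t" using \<open>r \<in> {0..t}\<close> by fastforce
    then show ?thesis using convex_le_fm[OF f c] c(2) that ft by cases (auto simp: fm_def)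
  qed
  have gd: "0 \<le> g" "g < d" "d \<le> t" "c g \<le> a * g + b" "c d \<le> a * d + b"
    using T le[of g] le[of d] by (auto simp: touch_def)
  define \<theta> where "\<theta> = (s - g) / (d - g)"
  have \<theta>: "0 \<le> \<theta>" "\<theta> \<le> 1" using s gd by (auto simp: \<theta>_def)
  have l: "\<theta> * (d - g) = s - g" using gd by (simp add: \<theta>_def)
  then have se: "(1 - \<theta>) * g + \<theta> * d = s" by (simp add: algebra_simps)
  have "c s \<le> (1 - \<theta>) * c g + \<theta> * c d"
    using convex_onD[OF c(1) \<theta>, of g d] gd se by simp
  also have "\<dots> \<le> (1 - \<theta>) * (a * g + b) + \<theta> * (a * d + b)"
    using gd \<theta> by (intro add_mono mult_left_mono) auto
  also have "\<dots> = a * ((1 - \<theta>) * g + \<theta> * d) + b" by (simp add: algebra_simps)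
  finally show "x \<le> a * s + b" by (simp add: x se)
qed

lemma exc_int_touch:
  assumes f: "cadlag f" and ft: "f t \<le> lft f t" and T: "touch f t a b g d" and u: "g < u" "u < d"
  shows "exc_int f t u = {g<..<d}"
proof -
  note C = conv_minorant_touch[OF f ft T]
  have gd: "0 \<le> g" "g < d" "d \<le> t" using T by (auto simp: touch_def)
  have sub: "{g<..<d} \<subseteq> exc_set f t"
  proof
    fix s assume s: "s \<in> {g<..<d}"
    then have "a * s + b \<le> fm f s" "fm f s \<noteq> a * s + b" using T by (auto simp: touch_def)
    then show "s \<in> exc_set f t" using s gd C[of s] by (auto simp: exc_set_def fm_def)
  qed
  have g: "g \<notin> exc_set f t"
    using T C[of g] gd unfolding exc_set_def touch_def fm_def by fastforce
  have d: "d \<notin> exc_set f t"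
    using T C[of d] gd unfolding exc_set_def touch_def fm_def by fastforce
  let ?K = "connected_component_set (exc_set f t) u"
  have "{g<..<d} \<subseteq> ?K"
    using u sub by (intro connected_component_maximal) auto
  moreover have "?K \<subseteq> {g<..<d}"
  proof
    fix x assume x: "x \<in> ?K"
    have uK: "u \<in> ?K" using u sub by (simp add: connected_component_refl subset_iff)
    have K: "connected ?K" "?K \<subseteq> exc_set f t" by (simp_all add: connected_component_subset)
    have "x < d"
    proof (rule ccontr)
      assume "\<not> x < d"
      then have "d \<in> ?K" using connectedD_interval[OF K(1) uK x, of d] u by auto
      then show False using K(2) d by blast
    qed
    moreover have "g < x"
    proof (rule ccontr)
      assume "\<not> g < x"
      then have "g \<in> ?K" using connectedD_interval[OF K(1) x uK, of g] u by auto
      then show False using K(2) g by blast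
    qed
    ultimately show "x \<in> {g<..<d}" by simp
  qed
  ultimately show ?thesis by (auto simp: exc_int_def)
qed

definition samp :: "(real => real) => real => nat => nat => real" where
  "samp f t n l = f (gp t n l)"

definition fg :: "real => nat => nat \<times> nat => real" where
  "fg t n p = gp t n (fst p)"

definition fd :: "real => nat => nat \<times> nat => real" where
  "fd t n p = gp t n (fst p + snd p)"

text \<open>Together with \<open>fb\<close> this is the line through the end points of a face, in
  real time instead of grid steps.\<close>

definition fa :: "(real => real) => real => nat => nat \<times> nat => real" where
  "fa f t n p = (f (fd t n p) - f (fg t n p)) / (fd t n p - fg t n p)"

definition fb :: "(real => real) => real => nat => nat \<times> nat => real" where
  "fb f t n p = f (fg t n p) - fa f t n p * fg t n p"

lemma reg_eq: "reg t n p = {fg t n p ..< fd t n p}"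
  by (simp add: reg_def fg_def fd_def)

lemma face_line:
  assumes t: "0 < t" and p: "p \<in> faces (samp f t n) n"
  shows "0 < n" "0 \<le> fg t n p" "fg t n p < fd t n p" "fd t n p \<le> t"
    "f (fg t n p) = fa f t n p * fg t n p + fb f t n p"
    "f (fd t n p) = fa f t n p * fd t n p + fb f t n p"
    "\<And>l. l \<le> n ==> fa f t n p * (gp t n l) + fb f t n p \<le> f (gp t n l)"
proof -
  obtain i k where pe: "p = (i, k)" by fastforce
  obtain \<beta> where b: "0 < k" "i + k \<le> n" "samp f t n (i + k) = samp f t n i + \<beta> * real k"
    "\<And>l. l \<le> n ==> l \<noteq> i ==> l \<noteq> i + k ==> samp f t n i + \<beta> * (real l - real i) < samp f t n l"
    using facesD[of i k "samp f t n" n] p pe by blast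
  show n: "0 < n" using b by simp
  show "0 \<le> fg t n p" using t by (simp add: fg_def)
  have diff: "fd t n p - fg t n p = gp t n k"
    by (simp add: fd_def fg_def pe algebra_simps add_divide_distrib)
  have "0 < gp t n k" using b n t by simp
  with diff show lt: "fg t n p < fd t n p" by linarith
  have "real (i + k) * t \<le> real n * t" using b t by (intro mult_right_mono) auto
  then show "fd t n p \<le> t" using n by (simp add: fd_def pe field_simps)
  show 1: "f (fg t n p) = fa f t n p * fg t n p + fb f t n p" by (simp add: fb_def)
  have "fa f t n p * (fd t n p - fg t n p) = f (fd t n p) - f (fg t n p)" using lt by (simp add: fa_def)
  then show "f (fd t n p) = fa f t n p * fd t n p + fb f t n p" by (simp add: fb_def algebra_simps)
  have \<beta>: "\<beta> = fa f t n p * (t / real n)"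
  proof -
    have "\<beta> * real k = f (fd t n p) - f (fg t n p)" using b(3) by (simp add: samp_def fd_def fg_def pe)
    then have "fa f t n p = \<beta> * real k / (gp t n k)" unfolding fa_def diff by simp
    then show ?thesis using b(1) n t by simp
  qed
  fix l assume l: "l \<le> n"
  have "samp f t n i + \<beta> * (real l - real i) \<le> samp f t n l"
    using b(3) b(4)[OF l] by (cases "l = i \<or> l = i + k") (auto simp: algebra_simps)
  moreover have "\<beta> * (real l - real i) = fa f t n p * (gp t n l) - fa f t n p * fg t n p"
    unfolding \<beta> by (simp add: fg_def pe algebra_simps diff_divide_distrib)
  ultimately show "fa f t n p * (gp t n l) + fb f t n p \<le> f (gp t n l)"
    by (simp add: samp_def fb_def fg_def pe)
qed

lemma grid_right:
  assumes "0 \<le> s" "s \<le> t" "0 < t"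
  obtains l where "\<And>n. 0 < n ==> l n \<le> n" "\<And>n. 0 < n ==> s \<le> gp t n (l n)"
    "\<And>n. 0 < n ==> gp t n (l n) \<le> s + t / real n"
proof
  define l where "l n = nat \<lceil>s * real n / t\<rceil>" for n :: nat
  fix n :: nat assume n: "0 < n"
  have 0: "0 \<le> s * real n / t" using assms by simp
  have r: "real (l n) = of_int \<lceil>s * real n / t\<rceil>" using 0 by (simp add: l_def)
  have "s * real n / t \<le> real n" using assms n by (simp add: field_simps mult_right_mono)
  then show "l n \<le> n" unfolding l_def by (simp add: ceiling_le_iff nat_le_iff)
  have "s * real n / t \<le> real (l n)" unfolding r by (rule le_of_int_ceiling)
  then show "s \<le> gp t n (l n)" using assms n by (simp add: field_simps)
  have "real (l n) \<le> s * real n / t + 1" unfolding r by (rule of_int_ceiling_le_add_one)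
  then show "gp t n (l n) \<le> s + t / real n" using assms n by (simp add: field_simps)
qed

lemma grid_left:
  assumes "0 < s" "s \<le> t" "0 < t"
  obtains l where "\<And>n. 0 < n ==> l n \<le> n" "\<And>n. 0 < n ==> gp t n (l n) < s"
    "\<And>n. 0 < n ==> s - t / real n \<le> gp t n (l n)"
proof
  \<comment> \<open>One less than the ceiling, so that the grid point lies strictly to the left of
    \<open>s\<close> even when \<open>s\<close> is on the grid.\<close>
  define l where "l n = nat (\<lceil>s * real n / t\<rceil> - 1)" for n :: nat
  fix n :: nat assume n: "0 < n"
  have 0: "0 < s * real n / t" using assms n by simp
  then have "1 \<le> \<lceil>s * real n / t\<rceil>" by (simp add: less_ceiling_iff int_one_le_iff_zero_less)
  then have r: "real (l n) = of_int \<lceil>s * real n / t\<rceil> - 1" by (simp add: l_def)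
  have "s * real n / t \<le> real n" using assms n by (simp add: field_simps mult_right_mono)
  then have "\<lceil>s * real n / t\<rceil> \<le> int n" by (simp add: ceiling_le_iff)
  then show "l n \<le> n" unfolding l_def by linarith
  have "real (l n) < s * real n / t" unfolding r by linarith
  then show "gp t n (l n) < s" using assms n by (simp add: field_simps)
  have "s * real n / t - 1 \<le> real (l n)" unfolding r by linarith
  then have "(s * real n / t - 1) * (t / real n) \<le> real (l n) * (t / real n)"
    using assms n by (intro mult_right_mono) auto
  moreover have "(s * real n / t - 1) * (t / real n) = s - t / real n" using assms n by (simp add: field_simps)
  ultimately show "s - t / real n \<le> gp t n (l n)" by simp
qed

lemma lim_t_over:
  fixes N :: "nat => nat"
  assumes "filterlim N at_top sequentially"
  shows "(\<lambda>n. t / real (N n)) \<longlonglongrightarrow> 0"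
proof -
  have "filterlim (\<lambda>n. real (N n)) at_top sequentially"
    by (rule filterlim_compose[OF filterlim_real_sequentially assms])
  then show ?thesis by (intro tendsto_divide_0[OF tendsto_const] filterlim_at_top_imp_at_infinity)
qed

text \<open>Compactness of face lines. The line is at most \<open>B\<close> at 0 and at
  \<open>t\<close> and, being a chord of the path around \<open>u\<close>, at least
  \<open>- B\<close> at the interior point \<open>u\<close>; this bounds slope and intercept. In the
  limit it stays below values (grid points from the right) and left limits (from the left), and
  lower semicontinuity turns the end points into contacts.\<close>

lemma faces_subseq:
  assumes f: "cadlag f" and t: "0 < t" and u: "0 < u" "u < t" and \<sigma>: "strict_mono \<sigma>"
    and p: "\<And>n. p n \<in> faces (samp f t (\<sigma> n)) (\<sigma> n)" "\<And>n. u \<in> reg t (\<sigma> n) (p n)"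
  obtains r g d a b where "strict_mono (r :: nat => nat)"
    "(\<lambda>n. fg t (\<sigma> (r n)) (p (r n))) \<longlonglongrightarrow> g" "(\<lambda>n. fd t (\<sigma> (r n)) (p (r n))) \<longlonglongrightarrow> d"
    "(\<lambda>n. fa f t (\<sigma> (r n)) (p (r n))) \<longlonglongrightarrow> a" "(\<lambda>n. fb f t (\<sigma> (r n)) (p (r n))) \<longlonglongrightarrow> b"
    "0 \<le> g" "g \<le> u" "u \<le> d" "d \<le> t" "\<And>s. s \<in> {0..t} ==> a * s + b \<le> fm f s"
    "fm f g = a * g + b" "fm f d = a * d + b"
proof -
  obtain B where B: "0 < B" "\<And>s. s \<in> {0..t} ==> \<bar>f s\<bar> \<le> B" using cadlag_bounded[OF f] by metis
  define G where "G n = fg t (\<sigma> n) (p n)" for n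
  define D where "D n = fd t (\<sigma> n) (p n)" for n
  define A where "A n = fa f t (\<sigma> n) (p n)" for n
  define C where "C n = fb f t (\<sigma> n) (p n)" for n
  note fl = face_line[OF t p(1)]
  have pos: "0 < \<sigma> n" for n by (rule fl(1))
  have G: "0 \<le> G n" "G n \<le> u" "u \<le> D n" "D n \<le> t" "G n < D n" for n
    using fl(2-4)[of n] p(2)[of n] by (auto simp: G_def D_def reg_eq)
  have fG: "f (G n) = A n * G n + C n" "f (D n) = A n * D n + C n" for n
    using fl(5,6)[of n] by (simp_all add: G_def D_def A_def C_def)
  have sup: "A n * (gp t (\<sigma> n) l) + C n \<le> f (gp t (\<sigma> n) l)" if "l \<le> \<sigma> n" for l n
    using fl(7)[OF that] by (simp add: A_def C_def)
  have c0: "C n \<le> B" for n using sup[of 0 n] B(2)[of 0] t by simp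
  have ct: "A n * t + C n \<le> B" for n using sup[of "\<sigma> n" n] B(2)[of t] t pos[of n] by simp
  have cu: "- B \<le> A n * u + C n" for n
  proof -
    have "- B \<le> A n * G n + C n" "- B \<le> A n * D n + C n"
      using B(2)[of "G n"] B(2)[of "D n"] G[of n] fG[of n] by auto
    moreover have "A n * G n \<le> A n * u \<or> A n * D n \<le> A n * u"
      using G[of n] by (cases "A n \<ge> 0") (auto intro: mult_left_mono mult_left_mono_neg)
    ultimately show ?thesis by auto
  qed
  \<comment> \<open>Comparing the line at \<open>u\<close> with its value at \<open>t\<close> bounds
    the slope from above, comparing with its value at 0 bounds it from below.\<close>
  define K where "K = max (2 * B / (t - u)) (2 * B / u)"
  have Kp: "0 \<le> K" using B u by (simp add: K_def le_max_iff_disj)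
  have Ab: "\<bar>A n\<bar> \<le> K" for n
  proof -
    have "A n * (t - u) \<le> 2 * B" using ct[of n] cu[of n] by (simp add: algebra_simps)
    then have "A n \<le> 2 * B / (t - u)" using u by (simp add: pos_le_divide_eq)
    moreover have "- A n * u \<le> 2 * B" using c0[of n] cu[of n] by simp
    then have "- A n \<le> 2 * B / u" using u by (simp add: pos_le_divide_eq)
    ultimately show ?thesis by (auto simp: K_def)
  qed
  have Cb: "\<bar>C n\<bar> \<le> B + K * u" for n
  proof -
    have "\<bar>A n * u\<bar> \<le> K * u" using Ab[of n] u by (simp add: abs_mult mult_right_mono)
    moreover have "0 \<le> K * u" using Kp u by simp
    ultimately show ?thesis using c0[of n] cu[of n] by linarith
  qed
  have "bounded (range (\<lambda>n. (G n, D n, A n, C n)))"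
  proof (rule bounded_subset)
    show "bounded ({0..t} \<times> {0..t} \<times> {-K..K} \<times> {-(B + K * u)..B + K * u})"
      by (intro bounded_Times bounded_closed_interval)
    show "range (\<lambda>n. (G n, D n, A n, C n)) \<subseteq> {0..t} \<times> {0..t} \<times> {-K..K} \<times> {-(B + K * u)..B + K * u}"
    proof (intro image_subsetI)
      fix n
      show "(G n, D n, A n, C n) \<in> {0..t} \<times> {0..t} \<times> {-K..K} \<times> {-(B + K * u)..B + K * u}"
        using G[of n] Ab[of n] Cb[of n] u by (auto simp: abs_le_iff)
    qed
  qed
  then obtain l r where r: "strict_mono r" and lim: "((\<lambda>n. (G n, D n, A n, C n)) \<circ> r) \<longlonglongrightarrow> l"
    using bounded_imp_convergent_subsequence by blast
  obtain g d a b where l: "l = (g, d, a, b)" by (cases l) auto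
  have lims: "(\<lambda>n. G (r n)) \<longlonglongrightarrow> g" "(\<lambda>n. D (r n)) \<longlonglongrightarrow> d" "(\<lambda>n. A (r n)) \<longlonglongrightarrow> a" "(\<lambda>n. C (r n)) \<longlonglongrightarrow> b"
    using tendsto_fst[OF lim] tendsto_fst[OF tendsto_snd[OF lim]] tendsto_fst[OF tendsto_snd[OF tendsto_snd[OF lim]]]
      tendsto_snd[OF tendsto_snd[OF tendsto_snd[OF lim]]] by (simp_all add: comp_def l)
  have g: "0 \<le> g" "g \<le> u" and d: "u \<le> d" "d \<le> t"
    using LIMSEQ_le_const[OF lims(1)] LIMSEQ_le_const2[OF lims(1)] LIMSEQ_le_const[OF lims(2)] LIMSEQ_le_const2[OF lims(2)] G
    by blast+
  define N where "N n = \<sigma> (r n)" for n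
  have Nt: "filterlim N at_top sequentially"
    unfolding N_def using strict_mono_o[OF \<sigma> r] by (intro filterlim_subseq) (simp add: comp_def)
  have N0: "0 < N n" for n using pos by (simp add: N_def)
  have t0: "(\<lambda>n. t / real (N n)) \<longlonglongrightarrow> 0" by (rule lim_t_over[OF Nt])
  have sr: "a * s + b \<le> f s" if s: "s \<in> {0..t}" for s
  proof -
    obtain l where l: "\<And>n. 0 < n ==> l n \<le> n" "\<And>n. 0 < n ==> s \<le> gp t n (l n)"
      "\<And>n. 0 < n ==> gp t n (l n) \<le> s + t / real n"
      using grid_right[of s t] s t by (metis atLeastAtMost_iff)
    define q where "q n = gp t (N n) (l (N n))" for n
    have q: "q \<longlonglongrightarrow> s"
    proof (rule tendsto_sandwich)
      show "(\<lambda>n. s) \<longlonglongrightarrow> s" "(\<lambda>n. s + t / real (N n)) \<longlonglongrightarrow> s"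
        using tendsto_add[OF tendsto_const t0, of s] by auto
    qed (use l N0 in \<open>auto simp: q_def\<close>)
    have "(\<lambda>n. f (q n)) \<longlonglongrightarrow> f s"
      using l N0 s by (intro cadlag_seq_right[OF f _ q]) (auto simp: q_def)
    moreover have "(\<lambda>n. A (r n) * q n + C (r n)) \<longlonglongrightarrow> a * s + b" by (intro tendsto_intros lims q)
    moreover have "A (r n) * q n + C (r n) \<le> f (q n)" for n
      using sup[of "l (N n)" "r n"] l(1)[OF N0] by (simp add: q_def N_def)
    ultimately show ?thesis by (intro LIMSEQ_le) auto
  qed
  have sl: "a * s + b \<le> lft f s" if s: "0 < s" "s \<le> t" for s
  proof -
    obtain l where l: "\<And>n. 0 < n ==> l n \<le> n" "\<And>n. 0 < n ==> gp t n (l n) < s"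
      "\<And>n. 0 < n ==> s - t / real n \<le> gp t n (l n)"
      using grid_left[of s t] s t by metis
    define q where "q n = gp t (N n) (l (N n))" for n
    have q: "q \<longlonglongrightarrow> s"
    proof (rule tendsto_sandwich[of "\<lambda>n. s - t / real (N n)" q sequentially "\<lambda>_. s"])
      show "(\<lambda>n. s) \<longlonglongrightarrow> s" "(\<lambda>n. s - t / real (N n)) \<longlonglongrightarrow> s"
        using tendsto_diff[OF tendsto_const t0, of s] by auto
    qed (use l N0 in \<open>auto simp: q_def less_imp_le\<close>)
    have "(\<lambda>n. f (q n)) \<longlonglongrightarrow> lft f s"
      using l N0 by (intro cadlag_seq_left[OF f s(1) q]) (auto simp: q_def)
    moreover have "(\<lambda>n. A (r n) * q n + C (r n)) \<longlonglongrightarrow> a * s + b" by (intro tendsto_intros lims q)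
    moreover have "A (r n) * q n + C (r n) \<le> f (q n)" for n
      using sup[of "l (N n)" "r n"] l(1)[OF N0] by (simp add: q_def N_def)
    ultimately show ?thesis by (intro LIMSEQ_le) auto
  qed
  have sup': "a * s + b \<le> fm f s" if "s \<in> {0..t}" for s
    using sr[OF that] sl[of s] that by (cases "s = 0") (auto simp: fm_def)
  have tch: "fm f q = a * q + b" if q: "(\<lambda>n. Q n) \<longlonglongrightarrow> q" "\<And>n. Q n \<in> {0..t}" "\<And>n. f (Q n) = A (r n) * Q n + C (r n)" for Q q
  proof (rule antisym)
    have qt: "0 \<le> q" using q(2) by (intro LIMSEQ_le_const[OF q(1)]) auto
    have qt2: "q \<le> t" using q(2) by (intro LIMSEQ_le_const2[OF q(1)]) auto
    show "a * q + b \<le> fm f q" using qt qt2 by (intro sup') auto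
    have lf: "(\<lambda>n. f (Q n)) \<longlonglongrightarrow> a * q + b" unfolding q(3) by (intro tendsto_intros lims q)
    show "fm f q \<le> a * q + b"
    proof (rule field_le_epsilon)
      fix e :: real assume e: "0 < e"
      have "eventually (\<lambda>n. fm f q - e < f (Q n)) sequentially"
        using q(2) by (intro cadlag_seq_lower[OF f qt q(1) _ e]) auto
      then have "fm f q - e \<le> a * q + b"
        by (intro tendsto_lowerbound[OF lf]) (auto elim: eventually_mono)
      then show "fm f q \<le> a * q + b + e" by simp
    qed
  qed
  have "fm f g = a * g + b" "fm f d = a * d + b"
    using G order_trans[OF G(2) less_imp_le[OF u(2)]] order_trans[OF less_imp_le[OF u(1)] G(3)]
    by (auto intro!: tch lims fG)
  then show ?thesis
    using that[OF r lims(1,2,3,4)[unfolded G_def D_def A_def C_def] g d sup'] by blast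
qed

text \<open>Let \<open>D\<close> be a subsequential limit line minus the given one. It is at most 0
  at \<open>g\<close> and \<open>d\<close> and at least 0 at the new contacts \<open>g'\<close> and
  \<open>d'\<close>. Since \<open>g' < d\<close> and \<open>g < d'\<close>, its slope can be neither
  positive nor negative, so the lines and then the contacts coincide.\<close>

lemma faces_limit:
  assumes f: "cadlag f" and t: "0 < t" and T: "touch f t a b g d" and u: "g < u" "u < d"
    and p: "\<And>n. p n \<in> faces (samp f t (Suc n)) (Suc n)" "\<And>n. u \<in> reg t (Suc n) (p n)"
  shows "(\<lambda>n. fg t (Suc n) (p n)) \<longlonglongrightarrow> g" "(\<lambda>n. fd t (Suc n) (p n)) \<longlonglongrightarrow> d"
    "(\<lambda>n. fa f t (Suc n) (p n)) \<longlonglongrightarrow> a" "(\<lambda>n. fb f t (Suc n) (p n)) \<longlonglongrightarrow> b"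
proof -
  have gd: "0 \<le> g" "g < d" "d \<le> t" "fm f g = a * g + b" "fm f d = a * d + b" using T by (auto simp: touch_def)
  have u': "0 < u" "u < t" using u gd by auto
  have main: "\<exists>r. strict_mono r \<and> (\<lambda>n. fg t (Suc (\<sigma> (r n))) (p (\<sigma> (r n)))) \<longlonglongrightarrow> g \<and>
     (\<lambda>n. fd t (Suc (\<sigma> (r n))) (p (\<sigma> (r n)))) \<longlonglongrightarrow> d \<and>
     (\<lambda>n. fa f t (Suc (\<sigma> (r n))) (p (\<sigma> (r n)))) \<longlonglongrightarrow> a \<and> (\<lambda>n. fb f t (Suc (\<sigma> (r n))) (p (\<sigma> (r n)))) \<longlonglongrightarrow> b"
    if \<sigma>: "strict_mono \<sigma>" for \<sigma> :: "nat => nat"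
  proof -
    have \<sigma>': "strict_mono (\<lambda>n. Suc (\<sigma> n))" using \<sigma> by (simp add: strict_mono_def)
    obtain r g' d' a' b' where r: "strict_mono (r :: nat => nat)"
      and l: "(\<lambda>n. fg t (Suc (\<sigma> (r n))) (p (\<sigma> (r n)))) \<longlonglongrightarrow> g'" "(\<lambda>n. fd t (Suc (\<sigma> (r n))) (p (\<sigma> (r n)))) \<longlonglongrightarrow> d'"
      "(\<lambda>n. fa f t (Suc (\<sigma> (r n))) (p (\<sigma> (r n)))) \<longlonglongrightarrow> a'" "(\<lambda>n. fb f t (Suc (\<sigma> (r n))) (p (\<sigma> (r n)))) \<longlonglongrightarrow> b'"
      and x: "0 \<le> g'" "g' \<le> u" "u \<le> d'" "d' \<le> t" and s: "\<And>s. s \<in> {0..t} ==> a' * s + b' \<le> fm f s"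
      and e: "fm f g' = a' * g' + b'" "fm f d' = a' * d' + b'"
      using faces_subseq[OF f t u' \<sigma>', of "\<lambda>n. p (\<sigma> n)"] p by blast
    define D where "D x = (a' - a) * x + (b' - b)" for x
    have Dx: "D y = (a' * y + b') - (a * y + b)" for y by (simp add: D_def algebra_simps)
    have sup: "a * y + b \<le> fm f y" if "y \<in> {0..t}" for y using T that by (simp add: touch_def)
    have D: "D g \<le> 0" "D d \<le> 0" "0 \<le> D g'" "0 \<le> D d'"
      using s[of g] s[of d] sup[of g'] sup[of d'] x u gd e by (auto simp: Dx)
    have "\<not> a' - a > 0"
    proof
      assume "a' - a > 0"
      moreover have "g' < d" using x u by simp
      ultimately have "D g' < D d" by (simp add: D_def)
      then show False using D by simp
    qed
    moreover have "\<not> a' - a < 0"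
    proof
      assume "a' - a < 0"
      moreover have "g < d'" using x u by simp
      ultimately have "D d' < D g" by (simp add: D_def)
      then show False using D by simp
    qed
    ultimately have a: "a' = a" by simp
    then have b: "b' = b" using D by (simp add: D_def)
    have "g' = g \<or> g' = d" "d' = g \<or> d' = d"
      using T e x u gd unfolding a b touch_def by auto
    then have "g' = g" "d' = d" using x u by auto
    then show ?thesis using r l a b by blast
  qed
  show "(\<lambda>n. fg t (Suc n) (p n)) \<longlonglongrightarrow> g"
    using main by (intro tendsto_subsubseq) blast
  show "(\<lambda>n. fd t (Suc n) (p n)) \<longlonglongrightarrow> d"
    using main by (intro tendsto_subsubseq) blast
  show "(\<lambda>n. fa f t (Suc n) (p n)) \<longlonglongrightarrow> a"
    using main by (intro tendsto_subsubseq) blast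
  show "(\<lambda>n. fb f t (Suc n) (p n)) \<longlonglongrightarrow> b"
    using main by (intro tendsto_subsubseq) blast
qed

text \<open>Along infinitely many \<open>n\<close> both ends of the face stay at distance
  \<open>\<epsilon>\<close> from \<open>u\<close>, so the limiting contacts do not merge at
  \<open>u\<close>; the last assumption rules out a third contact.\<close>

lemma touchI_subseq:
  assumes f: "cadlag f" and t: "0 < t" and u: "0 < u" "u < t" and \<epsilon>: "0 < \<epsilon>"
    and p: "\<And>n. p n \<in> faces (samp f t (Suc n)) (Suc n)" "\<And>n. u \<in> reg t (Suc n) (p n)"
    and fr: "frequently (\<lambda>n. fg t (Suc n) (p n) \<le> u - \<epsilon> \<and> u + \<epsilon> \<le> fd t (Suc n) (p n)) sequentially"
    and no3: "\<And>a b c1 c2 c3. (\<And>s. s \<in> {0..t} ==> a * s + b \<le> fm f s) ==> 0 \<le> c1 ==> c1 < c2 ==> c2 < c3 ==> c3 \<le> t ==>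
       fm f c1 = a * c1 + b ==> fm f c2 = a * c2 + b ==> fm f c3 = a * c3 + b ==> False"
  shows "\<exists>a b g d. touch f t a b g d \<and> g < u \<and> u < d"
proof -
  have "infinite {n. fg t (Suc n) (p n) \<le> u - \<epsilon> \<and> u + \<epsilon> \<le> fd t (Suc n) (p n)}"
    using fr by (simp add: frequently_cofinite flip: cofinite_eq_sequentially)
  then obtain \<sigma> :: "nat => nat" where \<sigma>: "strict_mono \<sigma>"
    "\<And>n. fg t (Suc (\<sigma> n)) (p (\<sigma> n)) \<le> u - \<epsilon>" "\<And>n. u + \<epsilon> \<le> fd t (Suc (\<sigma> n)) (p (\<sigma> n))"
    using infinite_enumerate by (metis (mono_tags, lifting) mem_Collect_eq)
  have \<sigma>': "strict_mono (\<lambda>n. Suc (\<sigma> n))" using \<sigma> by (simp add: strict_mono_def)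
  obtain r g d a b where r: "strict_mono (r :: nat => nat)"
    and l: "(\<lambda>n. fg t (Suc (\<sigma> (r n))) (p (\<sigma> (r n)))) \<longlonglongrightarrow> g" "(\<lambda>n. fd t (Suc (\<sigma> (r n))) (p (\<sigma> (r n)))) \<longlonglongrightarrow> d"
      "(\<lambda>n. fa f t (Suc (\<sigma> (r n))) (p (\<sigma> (r n)))) \<longlonglongrightarrow> a" "(\<lambda>n. fb f t (Suc (\<sigma> (r n))) (p (\<sigma> (r n)))) \<longlonglongrightarrow> b"
    and x: "0 \<le> g" "g \<le> u" "u \<le> d" "d \<le> t" and s: "\<And>s. s \<in> {0..t} ==> a * s + b \<le> fm f s"
    and e: "fm f g = a * g + b" "fm f d = a * d + b"
    using faces_subseq[OF f t u \<sigma>', of "\<lambda>n. p (\<sigma> n)"] p by blast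
  have g: "g \<le> u - \<epsilon>" using \<sigma>(2) by (intro LIMSEQ_le_const2[OF l(1)]) auto
  have d: "u + \<epsilon> \<le> d" using \<sigma>(3) by (intro LIMSEQ_le_const[OF l(2)]) auto
  have only: "c = g \<or> c = d" if c: "c \<in> {0..t}" "fm f c = a * c + b" for c
  proof (rule ccontr)
    assume "\<not> ?thesis"
    then consider "c < g" | "g < c" "c < d" | "d < c" by linarith
    then show False
      using no3[of a b c g d, OF s] no3[of a b g c d, OF s] no3[of a b g d c, OF s] c e x g d \<epsilon>
      by cases auto
  qed
  have "\<forall>c\<in>{0..t}. fm f c = a * c + b \<longleftrightarrow> c = g \<or> c = d" using only e by blast
  then have "touch f t a b g d" unfolding touch_def using x(1,4) g d \<epsilon> s by simp
  then show ?thesis using g d \<epsilon> by (intro exI[of _ a] exI[of _ b] exI[of _ g] exI[of _ d]) auto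
qed

section \<open>Smoothed block values and the limit of a sampled face\<close>

definition incr :: "(real => real) => real => nat => nat => real" where
  "incr f t n m = samp f t n (Suc m) - samp f t n m"

lemma walk_incr: "walk (incr f t n) l = samp f t n l - f 0"
  by (induction l) (auto simp: walk_Suc incr_def samp_def)

lemma walk_shift_incr: "walk (shift_seq i (incr f t n)) j = samp f t n (i + j) - samp f t n i"
  by (simp add: walk_shift walk_incr)

definition Lam :: "real measure" where
  "Lam = unif 1"

lemma sets_Lam [simp, measurable_cong]: "sets Lam = sets borel" and space_Lam [simp]: "space Lam = UNIV"
  by (simp_all add: Lam_def)

interpretation Lam: prob_space Lam
  unfolding Lam_def by (intro prob_space_uniform_measure) auto

lemma AE_Lam_affine:
  assumes "countable A" "\<epsilon> \<noteq> 0"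
  shows "AE x in Lam. s + \<epsilon> * x \<notin> A"
proof -
  have "countable ((\<lambda>y. (y - s) / \<epsilon>) ` A)" using assms by simp
  then have "AE x in lborel. x \<notin> (\<lambda>y. (y - s) / \<epsilon>) ` A"
    by (intro AE_not_in countable_imp_null_set_lborel)
  then have "AE x in Lam. x \<notin> (\<lambda>y. (y - s) / \<epsilon>) ` A"
    unfolding Lam_def by (intro AE_uniform_measureI) (auto elim: eventually_mono)
  then show ?thesis
  proof eventually_elim
    case (elim x)
    have "x = ((s + \<epsilon> * x) - s) / \<epsilon>" using assms by simp
    then show ?case using elim by blast
  qed
qed

text \<open>The block minus its chord, read as a step function of real time with steps of length
  \<open>t / n\<close> and vanishing outside the block.\<close>

definition eblk :: "real => nat => nat => (nat => real) => real => real" where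
  "eblk t n k y r = (if 0 \<le> r \<and> nat \<lfloor>r * real n / t\<rfloor> < k
     then walk y (nat \<lfloor>r * real n / t\<rfloor>) - real (nat \<lfloor>r * real n / t\<rfloor>) / real k * walk y k else 0)"

definition eavg :: "real => nat => real => real => nat => (nat => real) => real" where
  "eavg t n s \<epsilon> k y = (\<integral>x. eblk t n k y (s + \<epsilon> * x) \<partial>Lam)"

lemma eblk_measurable [measurable]: "eblk t n k y \<in> borel_measurable borel"
  unfolding eblk_def by measurable

lemma eblk_sum: "eblk t n k y r = (\<Sum>j<k. indicator {r. 0 \<le> r \<and> nat \<lfloor>r * real n / t\<rfloor> = j} r *
   (walk y j - real j / real k * walk y k))"
proof (cases "0 \<le> r \<and> nat \<lfloor>r * real n / t\<rfloor> < k")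
  case True
  let ?J = "nat \<lfloor>r * real n / t\<rfloor>"
  have "(\<Sum>j<k. indicator {r. 0 \<le> r \<and> nat \<lfloor>r * real n / t\<rfloor> = j} r * (walk y j - real j / real k * walk y k))
     = (\<Sum>j<k. if j = ?J then walk y j - real j / real k * walk y k else 0)"
    using True by (intro sum.cong refl) (auto simp: indicator_def)
  also have "\<dots> = walk y ?J - real ?J / real k * walk y k" using True by (subst sum.delta) auto
  finally show ?thesis using True by (simp add: eblk_def)
next
  case False
  then have "(\<Sum>j<k. indicator {r. 0 \<le> r \<and> nat \<lfloor>r * real n / t\<rfloor> = j} r * (walk y j - real j / real k * walk y k)) = 0"
    by (intro sum.neutral) (auto simp: indicator_def)
  then show ?thesis using False by (simp only: eblk_def if_False)
qed

text \<open>Exhibits the smoothed value as a linear combination of finitely many walk values, which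
  shows both that it is measurable and that it depends only on the first \<open>k\<close>
  increments.\<close>

lemma eavg_sum: "eavg t n s \<epsilon> k y = (\<Sum>j<k.
   measure Lam {x. 0 \<le> s + \<epsilon> * x \<and> nat \<lfloor>(s + \<epsilon> * x) * real n / t\<rfloor> = j} * (walk y j - real j / real k * walk y k))"
proof -
  let ?A = "\<lambda>j. {x. 0 \<le> s + \<epsilon> * x \<and> nat \<lfloor>(s + \<epsilon> * x) * real n / t\<rfloor> = j}"
  have [measurable]: "?A j \<in> sets borel" for j by measurable
  have "eavg t n s \<epsilon> k y = (\<integral>x. (\<Sum>j<k. indicator (?A j) x * (walk y j - real j / real k * walk y k)) \<partial>Lam)"
    unfolding eavg_def eblk_sum by (intro Bochner_Integration.integral_cong sum.cong) (auto simp: indicator_def)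
  also have "\<dots> = (\<Sum>j<k. \<integral>x. indicator (?A j) x * (walk y j - real j / real k * walk y k) \<partial>Lam)"
    by (intro Bochner_Integration.integral_sum integrable_mult_left integrable_real_indicator)
      (auto simp: Lam.emeasure_eq_measure)
  finally show ?thesis by simp
qed

text \<open>The purpose of smoothing: a countable exceptional set, such as the jump times, is
  negligible for the uniform averaging variable.\<close>

lemma eavg_limit:
  assumes \<epsilon>: "\<epsilon> \<noteq> 0" and A: "countable A"
    and lim: "\<And>r. r \<notin> A ==> (\<lambda>n. eblk t (N n) (k n) (y n) r) \<longlonglongrightarrow> e r"
    and B: "\<And>n r. \<bar>eblk t (N n) (k n) (y n) r\<bar> \<le> B" and e [measurable]: "e \<in> borel_measurable borel"
  shows "(\<lambda>n. eavg t (N n) s \<epsilon> (k n) (y n)) \<longlonglongrightarrow> (\<integral>x. e (s + \<epsilon> * x) \<partial>Lam)"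
  unfolding eavg_def
proof (rule integral_dominated_convergence[where w = "\<lambda>_. B"])
  show "AE x in Lam. (\<lambda>n. eblk t (N n) (k n) (y n) (s + \<epsilon> * x)) \<longlonglongrightarrow> e (s + \<epsilon> * x)"
    using AE_Lam_affine[OF A \<epsilon>, of s] by eventually_elim (rule lim)
qed (use B in auto)

lemma smooth_limit:
  fixes e :: "real => real" and B s :: real
  assumes e [measurable]: "e \<in> borel_measurable borel" and B: "\<And>r. \<bar>e r\<bar> \<le> B"
    and c: "(e \<longlongrightarrow> e s) (at_right s)"
  shows "(\<lambda>p. \<integral>x. e (s + 1 / real (Suc p) * x) \<partial>Lam) \<longlonglongrightarrow> e s"
proof -
  have "(\<lambda>p. \<integral>x. e (s + 1 / real (Suc p) * x) \<partial>Lam) \<longlonglongrightarrow> (\<integral>x. e s \<partial>Lam)"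
  proof (rule integral_dominated_convergence[where w = "\<lambda>_. B"])
    have "AE x in Lam. 0 < x"
      unfolding Lam_def by (intro AE_uniform_measureI) auto
    then show "AE x in Lam. (\<lambda>p. e (s + 1 / real (Suc p) * x)) \<longlonglongrightarrow> e s"
    proof eventually_elim
      case (elim x)
      have "(\<lambda>p. s + 1 / real (Suc p) * x) \<longlonglongrightarrow> s + 0 * x"
        by (intro tendsto_intros LIMSEQ_inverse_real_of_nat[unfolded inverse_eq_divide])
      moreover have "s < s + 1 / real (Suc p) * x" for p using elim by simp
      ultimately have "filterlim (\<lambda>p. s + 1 / real (Suc p) * x) (at_right s) sequentially"
        by (intro filterlim_at_withinI) auto
      with c show ?case by (rule filterlim_compose)
    qed
  qed (use B in auto)
  then show ?thesis using Lam.prob_space by simp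
qed

lemma cadlag_borel:
  assumes f: "cadlag f"
  shows "(\<lambda>s. if 0 \<le> s then f s else 0) \<in> borel_measurable borel"
proof (rule borel_measurable_LIMSEQ_real)
  let ?q = "\<lambda>n s. (of_int \<lfloor>s * real (Suc n)\<rfloor> + 1) / real (Suc n)"
  show "(\<lambda>n. if 0 \<le> s then f (?q n s) else 0) \<longlonglongrightarrow> (if 0 \<le> s then f s else 0)" for s
  proof (cases "0 \<le> s")
    case True
    have "s \<le> ?q n s" "?q n s \<le> s + 1 / real (Suc n)" for n
    proof -
      have "s * real (Suc n) \<le> of_int \<lfloor>s * real (Suc n)\<rfloor> + 1" "of_int \<lfloor>s * real (Suc n)\<rfloor> \<le> s * real (Suc n)" by linarith+
      then show "s \<le> ?q n s" "?q n s \<le> s + 1 / real (Suc n)" by (simp_all add: field_simps del: of_nat_Suc)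
    qed
    moreover have "(\<lambda>n. s + 1 / real (Suc n)) \<longlonglongrightarrow> s + 0"
      by (intro tendsto_intros LIMSEQ_inverse_real_of_nat[unfolded inverse_eq_divide])
    ultimately have "(\<lambda>n. ?q n s) \<longlonglongrightarrow> s"
      by (intro tendsto_sandwich[of "\<lambda>_. s" "\<lambda>n. ?q n s" sequentially "\<lambda>n. s + 1 / real (Suc n)"]) auto
    then have "(\<lambda>n. f (?q n s)) \<longlonglongrightarrow> f s"
      using True \<open>\<And>n. s \<le> ?q n s\<close> by (intro cadlag_seq_right[OF f]) auto
    then show ?thesis using True by simp
  qed simp
  show "(\<lambda>s. if 0 \<le> s then f (?q n s) else 0) \<in> borel_measurable borel" for n
  proof -
    have "(\<lambda>s. f ((of_int \<lfloor>s * real (Suc n)\<rfloor> + 1) / real (Suc n))) \<in> borel_measurable borel"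
      by measurable
    then show ?thesis by measurable
  qed
qed

text \<open>The height of the path above a line. The right end is excluded so that the function is
  right continuous everywhere, which is what removing the smoothing requires.\<close>

definition eF :: "(real => real) => real => real => real => real => real => real" where
  "eF f a b g d r = (if 0 \<le> r \<and> r < d - g then f (g + r) - (a * (g + r) + b) else 0)"

lemma eF_borel: "cadlag f ==> 0 \<le> g ==> eF f a b g d \<in> borel_measurable borel"
proof -
  assume f: "cadlag f" and g: "0 \<le> g"
  note cadlag_borel[OF f, measurable]
  have "eF f a b g d = (\<lambda>r. if 0 \<le> r \<and> r < d - g then (if 0 \<le> g + r then f (g + r) else 0) - (a * (g + r) + b) else 0)"
    using g by (auto simp: eF_def)
  also have "\<dots> \<in> borel_measurable borel"
    using measurable_compose[OF borel_measurable_add[OF borel_measurable_const[of g] measurable_ident] cadlag_borel[OF f]]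
    by measurable
  finally show ?thesis .
qed

lemma eF_right:
  assumes f: "cadlag f" and g: "0 \<le> g"
  shows "(eF f a b g d \<longlongrightarrow> eF f a b g d s) (at_right s)"
proof (cases "0 \<le> s \<and> s < d - g")
  case True
  have "(f \<longlongrightarrow> f (g + s)) (at_right (g + s))" using True g by (intro cadlag_tendsto_right[OF f]) auto
  then have "((\<lambda>r. f (r + g)) \<longlongrightarrow> f (g + s)) (at_right s)"
    using filterlim_at_right_to_0 at_right_to_0[of "g + s"] at_right_to_0[of s]
    by (simp add: filterlim_filtermap add.commute add.left_commute)
  then have "((\<lambda>r. f (g + r) - (a * (g + r) + b)) \<longlongrightarrow> f (g + s) - (a * (g + s) + b)) (at_right s)"
    by (intro tendsto_intros) (auto simp: add.commute)
  moreover have "eventually (\<lambda>r. s < r \<and> r < d - g) (at_right s)"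
    using True by (auto simp: eventually_at_right_field)
  then have "eventually (\<lambda>r. f (g + r) - (a * (g + r) + b) = eF f a b g d r) (at_right s)"
    by eventually_elim (use True in \<open>auto simp: eF_def\<close>)
  ultimately show ?thesis using True by (auto simp: eF_def intro: Lim_transform_eventually)
next
  case False
  have "eventually (\<lambda>r. eF f a b g d r = 0) (at_right s)"
  proof (cases "s < 0")
    case True
    then have "eventually (\<lambda>r. s < r \<and> r < 0) (at_right s)" by (auto simp: eventually_at_right_field)
    then show ?thesis by eventually_elim (auto simp: eF_def)
  next
    case c: False
    have "eventually (\<lambda>r. s < r) (at_right s)" by (auto simp: eventually_at_right_field intro: exI[of _ "s + 1"])
    then show ?thesis by eventually_elim (use c False in \<open>auto simp: eF_def\<close>)
  qed
  then show ?thesis using False by (auto simp: eF_def intro: tendsto_eventually)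
qed

lemma order_tendsto_less:
  fixes x y :: "nat => real"
  assumes "x \<longlonglongrightarrow> a" "y \<longlonglongrightarrow> b" "a < b"
  shows "eventually (\<lambda>n. x n < y n) sequentially"
proof -
  have "(\<lambda>n. y n - x n) \<longlonglongrightarrow> b - a" by (intro tendsto_intros assms)
  then have "eventually (\<lambda>n. 0 < y n - x n) sequentially" using assms(3) by (intro order_tendstoD) auto
  then show ?thesis by eventually_elim simp
qed

lemma floor_grid_limit:
  assumes t: "0 < t" and r: "0 \<le> r" and N: "filterlim N at_top sequentially" "\<And>n. 0 < N n"
  shows "(\<lambda>n. gp t (N n) (nat \<lfloor>r * real (N n) / t\<rfloor>)) \<longlonglongrightarrow> r"
proof -
  have b: "r - t / real (N n) \<le> gp t (N n) (nat \<lfloor>r * real (N n) / t\<rfloor>)"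
     "gp t (N n) (nat \<lfloor>r * real (N n) / t\<rfloor>) \<le> r" for n
  proof -
    have e: "real (nat \<lfloor>r * real (N n) / t\<rfloor>) = of_int \<lfloor>r * real (N n) / t\<rfloor>" using r t by simp
    have "r * real (N n) / t - 1 \<le> real (nat \<lfloor>r * real (N n) / t\<rfloor>)" unfolding e by linarith
    then have "(r * real (N n) / t - 1) * (t / real (N n)) \<le> real (nat \<lfloor>r * real (N n) / t\<rfloor>) * (t / real (N n))"
      using t by (intro mult_right_mono) auto
    moreover have "(r * real (N n) / t - 1) * (t / real (N n)) = r - t / real (N n)" using t N(2)[of n] by (simp add: field_simps)
    ultimately show "r - t / real (N n) \<le> gp t (N n) (nat \<lfloor>r * real (N n) / t\<rfloor>)" by simp
    have "real (nat \<lfloor>r * real (N n) / t\<rfloor>) \<le> r * real (N n) / t" unfolding e by linarith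
    then have "real (nat \<lfloor>r * real (N n) / t\<rfloor>) * (t / real (N n)) \<le> r * real (N n) / t * (t / real (N n))"
      using t by (intro mult_right_mono) auto
    then show "gp t (N n) (nat \<lfloor>r * real (N n) / t\<rfloor>) \<le> r" using t N(2)[of n] by simp
  qed
  have "(\<lambda>n. r - t / real (N n)) \<longlonglongrightarrow> r - 0" by (intro tendsto_intros lim_t_over N)
  then have l: "(\<lambda>n. r - t / real (N n)) \<longlonglongrightarrow> r" by simp
  show ?thesis
    by (rule tendsto_sandwich[OF always_eventually always_eventually l tendsto_const]) (intro allI b)+
qed

lemma eblk_le:
  assumes "\<And>j. j \<le> k ==> \<bar>walk y j\<bar> \<le> B"
  shows "\<bar>eblk t n k y r\<bar> \<le> 2 * B"
proof -
  have B: "0 \<le> B" using assms[of 0] by simp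
  have "\<bar>walk y j - real j / real k * walk y k\<bar> \<le> 2 * B" if "j < k" for j
  proof -
    define X where "X = real j / real k * walk y k"
    have "\<bar>X\<bar> \<le> 1 * B"
      unfolding abs_mult X_def using that assms[of k] by (intro mult_mono) auto
    then show ?thesis
      using assms[OF less_imp_le[OF that]] unfolding X_def[symmetric] by linarith
  qed
  then show ?thesis using B by (auto simp: eblk_def)
qed

lemma faces_incr:
  assumes "f 0 = 0" shows "faces (walk (incr f t n)) n = faces (samp f t n) n"
proof -
  have "walk (incr f t n) = samp f t n" using assms by (auto simp: walk_incr)
  then show ?thesis by simp
qed

text \<open>By \<open>faces_limit\<close> the sampled chord converges to the touching line. At
  continuity times of the path the sampled values converge too, and outside [0, d - g] both
  functions vanish in the limit.\<close>

lemma face_block_limit: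
  assumes f: "cadlag f" and t: "0 < t" and T: "touch f t a b g d" and u: "g < u" "u < d"
    and p: "\<And>n. p n \<in> faces (samp f t (Suc n)) (Suc n)" "\<And>n. u \<in> reg t (Suc n) (p n)"
  defines "y \<equiv> (\<lambda>n. shift_seq (fst (p n)) (incr f t (Suc n)))"
  shows "(\<lambda>n. gp t (Suc n) (snd (p n))) \<longlonglongrightarrow> d - g"
    and "(\<lambda>n. walk (y n) (snd (p n))) \<longlonglongrightarrow> a * (d - g)"
    and "\<epsilon> \<noteq> 0 ==> (\<lambda>n. eavg t (Suc n) s \<epsilon> (snd (p n)) (y n)) \<longlonglongrightarrow> (\<integral>x. eF f a b g d (s + \<epsilon> * x) \<partial>Lam)"
proof -
  note L = faces_limit[OF f t T u p]
  note fl = face_line[OF t p(1)]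
  have gd: "0 \<le> g" "g < d" "d \<le> t" using T by (auto simp: touch_def)
  have diff: "gp t (Suc n) (snd (p n)) = fd t (Suc n) (p n) - fg t (Suc n) (p n)" for n
    by (simp add: fd_def fg_def algebra_simps add_divide_distrib del: of_nat_Suc)
  show len: "(\<lambda>n. gp t (Suc n) (snd (p n))) \<longlonglongrightarrow> d - g"
    unfolding diff by (intro tendsto_intros L)
  have fG: "(\<lambda>n. f (fg t (Suc n) (p n))) \<longlonglongrightarrow> a * g + b"
    unfolding fl(5) by (intro tendsto_intros L)
  have wj: "walk (y n) j = f (fg t (Suc n) (p n) + gp t (Suc n) j) - f (fg t (Suc n) (p n))" for n j
    by (simp add: y_def walk_shift_incr samp_def fg_def add_divide_distrib algebra_simps del: of_nat_Suc)
  have wk: "walk (y n) (snd (p n)) = f (fd t (Suc n) (p n)) - f (fg t (Suc n) (p n))" for n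
    unfolding wj diff by simp
  have "(\<lambda>n. walk (y n) (snd (p n))) \<longlonglongrightarrow> (a * d + b) - (a * g + b)"
    unfolding wk fl(5,6) by (intro tendsto_intros L)
  then show inc: "(\<lambda>n. walk (y n) (snd (p n))) \<longlonglongrightarrow> a * (d - g)" by (simp add: algebra_simps)
  obtain B where B: "0 < B" "\<And>s. s \<in> {0..t} ==> \<bar>f s\<bar> \<le> B" using cadlag_bounded[OF f] by metis
  assume \<epsilon>: "\<epsilon> \<noteq> 0"
  \<comment> \<open>Excluded are the two ends of the block and the jump times of \<open>f\<close>,
    where values at nearby grid points need not converge.\<close>
  let ?A = "{0, d - g} \<union> (\<lambda>x. x - g) ` {s. 0 < s \<and> lft f s \<noteq> f s}"
  show "(\<lambda>n. eavg t (Suc n) s \<epsilon> (snd (p n)) (y n)) \<longlonglongrightarrow> (\<integral>x. eF f a b g d (s + \<epsilon> * x) \<partial>Lam)"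
  proof (rule eavg_limit[OF \<epsilon>])
    show "countable ?A" using countable_cadlag_jumps[OF f] by simp
    show "eF f a b g d \<in> borel_measurable borel" by (rule eF_borel[OF f gd(1)])
    show "\<bar>eblk t (Suc n) (snd (p n)) (y n) r\<bar> \<le> 2 * (2 * B)" for n r
    proof (rule eblk_le)
      fix j assume j: "j \<le> snd (p n)"
      have "gp t (Suc n) j \<le> gp t (Suc n) (snd (p n))"
        using j t by (intro divide_right_mono mult_right_mono) auto
      then have "fg t (Suc n) (p n) + gp t (Suc n) j \<in> {0..t}" "fg t (Suc n) (p n) \<in> {0..t}"
        using fl(2,3,4)[of n] diff[of n] t by auto
      then show "\<bar>walk (y n) j\<bar> \<le> 2 * B" unfolding wj using B(2) by (smt (verit))
    qed
    fix r assume r: "r \<notin> ?A"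
    let ?J = "\<lambda>n. nat \<lfloor>r * real (Suc n) / t\<rfloor>"
    show "(\<lambda>n. eblk t (Suc n) (snd (p n)) (y n) r) \<longlonglongrightarrow> eF f a b g d r"
    proof (cases "0 \<le> r")
      case False
      then show ?thesis by (simp add: eblk_def eF_def)
    next
      case True
      have J: "(\<lambda>n. gp t (Suc n) (?J n)) \<longlonglongrightarrow> r"
        by (rule floor_grid_limit[OF t True]) (auto simp: filterlim_Suc)
      have lt: "?J n < snd (p n) \<longleftrightarrow> gp t (Suc n) (?J n) < gp t (Suc n) (snd (p n))" for n
        using t by (simp add: divide_less_cancel del: of_nat_Suc)
      show ?thesis
      proof (cases "r < d - g")
        case l: True
        have r0: "0 < r" using True r by auto
        have ev: "eventually (\<lambda>n. ?J n < snd (p n)) sequentially"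
          unfolding lt by (rule order_tendsto_less[OF J len l]) 
        have nj: "lft f (g + r) = f (g + r)"
        proof (rule ccontr)
          assume "lft f (g + r) \<noteq> f (g + r)"
          then have "r \<in> (\<lambda>x. x - g) ` {s. 0 < s \<and> lft f s \<noteq> f s}"
            using r0 gd by (intro image_eqI[of _ _ "g + r"]) auto
          then show False using r by blast
        qed
        have "(\<lambda>n. f (fg t (Suc n) (p n) + gp t (Suc n) (?J n))) \<longlonglongrightarrow> f (g + r)"
          using r0 gd nj by (intro cadlag_seq_cont[OF f] tendsto_add L J) auto
        then have w: "(\<lambda>n. walk (y n) (?J n)) \<longlonglongrightarrow> f (g + r) - (a * g + b)"
          unfolding wj by (intro tendsto_diff fG)
        have "(\<lambda>n. (gp t (Suc n) (?J n)) / (gp t (Suc n) (snd (p n)))) \<longlonglongrightarrow> r / (d - g)"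
          using gd by (intro tendsto_divide J len) auto
        then have q: "(\<lambda>n. real (?J n) / real (snd (p n))) \<longlonglongrightarrow> r / (d - g)"
          using t by simp
        then have "(\<lambda>n. walk (y n) (?J n) - real (?J n) / real (snd (p n)) * walk (y n) (snd (p n)))
            \<longlonglongrightarrow> f (g + r) - (a * g + b) - r / (d - g) * (a * (d - g))"
          by (intro tendsto_diff w tendsto_mult q inc)
        moreover have "f (g + r) - (a * g + b) - r / (d - g) * (a * (d - g)) = eF f a b g d r"
        proof -
          have "r / (d - g) * (a * (d - g)) = a * r" using gd by simp
          then show ?thesis using r0 l by (simp add: eF_def algebra_simps del: times_divide_eq_left)
        qed
        moreover have "eventually (\<lambda>n. walk (y n) (?J n) - real (?J n) / real (snd (p n)) * walk (y n) (snd (p n))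
            = eblk t (Suc n) (snd (p n)) (y n) r) sequentially"
          using ev by eventually_elim (use True in \<open>simp add: eblk_def del: of_nat_Suc\<close>)
        ultimately show ?thesis by (auto intro: Lim_transform_eventually)
      next
        case ge: False
        then have "d - g < r" using r by auto
        then have "eventually (\<lambda>n. gp t (Suc n) (snd (p n)) < gp t (Suc n) (?J n)) sequentially"
          by (rule order_tendsto_less[OF len J])
        then have "eventually (\<lambda>n. eblk t (Suc n) (snd (p n)) (y n) r = eF f a b g d r) sequentially"
        proof eventually_elim
          case (elim n)
          then have "\<not> ?J n < snd (p n)" unfolding lt by linarith
          then show ?case using ge by (simp add: eblk_def eF_def del: of_nat_Suc)
        qed
        then show ?thesis by (rule tendsto_eventually)
      qed
    qed
  qed
qed

section \<open>Discrete Vervaat transforms\<close>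

lemma eF_bounded:
  assumes "cadlag f" "0 \<le> g"
  obtains B where "\<And>r. \<bar>eF f a b g d r\<bar> \<le> B"
proof -
  obtain B where B: "0 < B" "\<And>s. s \<in> {0..d} ==> \<bar>f s\<bar> \<le> B" using cadlag_bounded[OF assms(1)] by metis
  have "\<bar>eF f a b g d r\<bar> \<le> B + \<bar>a\<bar> * \<bar>d\<bar> + \<bar>b\<bar>" for r
  proof (cases "0 \<le> r \<and> r < d - g")
    case True
    then have "\<bar>f (g + r)\<bar> \<le> B" using assms by (intro B) auto
    moreover have "\<bar>a * (g + r)\<bar> \<le> \<bar>a\<bar> * \<bar>d\<bar>"
      unfolding abs_mult using True assms by (intro mult_left_mono) auto
    ultimately show ?thesis using True by (simp add: eF_def)
  next
    case False
    then show ?thesis using B by (auto simp: eF_def)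
  qed
  then show ?thesis by (rule that)
qed

definition slp :: "(real => real) => real => real => real" where
  "slp f a l = (f (a + l) - f a) / l"

definition mK :: "(real => real) => real => real => real => real" where
  "mK f a l u = min (knight f a l u) (lft (knight f a l) u)"

lemma knight_slp: "knight f a l s = f (a + s) - f a - s * slp f a l"
  by (simp add: knight_def slp_def)

lemma lft_knight:
  assumes f: "cadlag f" and "0 \<le> a" "0 < u"
  shows "lft (knight f a l) u = lft f (a + u) - f a - u * slp f a l"
proof -
  have "(f \<longlongrightarrow> lft f (a + u)) (at_left (a + u))" using assms by (intro cadlag_tendsto_left[OF f]) auto
  then have "((\<lambda>s. f (s + a)) \<longlongrightarrow> lft f (a + u)) (at_left u)"
  proof -
    have e: "filtermap (\<lambda>x. x + a) (at_left u) = at_left (a + u)"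
      using filtermap_at_left_shift[of "- a" u] by (simp add: add.commute)
    show ?thesis using \<open>(f \<longlongrightarrow> lft f (a + u)) (at_left (a + u))\<close> unfolding e[symmetric] filterlim_filtermap .
  qed
  then have "((\<lambda>s. f (a + s)) \<longlongrightarrow> lft f (a + u)) (at_left u)" by (simp add: add.commute)
  then have "(knight f a l \<longlongrightarrow> lft f (a + u) - f a - u * slp f a l) (at_left u)"
    unfolding knight_slp[abs_def] by (intro tendsto_intros)
  then have "Lim (at_left u) (knight f a l) = lft f (a + u) - f a - u * slp f a l"
    by (intro tendsto_Lim) auto
  then show ?thesis using assms by (simp add: lft_def)
qed

lemma mK_0 [simp]: "mK f a l 0 = 0"
  by (simp add: mK_def knight_slp)

lemma mK_pos: "cadlag f ==> 0 \<le> a ==> 0 < u ==> mK f a l u = fm f (a + u) - f a - u * slp f a l"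
  by (simp add: mK_def lft_knight knight_slp fm_def)

text \<open>The discrete Knight bridge of the \<open>k\<close> steps that start at
  \<open>q\<close>.\<close>

definition bridge :: "(real => real) => real => nat => nat => nat => nat => real" where
  "bridge f t n q k j = samp f t n (q + j) - samp f t n q - real j / real k * (samp f t n (q + k) - samp f t n q)"

lemma rot_min:
  assumes "r < k" "exc k (rot r k (shift_seq q (incr f t n)))" "j \<le> k"
  shows "bridge f t n q k r \<le> bridge f t n q k j"
proof -
  define w where "w = walk (shift_seq q (incr f t n))"
  have b: "bridge f t n q k j = w j - real j / real k * w k" for j
    by (simp add: bridge_def w_def walk_shift_incr)
  have lt: "w k * (real l - real r) < (w l - w r) * real k" if "l < k" "l \<noteq> r" for l
    using assms(2) that unfolding exc_rot_iff[OF assms(1)] by (simp add: w_def)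
  have main: "bridge f t n q k r \<le> bridge f t n q k l" if "l < k" for l
  proof (cases "l = r")
    case False
    have "w k * (real l - real r) / real k < w l - w r"
      using lt[OF that False] that by (simp add: pos_divide_less_eq)
    then show ?thesis unfolding b by (simp add: diff_divide_distrib algebra_simps)
  qed simp
  show ?thesis
  proof (cases "j = k")
    case True
    have "bridge f t n q k k = bridge f t n q k 0" using assms(1) by (simp add: b w_def)
    then show ?thesis using main[of 0] assms(1) True by simp
  qed (use main assms in auto)
qed

text \<open>Subtracting the chord commutes with rotation. By \<open>rot_min\<close> the subtracted
  value is the minimum of the bridge, so this is the discrete Vervaat transform.\<close>

lemma rot_block_value:
  assumes "r < k" "j \<le> k"
  shows "walk (rot r k (shift_seq q (incr f t n))) j - real j / real k * walk (rot r k (shift_seq q (incr f t n))) k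
    = bridge f t n q k (if r + j \<le> k then r + j else r + j - k) - bridge f t n q k r"
proof -
  define w where "w = walk (shift_seq q (incr f t n))"
  have b: "bridge f t n q k j = w j - real j / real k * w k" for j
    by (simp add: bridge_def w_def walk_shift_incr)
  have k: "walk (rot r k (shift_seq q (incr f t n))) k = w k"
    using assms by (subst walk_rot) (auto simp: w_def)
  show ?thesis unfolding k
    using assms by (subst walk_rot) (auto simp: b w_def[symmetric] of_nat_diff field_simps)
qed

lemma bridge_limit:
  assumes t: "0 < t" and l: "0 < l" and N: "\<And>n. 0 < N n"
    and fa: "(\<lambda>n. f (gp t (N n) (q n))) \<longlonglongrightarrow> f a"
    and fb: "(\<lambda>n. f (gp t (N n) (q n + k n))) \<longlonglongrightarrow> f (a + l)"
    and kl: "(\<lambda>n. gp t (N n) (k n)) \<longlonglongrightarrow> l"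
    and j: "(\<lambda>n. gp t (N n) (j n)) \<longlonglongrightarrow> c" "(\<lambda>n. f (gp t (N n) (q n + j n))) \<longlonglongrightarrow> F"
  shows "(\<lambda>n. bridge f t (N n) (q n) (k n) (j n)) \<longlonglongrightarrow> F - f a - c * slp f a l"
proof -
  have ratio: "real (j n) / real (k n) = (gp t (N n) (j n)) / (gp t (N n) (k n))" for n
    using t N[of n] by simp
  have "(\<lambda>n. f (gp t (N n) (q n + j n)) - f (gp t (N n) (q n)) -
      (gp t (N n) (j n)) / (gp t (N n) (k n)) *
        (f (gp t (N n) (q n + k n)) - f (gp t (N n) (q n))))
     \<longlonglongrightarrow> F - f a - c / l * (f (a + l) - f a)"
    using l by (intro tendsto_diff tendsto_mult tendsto_divide j fa fb kl) auto
  then show ?thesis unfolding bridge_def samp_def ratio by (simp add: slp_def)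
qed

text \<open>Positions of the discrete minimum converge along a subsequence. Their values are bounded
  above by the bridge at any competitor \<open>c\<close>, approached through grid points from the
  right for its value and from the left for its left limit; they are bounded below by lower
  semicontinuity at \<open>\<rho>\<close>. Hence \<open>\<rho>\<close> is a minimum and the minimal
  values converge.\<close>

lemma rot_block_core:
  assumes f: "cadlag f" and t: "0 < t" and a: "0 \<le> a" and l: "0 < l" and \<sigma>: "strict_mono \<sigma>" "\<And>n. 0 < \<sigma> n"
    and qk: "\<And>n. q n + k n \<le> \<sigma> n" "\<And>n. 0 < k n"
    and qa: "\<And>n. a \<le> gp t (\<sigma> n) (q n)" "(\<lambda>n. gp t (\<sigma> n) (q n)) \<longlonglongrightarrow> a"
    and qb: "\<And>n. a + l \<le> gp t (\<sigma> n) (q n + k n)" "(\<lambda>n. gp t (\<sigma> n) (q n + k n)) \<longlonglongrightarrow> a + l"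
    and r: "\<And>n. r n < k n" "\<And>n. exc (k n) (rot (r n) (k n) (shift_seq (q n) (incr f t (\<sigma> n))))"
  obtains h \<rho> where "strict_mono (h :: nat => nat)" "0 \<le> \<rho>" "\<rho> \<le> l" "\<And>c. c \<in> {0..l} ==> mK f a l \<rho> \<le> mK f a l c"
    "(\<lambda>n. gp t (\<sigma> (h n)) (r (h n))) \<longlonglongrightarrow> \<rho>"
    "(\<lambda>n. bridge f t (\<sigma> (h n)) (q (h n)) (k (h n)) (r (h n))) \<longlonglongrightarrow> mK f a l \<rho>"
proof -
  have kl: "(\<lambda>n. gp t (\<sigma> n) (k n)) \<longlonglongrightarrow> l"
  proof -
    have "(\<lambda>n. gp t (\<sigma> n) (q n + k n) - gp t (\<sigma> n) (q n)) \<longlonglongrightarrow> (a + l) - a"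
      by (intro tendsto_diff qa qb)
    then show ?thesis by (simp add: algebra_simps add_divide_distrib)
  qed
  have fa: "(\<lambda>n. f (gp t (\<sigma> n) (q n))) \<longlonglongrightarrow> f a"
    using qa by (intro cadlag_seq_right[OF f a]) auto
  have fb: "(\<lambda>n. f (gp t (\<sigma> n) (q n + k n))) \<longlonglongrightarrow> f (a + l)"
    using qb a l by (intro cadlag_seq_right[OF f]) auto
  have ratio: "real j / real (k n) = (gp t (\<sigma> n) j) / (gp t (\<sigma> n) (k n))" for j n
    using t \<sigma>(2)[of n] by simp
  have br: "(\<lambda>n. bridge f t (\<sigma> (s n)) (q (s n)) (k (s n)) (j n)) \<longlonglongrightarrow> F - f a - c * slp f a l"
    if s: "strict_mono s" and j: "(\<lambda>n. gp t (\<sigma> (s n)) (j n)) \<longlonglongrightarrow> c"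
      "(\<lambda>n. f (gp t (\<sigma> (s n)) (q (s n) + j n))) \<longlonglongrightarrow> F" for s :: "nat => nat" and j c F
  proof -
    have sub: "(\<lambda>n. x (s n)) \<longlonglongrightarrow> y" if "x \<longlonglongrightarrow> y" for x :: "nat => real" and y
      using LIMSEQ_subseq_LIMSEQ[OF that s] by (simp add: comp_def)
    show ?thesis by (rule bridge_limit[OF t l \<sigma>(2) sub[OF fa] sub[OF fb] sub[OF kl] j])
  qed
  have rb: "gp t (\<sigma> n) (r n) \<in> {0..t}" for n
  proof -
    have "real (r n) * t \<le> real (\<sigma> n) * t" using r(1)[of n] qk(1)[of n] t by (intro mult_right_mono) auto
    then show ?thesis using t \<sigma>(2)[of n] by (simp add: field_simps)
  qed
  obtain \<rho> h where h: "strict_mono (h :: nat => nat)" and \<rho>l: "((\<lambda>n. gp t (\<sigma> n) (r n)) \<circ> h) \<longlonglongrightarrow> \<rho>"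
    using compact_imp_seq_compact[OF compact_Icc[of 0 t], unfolded seq_compact_def, rule_format, of "\<lambda>n. gp t (\<sigma> n) (r n)"] rb
    by blast
  have hs: "(\<lambda>n. x (h n)) \<longlonglongrightarrow> y" if "x \<longlonglongrightarrow> y" for x :: "nat => real" and y
    using LIMSEQ_subseq_LIMSEQ[OF that h] by (simp add: comp_def)
  have \<rho>L: "(\<lambda>n. gp t (\<sigma> (h n)) (r (h n))) \<longlonglongrightarrow> \<rho>" using \<rho>l by (simp add: comp_def)
  have \<rho>0: "0 \<le> \<rho>" using t by (intro LIMSEQ_le_const[OF \<rho>L]) auto
  have \<rho>1: "\<rho> \<le> l"
  proof (rule LIMSEQ_le[OF \<rho>L hs[OF kl]])
    have "gp t (\<sigma> (h n)) (r (h n)) \<le> gp t (\<sigma> (h n)) (k (h n))" for n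
      using r(1)[of "h n"] t by (intro divide_right_mono mult_right_mono) auto
    then show "\<exists>N. \<forall>n\<ge>N. gp t (\<sigma> (h n)) (r (h n)) \<le> gp t (\<sigma> (h n)) (k (h n))" by blast
  qed
  define b where "b n = bridge f t (\<sigma> (h n)) (q (h n)) (k (h n)) (r (h n))" for n
  have bmin: "b n \<le> bridge f t (\<sigma> (h n)) (q (h n)) (k (h n)) j" if "j \<le> k (h n)" for n j
    unfolding b_def using that by (intro rot_min r)
  have Nt: "filterlim (\<lambda>n. \<sigma> (h n)) at_top sequentially"
    using strict_mono_o[OF \<sigma>(1) h] by (intro filterlim_subseq) (simp add: comp_def)
  have t0: "(\<lambda>n. t / real (\<sigma> (h n))) \<longlonglongrightarrow> 0" by (rule lim_t_over[OF Nt])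
  have up: "eventually (\<lambda>n. b n < M + e) sequentially"
    if e: "0 < e" and j: "eventually (\<lambda>n. j n \<le> k (h n)) sequentially"
      and lim: "(\<lambda>n. bridge f t (\<sigma> (h n)) (q (h n)) (k (h n)) (j n)) \<longlonglongrightarrow> M" for e M j
  proof -
    have "eventually (\<lambda>n. bridge f t (\<sigma> (h n)) (q (h n)) (k (h n)) (j n) < M + e) sequentially"
      using e by (intro order_tendstoD(2)[OF lim]) auto
    with j show ?thesis by eventually_elim (use bmin in \<open>auto intro: le_less_trans\<close>)
  qed
  have upK: "eventually (\<lambda>n. b n < knight f a l c + e) sequentially" if c: "c \<in> {0..l}" and e: "0 < e" for c e
  proof (cases "c = l")
    case True
    have "(\<lambda>n. bridge f t (\<sigma> (h n)) (q (h n)) (k (h n)) (k (h n))) \<longlonglongrightarrow> f (a + l) - f a - l * slp f a l"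
      using hs[OF kl] hs[OF fb] by (intro br h)
    then show ?thesis using up[OF e, of "\<lambda>n. k (h n)"] True by (simp add: knight_slp)
  next
    case False
    obtain L where L: "\<And>n. 0 < n ==> c \<le> gp t n (L n)" "\<And>n. 0 < n ==> gp t n (L n) \<le> c + t / real n"
    proof (cases "c \<le> t")
      case True
      then show ?thesis using grid_right[of c t] c t that by (metis atLeastAtMost_iff)
    next
      case False
      show ?thesis
      proof (rule that)
        fix n :: nat assume n: "0 < n"
        have 0: "0 \<le> c * real n / t" using c t by simp
        then have rr: "real (nat \<lceil>c * real n / t\<rceil>) = of_int \<lceil>c * real n / t\<rceil>" by simp
        have "c * real n / t \<le> real (nat \<lceil>c * real n / t\<rceil>)" unfolding rr by (rule le_of_int_ceiling)
        then show "c \<le> gp t n (nat \<lceil>c * real n / t\<rceil>)" using t n by (simp add: field_simps)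
        have "real (nat \<lceil>c * real n / t\<rceil>) \<le> c * real n / t + 1" unfolding rr by (rule of_int_ceiling_le_add_one)
        then show "gp t n (nat \<lceil>c * real n / t\<rceil>) \<le> c + t / real n" using t n by (simp add: field_simps)
      qed
    qed
    define j where "j n = L (\<sigma> (h n))" for n
    have jl: "c \<le> gp t (\<sigma> (h n)) (j n)" "gp t (\<sigma> (h n)) (j n) \<le> c + t / real (\<sigma> (h n))" for n
      using L[OF \<sigma>(2)[of "h n"]] by (simp_all add: j_def)
    have "(\<lambda>n. c + t / real (\<sigma> (h n))) \<longlonglongrightarrow> c + 0" by (intro tendsto_intros t0)
    then have cl: "(\<lambda>n. c + t / real (\<sigma> (h n))) \<longlonglongrightarrow> c" by simp
    have jc: "(\<lambda>n. gp t (\<sigma> (h n)) (j n)) \<longlonglongrightarrow> c"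
      by (rule tendsto_sandwich[OF always_eventually always_eventually tendsto_const cl]) (intro allI jl)+
    have add: "gp t (\<sigma> (h n)) (q (h n) + j n) = gp t (\<sigma> (h n)) (q (h n)) + gp t (\<sigma> (h n)) (j n)" for n
      by (simp add: algebra_simps add_divide_distrib)
    have "(\<lambda>n. f (gp t (\<sigma> (h n)) (q (h n) + j n))) \<longlonglongrightarrow> f (a + c)"
      unfolding add using a c qa(1) jl(1)
      by (intro cadlag_seq_right[OF f] tendsto_add hs[OF qa(2)] jc always_eventually allI add_mono) auto
    then have "(\<lambda>n. bridge f t (\<sigma> (h n)) (q (h n)) (k (h n)) (j n)) \<longlonglongrightarrow> f (a + c) - f a - c * slp f a l"
      by (intro br h jc)
    moreover have "eventually (\<lambda>n. gp t (\<sigma> (h n)) (j n) < gp t (\<sigma> (h n)) (k (h n))) sequentially"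
      using c False by (intro order_tendsto_less[OF jc hs[OF kl]]) auto
    then have "eventually (\<lambda>n. j n \<le> k (h n)) sequentially"
    proof eventually_elim
      case (elim n)
      then show ?case using t \<sigma>(2)[of "h n"] by (simp add: divide_less_cancel)
    qed
    ultimately show ?thesis using up[OF e, of j] by (simp add: knight_slp)
  qed
  have upL: "eventually (\<lambda>n. b n < lft f (a + c) - f a - c * slp f a l + e) sequentially" if c: "0 < c" "c \<le> l" and e: "0 < e" for c e
  proof -
    have act: "a + c \<le> t"
    proof -
      have "real (q 0 + k 0) * t \<le> real (\<sigma> 0) * t" using qk(1)[of 0] t by (intro mult_right_mono) auto
      then have "gp t (\<sigma> 0) (q 0 + k 0) \<le> t" using \<sigma>(2)[of 0] by (simp add: field_simps)
      then show ?thesis using qb(1)[of 0] c by linarith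
    qed
    obtain L where L: "\<And>n. 0 < n ==> gp t n (L n) < a + c" "\<And>n. 0 < n ==> a + c - t / real n \<le> gp t n (L n)"
      using grid_left[of "a + c" t] a c act t by (metis add_nonneg_pos)
    define m where "m n = L (\<sigma> (h n))" for n
    have ml: "gp t (\<sigma> (h n)) (m n) < a + c" "a + c - t / real (\<sigma> (h n)) \<le> gp t (\<sigma> (h n)) (m n)" for n
      using L[OF \<sigma>(2)[of "h n"]] by (simp_all add: m_def)
    have "(\<lambda>n. a + c - t / real (\<sigma> (h n))) \<longlonglongrightarrow> a + c - 0" by (intro tendsto_intros t0)
    then have cl: "(\<lambda>n. a + c - t / real (\<sigma> (h n))) \<longlonglongrightarrow> a + c" by simp
    have mc: "(\<lambda>n. gp t (\<sigma> (h n)) (m n)) \<longlonglongrightarrow> a + c"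
      by (rule tendsto_sandwich[OF always_eventually always_eventually cl tendsto_const]) (intro allI ml less_imp_le)+
    define j where "j n = m n - q (h n)" for n
    have "eventually (\<lambda>n. gp t (\<sigma> (h n)) (q (h n)) < gp t (\<sigma> (h n)) (m n)) sequentially"
      using c by (intro order_tendsto_less[OF hs[OF qa(2)] mc]) auto
    then have ev: "eventually (\<lambda>n. q (h n) + j n = m n \<and> j n \<le> k (h n)) sequentially"
    proof eventually_elim
      case (elim n)
      have "gp t (\<sigma> (h n)) (m n) < gp t (\<sigma> (h n)) (q (h n) + k (h n))"
        using ml(1)[of n] qb(1)[of "h n"] c by linarith
      then have "m n < q (h n) + k (h n)" using t \<sigma>(2)[of "h n"] by (simp add: divide_less_cancel del: of_nat_add)
      moreover have "q (h n) < m n" using elim t \<sigma>(2)[of "h n"] by (simp add: divide_less_cancel)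
      ultimately show ?case by (auto simp: j_def)
    qed
    have "(\<lambda>n. gp t (\<sigma> (h n)) (m n) - gp t (\<sigma> (h n)) (q (h n))) \<longlonglongrightarrow> (a + c) - a"
      by (intro tendsto_diff mc hs[OF qa(2)])
    then have "(\<lambda>n. gp t (\<sigma> (h n)) (m n) - gp t (\<sigma> (h n)) (q (h n))) \<longlonglongrightarrow> c" by simp
    moreover have "eventually (\<lambda>n. gp t (\<sigma> (h n)) (m n) - gp t (\<sigma> (h n)) (q (h n)) = gp t (\<sigma> (h n)) (j n)) sequentially"
      using ev
    proof eventually_elim
      case (elim n)
      then have "real (m n) = real (q (h n)) + real (j n)" by linarith
      then show ?case by (simp add: algebra_simps add_divide_distrib)
    qed
    ultimately have jc: "(\<lambda>n. gp t (\<sigma> (h n)) (j n)) \<longlonglongrightarrow> c" by (rule Lim_transform_eventually)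
    have "(\<lambda>n. f (gp t (\<sigma> (h n)) (m n))) \<longlonglongrightarrow> lft f (a + c)"
      using a c ml by (intro cadlag_seq_left[OF f _ mc]) auto
    moreover have "eventually (\<lambda>n. f (gp t (\<sigma> (h n)) (m n)) = f (gp t (\<sigma> (h n)) (q (h n) + j n))) sequentially"
      using ev by eventually_elim (auto simp flip: of_nat_add)
    ultimately have "(\<lambda>n. f (gp t (\<sigma> (h n)) (q (h n) + j n))) \<longlonglongrightarrow> lft f (a + c)" by (rule Lim_transform_eventually)
    then have "(\<lambda>n. bridge f t (\<sigma> (h n)) (q (h n)) (k (h n)) (j n)) \<longlonglongrightarrow> lft f (a + c) - f a - c * slp f a l"
      by (intro br h jc)
    with ev e show ?thesis by (intro up) (auto elim: eventually_mono)
  qed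
  have upM: "eventually (\<lambda>n. b n < mK f a l c + e) sequentially" if c: "c \<in> {0..l}" and e: "0 < e" for c e
  proof (cases "c = 0")
    case True
    then show ?thesis using upK[OF c e] by (simp add: knight_slp)
  next
    case False
    then have "eventually (\<lambda>n. b n < lft (knight f a l) c + e) sequentially"
      using upL[of c e] c e by (simp add: lft_knight[OF f a])
    with upK[OF c e] show ?thesis by eventually_elim (simp add: mK_def)
  qed
  have low: "eventually (\<lambda>n. mK f a l \<rho> - e < b n) sequentially" if e: "0 < e" for e
  proof -
    have add: "gp t (\<sigma> (h n)) (q (h n) + r (h n)) = gp t (\<sigma> (h n)) (q (h n)) + gp t (\<sigma> (h n)) (r (h n))" for n
      by (simp add: algebra_simps add_divide_distrib)
    have T: "(\<lambda>n. gp t (\<sigma> (h n)) (q (h n) + r (h n))) \<longlonglongrightarrow> a + \<rho>"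
      unfolding add by (intro tendsto_add hs[OF qa(2)] \<rho>L)
    have Tge: "a \<le> gp t (\<sigma> (h n)) (q (h n) + r (h n))" for n
      unfolding add using qa(1)[of "h n"] t by (simp add: add_increasing2)
    \<comment> \<open>For \<open>\<rho> = 0\<close> the bound by \<open>fm f a\<close> would be too
      weak if \<open>f\<close> jumps at \<open>a\<close>. All grid points lie to the right of
      \<open>a\<close>, so right continuity is available instead.\<close>
    show ?thesis
    proof (cases "\<rho> = 0")
      case True
      have "(\<lambda>n. f (gp t (\<sigma> (h n)) (q (h n) + r (h n)))) \<longlonglongrightarrow> f a"
        using T True Tge by (intro cadlag_seq_right[OF f a]) auto
      then have "b \<longlonglongrightarrow> f a - f a - \<rho> * slp f a l"
        unfolding b_def[abs_def] by (intro br h \<rho>L)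
      then have "b \<longlonglongrightarrow> 0" using True by simp
      then show ?thesis using e True by (intro order_tendstoD) auto
    next
      case False
      have lo: "eventually (\<lambda>n. fm f (a + \<rho>) - e / 2 < f (gp t (\<sigma> (h n)) (q (h n) + r (h n)))) sequentially"
        using e a \<rho>0 t by (intro cadlag_seq_lower[OF f _ T]) auto
      define d where "d n = f (gp t (\<sigma> (h n)) (q (h n) + r (h n))) - b n" for n
      have "(\<lambda>n. f (gp t (\<sigma> (h n)) (q (h n))) + (gp t (\<sigma> (h n)) (r (h n))) / (gp t (\<sigma> (h n)) (k (h n))) *
          (f (gp t (\<sigma> (h n)) (q (h n) + k (h n))) - f (gp t (\<sigma> (h n)) (q (h n)))))
        \<longlonglongrightarrow> f a + \<rho> / l * (f (a + l) - f a)"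
        using l by (intro tendsto_diff tendsto_add tendsto_mult tendsto_divide \<rho>L hs[OF fa] hs[OF fb] hs[OF kl]) auto
      then have "d \<longlonglongrightarrow> f a + \<rho> * slp f a l"
        unfolding d_def[abs_def] b_def bridge_def samp_def ratio by (simp add: slp_def)
      then have "eventually (\<lambda>n. d n < f a + \<rho> * slp f a l + e / 2) sequentially"
        using e by (intro order_tendstoD) auto
      with lo show ?thesis
      proof eventually_elim
        case (elim n)
        then show ?case using mK_pos[OF f a, of \<rho> l] \<rho>0 False by (simp add: d_def)
      qed
    qed
  qed
  have min: "mK f a l \<rho> \<le> mK f a l c" if c: "c \<in> {0..l}" for c
  proof (rule field_le_epsilon)
    fix e :: real assume "0 < e"
    then have "eventually (\<lambda>n. mK f a l \<rho> - e/2 < b n) sequentially" "eventually (\<lambda>n. b n < mK f a l c + e/2) sequentially"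
      using low[of "e/2"] upM[OF c, of "e/2"] by auto
    then have "eventually (\<lambda>n. mK f a l \<rho> < mK f a l c + e) sequentially" by eventually_elim linarith
    then show "mK f a l \<rho> \<le> mK f a l c + e" by simp
  qed
  have "b \<longlonglongrightarrow> mK f a l \<rho>"
  proof (rule order_tendstoI)
    fix y assume "y < mK f a l \<rho>"
    then show "eventually (\<lambda>n. y < b n) sequentially" using low[of "mK f a l \<rho> - y"] by simp
  next
    fix y assume "mK f a l \<rho> < y"
    then show "eventually (\<lambda>n. b n < y) sequentially" using upM[of \<rho> "y - mK f a l \<rho>"] \<rho>0 \<rho>1 by simp
  qed
  then show ?thesis using that[OF h \<rho>0 \<rho>1 min \<rho>L] unfolding b_def[abs_def] by blast
qed

text \<open>The Vervaat transform as two pieces, the bridge after \<open>\<rho>\<close> followed by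
  the bridge before it. Each piece is a height above the same line, so measurability, boundedness
  and right continuity carry over from \<open>eF\<close>.\<close>

definition eG :: "(real => real) => real => real => real => real => real" where
  "eG f a l \<rho> s = eF f (slp f a l) (f a - a * slp f a l + mK f a l \<rho>) (a + \<rho>) (a + l) s +
     eF f (slp f a l) (f a - a * slp f a l + mK f a l \<rho>) a (a + \<rho>) (s - (l - \<rho>))"

lemma eG_eq:
  assumes "0 \<le> \<rho>" "\<rho> \<le> l"
  shows "eG f a l \<rho> s = (if 0 \<le> s \<and> s < l then
    knight f a l (if \<rho> + s < l then \<rho> + s else \<rho> + s - l) - mK f a l \<rho> else 0)"
proof -
  have 1: "a + l - (a + \<rho>) = l - \<rho>" and 2: "a + \<rho> - a = \<rho>" and 3: "a + (s - (l - \<rho>)) = a + (\<rho> + s - l)"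
    and 4: "a + \<rho> + s = a + (\<rho> + s)" by simp_all
  consider "s < 0" | "l \<le> s" | "0 \<le> s" "s < l" "\<rho> + s < l" | "0 \<le> s" "s < l" "\<not> \<rho> + s < l" by linarith
  then show ?thesis
    unfolding eG_def eF_def knight_slp 1 2 3 4 by cases (use assms in \<open>simp_all add: algebra_simps\<close>)
qed

lemma eG_borel:
  assumes f: "cadlag f" and "0 \<le> a" "0 \<le> \<rho>"
  shows "eG f a l \<rho> \<in> borel_measurable borel"
proof -
  have [measurable]: "eF f p q (a + \<rho>) d \<in> borel_measurable borel" "eF f p q a d \<in> borel_measurable borel" for p q d
    using assms by (auto intro!: eF_borel)
  show ?thesis unfolding eG_def[abs_def] by measurable
qed

lemma eG_right:
  assumes f: "cadlag f" and "0 \<le> a" "0 \<le> \<rho>"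
  shows "(eG f a l \<rho> \<longlongrightarrow> eG f a l \<rho> s) (at_right s)"
proof -
  have sh: "((\<lambda>s. g (s - c)) \<longlongrightarrow> g (s - c)) (at_right s)" if "(g \<longlongrightarrow> g (s - c)) (at_right (s - c))" for g :: "real => real" and c
  proof -
    have e: "filtermap (\<lambda>x. x - c) (at_right s) = at_right (s - c)"
      using filtermap_at_right_shift[of c s] by simp
    show ?thesis using that unfolding e[symmetric] filterlim_filtermap .
  qed
  show ?thesis unfolding eG_def[abs_def]
    using assms by (intro tendsto_add sh eF_right[OF f]) auto
qed

lemma eG_bounded:
  assumes f: "cadlag f" and "0 \<le> a" "0 \<le> \<rho>"
  obtains B where "\<And>s. \<bar>eG f a l \<rho> s\<bar> \<le> B"
proof -
  obtain B1 where B1: "\<And>s. \<bar>eF f (slp f a l) (f a - a * slp f a l + mK f a l \<rho>) (a + \<rho>) (a + l) s\<bar> \<le> B1"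
    using eF_bounded[OF f, of "a + \<rho>"] assms by (metis add_nonneg_nonneg)
  obtain B2 where B2: "\<And>s. \<bar>eF f (slp f a l) (f a - a * slp f a l + mK f a l \<rho>) a (a + \<rho>) s\<bar> \<le> B2"
    using eF_bounded[OF f, of a] assms by metis
  show ?thesis
  proof (rule that[of "B1 + B2"])
    show "\<bar>eG f a l \<rho> s\<bar> \<le> B1 + B2" for s
      unfolding eG_def using B1[of s] B2[of "s - (l - \<rho>)"] by linarith
  qed
qed

definition mins :: "(real => real) => real => real => real set" where
  "mins f a l = {c \<in> {0..l}. \<forall>c'\<in>{0..l}. mK f a l c \<le> mK f a l c'}"

lemma rmod_simps:
  assumes "0 < l"
  shows "0 \<le> y ==> y < l ==> rmod y l = y" "l \<le> y ==> y < 2 * l ==> rmod y l = y - l"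
proof -
  assume "0 \<le> y" "y < l"
  then have "\<lfloor>y / l\<rfloor> = 0" using assms by (simp add: floor_eq_iff)
  then show "rmod y l = y" by (simp add: rmod_def)
next
  assume "l \<le> y" "y < 2 * l"
  then have "\<lfloor>y / l\<rfloor> = 1" using assms by (simp add: floor_eq_iff field_simps)
  then show "rmod y l = y - l" by (simp add: rmod_def)
qed

text \<open>There are at most two minima, so a last one exists. When there are two, they are 0 and
  \<open>l\<close>, and rotating by either gives the same path. The right end point is excepted
  because \<open>eG\<close> is set to 0 there.\<close>

lemma vervaat_mins:
  assumes l: "0 < l" and ne: "mins f a l \<noteq> {}"
    and uniq: "\<And>c1 c2. c1 \<in> mins f a l ==> c2 \<in> mins f a l ==> c1 < c2 ==> c1 = 0 \<and> c2 = l"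
  obtains \<rho> where "\<rho> \<in> mins f a l" "\<And>c. c \<in> mins f a l ==> c = \<rho> \<or> c = 0 \<and> \<rho> = l"
    "\<And>s. s \<noteq> l ==> vervaat l (knight f a l) s = eG f a l \<rho> s"
proof -
  have "\<exists>\<rho>\<in>mins f a l. \<forall>c\<in>mins f a l. c \<le> \<rho>"
  proof -
    obtain c where c: "c \<in> mins f a l" using ne by blast
    show ?thesis
    proof (cases "\<exists>c'\<in>mins f a l. c < c'")
      case True
      then obtain c' where c': "c' \<in> mins f a l" "c < c'" by blast
      then have "c' = l" using uniq[OF c] by blast
      then show ?thesis using c' by (auto simp: mins_def intro!: bexI[of _ l])
    next
      case False
      then show ?thesis using c by (meson not_less)
    qed
  qed
  then obtain \<rho> where \<rho>: "\<rho> \<in> mins f a l" and mx: "\<And>c. c \<in> mins f a l ==> c \<le> \<rho>" by blast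
  have \<rho>l: "0 \<le> \<rho>" "\<rho> \<le> l" and mn: "\<And>c. c \<in> {0..l} ==> mK f a l \<rho> \<le> mK f a l c"
    using \<rho> by (auto simp: mins_def)
  have inf: "Inf ((\<lambda>u. min (knight f a l u) (lft (knight f a l) u)) ` {0..l}) = mK f a l \<rho>"
  proof (rule cInf_eq_minimum)
    show "mK f a l \<rho> \<in> (\<lambda>u. min (knight f a l u) (lft (knight f a l) u)) ` {0..l}"
      using \<rho>l by (auto simp: mK_def intro!: image_eqI[of _ _ \<rho>])
    show "mK f a l \<rho> \<le> x" if "x \<in> (\<lambda>u. min (knight f a l u) (lft (knight f a l) u)) ` {0..l}" for x
      using that mn by (auto simp flip: mK_def)
  qed
  have set: "{u \<in> {0..l}. min (knight f a l u) (lft (knight f a l) u) = mK f a l \<rho>} = mins f a l"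
  proof -
    have "(mK f a l u = mK f a l \<rho>) \<longleftrightarrow> u \<in> mins f a l" if "u \<in> {0..l}" for u
    proof
      assume "mK f a l u = mK f a l \<rho>"
      then show "u \<in> mins f a l" using that mn by (auto simp: mins_def)
    next
      assume "u \<in> mins f a l"
      then show "mK f a l u = mK f a l \<rho>" using mn[OF that] \<rho>l by (auto simp: mins_def intro: antisym)
    qed
    then show ?thesis by (auto simp: mins_def simp flip: mK_def)
  qed
  have sup: "Sup (mins f a l) = \<rho>" using \<rho> mx by (intro cSup_eq_maximum) auto
  show ?thesis
  proof (rule that[OF \<rho>])
    fix c assume c: "c \<in> mins f a l"
    show "c = \<rho> \<or> c = 0 \<and> \<rho> = l" using uniq[OF c \<rho>] mx[OF c] by linarith
  next
    fix s assume s: "s \<noteq> l"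
    show "vervaat l (knight f a l) s = eG f a l \<rho> s"
    proof (cases "0 \<le> s \<and> s < l")
      case True
      have "rmod (\<rho> + s) l = (if \<rho> + s < l then \<rho> + s else \<rho> + s - l)"
        using True \<rho>l rmod_simps[OF l, of "\<rho> + s"] by auto
      then show ?thesis
        using True unfolding vervaat_def Let_def inf set sup eG_eq[OF \<rho>l] by simp
    next
      case False
      then have "\<not> (0 \<le> s \<and> s \<le> l)" using s by auto
      then show ?thesis using False unfolding vervaat_def eG_eq[OF \<rho>l] by (simp only: Let_def if_False)
    qed
  qed
qed

text \<open>If both 0 and \<open>l\<close> are minima, the discrete argmin may oscillate between
  them and need not converge. The rotated limits agree in the two cases, so a subsequence argument
  still gives convergence of the blocks.\<close>

lemma rot_block_limit:
  assumes f: "cadlag f" and t: "0 < t" and a: "0 \<le> a" and l: "0 < l"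
    and qk: "\<And>n. q n + k n \<le> Suc n"
    and qa: "\<And>n. a \<le> gp t (Suc n) (q n)" "(\<lambda>n. gp t (Suc n) (q n)) \<longlonglongrightarrow> a"
    and qb: "\<And>n. a + l \<le> gp t (Suc n) (q n + k n)" "(\<lambda>n. gp t (Suc n) (q n + k n)) \<longlonglongrightarrow> a + l"
    and r: "\<And>n. 0 < k n ==> r n < k n" "\<And>n. 0 < k n ==> exc (k n) (rot (r n) (k n) (shift_seq (q n) (incr f t (Suc n))))"
    and \<rho>: "\<rho> \<in> mins f a l" "\<And>c. c \<in> mins f a l ==> c = \<rho> \<or> c = 0 \<and> \<rho> = l"
  defines "y \<equiv> (\<lambda>n. rot (r n) (k n) (shift_seq (q n) (incr f t (Suc n))))"
  shows "(\<lambda>n. gp t (Suc n) (k n)) \<longlonglongrightarrow> l"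
    and "(\<lambda>n. walk (y n) (k n)) \<longlonglongrightarrow> f (a + l) - f a"
    and "\<epsilon> \<noteq> 0 ==> (\<lambda>n. eavg t (Suc n) s \<epsilon> (k n) (y n)) \<longlonglongrightarrow> (\<integral>x. eG f a l \<rho> (s + \<epsilon> * x) \<partial>Lam)"
proof -
  have dist: "gp t (Suc n) (i + j) = gp t (Suc n) i + gp t (Suc n) j" for i j n
    by (simp add: algebra_simps add_divide_distrib)
  show kl: "(\<lambda>n. gp t (Suc n) (k n)) \<longlonglongrightarrow> l"
  proof -
    have "(\<lambda>n. gp t (Suc n) (q n + k n) - gp t (Suc n) (q n)) \<longlonglongrightarrow> (a + l) - a"
      by (intro tendsto_diff qa qb)
    then show ?thesis unfolding dist by simp
  qed
  have fa: "(\<lambda>n. f (gp t (Suc n) (q n))) \<longlonglongrightarrow> f a"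
    using qa by (intro cadlag_seq_right[OF f a]) auto
  have fb: "(\<lambda>n. f (gp t (Suc n) (q n + k n))) \<longlonglongrightarrow> f (a + l)"
    using qb a l by (intro cadlag_seq_right[OF f]) auto
  have kev: "eventually (\<lambda>n. 0 < k n) sequentially"
    using order_tendstoD(1)[OF kl l] by eventually_elim (auto intro: Nat.gr0I)
  have wk: "walk (y n) (k n) = samp f t (Suc n) (q n + k n) - samp f t (Suc n) (q n)" for n
  proof (cases "0 < k n")
    case True
    then show ?thesis unfolding y_def using r(1)[OF True] by (subst walk_rot) (auto simp: walk_shift_incr)
  qed simp
  have "(\<lambda>n. f (gp t (Suc n) (q n + k n)) - f (gp t (Suc n) (q n))) \<longlonglongrightarrow> f (a + l) - f a"
    by (intro tendsto_diff fa fb)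
  then show "(\<lambda>n. walk (y n) (k n)) \<longlonglongrightarrow> f (a + l) - f a"
    unfolding wk samp_def .
  have \<rho>l: "0 \<le> \<rho>" "\<rho> \<le> l" using \<rho>(1) by (auto simp: mins_def)
  obtain B where B: "0 < B" "\<And>s. s \<in> {0..t} ==> \<bar>f s\<bar> \<le> B" using cadlag_bounded[OF f] by metis
  have sB: "\<bar>walk (shift_seq (q n) (incr f t (Suc n))) i\<bar> \<le> 2 * B" if "i \<le> k n" for n i
  proof -
    have "real (q n + i) * t \<le> real (Suc n) * t" "real (q n) * t \<le> real (Suc n) * t"
      using that qk[of n] t by (auto intro!: mult_right_mono simp del: of_nat_Suc)
    then have "gp t (Suc n) (q n + i) \<in> {0..t}" "gp t (Suc n) (q n) \<in> {0..t}"
      using t by (auto simp: pos_divide_le_eq mult.commute simp del: of_nat_Suc)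
    then have "\<bar>samp f t (Suc n) (q n + i)\<bar> \<le> B" "\<bar>samp f t (Suc n) (q n)\<bar> \<le> B"
      unfolding samp_def by (auto intro: B(2))
    then show ?thesis unfolding walk_shift_incr by linarith
  qed
  let ?J = "{s. 0 < s \<and> lft f s \<noteq> f s}"
  \<comment> \<open>Besides the ends and the junction \<open>l - \<rho>\<close>, these are the times
    at which the rotated path passes a jump of \<open>f\<close>, before and after wrapping
    around.\<close>
  let ?A = "{0, l, l - \<rho>} \<union> (\<lambda>s. s - a - \<rho>) ` ?J \<union> (\<lambda>s. s - a - \<rho> + l) ` ?J"
  assume \<epsilon>: "\<epsilon> \<noteq> 0"
  show "(\<lambda>n. eavg t (Suc n) s \<epsilon> (k n) (y n)) \<longlonglongrightarrow> (\<integral>x. eG f a l \<rho> (s + \<epsilon> * x) \<partial>Lam)"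
  proof (rule eavg_limit[OF \<epsilon>])
    show "countable ?A" using countable_cadlag_jumps[OF f] by simp
    show "eG f a l \<rho> \<in> borel_measurable borel" by (rule eG_borel[OF f a \<rho>l(1)])
    show "\<bar>eblk t (Suc n) (k n) (y n) x\<bar> \<le> 2 * (6 * B)" for n x
    proof (rule eblk_le)
      fix j assume j: "j \<le> k n"
      show "\<bar>walk (y n) j\<bar> \<le> 6 * B"
      proof (cases "0 < k n")
        case True
        show ?thesis unfolding y_def walk_rot[OF r(1)[OF True] j]
        proof -
          have "r n + j - k n \<le> k n" "r n \<le> k n" using r(1)[OF True] j by auto
          then show "\<bar>if r n + j \<le> k n then walk (shift_seq (q n) (incr f t (Suc n))) (r n + j) - walk (shift_seq (q n) (incr f t (Suc n))) (r n)
            else walk (shift_seq (q n) (incr f t (Suc n))) (k n) - walk (shift_seq (q n) (incr f t (Suc n))) (r n) +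
              walk (shift_seq (q n) (incr f t (Suc n))) (r n + j - k n)\<bar> \<le> 6 * B"
            using sB[of "r n + j" n] sB[of "r n" n] sB[of "k n" n] sB[of "r n + j - k n" n] B(1)
            by (auto split: if_split)
        qed
      qed (use j B in auto)
    qed
    fix x assume x: "x \<notin> ?A"
    let ?N = "\<lambda>n. nat \<lfloor>x * real (Suc n) / t\<rfloor>"
    show "(\<lambda>n. eblk t (Suc n) (k n) (y n) x) \<longlonglongrightarrow> eG f a l \<rho> x"
    proof (cases "0 \<le> x")
      case False
      then show ?thesis by (simp add: eblk_def eG_eq[OF \<rho>l])
    next
      case x0: True
      have J: "(\<lambda>n. gp t (Suc n) (?N n)) \<longlonglongrightarrow> x"
        by (rule floor_grid_limit[OF t x0]) (auto simp: filterlim_Suc)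
      have lt: "i < j \<longleftrightarrow> gp t (Suc n) i < gp t (Suc n) j" for i j n
        using t by (simp add: divide_less_cancel del: of_nat_Suc)
      show ?thesis
      proof (cases "x < l")
        case ge: False
        then have "l < x" using x by auto
        then have "eventually (\<lambda>n. gp t (Suc n) (k n) < gp t (Suc n) (?N n)) sequentially"
          by (rule order_tendsto_less[OF kl J])
        then have "eventually (\<lambda>n. eblk t (Suc n) (k n) (y n) x = eG f a l \<rho> x) sequentially"
        proof eventually_elim
          case (elim n)
          then have "\<not> ?N n < k n" unfolding lt[of _ _ n] by linarith
          then show ?case using ge unfolding eblk_def eG_eq[OF \<rho>l] by (simp del: of_nat_Suc)
        qed
        then show ?thesis by (rule tendsto_eventually)
      next
        case xl: True
        have xp: "0 < x" using x0 x by auto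
        have ev: "eventually (\<lambda>n. ?N n < k n) sequentially"
        proof -
          have "eventually (\<lambda>n. gp t (Suc n) (?N n) < gp t (Suc n) (k n)) sequentially"
            by (rule order_tendsto_less[OF J kl xl])
          then show ?thesis by (simp only: lt[symmetric])
        qed
        obtain n0 where n0: "\<And>n. n0 \<le> n ==> 0 < k n \<and> ?N n < k n"
          using eventually_conj[OF kev ev] unfolding eventually_sequentially by blast
        show ?thesis
        proof (rule tendsto_subsubseq)
          fix \<tau> :: "nat => nat" assume \<tau>: "strict_mono \<tau>"
          \<comment> \<open>The shift by \<open>n0\<close> makes every block nonempty, as
            \<open>rot_block_core\<close> demands for all indices.\<close>
          define \<sigma> where "\<sigma> n = \<tau> (n + n0)" for n
          have \<sigma>m: "strict_mono \<sigma>" using \<tau> by (simp add: \<sigma>_def strict_mono_def)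
          then have \<sigma>S: "strict_mono (\<lambda>n. Suc (\<sigma> n))" by (simp add: strict_mono_def)
          have \<sigma>n: "n0 \<le> \<sigma> n" for n
            using seq_suble[OF \<tau>, of "n + n0"] by (simp add: \<sigma>_def)
          have sub: "(\<lambda>n. g (\<sigma> n)) \<longlonglongrightarrow> y" if "g \<longlonglongrightarrow> y" for g :: "nat => real" and y
            using LIMSEQ_subseq_LIMSEQ[OF that \<sigma>m] by (simp add: comp_def)
          have kp: "0 < k (\<sigma> n)" for n using n0[OF \<sigma>n] by simp
          obtain h \<rho>' where h: "strict_mono (h :: nat => nat)" and \<rho>': "0 \<le> \<rho>'" "\<rho>' \<le> l"
            "\<And>c. c \<in> {0..l} ==> mK f a l \<rho>' \<le> mK f a l c"
            and rl: "(\<lambda>n. gp t (Suc (\<sigma> (h n))) (r (\<sigma> (h n)))) \<longlonglongrightarrow> \<rho>'"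
            and bl: "(\<lambda>n. bridge f t (Suc (\<sigma> (h n))) (q (\<sigma> (h n))) (k (\<sigma> (h n))) (r (\<sigma> (h n)))) \<longlonglongrightarrow> mK f a l \<rho>'"
            by (rule rot_block_core[OF f t a l \<sigma>S, of "\<lambda>n. q (\<sigma> n)" "\<lambda>n. k (\<sigma> n)" "\<lambda>n. r (\<sigma> n)"])
              (use qk kp qa(1) sub[OF qa(2)] qb(1) sub[OF qb(2)] r in auto)
          have \<rho>'m: "\<rho>' \<in> mins f a l" using \<rho>' by (auto simp: mins_def)
          then have \<rho>'c: "\<rho>' = \<rho> \<or> \<rho>' = 0 \<and> \<rho> = l" by (rule \<rho>(2))
          have mm: "mK f a l \<rho>' = mK f a l \<rho>"
            using \<rho>'(3)[of \<rho>] \<rho>(1) \<rho>' \<rho>l by (auto simp: mins_def intro!: antisym)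
          define s where "s n = \<sigma> (h n)" for n
          have s: "strict_mono s" using strict_mono_o[OF \<sigma>m h] by (simp add: s_def[abs_def] comp_def)
          have sn: "n0 \<le> s n" for n by (simp add: s_def \<sigma>n)
          have ss: "(\<lambda>n. g (s n)) \<longlonglongrightarrow> y" if "g \<longlonglongrightarrow> y" for g :: "nat => real" and y
            using LIMSEQ_subseq_LIMSEQ[OF that s] by (simp add: comp_def)
          define i where "i n = (if r (s n) + ?N (s n) \<le> k (s n) then r (s n) + ?N (s n) else r (s n) + ?N (s n) - k (s n))" for n
          define w where "w = (if \<rho>' + x < l then \<rho>' + x else \<rho>' + x - l)"
          have ne: "\<rho>' + x \<noteq> l" using \<rho>'c x xl by auto
          have rN: "(\<lambda>n. gp t (Suc (s n)) (r (s n) + ?N (s n))) \<longlonglongrightarrow> \<rho>' + x"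
            unfolding dist by (intro tendsto_add ss[OF J] rl[folded s_def])
          have il: "(\<lambda>n. gp t (Suc (s n)) (i n)) \<longlonglongrightarrow> w"
          proof (cases "\<rho>' + x < l")
            case True
            have "eventually (\<lambda>n. r (s n) + ?N (s n) < k (s n)) sequentially"
              using order_tendsto_less[OF rN ss[OF kl] True] by (simp only: lt[symmetric])
            then have "eventually (\<lambda>n. gp t (Suc (s n)) (r (s n) + ?N (s n)) = gp t (Suc (s n)) (i n)) sequentially"
              by eventually_elim (simp add: i_def)
            then show ?thesis using Lim_transform_eventually[OF rN] True by (simp add: w_def)
          next
            case False
            then have "l < \<rho>' + x" using ne by simp
            then have "eventually (\<lambda>n. k (s n) < r (s n) + ?N (s n)) sequentially"
              using order_tendsto_less[OF ss[OF kl] rN] by (simp only: lt[symmetric])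
            then have "eventually (\<lambda>n. gp t (Suc (s n)) (r (s n) + ?N (s n)) - gp t (Suc (s n)) (k (s n))
               = gp t (Suc (s n)) (i n)) sequentially"
            proof eventually_elim
              case (elim n)
              then have "real (i n) = real (r (s n) + ?N (s n)) - real (k (s n))" by (simp add: i_def of_nat_diff)
              then show ?case by (simp only: left_diff_distrib diff_divide_distrib)
            qed
            moreover have "(\<lambda>n. gp t (Suc (s n)) (r (s n) + ?N (s n)) - gp t (Suc (s n)) (k (s n))) \<longlonglongrightarrow> \<rho>' + x - l"
              by (intro tendsto_diff rN ss[OF kl])
            ultimately show ?thesis using False Lim_transform_eventually by (auto simp: w_def)
          qed
          have w0: "0 < w" using \<rho>' xp ne by (auto simp: w_def)
          have nj: "lft f (a + w) = f (a + w)"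
          proof (rule ccontr)
            assume "lft f (a + w) \<noteq> f (a + w)"
            then have aw: "a + w \<in> ?J" using a w0 by auto
            \<comment> \<open>For \<open>\<rho>' = 0\<close> and \<open>\<rho> = l\<close> no
              wrapping occurs and \<open>w = x\<close>; this falls under the second
              alternative.\<close>
            have "x = (a + w) - a - \<rho> \<or> x = (a + w) - a - \<rho> + l"
              using \<rho>'c xl by (auto simp: w_def)
            then have "x \<in> (\<lambda>s. s - a - \<rho>) ` ?J \<union> (\<lambda>s. s - a - \<rho> + l) ` ?J" using aw by blast
            then show False using x by blast
          qed
          have "(\<lambda>n. f (gp t (Suc (s n)) (q (s n) + i n))) \<longlonglongrightarrow> f (a + w)"
            unfolding dist using a w0 by (intro cadlag_seq_cont[OF f _ nj] tendsto_add ss[OF qa(2)] il) auto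
          then have "(\<lambda>n. bridge f t (Suc (s n)) (q (s n)) (k (s n)) (i n)) \<longlonglongrightarrow> f (a + w) - f a - w * slp f a l"
            by (intro bridge_limit[OF t l _ ss[OF fa] ss[OF fb] ss[OF kl] il]) simp_all
          then have "(\<lambda>n. bridge f t (Suc (s n)) (q (s n)) (k (s n)) (i n) - bridge f t (Suc (s n)) (q (s n)) (k (s n)) (r (s n)))
             \<longlonglongrightarrow> knight f a l w - mK f a l \<rho>'"
            unfolding knight_slp by (intro tendsto_diff bl[folded s_def])
          moreover have "eblk t (Suc (s n)) (k (s n)) (y (s n)) x =
              bridge f t (Suc (s n)) (q (s n)) (k (s n)) (i n) - bridge f t (Suc (s n)) (q (s n)) (k (s n)) (r (s n))" for n
          proof -
            have c: "0 < k (s n)" "?N (s n) < k (s n)" using n0[OF sn] by auto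
            have "eblk t (Suc (s n)) (k (s n)) (y (s n)) x =
               walk (y (s n)) (?N (s n)) - real (?N (s n)) / real (k (s n)) * walk (y (s n)) (k (s n))"
              using x0 c by (simp add: eblk_def del: of_nat_Suc)
            then show ?thesis
              unfolding y_def i_def using rot_block_value[OF r(1)[OF c(1)] less_imp_le[OF c(2)]] by simp
          qed
          moreover have "knight f a l w - mK f a l \<rho>' = eG f a l \<rho> x"
            using \<rho>'c x0 xl unfolding eG_eq[OF \<rho>l] mm by (auto simp: w_def)
          ultimately have L: "(\<lambda>n. eblk t (Suc (s n)) (k (s n)) (y (s n)) x) \<longlonglongrightarrow> eG f a l \<rho> x" by simp
          show "\<exists>r. strict_mono (r :: nat => nat) \<and> (\<lambda>n. eblk t (Suc (\<tau> (r n))) (k (\<tau> (r n))) (y (\<tau> (r n))) x) \<longlonglongrightarrow> eG f a l \<rho> x"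
            using L h by (intro exI[of _ "\<lambda>n. h n + n0"]) (simp add: s_def \<sigma>_def strict_mono_def)
        qed
      qed
    qed
  qed
qed

section \<open>Laws and test functions\<close>

lemma ramp_tendsto: "(\<lambda>p. min 1 (max 0 (real p * (y - x)))) \<longlonglongrightarrow> indicator {x<..} (y::real)"
proof (cases "x < y")
  case True
  obtain N where "1 < real N * (y - x)" using True reals_Archimedean3[of "y - x"] by auto
  then have "1 \<le> real p * (y - x)" if "N \<le> p" for p
    using that True by (smt (verit) mult_right_mono of_nat_mono)
  moreover have "min 1 (max 0 z) = 1" if "1 \<le> z" for z :: real using that by simp
  ultimately have "eventually (\<lambda>p. min 1 (max 0 (real p * (y - x))) = 1) sequentially"
    by (intro eventually_sequentiallyI[of N]) blast
  then show ?thesis using True by (auto intro: tendsto_eventually)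
next
  case False
  then have "real p * (y - x) \<le> 0" for p by (intro mult_nonneg_nonpos) auto
  then have "max 0 (real p * (y - x)) = 0" for p by (simp add: max_absorb1)
  then show ?thesis using False by simp
qed

definition tests :: "('c => real => real) => bool" where
  "tests h \<longleftrightarrow> (\<forall>c. continuous_on UNIV (h c) \<and> (\<forall>x. 0 \<le> h c x \<and> h c x \<le> 1))"

lemma tests_measurable: "tests h ==> h c \<in> borel_measurable borel"
  by (intro borel_measurable_continuous_onI) (simp add: tests_def)

lemma prod_ennreal_le_1:
  assumes "\<And>c. c \<in> C ==> f c \<le> (1::ennreal)"
  shows "prod f C \<le> 1"
  using assms
proof (induction C rule: infinite_finite_induct)
  case (insert c C)
  then show ?case using mult_mono[of "f c" 1 "prod f C" 1] by simp
qed simp_all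

text \<open>Exchanges one continuous test for an indicator while the weights carry the other
  coordinates. Ramps reach the open half lines, and these determine the two weighted image
  measures.\<close>

lemma (in prob_space) eq_law_step:
  fixes F G :: "'a => real" and W1 W2 :: "'a => ennreal"
  assumes [measurable]: "F \<in> borel_measurable M" "G \<in> borel_measurable M" "W1 \<in> borel_measurable M" "W2 \<in> borel_measurable M"
    and W: "\<And>u. W1 u \<le> 1" "\<And>u. W2 u \<le> 1"
    and eq: "\<And>h. continuous_on UNIV h ==> (\<And>x. 0 \<le> h x \<and> h x \<le> (1::real)) ==>
       (\<integral>\<^sup>+u. W1 u * ennreal (h (F u)) \<partial>M) = (\<integral>\<^sup>+u. W2 u * ennreal (h (G u)) \<partial>M)"
    and A: "A \<in> sets borel"
  shows "(\<integral>\<^sup>+u. W1 u * indicator A (F u) \<partial>M) = (\<integral>\<^sup>+u. W2 u * indicator A (G u) \<partial>M)"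
proof -
  define P where "P W Z = distr (density M W) borel Z" for W and Z :: "'a => real"
  have em: "emeasure (P W Z) B = (\<integral>\<^sup>+u. W u * indicator B (Z u) \<partial>M)"
    if [measurable]: "W \<in> borel_measurable M" "Z \<in> borel_measurable M" "B \<in> sets borel" for W Z B
  proof -
    have "emeasure (P W Z) B = emeasure (density M W) (Z -` B \<inter> space M)"
      unfolding P_def by (subst emeasure_distr) auto
    also have "\<dots> = (\<integral>\<^sup>+u. W u * indicator (Z -` B \<inter> space M) u \<partial>M)"
      by (subst emeasure_density) auto
    also have "\<dots> = (\<integral>\<^sup>+u. W u * indicator B (Z u) \<partial>M)"
      by (intro nn_integral_cong) (auto simp: indicator_def)
    finally show ?thesis .
  qed
  have lim: "(\<lambda>p. \<integral>\<^sup>+u. W u * ennreal (min 1 (max 0 (real p * (Z u - x)))) \<partial>M) \<longlonglongrightarrow> (\<integral>\<^sup>+u. W u * indicator {x<..} (Z u) \<partial>M)"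
    if [measurable]: "W \<in> borel_measurable M" "Z \<in> borel_measurable M" and W1: "\<And>u. W u \<le> 1" for W Z x
  proof (rule nn_integral_dominated_convergence[where w = "\<lambda>_. 1"])
    show "AE u in M. W u * ennreal (min 1 (max 0 (real p * (Z u - x)))) \<le> 1" for p
    proof (rule AE_I2)
      fix u
      have "ennreal (min 1 (max 0 (real p * (Z u - x)))) \<le> 1" by (simp add: ennreal_le_1)
      then show "W u * ennreal (min 1 (max 0 (real p * (Z u - x)))) \<le> 1"
        using mult_mono[OF W1[of u]] by fastforce
    qed
    show "AE u in M. (\<lambda>p. W u * ennreal (min 1 (max 0 (real p * (Z u - x))))) \<longlonglongrightarrow> W u * indicator {x<..} (Z u)"
    proof (rule AE_I2)
      fix u
      have "(\<lambda>p. ennreal (min 1 (max 0 (real p * (Z u - x))))) \<longlonglongrightarrow> ennreal (indicator {x<..} (Z u))"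
        by (intro tendsto_ennrealI ramp_tendsto)
      moreover have "W u \<noteq> \<top>" using W1[of u] by (auto simp: top_unique)
      ultimately show "(\<lambda>p. W u * ennreal (min 1 (max 0 (real p * (Z u - x))))) \<longlonglongrightarrow> W u * indicator {x<..} (Z u)"
        by (auto simp: ennreal_indicator intro!: ennreal_tendsto_cmult simp: less_top)
    qed
  qed (auto simp: emeasure_space_1)
  have "P W1 F = P W2 G"
  proof (rule measure_eqI_lessThan)
    show "sets (P W1 F) = sets borel" "sets (P W2 G) = sets borel" by (simp_all add: P_def)
    fix x
    have "emeasure (P W1 F) {x<..} = (\<integral>\<^sup>+u. W1 u * indicator {x<..} (F u) \<partial>M)" by (simp add: em)
    also have "\<dots> \<le> (\<integral>\<^sup>+u. 1 \<partial>M)"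
      by (intro nn_integral_mono order_trans[OF mult_mono[OF W(1)]]) (auto simp: indicator_def)
    also have "\<dots> < \<infinity>" by (simp add: emeasure_space_1)
    finally show "emeasure (P W1 F) {x<..} < \<infinity>" .
    have "(\<integral>\<^sup>+u. W1 u * indicator {x<..} (F u) \<partial>M) = (\<integral>\<^sup>+u. W2 u * indicator {x<..} (G u) \<partial>M)"
    proof (rule LIMSEQ_unique[OF lim])
      have "(\<lambda>p. \<integral>\<^sup>+u. W1 u * ennreal (min 1 (max 0 (real p * (F u - x)))) \<partial>M) =
         (\<lambda>p. \<integral>\<^sup>+u. W2 u * ennreal (min 1 (max 0 (real p * (G u - x)))) \<partial>M)"
        by (intro ext eq[of "\<lambda>y. min 1 (max 0 (real _ * (y - x)))"]) (auto intro!: continuous_intros)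
      then show "(\<lambda>p. \<integral>\<^sup>+u. W1 u * ennreal (min 1 (max 0 (real p * (F u - x)))) \<partial>M) \<longlonglongrightarrow> (\<integral>\<^sup>+u. W2 u * indicator {x<..} (G u) \<partial>M)"
        using lim[of W2 G x] W by simp
    qed (use W in auto)
    then show "emeasure (P W1 F) {x<..} = emeasure (P W2 G) {x<..}" by (simp add: em)
  qed
  then have "emeasure (P W1 F) A = emeasure (P W2 G) A" by simp
  then show ?thesis using A by (simp add: em)
qed

text \<open>Tests become indicators one coordinate at a time; \<open>D\<close> collects the
  coordinates already done. The induction runs over all \<open>h\<close>, because each step needs an
  arbitrary test in the new coordinate.\<close>

lemma (in prob_space) eq_law_tests:
  fixes F G :: "'c => 'a => real"
  assumes F: "\<And>c. c \<in> J ==> F c \<in> borel_measurable M" and G: "\<And>c. c \<in> J ==> G c \<in> borel_measurable M" and J: "finite J"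
    and eq: "\<And>h. tests h ==> (\<integral>\<^sup>+u. (\<Prod>c\<in>J. ennreal (h c (F c u))) \<partial>M) = (\<integral>\<^sup>+u. (\<Prod>c\<in>J. ennreal (h c (G c u))) \<partial>M)"
    and A: "\<And>c. c \<in> J ==> A c \<in> sets borel"
  shows "emeasure M {u\<in>space M. \<forall>c\<in>J. F c u \<in> A c} = emeasure M {u\<in>space M. \<forall>c\<in>J. G c u \<in> A c}"
proof -
  have main: "(\<integral>\<^sup>+u. (\<Prod>c\<in>D. indicator (A c) (F c u)) * (\<Prod>c\<in>J - D. ennreal (h c (F c u))) \<partial>M) =
     (\<integral>\<^sup>+u. (\<Prod>c\<in>D. indicator (A c) (G c u)) * (\<Prod>c\<in>J - D. ennreal (h c (G c u))) \<partial>M)"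
    if D: "finite D" "D \<subseteq> J" "tests h" for D h
    using D
  proof (induction D arbitrary: h rule: finite_induct)
    case empty
    then show ?case using eq by simp
  next
    case (insert d D)
    define W where "W Z u = (\<Prod>c\<in>D. indicator (A c) (Z c u)) * (\<Prod>c\<in>J - insert d D. ennreal (h c (Z c u)))" for Z :: "'c => 'a => real" and u
    have Wm: "W Z \<in> borel_measurable M" if Z: "\<And>c. c \<in> J ==> Z c \<in> borel_measurable M" for Z
    proof -
      have "(\<lambda>u. indicator (A c) (Z c u) :: ennreal) \<in> borel_measurable M" if "c \<in> D" for c
        using A[of c] Z[of c] insert.prems that by (intro borel_measurable_indicator') (auto intro: measurable_sets)
      moreover have "(\<lambda>u. ennreal (h c (Z c u))) \<in> borel_measurable M" if "c \<in> J" for c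
        using measurable_compose[OF Z[OF that] tests_measurable[OF insert.prems(2)]] by simp
      ultimately show ?thesis unfolding W_def[abs_def]
        by (intro borel_measurable_times_ennreal borel_measurable_prod_ennreal) auto
    qed
    have W1: "W Z u \<le> 1" for Z u
    proof -
      have "(\<Prod>c\<in>D. indicator (A c) (Z c u) :: ennreal) \<le> 1" by (intro prod_ennreal_le_1) (auto simp: indicator_def)
      moreover have "(\<Prod>c\<in>J - insert d D. ennreal (h c (Z c u))) \<le> 1"
        using insert.prems by (intro prod_ennreal_le_1) (auto simp: tests_def)
      ultimately show ?thesis unfolding W_def using mult_mono by fastforce
    qed
    have dJ: "d \<in> J" using insert by auto
    have "(\<integral>\<^sup>+u. W F u * indicator (A d) (F d u) \<partial>M) = (\<integral>\<^sup>+u. W G u * indicator (A d) (G d u) \<partial>M)"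
    proof (rule eq_law_step)
      fix h0 :: "real => real" assume h0: "continuous_on UNIV h0" "\<And>x. 0 \<le> h0 x \<and> h0 x \<le> 1"
      define h' where "h' = h(d := h0)"
      have t: "tests h'" using insert.prems h0 by (auto simp: tests_def h'_def)
      have e: "J - D = insert d (J - insert d D)" using insert dJ by auto
      have "W Z u * ennreal (h0 (Z d u)) = (\<Prod>c\<in>D. indicator (A c) (Z c u)) * (\<Prod>c\<in>J - D. ennreal (h' c (Z c u)))" for Z u
      proof -
        have "(\<Prod>c\<in>J - D. ennreal (h' c (Z c u))) = ennreal (h0 (Z d u)) * (\<Prod>c\<in>J - insert d D. ennreal (h' c (Z c u)))"
          unfolding e using J by (subst prod.insert) (auto simp: h'_def)
        also have "(\<Prod>c\<in>J - insert d D. ennreal (h' c (Z c u))) = (\<Prod>c\<in>J - insert d D. ennreal (h c (Z c u)))"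
          by (intro prod.cong) (auto simp: h'_def)
        finally show ?thesis by (simp add: W_def ac_simps)
      qed
      then show "(\<integral>\<^sup>+u. W F u * ennreal (h0 (F d u)) \<partial>M) = (\<integral>\<^sup>+u. W G u * ennreal (h0 (G d u)) \<partial>M)"
        using insert.IH[OF _ t] insert.prems by simp
    qed (use F G A dJ Wm W1 in auto)
    moreover have "W Z u * indicator (A d) (Z d u) =
      (\<Prod>c\<in>insert d D. indicator (A c) (Z c u)) * (\<Prod>c\<in>J - insert d D. ennreal (h c (Z c u)))" for Z u
      unfolding W_def by (subst prod.insert[OF insert.hyps]) (simp only: ac_simps)
    ultimately show ?case by simp
  qed
  have "tests (\<lambda>_ _. 1)" by (simp add: tests_def)
  then have e: "(\<integral>\<^sup>+u. (\<Prod>c\<in>J. indicator (A c) (F c u)) \<partial>M) = (\<integral>\<^sup>+u. (\<Prod>c\<in>J. indicator (A c) (G c u)) \<partial>M)"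
    using main[OF J order_refl] by simp
  have i: "(\<integral>\<^sup>+u. (\<Prod>c\<in>J. indicator (A c) (Z c u)) \<partial>M) = emeasure M {u\<in>space M. \<forall>c\<in>J. Z c u \<in> A c}"
    if Z: "\<And>c. c \<in> J ==> Z c \<in> borel_measurable M" for Z :: "'c => 'a => real"
  proof -
    have s: "{u\<in>space M. \<forall>c\<in>J. Z c u \<in> A c} \<in> sets M"
    proof -
      have "{u\<in>space M. Z c u \<in> A c} \<in> sets M" if "c \<in> J" for c
        using measurable_sets[OF Z[OF that] A[OF that]] by (simp add: vimage_def Int_def conj_commute)
      then show ?thesis using J by (intro sets.sets_Collect_finite_All) auto
    qed
    have "(\<integral>\<^sup>+u. (\<Prod>c\<in>J. indicator (A c) (Z c u)) \<partial>M) = (\<integral>\<^sup>+u. indicator {u\<in>space M. \<forall>c\<in>J. Z c u \<in> A c} u \<partial>M)"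
    proof (intro nn_integral_cong)
      fix u assume u: "u \<in> space M"
      show "(\<Prod>c\<in>J. indicator (A c) (Z c u)) = (indicator {u\<in>space M. \<forall>c\<in>J. Z c u \<in> A c} u :: ennreal)"
      proof (cases "\<forall>c\<in>J. Z c u \<in> A c")
        case False
        then obtain c where "c \<in> J" "Z c u \<notin> A c" by blast
        then show ?thesis using False J by (auto simp: indicator_def prod_zero_iff)
      qed (use u in auto)
    qed
    then show ?thesis using s by simp
  qed
  show ?thesis using e i[OF F] i[OF G] by simp
qed

lemma (in prob_space) emeasure_eventually_le:
  assumes B: "\<And>n. B n \<in> sets M" and le: "\<And>n. emeasure M (B n) \<le> C"
  shows "emeasure M {u\<in>space M. eventually (\<lambda>n. u \<in> B n) sequentially} \<le> C"
proof -
  let ?I = "\<lambda>N. {u\<in>space M. \<forall>n\<ge>N. u \<in> B n}"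
  have I: "?I N \<in> sets M" for N using B by measurable
  have "{u\<in>space M. eventually (\<lambda>n. u \<in> B n) sequentially} = (\<Union>N. ?I N)"
    by (auto simp: eventually_sequentially)
  moreover have "emeasure M (\<Union>N. ?I N) = (SUP N. emeasure M (?I N))"
  proof (rule SUP_emeasure_incseq[symmetric])
    show "range ?I \<subseteq> sets M" using I by blast
    show "incseq ?I" unfolding incseq_def by (blast intro: order_trans)
  qed
  moreover have "emeasure M (?I N) \<le> C" for N
    by (rule order_trans[OF emeasure_mono le[of N]]) (use B in auto)
  ultimately show ?thesis by (simp add: SUP_le_iff)
qed

text \<open>For fixed \<open>m\<close>, the event that \<open>B m n\<close> occurs for all large
  \<open>n\<close> has probability at most \<open>C m\<close>, by continuity from below. The
  intersection over \<open>m\<close> is null.\<close>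

lemma (in prob_space) AE_frequently_not:
  assumes B: "\<And>m n. B m n \<in> sets M" and le: "\<And>m n. emeasure M (B m n) \<le> ennreal (C m)" and C: "C \<longlonglongrightarrow> 0"
  shows "AE u in M. \<exists>m. frequently (\<lambda>n. u \<notin> B m n) sequentially"
proof -
  let ?E = "\<lambda>m. {u\<in>space M. eventually (\<lambda>n. u \<in> B m n) sequentially}"
  have E: "?E m \<in> sets M" for m unfolding eventually_sequentially using B by measurable
  have all: "(\<Inter>m. ?E m) \<in> sets M" using E by auto
  have "emeasure M (\<Inter>m. ?E m) \<le> ennreal (C m)" for m
    by (rule order_trans[OF emeasure_mono emeasure_eventually_le[OF B le]]) (use E in auto)
  moreover have "(\<lambda>m. ennreal (C m)) \<longlonglongrightarrow> ennreal 0" by (intro tendsto_ennrealI C)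
  ultimately have "emeasure M (\<Inter>m. ?E m) \<le> ennreal 0" by (intro LIMSEQ_le_const) auto
  then have "emeasure M (\<Inter>m. ?E m) = 0" by simp
  then have "AE u in M. u \<notin> (\<Inter>m. ?E m)" using all by (intro AE_not_in) (simp add: null_setsI)
  then show ?thesis
    using AE_space by eventually_elim (auto simp: frequently_def)
qed

lemma (in prob_space) AE_eventually_not_trivial:
  assumes B: "\<And>n. B n \<in> sets M" and lim: "(\<lambda>n. measure M (B n)) \<longlonglongrightarrow> 0"
  shows "AE u in M. \<not> eventually (\<lambda>n. u \<in> B n) sequentially"
proof -
  let ?E = "{u\<in>space M. eventually (\<lambda>n. u \<in> B n) sequentially}"
  have E: "?E \<in> sets M" unfolding eventually_sequentially using B by measurable
  have "emeasure M ?E \<le> ennreal e" if e: "0 < e" for e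
  proof -
    obtain N where N: "\<And>n. N \<le> n ==> measure M (B n) < e"
      using order_tendstoD(2)[OF lim e] unfolding eventually_sequentially by blast
    have "emeasure M (B (n + N)) \<le> ennreal e" for n
      unfolding emeasure_eq_measure using N[of "n + N"] by (intro ennreal_leI) simp
    then have "emeasure M {u\<in>space M. eventually (\<lambda>n. u \<in> B (n + N)) sequentially} \<le> ennreal e"
      by (intro emeasure_eventually_le B)
    moreover have "eventually (\<lambda>n. u \<in> B (n + N)) sequentially = eventually (\<lambda>n. u \<in> B n) sequentially" for u
      by (rule eventually_sequentially_seg)
    ultimately show ?thesis by simp
  qed
  then have "measure M ?E \<le> e" if "0 < e" for e
    using that by (simp add: emeasure_eq_measure)
  then have "\<not> 0 < measure M ?E" using dense[of 0 "measure M ?E"] by (meson not_le)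
  then have "measure M ?E = 0" using measure_nonneg[of M ?E] by linarith
  then have "emeasure M ?E = 0" unfolding emeasure_eq_measure by simp
  then have "AE u in M. u \<notin> ?E" using E by (intro AE_not_in) (simp add: null_setsI)
  then show ?thesis using AE_space by eventually_elim auto
qed

text \<open>Fubini: with \<open>Y\<close> frozen, the section of \<open>E\<close> contains at most
  one value of the independent variable \<open>D\<close>, and that value has mass zero.\<close>

lemma (in prob_space) AE_diffuse_section:
  fixes D :: "'a => real"
  assumes [measurable]: "D \<in> borel_measurable M" "Y \<in> measurable M N" and E: "E \<in> sets (borel \<Otimes>\<^sub>M N)"
    and ind: "distr M (borel \<Otimes>\<^sub>M N) (\<lambda>u. (D u, Y u)) = distr M borel D \<Otimes>\<^sub>M distr M N Y"
    and diff: "\<And>x. measure M {u\<in>space M. D u = x} = 0"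
    and sec: "\<And>d d' y. (d, y) \<in> E ==> (d', y) \<in> E ==> d = d'"
  shows "AE u in M. (D u, Y u) \<notin> E"
proof -
  let ?D = "distr M borel D" and ?Y = "distr M N Y"
  interpret D: prob_space ?D by (rule prob_space_distr) simp
  interpret Y: prob_space ?Y by (rule prob_space_distr) simp
  interpret P: pair_sigma_finite ?D ?Y ..
  have E' : "E \<in> sets (?D \<Otimes>\<^sub>M ?Y)" using E by simp
  have pt: "emeasure ?D {x} = 0" for x
  proof -
    have "D -` {x} \<inter> space M = {u\<in>space M. D u = x}" by auto
    then show ?thesis using diff[of x] by (subst emeasure_distr) (auto simp: emeasure_eq_measure)
  qed
  have "emeasure (?D \<Otimes>\<^sub>M ?Y) E = (\<integral>\<^sup>+y. emeasure ?D ((\<lambda>x. (x, y)) -` E) \<partial>?Y)"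
    by (rule P.emeasure_pair_measure_alt2[OF E'])
  also have "\<dots> = (\<integral>\<^sup>+y. 0 \<partial>?Y)"
  proof (intro nn_integral_cong)
    fix y
    show "emeasure ?D ((\<lambda>x. (x, y)) -` E) = 0"
    proof (cases "(\<lambda>x. (x, y)) -` E = {}")
      case False
      then obtain d where "(d, y) \<in> E" by auto
      then have "(\<lambda>x. (x, y)) -` E \<subseteq> {d}" using sec by auto
      then have "emeasure ?D ((\<lambda>x. (x, y)) -` E) \<le> emeasure ?D {d}" by (intro emeasure_mono) auto
      then show ?thesis using pt by simp
    qed simp
  qed
  finally have z: "emeasure (distr M (borel \<Otimes>\<^sub>M N) (\<lambda>u. (D u, Y u))) E = 0" unfolding ind by simp
  have "emeasure M ((\<lambda>u. (D u, Y u)) -` E \<inter> space M) = 0"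
    using z E by (subst (asm) emeasure_distr) auto
  then have "(\<lambda>u. (D u, Y u)) -` E \<inter> space M \<in> null_sets M"
    using E by (intro null_setsI measurable_sets[of _ M "borel \<Otimes>\<^sub>M N"]) auto
  then have "AE u in M. u \<notin> (\<lambda>u. (D u, Y u)) -` E \<inter> space M" by (rule AE_not_in)
  then show ?thesis using AE_space by eventually_elim auto
qed

text \<open>Both lines lie below the same data and touch it on both sides of the gap, all up to
  \<delta>. Their difference is at most 2 \<delta> at the contacts of one and at least -2 \<delta>
  at those of the other; comparing across the gap bounds the slope in either direction.\<close>

lemma near_support_lines:
  fixes y :: "real => real"
  assumes gap: "p < p'" and \<delta>: "0 \<le> \<delta>"
    and r: "r1 \<le> p" "r1' \<le> p" "p' \<le> r2" "p' \<le> r2'"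
    and t1: "y r1 \<le> \<alpha> * r1 + \<gamma> + \<delta>" "\<alpha>' * r1 + \<gamma>' - \<delta> \<le> y r1"
    and t2: "y r2 \<le> \<alpha> * r2 + \<gamma> + \<delta>" "\<alpha>' * r2 + \<gamma>' - \<delta> \<le> y r2"
    and t1': "y r1' \<le> \<alpha>' * r1' + \<gamma>' + \<delta>" "\<alpha> * r1' + \<gamma> - \<delta> \<le> y r1'"
    and t2': "y r2' \<le> \<alpha>' * r2' + \<gamma>' + \<delta>" "\<alpha> * r2' + \<gamma> - \<delta> \<le> y r2'"
  shows "\<bar>\<alpha>' - \<alpha>\<bar> * (p' - p) \<le> 4 * \<delta>"
proof -
  define s where "s = \<alpha>' - \<alpha>"
  define A where "A x = s * x + (\<gamma>' - \<gamma>)" for x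
  have A: "A r1 \<le> 2 * \<delta>" "A r2 \<le> 2 * \<delta>" "- 2 * \<delta> \<le> A r1'" "- 2 * \<delta> \<le> A r2'"
    using t1 t2 t1' t2' by (simp_all add: A_def s_def algebra_simps)
  show ?thesis
  proof (cases "0 \<le> s")
    case True
    have "s * (p' - p) \<le> s * (r2 - r1')" using True r by (intro mult_left_mono) auto
    also have "\<dots> = A r2 - A r1'" by (simp add: A_def algebra_simps)
    finally show ?thesis using A True by (simp add: s_def)
  next
    case False
    have "- s * (p' - p) \<le> - s * (r2' - r1)" using False r by (intro mult_left_mono) auto
    also have "\<dots> = A r1 - A r2'" by (simp add: A_def algebra_simps)
    finally show ?thesis using A False by (simp add: s_def)
  qed
qed

section \<open>Almost sure properties of the paths\<close>

lemma (in prob_space) indep_pair_distr: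
  assumes [measurable]: "Z \<in> measurable M N1" "W \<in> measurable M N2"
    and eq: "\<And>A B. A \<in> sets N1 ==> B \<in> sets N2 ==> measure M {\<omega>\<in>space M. Z \<omega> \<in> A \<and> W \<omega> \<in> B} =
      measure M {\<omega>\<in>space M. Z \<omega> \<in> A} * measure M {\<omega>\<in>space M. W \<omega> \<in> B}"
  shows "distr M (N1 \<Otimes>\<^sub>M N2) (\<lambda>\<omega>. (Z \<omega>, W \<omega>)) = distr M N1 Z \<Otimes>\<^sub>M distr M N2 W"
proof (rule pair_measure_eqI[symmetric])
  show "sigma_finite_measure (distr M N1 Z)" "sigma_finite_measure (distr M N2 W)"
    by (auto intro!: prob_space_imp_sigma_finite prob_space_distr)
  show "sets (distr M N1 Z \<Otimes>\<^sub>M distr M N2 W) = sets (distr M (N1 \<Otimes>\<^sub>M N2) (\<lambda>\<omega>. (Z \<omega>, W \<omega>)))"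
    by (simp cong: sets_pair_measure_cong)
  fix A B assume "A \<in> sets (distr M N1 Z)" "B \<in> sets (distr M N2 W)"
  then have [measurable]: "A \<in> sets N1" "B \<in> sets N2" by auto
  have s: "Z -` A \<inter> space M = {\<omega>\<in>space M. Z \<omega> \<in> A}" "W -` B \<inter> space M = {\<omega>\<in>space M. W \<omega> \<in> B}"
    "(\<lambda>\<omega>. (Z \<omega>, W \<omega>)) -` (A \<times> B) \<inter> space M = {\<omega>\<in>space M. Z \<omega> \<in> A \<and> W \<omega> \<in> B}" by auto
  have "emeasure (distr M N1 Z) A * emeasure (distr M N2 W) B =
     ennreal (measure M {\<omega>\<in>space M. Z \<omega> \<in> A}) * ennreal (measure M {\<omega>\<in>space M. W \<omega> \<in> B})"
    by (simp add: emeasure_distr s emeasure_eq_measure)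
  also have "\<dots> = ennreal (measure M {\<omega>\<in>space M. Z \<omega> \<in> A \<and> W \<omega> \<in> B})"
    by (subst eq) (auto simp: ennreal_mult)
  also have "\<dots> = emeasure (distr M (N1 \<Otimes>\<^sub>M N2) (\<lambda>\<omega>. (Z \<omega>, W \<omega>))) (A \<times> B)"
    by (subst emeasure_distr) (auto simp: s emeasure_eq_measure)
  finally show "emeasure (distr M N1 Z) A * emeasure (distr M N2 W) B = emeasure (distr M (N1 \<Otimes>\<^sub>M N2) (\<lambda>\<omega>. (Z \<omega>, W \<omega>))) (A \<times> B)" .
qed

text \<open>As \<open>AE_diffuse_section\<close>, with a further independent variable
  \<open>W\<close> frozen first; it will be the sequence of stick fractions.\<close>

lemma (in prob_space) AE_diffuse_section2:
  fixes D :: "'a => real"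
  assumes [measurable]: "D \<in> borel_measurable M" "Y \<in> measurable M N" "W \<in> measurable M N2"
    and E: "E \<in> sets ((borel \<Otimes>\<^sub>M N) \<Otimes>\<^sub>M N2)"
    and ind: "distr M (borel \<Otimes>\<^sub>M N) (\<lambda>\<omega>. (D \<omega>, Y \<omega>)) = distr M borel D \<Otimes>\<^sub>M distr M N Y"
    and ind2: "distr M ((borel \<Otimes>\<^sub>M N) \<Otimes>\<^sub>M N2) (\<lambda>\<omega>. ((D \<omega>, Y \<omega>), W \<omega>)) = distr M (borel \<Otimes>\<^sub>M N) (\<lambda>\<omega>. (D \<omega>, Y \<omega>)) \<Otimes>\<^sub>M distr M N2 W"
    and diff: "\<And>x. measure M {\<omega>\<in>space M. D \<omega> = x} = 0"
    and sec: "\<And>d d' y w. ((d, y), w) \<in> E ==> ((d', y), w) \<in> E ==> d = d'"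
  shows "AE \<omega> in M. ((D \<omega>, Y \<omega>), W \<omega>) \<notin> E"
proof -
  let ?DY = "distr M (borel \<Otimes>\<^sub>M N) (\<lambda>\<omega>. (D \<omega>, Y \<omega>))" and ?W = "distr M N2 W"
  interpret DY: prob_space ?DY by (rule prob_space_distr) simp
  interpret W: prob_space ?W by (rule prob_space_distr) simp
  interpret P: pair_sigma_finite ?DY ?W ..
  have E': "E \<in> sets (?DY \<Otimes>\<^sub>M ?W)" using E by (simp cong: sets_pair_measure_cong)
  have z: "emeasure ?DY ((\<lambda>x. (x, w)) -` E) = 0" for w
  proof -
    have S: "(\<lambda>x. (x, w)) -` E \<in> sets (borel \<Otimes>\<^sub>M N)" using sets_Pair2[OF E] .
    have "AE \<omega> in M. (D \<omega>, Y \<omega>) \<notin> (\<lambda>x. (x, w)) -` E"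
      by (rule AE_diffuse_section[OF _ _ S ind diff]) (auto dest: sec)
    then have "emeasure M {\<omega>\<in>space M. (D \<omega>, Y \<omega>) \<in> (\<lambda>x. (x, w)) -` E} = 0"
    proof -
      have "{\<omega>\<in>space M. (D \<omega>, Y \<omega>) \<in> (\<lambda>x. (x, w)) -` E} \<in> sets M" using S by measurable
      then show ?thesis using \<open>AE \<omega> in M. (D \<omega>, Y \<omega>) \<notin> (\<lambda>x. (x, w)) -` E\<close>
        by (subst (asm) AE_iff_measurable[OF _ refl]) simp_all
    qed
    moreover have "(\<lambda>\<omega>. (D \<omega>, Y \<omega>)) -` ((\<lambda>x. (x, w)) -` E) \<inter> space M = {\<omega>\<in>space M. (D \<omega>, Y \<omega>) \<in> (\<lambda>x. (x, w)) -` E}"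
      by auto
    ultimately show ?thesis using S by (subst emeasure_distr) auto
  qed
  have "emeasure (?DY \<Otimes>\<^sub>M ?W) E = (\<integral>\<^sup>+w. emeasure ?DY ((\<lambda>x. (x, w)) -` E) \<partial>?W)"
    by (rule P.emeasure_pair_measure_alt2[OF E'])
  also have "\<dots> = 0" by (simp add: z)
  finally have "emeasure (distr M ((borel \<Otimes>\<^sub>M N) \<Otimes>\<^sub>M N2) (\<lambda>\<omega>. ((D \<omega>, Y \<omega>), W \<omega>))) E = 0" unfolding ind2 .
  then have "emeasure M ((\<lambda>\<omega>. ((D \<omega>, Y \<omega>), W \<omega>)) -` E \<inter> space M) = 0"
    using E by (subst (asm) emeasure_distr) auto
  then have "(\<lambda>\<omega>. ((D \<omega>, Y \<omega>), W \<omega>)) -` E \<inter> space M \<in> null_sets M"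
    using E by (intro null_setsI measurable_sets[of _ M "(borel \<Otimes>\<^sub>M N) \<Otimes>\<^sub>M N2"]) auto
  then have "AE \<omega> in M. \<omega> \<notin> (\<lambda>\<omega>. ((D \<omega>, Y \<omega>), W \<omega>)) -` E \<inter> space M" by (rule AE_not_in)
  then show ?thesis using AE_space by eventually_elim auto
qed

text \<open>The path with its increment over the gap from \<open>q\<close> to \<open>q'\<close>
  removed. It is a function of the increments outside the gap and therefore independent of the
  increment over it.\<close>

definition ypath :: "real => real => (real => real) => real => real" where
  "ypath q q' f r = (if 0 \<le> r \<and> r \<le> q then f r else if q' \<le> r then f r - (f q' - f q) else 0)"

lemma ypath_measurable [measurable]:
  "ypath q q' \<in> measurable PiB PiB"
  unfolding ypath_def[abs_def] by (rule measurable_PiM_single') (auto simp: space_PiM)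

locale levy_setup = prob_space M for M :: "'a measure" +
  fixes X :: "real => 'a => real" and t :: real
  assumes levy: "levy_process M X" and CD: "hyp_CD M X" and tpos: "0 < t"
begin

abbreviation path :: "'a => real => real" where "path \<omega> \<equiv> (\<lambda>s. X s \<omega>)"

lemma X_measurable [measurable]: "X s \<in> borel_measurable M"
  using levy by (simp add: levy_process_def)

lemma path_measurable [measurable]: "path \<in> measurable M PiB"
  by (rule measurable_PiM_single') (auto simp: space_PiM)

lemma X_0: "\<omega> \<in> space M ==> X 0 \<omega> = 0"
  using levy by (simp add: levy_process_def)

lemma X_cadlag: "\<omega> \<in> space M ==> cadlag (path \<omega>)"
  using levy by (simp add: levy_process_def)

lemma X_indep:
  fixes ts :: "nat => real"
  shows "0 \<le> ts 0 ==> (\<And>i. i < n ==> ts i \<le> ts (Suc i)) ==>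
    indep_vars (\<lambda>_. borel) (\<lambda>i \<omega>. X (ts (Suc i)) \<omega> - X (ts i) \<omega>) {..<n}"
  using levy unfolding levy_process_def by blast

lemma X_stationary: "0 \<le> s ==> 0 \<le> h ==> distr M borel (\<lambda>\<omega>. X (s + h) \<omega> - X s \<omega>) = distr M borel (X h)"
  using levy unfolding levy_process_def by blast

lemma X_stoch_cont: "0 < e ==> ((\<lambda>h. measure M {\<omega>\<in>space M. \<bar>X h \<omega>\<bar> > e}) \<longlongrightarrow> 0) (at_right 0)"
  using levy unfolding levy_process_def by blast

lemma X_diffuse: "0 < s ==> measure M {\<omega>\<in>space M. X s \<omega> = x} = 0"
  using CD by (simp add: hyp_CD_def)

lemma incr_diffuse:
  assumes "0 \<le> q" "q < q'"
  shows "measure M {\<omega>\<in>space M. X q' \<omega> - X q \<omega> = x} = 0"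
proof -
  have d: "distr M borel (\<lambda>\<omega>. X q' \<omega> - X q \<omega>) = distr M borel (X (q' - q))"
    using X_stationary[of q "q' - q"] assms by simp
  have "measure M {\<omega>\<in>space M. X q' \<omega> - X q \<omega> = x} = measure (distr M borel (\<lambda>\<omega>. X q' \<omega> - X q \<omega>)) {x}"
    by (subst measure_distr) (auto intro!: arg_cong[where f = prob])
  also have "\<dots> = measure M {\<omega>\<in>space M. X (q' - q) \<omega> = x}"
    unfolding d by (subst measure_distr) (auto intro!: arg_cong[where f = prob])
  finally show ?thesis using X_diffuse[of "q' - q"] assms by simp
qed

lemma diffuse_law_X: "0 < s ==> diffuse_law (distr M borel (X s))"
proof -
  assume s: "0 < s"
  interpret P: prob_space "distr M borel (X s)" by (rule prob_space_distr) simp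
  have "emeasure (distr M borel (X s)) {x} = 0" for x
  proof -
    have "X s -` {x} \<inter> space M = {\<omega>\<in>space M. X s \<omega> = x}" by auto
    then show ?thesis using X_diffuse[OF s, of x] by (subst emeasure_distr) (auto simp: emeasure_eq_measure)
  qed
  then show ?thesis by unfold_locales auto
qed

lemma incr_measurable [measurable]: "(\<lambda>\<omega>. incr (path \<omega>) t n) \<in> measurable M PiB"
  unfolding incr_def[abs_def] samp_def by (rule measurable_PiM_single') (auto simp: space_PiM)

lemma incr_law:
  assumes n: "0 < n"
  shows "distr M PiB (\<lambda>\<omega>. incr (path \<omega>) t n) = PiM UNIV (\<lambda>_. distr M borel (X (t / real n)))"
proof -
  define Z where "Z i \<omega> = incr (path \<omega>) t n i" for i \<omega>
  have Zm: "Z i \<in> borel_measurable M" for i unfolding Z_def[abs_def] incr_def samp_def by simp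
  have ind: "indep_vars (\<lambda>_. borel) Z {..<m}" for m
    using X_indep[of "\<lambda>i. gp t n i" m] tpos
    by (simp add: Z_def[abs_def] incr_def samp_def divide_right_mono mult_right_mono del: of_nat_Suc)
  have "indep_vars (\<lambda>_. borel) Z UNIV"
    unfolding indep_vars_def2
  proof (intro conjI ballI Zm)
    show "indep_sets (\<lambda>i. {Z i -` A \<inter> space M |A. A \<in> sets borel}) UNIV"
      unfolding indep_sets_finite_index_sets[of _ UNIV]
    proof (intro allI impI)
      fix J :: "nat set" assume "finite J"
      then obtain m where "J \<subseteq> {..<m}" by (metis finite_nat_iff_bounded)
      then have "indep_vars (\<lambda>_. borel) Z J" using ind indep_vars_subset by blast
      then show "indep_sets (\<lambda>i. {Z i -` A \<inter> space M |A. A \<in> sets borel}) J" unfolding indep_vars_def2 by blast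
    qed
  qed
  then have "distr M PiB (\<lambda>\<omega>. \<lambda>i\<in>UNIV. Z i \<omega>) = PiM UNIV (\<lambda>i. distr M borel (Z i))"
    using indep_vars_iff_distr_eq_PiM[where I = UNIV and X = Z and M' = "\<lambda>_. borel"] Zm by simp
  moreover have "distr M borel (Z i) = distr M borel (X (t / real n))" for i
  proof -
    have "gp t n (Suc i) = gp t n i + t / real n" by (simp add: algebra_simps add_divide_distrib)
    then show ?thesis using X_stationary[of "gp t n i" "t / real n"] tpos
      by (simp add: Z_def[abs_def] incr_def samp_def del: of_nat_Suc)
  qed
  ultimately show ?thesis by (simp add: Z_def restrict_def)
qed

lemma indep_gap_finite:
  assumes q: "0 \<le> q" "q < q'" and J: "finite J"
    and B: "B \<in> sets borel" and C: "C \<in> sets (PiM J (\<lambda>_. borel))"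
  shows "prob {\<omega>\<in>space M. X q' \<omega> - X q \<omega> \<in> B \<and> (\<lambda>j\<in>J. ypath q q' (path \<omega>) j) \<in> C} =
    prob {\<omega>\<in>space M. X q' \<omega> - X q \<omega> \<in> B} * prob {\<omega>\<in>space M. (\<lambda>j\<in>J. ypath q q' (path \<omega>) j) \<in> C}"
proof -
  define S where "S = {0, q, q'} \<union> {j\<in>J. 0 \<le> j \<and> j \<le> q \<or> q' \<le> j}"
  define T where "T = sorted_list_of_set S"
  have S: "finite S" using J by (simp add: S_def)
  have T: "set T = S" "sorted T" "distinct T" using S by (simp_all add: T_def)
  have S0: "0 \<le> s" if "s \<in> S" for s using that q by (auto simp: S_def)
  have Sgap: "s \<le> q \<or> q' \<le> s" if "s \<in> S" for s using that q by (auto simp: S_def)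
  define m where "m = length T"
  \<comment> \<open>Constant from the last time on; the final one of the \<open>m\<close> increments
    is trivial.\<close>
  define ts where "ts i = T ! min i (m - 1)" for i
  have m0: "0 < m" using T by (auto simp: m_def S_def)
  have ts_in: "ts i \<in> S" for i unfolding ts_def using T(1) m0 by (metis m_def nth_mem min.strict_coboundedI2 diff_less zero_less_one)
  have ts_mono: "ts i \<le> ts (Suc i)" for i
    unfolding ts_def using m0 by (intro sorted_nth_mono T(2)) (auto simp: m_def[symmetric] min_def)
  have ts_eq: "ts i = T ! i" if "i < m" for i
  proof -
    have "i \<le> m - 1" using that by simp
    then show ?thesis by (simp add: ts_def min_absorb1)
  qed
  have idx: "\<exists>i<m. ts i = s" if "s \<in> S" for s
    using that T(1) by (metis in_set_conv_nth m_def ts_eq)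
  have t0: "ts 0 = 0"
  proof -
    obtain i where "i < m" "ts i = 0" using idx[of 0] by (auto simp: S_def)
    moreover have "ts 0 \<le> ts i" using \<open>i < m\<close> m0 T(2) by (simp add: ts_eq m_def sorted_nth_mono)
    ultimately show ?thesis using S0[OF ts_in[of 0]] by simp
  qed
  obtain b where b: "b < m" "ts b = q" using idx[of q] by (auto simp: S_def)
  obtain b' where b': "b' < m" "ts b' = q'" using idx[of q'] by (auto simp: S_def)
  have mono: "ts i \<le> ts j" if "i \<le> j" for i j using lift_Suc_mono_le[of ts, OF ts_mono that] .
  have strict: "ts i < ts j" if "i < j" "j < m" for i j
    using mono[of i j] that T(3) by (auto simp: ts_eq nth_eq_iff_index_eq m_def le_less)
  have bb: "b < b'" using mono[of b' b] b b' q by (meson not_le)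
  \<comment> \<open>Times inside the gap were left out of \<open>S\<close>, because
    \<open>ypath\<close> is 0 there.\<close>
  have Sb: "b' = Suc b"
  proof (rule ccontr)
    assume "b' \<noteq> Suc b"
    then have "Suc b < b'" using bb by simp
    then have "q < ts (Suc b)" "ts (Suc b) < q'" using strict[of b "Suc b"] strict[of "Suc b" b'] b b' by auto
    then show False using Sgap[OF ts_in[of "Suc b"]] by simp
  qed
  define \<Delta> where "\<Delta> i \<omega> = X (ts (Suc i)) \<omega> - X (ts i) \<omega>" for i \<omega>
  have ind: "indep_vars (\<lambda>_. borel) \<Delta> {..<m}"
    unfolding \<Delta>_def[abs_def] using X_indep[of ts m] ts_mono t0 by simp
  have tele: "X (ts a) \<omega> = (\<Sum>i<a. \<Delta> i \<omega>)" if "\<omega> \<in> space M" for a \<omega>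
    using X_0[OF that] sum_lessThan_telescope[of "\<lambda>i. X (ts i) \<omega>" a] by (simp add: \<Delta>_def t0)
  define pos where "pos j = (SOME i. i < m \<and> ts i = j)" for j
  have pos: "pos j < m" "ts (pos j) = j" if "j \<in> S" for j
    using someI_ex[OF idx[OF that, simplified]] by (auto simp: pos_def)
  have good: "(0 \<le> j \<and> j \<le> q) \<or> q' \<le> j \<longleftrightarrow> j \<in> S" if "j \<in> J" for j
    using that q by (auto simp: S_def)
  define R where "R = {..<m} - {b}"
  define \<Phi> where "\<Phi> \<delta> = (\<lambda>j\<in>J. if j \<in> S then \<Sum>i\<in>{..<pos j} - {b}. \<delta> i else 0)" for \<delta> :: "nat => real"
  have i1: "indep_var (PiM {b} (\<lambda>_. borel)) (\<lambda>\<omega>. restrict (\<lambda>i. \<Delta> i \<omega>) {b}) (PiM R (\<lambda>_. borel)) (\<lambda>\<omega>. restrict (\<lambda>i. \<Delta> i \<omega>) R)"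
    using b by (intro indep_var_restrict[OF ind]) (auto simp: R_def)
  have \<Phi>m: "\<Phi> \<in> measurable (PiM R (\<lambda>_. borel)) (PiM J (\<lambda>_. borel))"
  proof -
    have "(\<lambda>\<delta>. if j \<in> S then \<Sum>i\<in>{..<pos j} - {b}. \<delta> i else 0 :: real) \<in> borel_measurable (PiM R (\<lambda>_. borel))" for j
    proof (cases "j \<in> S")
      case True
      then have "{..<pos j} - {b} \<subseteq> R" using pos[OF True] by (auto simp: R_def)
      then show ?thesis using True by (auto intro!: borel_measurable_sum measurable_component_singleton)
    qed simp
    then show ?thesis unfolding \<Phi>_def[abs_def] by (intro measurable_restrict) auto
  qed
  have e2: "(\<Phi> \<circ> (\<lambda>\<omega>. restrict (\<lambda>i. \<Delta> i \<omega>) R)) \<omega> = (\<lambda>j\<in>J. ypath q q' (path \<omega>) j)" if \<omega>: "\<omega> \<in> space M" for \<omega>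
  proof -
    have "(if j \<in> S then \<Sum>i\<in>{..<pos j} - {b}. restrict (\<lambda>i. \<Delta> i \<omega>) R i else 0) = ypath q q' (path \<omega>) j" if j: "j \<in> J" for j
    proof (cases "j \<in> S")
      case True
      have "(\<Sum>i\<in>{..<pos j} - {b}. restrict (\<lambda>i. \<Delta> i \<omega>) R i) = (\<Sum>i\<in>{..<pos j} - {b}. \<Delta> i \<omega>)"
        using pos[OF True] by (intro sum.cong) (auto simp: R_def)
      also have "\<dots> = ypath q q' (path \<omega>) j"
      proof (cases "j \<le> q")
        case l: True
        then have "\<not> b < pos j" using strict[of b "pos j"] pos[OF True] b by auto
        then have "{..<pos j} - {b} = {..<pos j}" by auto
        then show ?thesis using tele[OF \<omega>, of "pos j"] pos[OF True] l S0[OF True] by (simp add: ypath_def)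
      next
        case g: False
        then have jq: "q' \<le> j" using Sgap[OF True] by auto
        have "\<not> pos j \<le> b" using mono[of "pos j" b] pos[OF True] b g by auto
        then have "b < pos j" by simp
        then have "(\<Sum>i<pos j. \<Delta> i \<omega>) = \<Delta> b \<omega> + (\<Sum>i\<in>{..<pos j} - {b}. \<Delta> i \<omega>)"
          by (intro sum.remove) auto
        then show ?thesis using tele[OF \<omega>, of "pos j"] pos[OF True] g jq b b' Sb by (simp add: ypath_def \<Delta>_def)
      qed
      finally show ?thesis using True by simp
    next
      case False
      then show ?thesis using good[OF j] by (auto simp: ypath_def)
    qed
    then show ?thesis by (auto simp: \<Phi>_def)
  qed
  let ?b = "\<lambda>\<omega>. restrict (\<lambda>i. \<Delta> i \<omega>) {b}" and ?R = "\<lambda>\<omega>. restrict (\<lambda>i. \<Delta> i \<omega>) R"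
  define XB where "XB = (\<lambda>\<delta>. \<delta> b) -` B \<inter> space (PiM {b} (\<lambda>_. borel :: real measure))"
  define XC where "XC = \<Phi> -` C \<inter> space (PiM R (\<lambda>_. borel))"
  have XB: "XB \<in> sets (PiM {b} (\<lambda>_. borel))"
  proof -
    have m: "(\<lambda>\<delta>. \<delta> b) \<in> measurable (PiM {b} (\<lambda>_. borel)) (borel :: real measure)"
      by (rule measurable_component_singleton) simp
    show ?thesis unfolding XB_def by (rule measurable_sets[OF m B])
  qed
  have XC: "XC \<in> sets (PiM R (\<lambda>_. borel))" unfolding XC_def by (rule measurable_sets[OF \<Phi>m C])
  have D: "\<Delta> b \<omega> = X q' \<omega> - X q \<omega>" for \<omega> using b b' Sb by (auto simp: \<Delta>_def)
  have s1: "?b -` XB \<inter> space M = {\<omega>\<in>space M. X q' \<omega> - X q \<omega> \<in> B}"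
    by (auto simp: XB_def space_PiM D)
  have e3: "?R \<omega> \<in> XC \<longleftrightarrow> (\<lambda>j\<in>J. ypath q q' (path \<omega>) j) \<in> C" if "\<omega> \<in> space M" for \<omega>
    using e2[OF that] by (auto simp: XC_def space_PiM)
  have s2: "?R -` XC \<inter> space M = {\<omega>\<in>space M. (\<lambda>j\<in>J. ypath q q' (path \<omega>) j) \<in> C}"
    using e3 by auto
  have s3: "(\<lambda>\<omega>. (?b \<omega>, ?R \<omega>)) -` (XB \<times> XC) \<inter> space M =
      {\<omega>\<in>space M. X q' \<omega> - X q \<omega> \<in> B \<and> (\<lambda>j\<in>J. ypath q q' (path \<omega>) j) \<in> C}"
    using s1 s2 by auto
  show ?thesis using indep_varD[OF i1 XB XC] unfolding s1 s2 s3 .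
qed

text \<open>For a fixed set of gap increments both sides are finite measures in the set of paths,
  and they agree on cylinder sets by \<open>indep_gap_finite\<close>.\<close>

lemma gap_law:
  assumes q: "0 \<le> q" "q < q'"
  shows "distr M (borel \<Otimes>\<^sub>M PiB) (\<lambda>\<omega>. (X q' \<omega> - X q \<omega>, ypath q q' (path \<omega>))) =
    distr M borel (\<lambda>\<omega>. X q' \<omega> - X q \<omega>) \<Otimes>\<^sub>M distr M PiB (\<lambda>\<omega>. ypath q q' (path \<omega>))"
proof (rule indep_pair_distr)
  fix B :: "real set" and A :: "(real => real) set"
  assume B [measurable]: "B \<in> sets borel" and A [measurable]: "A \<in> sets PiB"
  let ?S = "PiB :: (real => real) measure"
  define D where "D \<omega> = X q' \<omega> - X q \<omega>" for \<omega>
  define Y where "Y \<omega> = ypath q q' (path \<omega>)" for \<omega>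
  have [measurable]: "D \<in> borel_measurable M" "Y \<in> measurable M ?S"
    unfolding D_def[abs_def] Y_def[abs_def] by measurable
  define E where "E = {\<omega>\<in>space M. D \<omega> \<in> B}"
  have E [measurable]: "E \<in> sets M" unfolding E_def by measurable
  define m1 where "m1 = distr (density M (indicator E)) ?S Y"
  define m2 where "m2 = scale_measure (emeasure M E) (distr M ?S Y)"
  have e1: "emeasure m1 C = emeasure M {\<omega>\<in>space M. D \<omega> \<in> B \<and> Y \<omega> \<in> C}" if [measurable]: "C \<in> sets ?S" for C
  proof -
    have "emeasure m1 C = emeasure (density M (indicator E)) (Y -` C \<inter> space M)"
      unfolding m1_def by (subst emeasure_distr) auto
    also have "\<dots> = (\<integral>\<^sup>+\<omega>. indicator E \<omega> * indicator (Y -` C \<inter> space M) \<omega> \<partial>M)"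
      by (subst emeasure_density) auto
    also have "\<dots> = (\<integral>\<^sup>+\<omega>. indicator {\<omega>\<in>space M. D \<omega> \<in> B \<and> Y \<omega> \<in> C} \<omega> \<partial>M)"
      by (intro nn_integral_cong) (auto simp: indicator_def E_def)
    also have "\<dots> = emeasure M {\<omega>\<in>space M. D \<omega> \<in> B \<and> Y \<omega> \<in> C}" by (subst nn_integral_indicator) auto
    finally show ?thesis .
  qed
  have e2: "emeasure m2 C = emeasure M E * emeasure M {\<omega>\<in>space M. Y \<omega> \<in> C}" if [measurable]: "C \<in> sets ?S" for C
  proof -
    have "Y -` C \<inter> space M = {\<omega>\<in>space M. Y \<omega> \<in> C}" by auto
    then show ?thesis unfolding m2_def by (simp add: emeasure_distr)
  qed
  have "m1 = m2"
  proof (rule measure_eqI_PiM_infinite)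
    show "sets m1 = sets ?S" "sets m2 = sets ?S" by (simp_all add: m1_def m2_def)
    show "finite_measure m1"
    proof
      show "emeasure m1 (space m1) \<noteq> \<infinity>"
        using e1[OF sets.top] by (simp add: m1_def emeasure_eq_measure)
    qed
    fix A' :: "real => real set" and J :: "real set" assume J: "finite J" and A': "\<And>i. i \<in> J ==> A' i \<in> sets borel"
    let ?C = "prod_emb UNIV (\<lambda>_. borel) J (Pi\<^sub>E J A')"
    have C: "?C \<in> sets ?S" using J A' by (intro sets_PiM_I) auto
    have Cm: "Y \<omega> \<in> ?C \<longleftrightarrow> (\<lambda>j\<in>J. Y \<omega> j) \<in> Pi\<^sub>E J A'" for \<omega>
      by (auto simp: prod_emb_def)
    have PJ: "Pi\<^sub>E J A' \<in> sets (PiM J (\<lambda>_. borel))" using J A' by (intro sets_PiM_I_finite) auto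
    have "emeasure M {\<omega>\<in>space M. D \<omega> \<in> B \<and> Y \<omega> \<in> ?C} = emeasure M E * emeasure M {\<omega>\<in>space M. Y \<omega> \<in> ?C}"
      unfolding emeasure_eq_measure E_def Cm unfolding D_def Y_def
      by (subst indep_gap_finite[OF q J B PJ]) (rule ennreal_mult[OF measure_nonneg measure_nonneg])
    then show "emeasure m1 ?C = emeasure m2 ?C" using e1[OF C] e2[OF C] by simp
  qed
  then have "emeasure M {\<omega>\<in>space M. D \<omega> \<in> B \<and> Y \<omega> \<in> A} = emeasure M E * emeasure M {\<omega>\<in>space M. Y \<omega> \<in> A}"
    using e1[OF A] e2[OF A] by simp
  then show "prob {\<omega> \<in> space M. X q' \<omega> - X q \<omega> \<in> B \<and> ypath q q' (path \<omega>) \<in> A} =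
      prob {\<omega> \<in> space M. X q' \<omega> - X q \<omega> \<in> B} * prob {\<omega> \<in> space M. ypath q q' (path \<omega>) \<in> A}"
    unfolding E_def D_def Y_def emeasure_eq_measure by (simp flip: ennreal_mult)
qed measurable

text \<open>There is no fixed time of discontinuity. A jump at \<open>s\<close> larger than
  \<open>1 / real (Suc m)\<close> forces the increments over [s - h, s] to exceed that size for all
  small \<open>h\<close>, while stochastic continuity makes this unlikely for each such
  \<open>h\<close>.\<close>

lemma AE_left_cont:
  assumes s: "0 < s"
  shows "AE \<omega> in M. lft (path \<omega>) s = X s \<omega>"
proof -
  have "AE \<omega> in M. \<bar>lft (path \<omega>) s - X s \<omega>\<bar> \<le> 1 / real (Suc m)" for m
  proof -
    let ?e = "1 / real (Suc m)"
    \<comment> \<open>Adding 2 instead of 1 keeps \<open>h n < s\<close> for \<open>n = 0\<close> as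
      well.\<close>
    define h where "h n = s / real (n + 2)" for n
    have h: "0 < h n" "h n < s" for n
    proof -
      have "s * 1 < s * real (n + 2)" using s by (intro mult_strict_left_mono) auto
      then show "0 < h n" "h n < s" using s by (simp_all add: h_def pos_divide_less_eq)
    qed
    have h0: "h \<longlonglongrightarrow> 0" unfolding h_def[abs_def]
      by (rule lim_t_over, rule filterlim_subseq) (simp add: strict_mono_def)
    have hr: "filterlim h (at_right 0) sequentially" using h h0 by (intro filterlim_at_withinI) auto
    define B where "B n = {\<omega>\<in>space M. \<bar>X s \<omega> - X (s - h n) \<omega>\<bar> > ?e}" for n
    have "measure M (B n) = measure M {\<omega>\<in>space M. \<bar>X (h n) \<omega>\<bar> > ?e}" for n
    proof -
      have d: "distr M borel (\<lambda>\<omega>. X s \<omega> - X (s - h n) \<omega>) = distr M borel (X (h n))"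
        using X_stationary[of "s - h n" "h n"] h[of n] by simp
      have "measure M (B n) = measure (distr M borel (\<lambda>\<omega>. X s \<omega> - X (s - h n) \<omega>)) {x. \<bar>x\<bar> > ?e}"
        unfolding B_def by (subst measure_distr) (auto intro!: arg_cong[where f = prob])
      also have "\<dots> = measure M {\<omega>\<in>space M. \<bar>X (h n) \<omega>\<bar> > ?e}"
        unfolding d by (subst measure_distr) (auto intro!: arg_cong[where f = prob])
      finally show ?thesis .
    qed
    moreover have "(\<lambda>n. measure M {\<omega>\<in>space M. \<bar>X (h n) \<omega>\<bar> > ?e}) \<longlonglongrightarrow> 0"
      by (rule filterlim_compose[OF X_stoch_cont hr]) simp
    ultimately have "AE \<omega> in M. \<not> eventually (\<lambda>n. \<omega> \<in> B n) sequentially"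
      by (intro AE_eventually_not_trivial) (auto simp: B_def)
    then show ?thesis using AE_space
    proof eventually_elim
      case (elim \<omega>)
      show ?case
      proof (rule ccontr)
        assume "\<not> \<bar>lft (path \<omega>) s - X s \<omega>\<bar> \<le> ?e"
        then have gt: "?e < \<bar>X s \<omega> - lft (path \<omega>) s\<bar>" by (simp add: abs_minus_commute)
        have "(\<lambda>n. s - h n) \<longlonglongrightarrow> s - 0" by (intro tendsto_intros h0)
        then have "(\<lambda>n. path \<omega> (s - h n)) \<longlonglongrightarrow> lft (path \<omega>) s"
          using h s by (intro cadlag_seq_left[OF X_cadlag[OF elim(2)] s]) auto
        then have "(\<lambda>n. \<bar>X s \<omega> - X (s - h n) \<omega>\<bar>) \<longlonglongrightarrow> \<bar>X s \<omega> - lft (path \<omega>) s\<bar>"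
          by (intro tendsto_intros)
        from order_tendstoD(1)[OF this gt] have "eventually (\<lambda>n. \<omega> \<in> B n) sequentially"
          by eventually_elim (use elim in \<open>auto simp: B_def\<close>)
        then show False using elim by blast
      qed
    qed
  qed
  then have "AE \<omega> in M. \<forall>m. \<bar>lft (path \<omega>) s - X s \<omega>\<bar> \<le> 1 / real (Suc m)" by (simp add: AE_all_countable)
  then show ?thesis
  proof eventually_elim
    case (elim \<omega>)
    show ?case
    proof (rule ccontr)
      assume "lft (path \<omega>) s \<noteq> X s \<omega>"
      then have "0 < \<bar>lft (path \<omega>) s - X s \<omega>\<bar>" by simp
      then obtain m where "1 / real (Suc m) < \<bar>lft (path \<omega>) s - X s \<omega>\<bar>" using nat_approx_posE by blast
      then show False using elim by (meson not_le)
    qed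
  qed
qed

end

section \<open>No line below the path with three contacts\<close>

lemma approx_right:
  assumes f: "cadlag f" and c: "0 \<le> c" and "0 < e" "0 < \<eta>"
  obtains r :: rat where "c < of_rat r" "of_rat r < c + \<eta>" "f (of_rat r) < f c + e"
proof -
  obtain \<eta>' where h: "0 < \<eta>'" "\<And>s. c \<le> s ==> s < c + \<eta>' ==> \<bar>f s - f c\<bar> < e"
    using cadlag_near[OF f c \<open>0 < e\<close>] by metis
  obtain r :: rat where "c < of_rat r" "of_rat r < c + min \<eta> \<eta>'"
    using of_rat_dense[of c "c + min \<eta> \<eta>'"] h assms by auto
  moreover from this have "of_rat r < c + \<eta>" "of_rat r < c + \<eta>'" by linarith+
  ultimately show ?thesis using that[of r] h(2)[of "of_rat r"] by auto
qed

lemma approx_left: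
  assumes f: "cadlag f" and c: "0 < c" and "0 < e" "0 < \<eta>"
  obtains r :: rat where "0 < real_of_rat r" "c - \<eta> < of_rat r" "of_rat r < c" "f (of_rat r) < lft f c + e"
proof -
  obtain \<eta>' where h: "0 < \<eta>'" "\<And>s. 0 \<le> s ==> c - \<eta>' < s ==> s < c ==> \<bar>f s - lft f c\<bar> < e"
    using cadlag_near[OF f less_imp_le[OF c] \<open>0 < e\<close>] by metis
  obtain r :: rat where "max 0 (c - min \<eta> \<eta>') < of_rat r" "of_rat r < c"
    using of_rat_dense[of "max 0 (c - min \<eta> \<eta>')" c] h assms by auto
  moreover from this have "0 < real_of_rat r" "c - \<eta> < of_rat r" "c - \<eta>' < of_rat r" by linarith+
  ultimately show ?thesis using that[of r] h(2)[of "of_rat r"] by auto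
qed

text \<open>Countably many test times. The end point \<open>t\<close> is included separately: it may
  be irrational, and a contact made by the value there cannot be approached from the right within
  [0, t].\<close>

fun tq :: "real => rat option => real" where
  "tq t None = t"
| "tq t (Some q) = of_rat q"

text \<open>The first component \<open>d\<close> is the removed increment, which is added back to
  the data right of the gap. For each \<open>k\<close> some rational line lies below the data and is
  touched in [0, p], [p', q] and [q', t], all up to \<open>1 / real (Suc k)\<close>. All quantifiers
  are countable, so the event is measurable; the line may change with \<open>k\<close>.\<close>

definition E3 :: "real => rat => rat => rat => rat => (real \<times> (real => real)) set" where
  "E3 t p p' q q' = {z \<in> space (borel \<Otimes>\<^sub>M PiB). \<forall>k::nat. \<exists>\<alpha>::rat. \<exists>\<gamma>::rat.
     (\<forall>i. 0 \<le> tq t i \<and> tq t i \<le> of_rat q --> of_rat \<alpha> * tq t i + of_rat \<gamma> - 1 / real (Suc k) \<le> snd z (tq t i)) \<and>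
     (\<forall>i. of_rat q' \<le> tq t i \<and> tq t i \<le> t --> of_rat \<alpha> * tq t i + of_rat \<gamma> - 1 / real (Suc k) \<le> snd z (tq t i) + fst z) \<and>
     (\<exists>i. 0 \<le> tq t i \<and> tq t i \<le> of_rat p \<and> snd z (tq t i) \<le> of_rat \<alpha> * tq t i + of_rat \<gamma> + 1 / real (Suc k)) \<and>
     (\<exists>i. of_rat p' \<le> tq t i \<and> tq t i \<le> of_rat q \<and> snd z (tq t i) \<le> of_rat \<alpha> * tq t i + of_rat \<gamma> + 1 / real (Suc k)) \<and>
     (\<exists>i. of_rat q' \<le> tq t i \<and> tq t i \<le> t \<and> snd z (tq t i) + fst z \<le> of_rat \<alpha> * tq t i + of_rat \<gamma> + 1 / real (Suc k))}"

lemma E3_sets: "E3 t p p' q q' \<in> sets (borel \<Otimes>\<^sub>M PiB)"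
  unfolding E3_def by measurable

lemma le_of_all_Suc:
  assumes "\<And>k::nat. x \<le> C * (1 / real (Suc k))"
  shows "x \<le> (0::real)"
proof -
  have "(\<lambda>k. C * (1 / real (Suc k))) \<longlonglongrightarrow> C * 0"
    by (intro tendsto_intros LIMSEQ_inverse_real_of_nat[unfolded inverse_eq_divide])
  then show ?thesis using assms by (intro LIMSEQ_le_const) auto
qed

text \<open>The two contacts left of the gap are separated by [p, p'] and fix the line up to a
  multiple of the tolerance, whatever \<open>d\<close> is. The contact right of the gap then fixes
  \<open>d\<close>.\<close>

lemma E3_section_le:
  assumes z: "(d, y) \<in> E3 t p p' q q'" "(d', y) \<in> E3 t p p' q q'" and o: "p < p'" "p' < q" "q < q'"
  shows "d \<le> d'"
proof -
  have gap: "real_of_rat p < of_rat p'" using o by (simp add: of_rat_less)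
  have "d - d' \<le> (4 * t / (of_rat p' - of_rat p) + 4) * (1 / real (Suc k))" for k
  proof -
    let ?\<delta> = "1 / real (Suc k)"
    obtain \<alpha> \<gamma> i1 i2 i3 where l: 
      "\<And>i. 0 \<le> tq t i \<and> tq t i \<le> of_rat q ==> of_rat \<alpha> * tq t i + of_rat \<gamma> - ?\<delta> \<le> y (tq t i)"
      "\<And>i. of_rat q' \<le> tq t i \<and> tq t i \<le> t ==> of_rat \<alpha> * tq t i + of_rat \<gamma> - ?\<delta> \<le> y (tq t i) + d"
      "0 \<le> tq t i1" "tq t i1 \<le> of_rat p" "y (tq t i1) \<le> of_rat \<alpha> * tq t i1 + of_rat \<gamma> + ?\<delta>"
      "of_rat p' \<le> tq t i2" "tq t i2 \<le> of_rat q" "y (tq t i2) \<le> of_rat \<alpha> * tq t i2 + of_rat \<gamma> + ?\<delta>"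
      "of_rat q' \<le> tq t i3" "tq t i3 \<le> t" "y (tq t i3) + d \<le> of_rat \<alpha> * tq t i3 + of_rat \<gamma> + ?\<delta>"
      using z(1) unfolding E3_def mem_Collect_eq fst_conv snd_conv by metis
    obtain \<alpha>' \<gamma>' i1' i2' i3' where l': 
      "\<And>i. 0 \<le> tq t i \<and> tq t i \<le> of_rat q ==> of_rat \<alpha>' * tq t i + of_rat \<gamma>' - ?\<delta> \<le> y (tq t i)"
      "\<And>i. of_rat q' \<le> tq t i \<and> tq t i \<le> t ==> of_rat \<alpha>' * tq t i + of_rat \<gamma>' - ?\<delta> \<le> y (tq t i) + d'"
      "0 \<le> tq t i1'" "tq t i1' \<le> of_rat p" "y (tq t i1') \<le> of_rat \<alpha>' * tq t i1' + of_rat \<gamma>' + ?\<delta>"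
      "of_rat p' \<le> tq t i2'" "tq t i2' \<le> of_rat q" "y (tq t i2') \<le> of_rat \<alpha>' * tq t i2' + of_rat \<gamma>' + ?\<delta>"
      "of_rat q' \<le> tq t i3'" "tq t i3' \<le> t" "y (tq t i3') + d' \<le> of_rat \<alpha>' * tq t i3' + of_rat \<gamma>' + ?\<delta>"
      using z(2) unfolding E3_def mem_Collect_eq fst_conv snd_conv by metis
    have o': "real_of_rat p < of_rat p'" "real_of_rat p' < of_rat q" "real_of_rat q < of_rat q'"
      using o by (simp_all add: of_rat_less)
    have m: "of_rat \<alpha> * tq t i1' + of_rat \<gamma> - ?\<delta> \<le> y (tq t i1')" "of_rat \<alpha> * tq t i2' + of_rat \<gamma> - ?\<delta> \<le> y (tq t i2')"
      "of_rat \<alpha>' * tq t i1 + of_rat \<gamma>' - ?\<delta> \<le> y (tq t i1)" "of_rat \<alpha>' * tq t i2 + of_rat \<gamma>' - ?\<delta> \<le> y (tq t i2)"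
      by (rule l(1) l'(1), use l(3-8) l'(3-8) o' in linarith)+
    have s: "\<bar>real_of_rat \<alpha>' - of_rat \<alpha>\<bar> * (of_rat p' - of_rat p) \<le> 4 * ?\<delta>"
      by (rule near_support_lines[OF gap _ l(4) l'(4) l(6) l'(6) l(5) m(3) l(8) m(4) l'(5) m(1) l'(8) m(2)]) simp
    have s': "\<bar>of_rat \<alpha>' - of_rat \<alpha>\<bar> \<le> 4 * ?\<delta> / (of_rat p' - of_rat p)"
      by (subst pos_le_divide_eq, use gap in simp, rule s)
    have a1: "of_rat \<alpha> * tq t i1' + of_rat \<gamma> - ?\<delta> \<le> of_rat \<alpha>' * tq t i1' + of_rat \<gamma>' + ?\<delta>"
      using l(1)[of i1'] l'(3,4,5) o' by linarith
    have a3: "d - d' \<le> of_rat \<alpha> * tq t i3 + of_rat \<gamma> - (of_rat \<alpha>' * tq t i3 + of_rat \<gamma>') + 2 * ?\<delta>"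
      using l(9,10,11) l'(2)[of i3] by linarith
    define S where "S = real_of_rat \<alpha> - of_rat \<alpha>'"
    have "d - d' \<le> S * (tq t i3 - tq t i1') + 4 * ?\<delta>"
      using a1 a3 by (simp add: S_def algebra_simps)
    also have "S * (tq t i3 - tq t i1') \<le> \<bar>S\<bar> * t"
    proof -
      have "S * (tq t i3 - tq t i1') \<le> \<bar>S\<bar> * (tq t i3 - tq t i1')"
        using l(9) l'(4) o' by (intro mult_right_mono) auto
      also have "\<dots> \<le> \<bar>S\<bar> * t" using l(10) l'(3) by (intro mult_left_mono) auto
      finally show ?thesis .
    qed
    also have "\<bar>S\<bar> * t \<le> 4 * ?\<delta> / (of_rat p' - of_rat p) * t"
    proof -
      have "0 \<le> t" using l(7,9,10) l'(3,4) o' by linarith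
      then show ?thesis using s' by (intro mult_right_mono) (auto simp: S_def abs_minus_commute)
    qed
    finally show ?thesis by (simp add: algebra_simps)
  qed
  then have "d - d' \<le> 0" by (rule le_of_all_Suc)
  then show ?thesis by simp
qed

lemma approx_fm:
  assumes f: "cadlag f" and c: "0 \<le> c" "c \<le> t" and e: "0 < e" and lo: "lo < c \<or> c = 0 \<and> lo = 0" and hi: "c < hi \<or> c = t \<and> hi = t"
  obtains i where "0 \<le> tq t i" "tq t i \<le> t" "lo \<le> tq t i" "tq t i \<le> hi" "f (tq t i) < fm f c + e" "\<bar>tq t i - c\<bar> < e"
proof (cases "fm f c = f c")
  case True
  show ?thesis
  proof (cases "c = t")
    case True
    show ?thesis by (rule that[of None]) (use True \<open>fm f c = f c\<close> c e lo hi in auto)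
  next
    case False
    then have h: "0 < min e (min (hi - c) (t - c))" using hi c e by auto
    obtain r where r: "c < of_rat r" "of_rat r < c + min e (min (hi - c) (t - c))" "f (of_rat r) < f c + e"
      using approx_right[OF f c(1) e h] by metis
    have "0 \<le> real_of_rat r" "of_rat r \<le> t" "lo \<le> of_rat r" "of_rat r \<le> hi" "\<bar>of_rat r - c\<bar> < e"
      using r c lo by linarith+
    then show ?thesis using r True by (intro that[of "Some r"]) (simp_all only: tq.simps)
  qed
next
  case False
  then have l: "fm f c = lft f c" by (auto simp: fm_def)
  have c0: "0 < c" using False c by (cases "c = 0") auto
  then have h: "0 < min e (c - lo)" using lo e by auto
  obtain r where r: "0 < real_of_rat r" "c - min e (c - lo) < of_rat r" "of_rat r < c" "f (of_rat r) < lft f c + e"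
    using approx_left[OF f c0 e h] by metis
  have "0 \<le> real_of_rat r" "of_rat r \<le> t" "lo \<le> of_rat r" "of_rat r \<le> hi" "\<bar>of_rat r - c\<bar> < e"
    using r c hi by linarith+
  then show ?thesis using r l by (intro that[of "Some r"]) (simp_all only: tq.simps)
qed

lemma rat_near:
  assumes "0 < (e::real)" obtains q :: rat where "\<bar>of_rat q - x\<bar> < e"
proof -
  obtain q where "x - e < of_rat q" "of_rat q < x + e" using of_rat_dense[of "x - e" "x + e"] assms by auto
  then show ?thesis using that[of q] by auto
qed

text \<open>Rationals are placed so that \<open>c1 < p < p' < c2 < q < q' < c3\<close>: the first
  pair separates the two contacts that determine the line, the second pair is the gap in front of
  the third.\<close>

lemma three_contacts_E3:
  assumes f: "cadlag f" and t: "0 < t" and sup: "\<And>s. s \<in> {0..t} ==> a * s + b \<le> fm f s"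
    and c: "0 \<le> c1" "c1 < c2" "c2 < c3" "c3 \<le> t"
    and e: "fm f c1 = a * c1 + b" "fm f c2 = a * c2 + b" "fm f c3 = a * c3 + b"
  obtains p p' q q' where "p < p'" "p' < q" "q < q'" "0 \<le> q"
    "(f (of_rat q') - f (of_rat q), ypath (of_rat q) (of_rat q') f) \<in> E3 t p p' q q'"
proof -
  obtain p where p: "c1 < of_rat p" "of_rat p < c2" using of_rat_dense[OF c(2)] by blast
  obtain p' where p': "of_rat p < real_of_rat p'" "of_rat p' < c2" using of_rat_dense[OF p(2)] by blast
  obtain q where q: "c2 < of_rat q" "of_rat q < c3" using of_rat_dense[OF c(3)] by blast
  obtain q' where q': "of_rat q < real_of_rat q'" "of_rat q' < c3" using of_rat_dense[OF q(2)] by blast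
  let ?y = "ypath (of_rat q) (of_rat q') f" and ?d = "f (of_rat q') - f (of_rat q)"
  have sf: "a * s + b \<le> f s" if "0 \<le> s" "s \<le> t" for s using sup[of s] that by (auto simp: fm_def)
  have y1: "?y s = f s" if "0 \<le> s" "s \<le> of_rat q" for s using that by (simp add: ypath_def)
  have y2: "?y s + ?d = f s" if "of_rat q' \<le> s" for s using that q' c q by (auto simp: ypath_def)
  have "\<exists>\<alpha>::rat. \<exists>\<gamma>::rat.
     (\<forall>i. 0 \<le> tq t i \<and> tq t i \<le> of_rat q --> of_rat \<alpha> * tq t i + of_rat \<gamma> - 1 / real (Suc k) \<le> ?y (tq t i)) \<and>
     (\<forall>i. of_rat q' \<le> tq t i \<and> tq t i \<le> t --> of_rat \<alpha> * tq t i + of_rat \<gamma> - 1 / real (Suc k) \<le> ?y (tq t i) + ?d) \<and>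
     (\<exists>i. 0 \<le> tq t i \<and> tq t i \<le> of_rat p \<and> ?y (tq t i) \<le> of_rat \<alpha> * tq t i + of_rat \<gamma> + 1 / real (Suc k)) \<and>
     (\<exists>i. of_rat p' \<le> tq t i \<and> tq t i \<le> of_rat q \<and> ?y (tq t i) \<le> of_rat \<alpha> * tq t i + of_rat \<gamma> + 1 / real (Suc k)) \<and>
     (\<exists>i. of_rat q' \<le> tq t i \<and> tq t i \<le> t \<and> ?y (tq t i) + ?d \<le> of_rat \<alpha> * tq t i + of_rat \<gamma> + 1 / real (Suc k))" for k
  proof -
    define \<delta> where "\<delta> = 1 / real (Suc k)"
    have \<delta>: "0 < \<delta>" by (simp add: \<delta>_def)
    \<comment> \<open>Over times up to \<open>t\<close> this slope error costs \<delta> / 4; with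
      the error of the intercept the line moves by at most \<delta> / 2.\<close>
    obtain \<alpha> :: rat where \<alpha>: "\<bar>of_rat \<alpha> - a\<bar> < \<delta> / (4 * t)" using rat_near[of "\<delta> / (4 * t)" a] \<delta> t by (metis divide_pos_pos mult_pos_pos zero_less_numeral)
    obtain \<gamma> :: rat where \<gamma>: "\<bar>of_rat \<gamma> - b\<bar> < \<delta> / 4" using rat_near[of "\<delta> / 4" b] \<delta> by (metis divide_pos_pos zero_less_numeral)
    have cl: "\<bar>(of_rat \<alpha> * s + of_rat \<gamma>) - (a * s + b)\<bar> \<le> \<delta> / 2" if s: "0 \<le> s" "s \<le> t" for s
    proof -
      have "\<bar>(of_rat \<alpha> - a) * s\<bar> \<le> \<delta> / (4 * t) * t"
        unfolding abs_mult using \<alpha> s by (intro mult_mono) auto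
      then have "\<bar>(of_rat \<alpha> - a) * s\<bar> \<le> \<delta> / 4" using t by simp
      moreover have "(of_rat \<alpha> * s + of_rat \<gamma>) - (a * s + b) = (of_rat \<alpha> - a) * s + (of_rat \<gamma> - b)" by (simp add: algebra_simps)
      ultimately show ?thesis using \<gamma> by linarith
    qed
    have lowr: "of_rat \<alpha> * s + of_rat \<gamma> - \<delta> \<le> f s" if "0 \<le> s" "s \<le> t" for s
      using cl[OF that] sf[OF that] \<delta> by linarith
    have tch: "\<exists>i. 0 \<le> tq t i \<and> tq t i \<le> t \<and> lo \<le> tq t i \<and> tq t i \<le> hi \<and> f (tq t i) \<le> of_rat \<alpha> * tq t i + of_rat \<gamma> + \<delta>"
      if cc: "0 \<le> c" "c \<le> t" "fm f c = a * c + b" "lo < c \<or> c = 0 \<and> lo = 0" "c < hi \<or> c = t \<and> hi = t" for c lo hi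
    proof -
      \<comment> \<open>Moving to a test time within \<open>e\<close> of the contact costs
        \<open>e\<close> in the path and \<open>\<bar>a\<bar> * e\<close> along the line, together
        \<delta> / 2.\<close>
      define e where "e = \<delta> / 2 / (\<bar>a\<bar> + 1)"
      have e: "0 < e" using \<delta> by (simp add: e_def)
      have ee: "e * (\<bar>a\<bar> + 1) = \<delta> / 2"
      proof -
        have "\<delta> / 2 / A * A = \<delta> / 2" if "A \<noteq> 0" for A using that by simp
        moreover have "\<bar>a\<bar> + 1 \<noteq> 0" by linarith
        ultimately show ?thesis unfolding e_def by blast
      qed
      obtain i where i: "0 \<le> tq t i" "tq t i \<le> t" "lo \<le> tq t i" "tq t i \<le> hi" "f (tq t i) < fm f c + e" "\<bar>tq t i - c\<bar> < e"
        using approx_fm[OF f cc(1,2) e cc(4,5)] by metis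
      have "\<bar>a * (c - tq t i)\<bar> \<le> \<bar>a\<bar> * e"
        unfolding abs_mult using i(6) by (intro mult_left_mono) (auto simp: abs_minus_commute)
      then have "a * c \<le> a * tq t i + \<bar>a\<bar> * e" by (simp add: abs_le_iff algebra_simps)
      then have "f (tq t i) \<le> a * tq t i + b + \<delta> / 2" using i(5) cc(3) ee by (simp add: algebra_simps)
      then have "f (tq t i) \<le> of_rat \<alpha> * tq t i + of_rat \<gamma> + \<delta>" using cl[OF i(1,2)] by linarith
      then show ?thesis using i by blast
    qed
    have "\<exists>i. 0 \<le> tq t i \<and> tq t i \<le> of_rat p \<and> ?y (tq t i) \<le> of_rat \<alpha> * tq t i + of_rat \<gamma> + \<delta>"
    proof -
      \<comment> \<open>The bound -1 imposes no restriction on the left, since \<open>c1\<close> may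
        be 0.\<close>
      obtain i where "0 \<le> tq t i" "tq t i \<le> of_rat p" "f (tq t i) \<le> of_rat \<alpha> * tq t i + of_rat \<gamma> + \<delta>"
        using tch[of c1 "-1" "of_rat p"] c p e(1) by auto
      then show ?thesis using y1[of "tq t i"] p p' q by (intro exI[of _ i]) auto
    qed
    moreover have "\<exists>i. of_rat p' \<le> tq t i \<and> tq t i \<le> of_rat q \<and> ?y (tq t i) \<le> of_rat \<alpha> * tq t i + of_rat \<gamma> + \<delta>"
    proof -
      obtain i where "0 \<le> tq t i" "of_rat p' \<le> tq t i" "tq t i \<le> of_rat q" "f (tq t i) \<le> of_rat \<alpha> * tq t i + of_rat \<gamma> + \<delta>"
        using tch[of c2 "of_rat p'" "of_rat q"] c p' q e(2) by auto
      then show ?thesis using y1[of "tq t i"] by (intro exI[of _ i]) auto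
    qed
    moreover have "\<exists>i. of_rat q' \<le> tq t i \<and> tq t i \<le> t \<and> ?y (tq t i) + ?d \<le> of_rat \<alpha> * tq t i + of_rat \<gamma> + \<delta>"
    proof -
      obtain i where "of_rat q' \<le> tq t i" "tq t i \<le> t" "f (tq t i) \<le> of_rat \<alpha> * tq t i + of_rat \<gamma> + \<delta>"
        using tch[of c3 "of_rat q'" "t + 1"] c q' e(3) by auto
      then show ?thesis using y2[of "tq t i"] by (intro exI[of _ i]) auto
    qed
    moreover have "\<forall>i. 0 \<le> tq t i \<and> tq t i \<le> of_rat q --> of_rat \<alpha> * tq t i + of_rat \<gamma> - \<delta> \<le> ?y (tq t i)"
      using lowr y1 q c by (smt (verit))
    moreover have "\<forall>i. of_rat q' \<le> tq t i \<and> tq t i \<le> t --> of_rat \<alpha> * tq t i + of_rat \<gamma> - \<delta> \<le> ?y (tq t i) + ?d"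
      using lowr y2 q q' c by (smt (verit))
    ultimately show ?thesis unfolding \<delta>_def[symmetric] by blast
  qed
  then have "(?d, ?y) \<in> E3 t p p' q q'" unfolding E3_def by (simp add: space_pair_measure space_PiM)
  moreover have "p < p'" "q < q'" using p' q' by (simp_all add: of_rat_less)
  moreover have "p' < q" using p' q by (smt (verit) of_rat_less)
  moreover have "0 \<le> q" using q c by (smt (verit) zero_le_of_rat_iff)
  ultimately show ?thesis using that by blast
qed

context levy_setup begin

lemma AE_no_three_contacts:
  "AE \<omega> in M. \<forall>a b c1 c2 c3. (\<forall>s\<in>{0..t}. a * s + b \<le> fm (path \<omega>) s) --> 0 \<le> c1 --> c1 < c2 --> c2 < c3 --> c3 \<le> t -->
     fm (path \<omega>) c1 = a * c1 + b --> fm (path \<omega>) c2 = a * c2 + b --> fm (path \<omega>) c3 = a * c3 + b --> False"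
proof -
  have "AE \<omega> in M. (X (of_rat q') \<omega> - X (of_rat q) \<omega>, ypath (of_rat q) (of_rat q') (path \<omega>)) \<notin> E3 t p p' q q'"
    if o: "p < p'" "p' < q" "q < q'" "0 \<le> q" for p p' q q'
  proof (rule AE_diffuse_section)
    show "E3 t p p' q q' \<in> sets (borel \<Otimes>\<^sub>M PiB)" by (rule E3_sets)
    have qq: "0 \<le> real_of_rat q" "real_of_rat q < of_rat q'" using o by (simp_all add: of_rat_less)
    show "distr M (borel \<Otimes>\<^sub>M PiB) (\<lambda>\<omega>. (X (of_rat q') \<omega> - X (of_rat q) \<omega>, ypath (of_rat q) (of_rat q') (path \<omega>))) =
      distr M borel (\<lambda>\<omega>. X (of_rat q') \<omega> - X (of_rat q) \<omega>) \<Otimes>\<^sub>M distr M PiB (\<lambda>\<omega>. ypath (of_rat q) (of_rat q') (path \<omega>))"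
      by (rule gap_law[OF qq])
    show "prob {\<omega> \<in> space M. X (of_rat q') \<omega> - X (of_rat q) \<omega> = x} = 0" for x by (rule incr_diffuse[OF qq])
    show "d = d'" if "(d, y) \<in> E3 t p p' q q'" "(d', y) \<in> E3 t p p' q q'" for d d' y
      using E3_section_le[OF that o(1-3)] E3_section_le[OF that(2,1) o(1-3)] by simp
  qed measurable
  then have "AE \<omega> in M. \<forall>p p' q q'. p < p' --> p' < q --> q < q' --> 0 \<le> q -->
     (X (of_rat q') \<omega> - X (of_rat q) \<omega>, ypath (of_rat q) (of_rat q') (path \<omega>)) \<notin> E3 t p p' q q'"
    by (simp add: AE_all_countable)
  then show ?thesis using AE_space
  proof eventually_elim
    case (elim \<omega>)
    show ?case
    proof (intro allI impI)
      fix a b c1 c2 c3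
      assume "\<forall>s\<in>{0..t}. a * s + b \<le> fm (path \<omega>) s" "0 \<le> c1" "c1 < c2" "c2 < c3" "c3 \<le> t"
        "fm (path \<omega>) c1 = a * c1 + b" "fm (path \<omega>) c2 = a * c2 + b" "fm (path \<omega>) c3 = a * c3 + b"
      then obtain p p' q q' where "p < p'" "p' < q" "q < q'" "0 \<le> q"
        "(X (of_rat q') \<omega> - X (of_rat q) \<omega>, ypath (of_rat q) (of_rat q') (path \<omega>)) \<in> E3 t p p' q q'"
        using three_contacts_E3[OF X_cadlag[OF elim(2)] tpos, of a b c1 c2 c3] by blast
      then show False using elim(1) by blast
    qed
  qed
qed

end

section \<open>Stick breaking and the minima of a Knight bridge\<close>

declare stick_L.simps [simp del]

lemma stick_S_measurable: "(\<lambda>v. stick_S t v n) \<in> borel_measurable PiB"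
proof (induction n)
  case (Suc n)
  note [measurable] = Suc
  show ?case by (simp add: stick_L.simps) measurable
qed simp

lemma stick_L_measurable: "(\<lambda>v. stick_L t v n) \<in> borel_measurable PiB"
proof -
  note [measurable] = stick_S_measurable[of t n]
  show ?thesis by (simp add: stick_L.simps) measurable
qed

lemma stick_pos:
  assumes "0 < t" "\<And>i. 0 < v i" "\<And>i. v i < 1"
  shows "0 \<le> stick_S t v n" "stick_S t v n < t" "0 < stick_L t v n" "stick_S t v n + stick_L t v n < t"
proof -
  have "0 \<le> stick_S t v n \<and> stick_S t v n < t"
  proof (induction n)
    case (Suc n)
    then have "v n * (t - stick_S t v n) < 1 * (t - stick_S t v n)" using assms by (intro mult_strict_right_mono) auto
    then have "v n * (t - stick_S t v n) < t - stick_S t v n" by (simp only: mult_1)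
    moreover have "0 < v n * (t - stick_S t v n)" using Suc assms by simp
    ultimately have "0 < stick_L t v n" "stick_L t v n < t - stick_S t v n" by (simp_all only: stick_L.simps)
    then show ?case using Suc by simp
  qed (use assms in simp)
  then show s: "0 \<le> stick_S t v n" "stick_S t v n < t" by auto
  have "v n * (t - stick_S t v n) < 1 * (t - stick_S t v n)" using assms s by (intro mult_strict_right_mono) auto
  then have "v n * (t - stick_S t v n) < t - stick_S t v n" by (simp only: mult_1)
  then show "stick_S t v n + stick_L t v n < t" unfolding stick_L.simps by (simp only: less_diff_eq add.commute)
  show "0 < stick_L t v n" unfolding stick_L.simps using s assms by simp
qed

text \<open>Evaluation at a random time is not jointly measurable on a product over uncountably many
  times. This limit is, as it combines countably many coordinates, and for a right continuous path
  it returns the value at \<open>a\<close>.\<close>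

definition cev :: "(real => real) => real => real" where
  "cev y a = lim (\<lambda>n. y ((of_int \<lfloor>a * real (Suc n)\<rfloor> + 1) / real (Suc n)))"

lemma cev_measurable:
  assumes [measurable]: "y \<in> measurable N PiB" "a \<in> borel_measurable N"
  shows "(\<lambda>z. cev (y z) (a z)) \<in> borel_measurable N"
  unfolding cev_def
proof (rule borel_measurable_lim_metric)
  fix n
  show "(\<lambda>z. y z ((of_int \<lfloor>a z * real (Suc n)\<rfloor> + 1) / real (Suc n))) \<in> borel_measurable N"
  proof (rule measurable_compose_countable[where f = "\<lambda>i z. y z ((of_int i + 1) / real (Suc n))" and g = "\<lambda>z. \<lfloor>a z * real (Suc n)\<rfloor>"])
    show "(\<lambda>z. \<lfloor>a z * real (Suc n)\<rfloor>) \<in> measurable N (count_space UNIV)" by measurable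
    show "(\<lambda>z. y z ((of_int i + 1) / real (Suc n))) \<in> borel_measurable N" for i
      using measurable_compose[OF assms(1) measurable_component_singleton] by simp
  qed
qed

lemma cev_seq:
  assumes "0 \<le> a"
  shows "(\<lambda>n. (of_int \<lfloor>a * real (Suc n)\<rfloor> + 1) / real (Suc n)) \<longlonglongrightarrow> a" "a < (of_int \<lfloor>a * real (Suc n)\<rfloor> + 1) / real (Suc n)"
proof -
  have b: "a < (of_int \<lfloor>a * real (Suc n)\<rfloor> + 1) / real (Suc n)" "(of_int \<lfloor>a * real (Suc n)\<rfloor> + 1) / real (Suc n) \<le> a + 1 / real (Suc n)" for n
  proof -
    have "a * real (Suc n) < of_int \<lfloor>a * real (Suc n)\<rfloor> + 1" "of_int \<lfloor>a * real (Suc n)\<rfloor> \<le> a * real (Suc n)" by linarith+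
    then show "a < (of_int \<lfloor>a * real (Suc n)\<rfloor> + 1) / real (Suc n)" "(of_int \<lfloor>a * real (Suc n)\<rfloor> + 1) / real (Suc n) \<le> a + 1 / real (Suc n)"
      by (simp_all add: field_simps del: of_nat_Suc)
  qed
  then show "a < (of_int \<lfloor>a * real (Suc n)\<rfloor> + 1) / real (Suc n)" by blast
  have "(\<lambda>n. a + 1 / real (Suc n)) \<longlonglongrightarrow> a + 0"
    by (intro tendsto_intros LIMSEQ_inverse_real_of_nat[unfolded inverse_eq_divide])
  then have l: "(\<lambda>n. a + 1 / real (Suc n)) \<longlonglongrightarrow> a" by simp
  show "(\<lambda>n. (of_int \<lfloor>a * real (Suc n)\<rfloor> + 1) / real (Suc n)) \<longlonglongrightarrow> a"
    by (rule tendsto_sandwich[OF always_eventually always_eventually tendsto_const l]) (intro allI b less_imp_le)+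
qed

lemma cev_ypath:
  assumes f: "cadlag f" and q: "0 \<le> q" "q < q'" and a: "0 \<le> a"
  shows "a < q ==> cev (ypath q q' f) a = f a" "q' \<le> a ==> cev (ypath q q' f) a = f a - (f q' - f q)"
proof -
  let ?s = "\<lambda>n. (of_int \<lfloor>a * real (Suc n)\<rfloor> + 1) / real (Suc n)"
  have fs: "(\<lambda>n. f (?s n)) \<longlonglongrightarrow> f a"
    by (rule cadlag_seq_right[OF f a cev_seq(1)[OF a]]) (rule always_eventually, intro allI less_imp_le cev_seq(2)[OF a])
  {
    assume "a < q"
    from order_tendstoD(2)[OF cev_seq(1)[OF a] this]
    have "eventually (\<lambda>n. f (?s n) = ypath q q' f (?s n)) sequentially"
    proof eventually_elim
      case (elim n)
      then show ?case using cev_seq(2)[OF a, of n] a by (simp add: ypath_def)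
    qed
    then have "(\<lambda>n. ypath q q' f (?s n)) \<longlonglongrightarrow> f a" by (rule Lim_transform_eventually[OF fs])
    then show "cev (ypath q q' f) a = f a" unfolding cev_def by (rule limI)
  next
    assume "q' \<le> a"
    then have "ypath q q' f (?s n) = f (?s n) - (f q' - f q)" for n
      using cev_seq(2)[OF a, of n] q by (simp add: ypath_def)
    then have "(\<lambda>n. ypath q q' f (?s n)) \<longlonglongrightarrow> f a - (f q' - f q)" by (simp only:) (intro tendsto_intros fs)
    then show "cev (ypath q q' f) a = f a - (f q' - f q)" unfolding cev_def by (rule limI)
  }
qed

text \<open>\<open>True\<close> stands for times left of the gap, \<open>False\<close> for times
  right of it.\<close>

definition sdq :: "bool => rat => rat => rat => bool" where
  "sdq side q q' r = (if side then r \<le> q else q' \<le> r)"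

text \<open>The gap lies inside stick \<open>i\<close>, so the slope of the Knight bridge, written
  out here with \<open>cev\<close>, contains the removed increment \<open>fst (fst z)\<close>. Two
  near contacts on one side of the gap, separated by [p, p'], are asked of a line with that slope;
  only the intercept is free.\<close>

definition EV :: "real => nat => bool => rat => rat => rat => rat => ((real \<times> (real => real)) \<times> (nat => real)) set" where
  "EV t i side p p' q q' = {z \<in> space ((borel \<Otimes>\<^sub>M PiB) \<Otimes>\<^sub>M PiB).
     0 < stick_L t (snd z) i \<and> (\<forall>k::nat. \<exists>\<gamma>::rat.
      (\<forall>r::rat. stick_S t (snd z) i < of_rat r \<and> of_rat r < stick_S t (snd z) i + stick_L t (snd z) i \<and> sdq side q q' r -->
        (cev (snd (fst z)) (stick_S t (snd z) i + stick_L t (snd z) i) + fst (fst z) - cev (snd (fst z)) (stick_S t (snd z) i)) / stick_L t (snd z) i * of_rat r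
          + of_rat \<gamma> - 1 / real (Suc k) \<le> snd (fst z) (of_rat r)) \<and>
      (\<exists>r::rat. stick_S t (snd z) i < of_rat r \<and> of_rat r < stick_S t (snd z) i + stick_L t (snd z) i \<and> sdq side q q' r \<and> r \<le> p \<and>
        snd (fst z) (of_rat r) \<le> (cev (snd (fst z)) (stick_S t (snd z) i + stick_L t (snd z) i) + fst (fst z) - cev (snd (fst z)) (stick_S t (snd z) i)) / stick_L t (snd z) i * of_rat r
          + of_rat \<gamma> + 1 / real (Suc k)) \<and>
      (\<exists>r::rat. stick_S t (snd z) i < of_rat r \<and> of_rat r < stick_S t (snd z) i + stick_L t (snd z) i \<and> sdq side q q' r \<and> p' \<le> r \<and>
        snd (fst z) (of_rat r) \<le> (cev (snd (fst z)) (stick_S t (snd z) i + stick_L t (snd z) i) + fst (fst z) - cev (snd (fst z)) (stick_S t (snd z) i)) / stick_L t (snd z) i * of_rat r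
          + of_rat \<gamma> + 1 / real (Suc k)))}"

lemma EV_sets: "EV t i side p p' q q' \<in> sets ((borel \<Otimes>\<^sub>M PiB) \<Otimes>\<^sub>M PiB)"
proof -
  let ?N = "((borel :: real measure) \<Otimes>\<^sub>M PiM (UNIV :: real set) (\<lambda>_. borel :: real measure)) \<Otimes>\<^sub>M PiM (UNIV :: nat set) (\<lambda>_. borel :: real measure)"
  have [measurable]: "(\<lambda>z. stick_S t (snd z) i) \<in> borel_measurable ?N" "(\<lambda>z. stick_L t (snd z) i) \<in> borel_measurable ?N"
    using measurable_compose[OF measurable_snd stick_S_measurable] measurable_compose[OF measurable_snd stick_L_measurable] by auto
  have [measurable]: "(\<lambda>z. cev (snd (fst z)) (stick_S t (snd z) i)) \<in> borel_measurable ?N"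
    "(\<lambda>z. cev (snd (fst z)) (stick_S t (snd z) i + stick_L t (snd z) i)) \<in> borel_measurable ?N"
    by (intro cev_measurable; measurable)+
  show ?thesis unfolding EV_def by measurable
qed

text \<open>The data at the two contacts do not involve \<open>d\<close> but determine the slope,
  and the slope is injective in \<open>d\<close>.\<close>

lemma EV_section:
  assumes z: "((d, y), v) \<in> EV t i side p p' q q'" "((d', y), v) \<in> EV t i side p p' q q'" and o: "p < p'"
  shows "d = d'"
proof -
  define a where "a = stick_S t v i"
  define l where "l = stick_L t v i"
  define \<beta> where "\<beta> d = (cev y (a + l) + d - cev y a) / l" for d
  have gap: "real_of_rat p < of_rat p'" using o by (simp add: of_rat_less)
  have l: "0 < l" using z(1) by (simp add: EV_def l_def)
  have ex: "\<exists>\<gamma>::rat. (\<forall>r::rat. a < of_rat r \<and> of_rat r < a + l \<and> sdq side q q' r --> \<beta> d * of_rat r + of_rat \<gamma> - 1 / real (Suc k) \<le> y (of_rat r)) \<and>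
      (\<exists>r::rat. a < of_rat r \<and> of_rat r < a + l \<and> sdq side q q' r \<and> r \<le> p \<and> y (of_rat r) \<le> \<beta> d * of_rat r + of_rat \<gamma> + 1 / real (Suc k)) \<and>
      (\<exists>r::rat. a < of_rat r \<and> of_rat r < a + l \<and> sdq side q q' r \<and> p' \<le> r \<and> y (of_rat r) \<le> \<beta> d * of_rat r + of_rat \<gamma> + 1 / real (Suc k))"
    if "((d, y), v) \<in> EV t i side p p' q q'" for d k
    using that unfolding EV_def mem_Collect_eq fst_conv snd_conv a_def[symmetric] l_def[symmetric] \<beta>_def[symmetric] by blast
  have "\<bar>\<beta> d' - \<beta> d\<bar> * (of_rat p' - of_rat p) \<le> 4 * (1 / real (Suc k))" for k
  proof -
    obtain \<gamma> :: rat and r1 r2 :: rat where h: "\<And>r::rat. a < of_rat r \<and> of_rat r < a + l \<and> sdq side q q' r ==> \<beta> d * of_rat r + of_rat \<gamma> - 1 / real (Suc k) \<le> y (of_rat r)"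
      "a < of_rat r1 \<and> of_rat r1 < a + l \<and> sdq side q q' r1" "r1 \<le> p" "y (of_rat r1) \<le> \<beta> d * of_rat r1 + of_rat \<gamma> + 1 / real (Suc k)"
      "a < of_rat r2 \<and> of_rat r2 < a + l \<and> sdq side q q' r2" "p' \<le> r2" "y (of_rat r2) \<le> \<beta> d * of_rat r2 + of_rat \<gamma> + 1 / real (Suc k)"
      using ex[OF z(1), of k] by blast
    obtain \<gamma>' :: rat and r1' r2' :: rat where h': "\<And>r::rat. a < of_rat r \<and> of_rat r < a + l \<and> sdq side q q' r ==> \<beta> d' * of_rat r + of_rat \<gamma>' - 1 / real (Suc k) \<le> y (of_rat r)"
      "a < of_rat r1' \<and> of_rat r1' < a + l \<and> sdq side q q' r1'" "r1' \<le> p" "y (of_rat r1') \<le> \<beta> d' * of_rat r1' + of_rat \<gamma>' + 1 / real (Suc k)"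
      "a < of_rat r2' \<and> of_rat r2' < a + l \<and> sdq side q q' r2'" "p' \<le> r2'" "y (of_rat r2') \<le> \<beta> d' * of_rat r2' + of_rat \<gamma>' + 1 / real (Suc k)"
      using ex[OF z(2), of k] by blast
    have r: "real_of_rat r1 \<le> of_rat p" "real_of_rat r1' \<le> of_rat p" "real_of_rat p' \<le> of_rat r2" "real_of_rat p' \<le> of_rat r2'"
      using h h' by (simp_all add: of_rat_less_eq)
    show ?thesis
      by (rule near_support_lines[OF gap _ r h(4) h'(1)[OF h(2)] h(7) h'(1)[OF h(5)] h'(4) h(1)[OF h'(2)] h'(7) h(1)[OF h'(5)]]) simp
  qed
  then have "\<bar>\<beta> d' - \<beta> d\<bar> * (of_rat p' - of_rat p) \<le> 0" by (rule le_of_all_Suc)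
  then have "\<beta> d' = \<beta> d" using gap by (simp add: mult_le_0_iff)
  then show ?thesis using l by (simp add: \<beta>_def)
qed

lemma le_line_near:
  fixes e :: real
  assumes "\<bar>r - c\<bar> \<le> e / 2 / (\<bar>\<beta>\<bar> + 1)" "F = \<beta> * c + \<gamma>" "x < F + e / 2"
  shows "x \<le> \<beta> * r + \<gamma> + e"
proof -
  have "0 < \<bar>\<beta>\<bar> + 1" by linarith
  then have "\<bar>r - c\<bar> * (\<bar>\<beta>\<bar> + 1) \<le> e / 2" using assms(1) by (simp only: pos_le_divide_eq)
  moreover have "\<beta> * (c - r) \<le> \<bar>\<beta>\<bar> * \<bar>r - c\<bar>" using abs_ge_self[of "\<beta> * (c - r)"] by (simp add: abs_mult abs_minus_commute)
  moreover have "\<bar>r - c\<bar> * (\<bar>\<beta>\<bar> + 1) = \<bar>\<beta>\<bar> * \<bar>r - c\<bar> + \<bar>r - c\<bar>" "\<beta> * (c - r) = \<beta> * c - \<beta> * r"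
    by (simp_all add: algebra_simps)
  ultimately show ?thesis using assms(2,3) abs_ge_zero[of "r - c"] by linarith
qed

text \<open>Two minima of the bridge are two contacts of the path with a line of the slope of the
  stick. Test times stay strictly inside the stick, so a minimum at its right end can be used only
  if it is attained as a left limit.\<close>

lemma EV_intro:
  assumes f: "cadlag f" and a: "0 \<le> stick_S t v i" and l: "0 < stick_L t v i"
    and pq: "0 \<le> q" "q < q'" 
    and inq: "stick_S t v i < of_rat q" "of_rat q' < stick_S t v i + stick_L t v i"
    and c: "c1 \<in> mins f (stick_S t v i) (stick_L t v i)" "c2 \<in> mins f (stick_S t v i) (stick_L t v i)"
    and c2: "0 < c2" "c2 < stick_L t v i \<or> mK f (stick_S t v i) (stick_L t v i) c2 = lft (knight f (stick_S t v i) (stick_L t v i)) c2"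
    and p: "stick_S t v i + c1 < of_rat p" "of_rat p' < stick_S t v i + c2" "c1 < stick_L t v i"
    and side: "if side then stick_S t v i + c2 < of_rat q \<and> p \<le> q else of_rat q' < stick_S t v i + c1 \<and> q' \<le> p'"
  shows "((f (of_rat q') - f (of_rat q), ypath (of_rat q) (of_rat q') f), v) \<in> EV t i side p p' q q'"
proof -
  define A where "A = stick_S t v i"
  define L where "L = stick_L t v i"
  let ?y = "ypath (of_rat q) (of_rat q') f" and ?d = "f (of_rat q') - f (of_rat q)"
  have qq: "0 \<le> real_of_rat q" "real_of_rat q < of_rat q'" using pq by (simp_all add: of_rat_less)
  note al = a[folded A_def] l[folded L_def] inq[folded A_def L_def] c[folded A_def L_def] c2[folded A_def L_def] p[folded A_def L_def] side[folded A_def L_def]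
  define \<beta> where "\<beta> = slp f A L"
  have \<beta>: "(cev ?y (A + L) + ?d - cev ?y A) / L = \<beta>"
    using cev_ypath[OF f qq, of A] cev_ypath[OF f qq, of "A + L"] al by (simp add: \<beta>_def slp_def)
  define m where "m = mK f A L c1"
  have m2: "mK f A L c2 = m" using al(5,6) by (auto simp: m_def mins_def intro: antisym)
  define \<gamma>0 where "\<gamma>0 = m + f A - A * \<beta>"
  have fk: "f s = knight f A L (s - A) + f A + (s - A) * \<beta>" for s by (simp add: knight_slp \<beta>_def)
  have low: "\<beta> * s + \<gamma>0 \<le> f s" if "A < s" "s < A + L" for s
  proof -
    have "m \<le> mK f A L (s - A)" using al(5) that by (auto simp: m_def mins_def)
    also have "\<dots> \<le> knight f A L (s - A)" by (simp add: mK_def)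
    finally show ?thesis using fk[of s] by (simp add: \<gamma>0_def algebra_simps)
  qed
  have tR: "\<exists>r::rat. A + c < of_rat r \<and> of_rat r < A + c + \<eta> \<and> f (of_rat r) \<le> \<beta> * of_rat r + \<gamma>0 + e"
    if h: "0 \<le> c" "knight f A L c = m" "0 < e" "0 < \<eta>" for c e \<eta>
  proof -
    define e' where "e' = e / 2 / (\<bar>\<beta>\<bar> + 1)"
    have e': "0 < e'" using h by (simp add: e'_def)
    obtain r where r: "A + c < of_rat r" "of_rat r < A + c + min e' \<eta>" "f (of_rat r) < f (A + c) + e / 2"
      using approx_right[OF f, of "A + c" "e / 2" "min e' \<eta>"] h e' al by auto
    have F: "f (A + c) = \<beta> * (A + c) + \<gamma>0" using fk[of "A + c"] h by (simp add: \<gamma>0_def algebra_simps)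
    have "f (of_rat r) \<le> \<beta> * of_rat r + \<gamma>0 + e"
      by (rule le_line_near[OF _ F r(3)], fold e'_def) (use r in auto)
    moreover have "of_rat r < A + c + \<eta>" using r by linarith
    ultimately show ?thesis using r by blast
  qed
  have tL: "\<exists>r::rat. A + c - \<eta> < of_rat r \<and> of_rat r < A + c \<and> f (of_rat r) \<le> \<beta> * of_rat r + \<gamma>0 + e"
    if h: "0 < c" "lft (knight f A L) c = m" "0 < e" "0 < \<eta>" for c e \<eta>
  proof -
    define e' where "e' = e / 2 / (\<bar>\<beta>\<bar> + 1)"
    have e': "0 < e'" using h by (simp add: e'_def)
    obtain r where r: "A + c - min e' \<eta> < of_rat r" "of_rat r < A + c" "f (of_rat r) < lft f (A + c) + e / 2"
      using approx_left[OF f, of "A + c" "e / 2" "min e' \<eta>"] h e' al by auto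
    have F: "lft f (A + c) = \<beta> * (A + c) + \<gamma>0"
      using lft_knight[OF f, of A c L] h al by (simp add: \<gamma>0_def \<beta>_def algebra_simps)
    have "f (of_rat r) \<le> \<beta> * of_rat r + \<gamma>0 + e"
      by (rule le_line_near[OF _ F r(3)], fold e'_def) (use r in auto)
    moreover have "A + c - \<eta> < of_rat r" using r by linarith
    ultimately show ?thesis using r by blast
  qed
  have tch: "\<exists>r::rat. A < of_rat r \<and> of_rat r < A + L \<and> lo < real_of_rat r \<and> real_of_rat r < hi \<and> f (of_rat r) \<le> \<beta> * of_rat r + \<gamma>0 + e"
    if h: "0 \<le> c" "c \<le> L" "mK f A L c = m" "c < L \<or> mK f A L c = lft (knight f A L) c" "0 < e" "lo < A + c" "A + c < hi" for c lo hi e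
  proof (cases "c < L \<and> knight f A L c = m")
    case True
    then obtain r :: rat where r: "A + c < of_rat r" "of_rat r < A + c + min (L - c) (hi - (A + c))" "f (of_rat r) \<le> \<beta> * of_rat r + \<gamma>0 + e"
      using tR[of c e "min (L - c) (hi - (A + c))"] h by auto
    have "A < real_of_rat r" "of_rat r < A + L" "lo < of_rat r" "of_rat r < hi" using r h by linarith+
    then show ?thesis using r by blast
  next
    case False
    have l: "lft (knight f A L) c = m" using False h by (auto simp: mK_def min_def split: if_splits)
    have c0: "0 < c"
    proof (rule ccontr)
      assume "\<not> 0 < c"
      then have "c = 0" using h by simp
      then show False using False l al by simp
    qed
    then obtain r :: rat where r: "A + c - min c (A + c - lo) < of_rat r" "of_rat r < A + c" "f (of_rat r) \<le> \<beta> * of_rat r + \<gamma>0 + e"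
      using tL[of c e "min c (A + c - lo)"] h l by auto
    have "A < real_of_rat r" "of_rat r < A + L" "lo < of_rat r" "of_rat r < hi" using r h by linarith+
    then show ?thesis using r by blast
  qed
  \<comment> \<open>Right of the gap \<open>ypath\<close> differs from the path by a constant, which
    the intercept absorbs.\<close>
  define sh where "sh = (if side then 0 else ?d)"
  have y: "?y (of_rat r) = f (of_rat r) - sh" if "A < of_rat r" "sdq side q q' r" for r
  proof (cases side)
    case True
    then have "real_of_rat r \<le> of_rat q" using that by (simp add: sdq_def of_rat_less_eq)
    moreover have "0 \<le> real_of_rat r" using that al by linarith
    ultimately show ?thesis using True by (simp add: ypath_def sh_def)
  next
    case False
    then have "real_of_rat q' \<le> of_rat r" using that by (simp add: sdq_def of_rat_less_eq)
    then show ?thesis using False qq by (simp add: ypath_def sh_def)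
  qed
  have main: "\<exists>\<gamma>::rat. (\<forall>r::rat. A < of_rat r \<and> of_rat r < A + L \<and> sdq side q q' r --> \<beta> * of_rat r + of_rat \<gamma> - 1 / real (Suc k) \<le> ?y (of_rat r)) \<and>
      (\<exists>r::rat. A < of_rat r \<and> of_rat r < A + L \<and> sdq side q q' r \<and> r \<le> p \<and> ?y (of_rat r) \<le> \<beta> * of_rat r + of_rat \<gamma> + 1 / real (Suc k)) \<and>
      (\<exists>r::rat. A < of_rat r \<and> of_rat r < A + L \<and> sdq side q q' r \<and> p' \<le> r \<and> ?y (of_rat r) \<le> \<beta> * of_rat r + of_rat \<gamma> + 1 / real (Suc k))" for k
  proof -
    define \<delta> where "\<delta> = 1 / real (Suc k)"
    have \<delta>: "0 < \<delta>" by (simp add: \<delta>_def)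
    obtain \<gamma> :: rat where \<gamma>: "\<bar>of_rat \<gamma> - (\<gamma>0 - sh)\<bar> < \<delta> / 2" using rat_near[of "\<delta> / 2" "\<gamma>0 - sh"] \<delta> by auto
    have 1: "\<beta> * of_rat r + of_rat \<gamma> - \<delta> \<le> ?y (of_rat r)" if "A < of_rat r" "of_rat r < A + L" "sdq side q q' r" for r
      using low[OF that(1,2)] y[OF that(1,3)] \<gamma> \<delta> by linarith
    have c1L: "0 \<le> c1" "c1 \<le> L" "0 \<le> c2" "c2 \<le> L" using al(5,6) by (auto simp: mins_def)
    have pl: "real_of_rat p \<le> of_rat q" if side using al(12) that by (simp add: of_rat_less_eq)
    have pl': "real_of_rat q' \<le> of_rat p'" if "\<not> side" using al(12) that by (simp add: of_rat_less_eq)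
    obtain r1 :: rat where r1: "A < of_rat r1" "of_rat r1 < A + L" "(if side then A - 1 else of_rat q') < real_of_rat r1" "real_of_rat r1 < of_rat p" "f (of_rat r1) \<le> \<beta> * of_rat r1 + \<gamma>0 + \<delta> / 2"
      using tch[of c1 "\<delta> / 2" "if side then A - 1 else of_rat q'" "of_rat p"] c1L m_def al(9,11,12) \<delta> by (auto split: if_splits)
    have s1: "sdq side q q' r1" "r1 \<le> p"
      using r1(3,4) pl unfolding sdq_def by (auto simp: of_rat_less of_rat_less_eq split: if_splits)
    obtain r2 :: rat where r2: "A < of_rat r2" "of_rat r2 < A + L" "of_rat p' < real_of_rat r2" "real_of_rat r2 < (if side then of_rat q else A + L + 1)" "f (of_rat r2) \<le> \<beta> * of_rat r2 + \<gamma>0 + \<delta> / 2"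
      using tch[of c2 "\<delta> / 2" "of_rat p'" "if side then of_rat q else A + L + 1"] c1L m2 al(8,10,12) \<delta> by (auto split: if_splits)
    have s2: "sdq side q q' r2" "p' \<le> r2"
      using r2(3,4) pl' unfolding sdq_def by (auto simp: of_rat_less of_rat_less_eq split: if_splits)
    have "?y (of_rat r1) \<le> \<beta> * of_rat r1 + of_rat \<gamma> + \<delta>" using y[OF r1(1) s1(1)] r1(5) \<gamma> by linarith
    moreover have "?y (of_rat r2) \<le> \<beta> * of_rat r2 + of_rat \<gamma> + \<delta>" using y[OF r2(1) s2(1)] r2(5) \<gamma> by linarith
    ultimately show ?thesis unfolding \<delta>_def[symmetric] using 1 r1(1,2) s1 r2(1,2) s2 by blast
  qed
  show ?thesis
    unfolding EV_def mem_Collect_eq fst_conv snd_conv A_def[symmetric] L_def[symmetric] \<beta>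
    using main al(2) by (simp add: space_pair_measure space_PiM)
qed

lemma cadlag_attains:
  assumes f: "cadlag f" and l: "0 < l"
  shows "\<exists>c\<in>{0..l}. \<forall>c'\<in>{0..l}. fm f c \<le> fm f c'"
proof -
  define m where "m = Inf (f ` {0..l})"
  obtain B where B: "\<And>s. s \<in> {0..l} ==> \<bar>f s\<bar> \<le> B" using cadlag_bounded[OF f] by metis
  have bd: "bdd_below (f ` {0..l})" by (rule bdd_belowI[of _ "- B"]) (use B in \<open>force simp: abs_le_iff\<close>)
  have mle: "m \<le> f s" if "s \<in> {0..l}" for s unfolding m_def using that bd by (intro cInf_lower) auto
  have "\<exists>u\<in>{0..l}. f u < m + 1 / real (Suc n)" for n
    using cInf_lessD[of "f ` {0..l}" "m + 1 / real (Suc n)"] l by (auto simp: m_def)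
  then obtain u where u: "\<And>n. u n \<in> {0..l}" "\<And>n. f (u n) < m + 1 / real (Suc n)" by metis
  obtain c r where c: "c \<in> {0..l}" "strict_mono (r :: nat => nat)" "(u \<circ> r) \<longlonglongrightarrow> c"
    using compact_Icc[of 0 l, unfolded compact_def] u(1) by blast
  have "fm f c \<le> m"
  proof (rule field_le_epsilon)
    fix e :: real assume e: "0 < e"
    have "eventually (\<lambda>n. fm f c - e / 2 < f ((u \<circ> r) n)) sequentially"
      by (rule cadlag_seq_lower[OF f _ c(3)]) (use c(1) u(1) e in auto)
    moreover have "(\<lambda>n. 1 / real (Suc n)) \<longlonglongrightarrow> 0" by (rule LIMSEQ_inverse_real_of_nat[unfolded inverse_eq_divide])
    then have "eventually (\<lambda>n. 1 / real (Suc (r n)) < e / 2) sequentially"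
      using LIMSEQ_subseq_LIMSEQ[OF _ c(2)] e by (intro order_tendstoD(2)[of _ 0]) (auto simp: o_def)
    ultimately have "eventually (\<lambda>n. fm f c \<le> m + e) sequentially"
    proof eventually_elim
      case (elim n)
      then show ?case using u(2)[of "r n"] unfolding o_def by linarith
    qed
    then show "fm f c \<le> m + e" by simp
  qed
  moreover have "m \<le> fm f s" if s: "s \<in> {0..l}" for s
  proof (cases "s = 0")
    case False
    have "m \<le> lft f s"
    proof (rule tendsto_lowerbound[OF cadlag_tendsto_left[OF f]])
      show "eventually (\<lambda>x. m \<le> f x) (at_left s)"
        using eventually_at_left_real[of 0 s] by (rule eventually_mono) (use False s mle in auto)
    qed (use False s in \<open>auto simp: trivial_limit_at_left_real\<close>)
    then show ?thesis using mle[OF s] by (simp add: fm_def)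
  qed (use mle s in simp)
  ultimately show ?thesis using c(1) by (meson order.trans)
qed

lemma cadlag_knight:
  assumes f: "cadlag f" and a: "0 \<le> a"
  shows "cadlag (knight f a l)"
proof -
  have sh: "filterlim (\<lambda>u. a + u) (at_right (a + s)) (at_right s)" "filterlim (\<lambda>u. a + u) (at_left (a + s)) (at_left s)" for s :: real
    using filtermap_at_right_shift[of "- a" s] filtermap_at_left_shift[of "- a" s] by (simp_all add: filterlim_def add.commute)
  have "(knight f a l \<longlongrightarrow> knight f a l s) (at_right s)" if "0 \<le> s" for s
    unfolding knight_slp[abs_def] using cadlag_tendsto_right[OF f, of "a + s"] a that
    by (intro tendsto_intros filterlim_compose[OF _ sh(1)]) auto
  moreover have "(knight f a l \<longlongrightarrow> lft f (a + s) - f a - s * slp f a l) (at_left s)" if "0 < s" for s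
    unfolding knight_slp[abs_def] using cadlag_tendsto_left[OF f, of "a + s"] a that
    by (intro tendsto_intros filterlim_compose[OF _ sh(2)]) auto
  ultimately show ?thesis unfolding cadlag_def continuous_within by blast
qed

lemma mins_nonempty: "cadlag f ==> 0 \<le> a ==> 0 < l ==> mins f a l \<noteq> {}"
  using cadlag_attains[OF cadlag_knight[of f a l], of l] by (auto simp: mins_def mK_def fm_def)

text \<open>The question is where a gap fits inside the stick. If \<open>c2 < l\<close>, it goes to
  the right of both minima. If \<open>c2 = l\<close>, \<open>c1 > 0\<close> and the minimum at
  \<open>l\<close> is a left limit, it goes to the left of both. If the minimum at \<open>l\<close>
  is the value of the bridge, that value is 0, so 0 is a minimum too, and the pair of 0 and
  \<open>c1\<close> is of the first kind.\<close>

lemma mins_unique: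
  assumes f: "cadlag f" and a: "0 \<le> stick_S t v i" and l: "0 < stick_L t v i"
    and noEV: "\<And>side p p' q q'. p < p' ==> 0 \<le> q ==> q < q' ==>
      ((f (of_rat q') - f (of_rat q), ypath (of_rat q) (of_rat q') f), v) \<notin> EV t i side p p' q q'"
    and c: "c1 \<in> mins f (stick_S t v i) (stick_L t v i)" "c2 \<in> mins f (stick_S t v i) (stick_L t v i)" "c1 < c2"
  shows "c1 = 0 \<and> c2 = stick_L t v i"
proof -
  let ?a = "stick_S t v i" and ?l = "stick_L t v i"
  have ml: "c \<in> mins f ?a ?l ==> 0 \<le> c \<and> c \<le> ?l" for c by (auto simp: mins_def)
  have I: False if c: "c1 \<in> mins f ?a ?l" "c2 \<in> mins f ?a ?l" "c1 < c2" "c2 < ?l" for c1 c2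
  proof -
    obtain p where p: "?a + c1 < of_rat p" "of_rat p < ?a + c2" using of_rat_dense[of "?a + c1" "?a + c2"] c by auto
    obtain p' where p': "of_rat p < real_of_rat p'" "of_rat p' < ?a + c2" using of_rat_dense[OF p(2)] by blast
    obtain q where q: "?a + c2 < of_rat q" "of_rat q < ?a + ?l" using of_rat_dense[of "?a + c2" "?a + ?l"] c by auto
    obtain q' where q': "of_rat q < real_of_rat q'" "of_rat q' < ?a + ?l" using of_rat_dense[OF q(2)] by blast
    have r: "real_of_rat 0 \<le> of_rat q" "real_of_rat p \<le> of_rat q" using p q a ml[OF c(2)] unfolding of_rat_0 by linarith+
    note o = r(1)[unfolded of_rat_less_eq] q'(1)[unfolded of_rat_less] r(2)[unfolded of_rat_less_eq] p'(1)[unfolded of_rat_less]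
    have b: "?a < of_rat q" "0 < c2" "c1 < ?l" using q c ml[OF c(1)] ml[OF c(2)] by linarith+
    show False
      using EV_intro[OF f a l o(1,2) b(1) q'(2) c(1,2) b(2) disjI1[OF c(4)] p(1) p'(2) b(3), of True] o(3) q(1) noEV[OF o(4,1,2), of True] by auto
  qed
  have "c2 = ?l"
    using I[OF c] ml[OF c(2)] by (cases "c2 < ?l") auto
  moreover have "c1 = 0"
  proof (rule ccontr)
    assume "c1 \<noteq> 0"
    then have c1: "0 < c1" using ml[OF c(1)] by simp
    have c1l: "c1 < ?l" using c \<open>c2 = ?l\<close> by simp
    show False
    proof (cases "mK f ?a ?l c2 = lft (knight f ?a ?l) c2")
      case True
      obtain q where q: "?a < of_rat q" "of_rat q < ?a + c1" using of_rat_dense[of "?a" "?a + c1"] c1 by auto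
      obtain q' where q': "of_rat q < real_of_rat q'" "of_rat q' < ?a + c1" using of_rat_dense[OF q(2)] by blast
      obtain p where p: "?a + c1 < of_rat p" "of_rat p < ?a + c2" using of_rat_dense[of "?a + c1" "?a + c2"] c by auto
      obtain p' where p': "of_rat p < real_of_rat p'" "of_rat p' < ?a + c2" using of_rat_dense[OF p(2)] by blast
      have r: "real_of_rat 0 \<le> of_rat q" "real_of_rat q' \<le> of_rat p'" using p p' q q' a unfolding of_rat_0 by linarith+
      note o = r(1)[unfolded of_rat_less_eq] q'(1)[unfolded of_rat_less] r(2)[unfolded of_rat_less_eq] p'(1)[unfolded of_rat_less]
      have b: "of_rat q' < ?a + ?l" "0 < c2" using q' c1 c1l c by linarith+
      show False
        using EV_intro[OF f a l o(1,2) q(1) b(1) c(1,2) b(2) disjI2[OF True] p(1) p'(2) c1l, of False] o(3) q'(2) noEV[OF o(4,1,2), of False] by auto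
    next
      case False
      then have "mK f ?a ?l c2 = 0" using \<open>c2 = ?l\<close> l by (auto simp: mK_def min_def knight_def split: if_splits)
      then have "0 \<in> mins f ?a ?l" using c(2) l by (auto simp: mins_def)
      then show False using I[OF _ c(1) c1 c1l] by simp
    qed
  qed
  ultimately show ?thesis by simp
qed

section \<open>The path together with an independent i.i.d. sequence\<close>

locale levy_seq = levy_setup M X t for M :: "'a measure" and X t +
  fixes W :: "nat => 'a => real" and \<rho> :: "real measure"
  assumes W_meas [measurable]: "\<And>i. W i \<in> borel_measurable M"
    and W_iid: "indep_vars (\<lambda>_. borel) W UNIV"
    and W_law: "\<And>i. distr M borel (W i) = \<rho>"
    and W_indep: "\<And>A B. A \<in> sets (PiM (UNIV :: real set) (\<lambda>_. borel)) ==> B \<in> sets (PiM (UNIV :: nat set) (\<lambda>_. borel)) ==>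
      measure M {\<omega> \<in> space M. (\<lambda>s. X s \<omega>) \<in> A \<and> (\<lambda>n. W n \<omega>) \<in> B} =
      measure M {\<omega> \<in> space M. (\<lambda>s. X s \<omega>) \<in> A} * measure M {\<omega> \<in> space M. (\<lambda>n. W n \<omega>) \<in> B}"
begin

abbreviation Ws :: "'a => nat => real" where "Ws \<omega> \<equiv> (\<lambda>n. W n \<omega>)"

lemma Ws_measurable [measurable]: "Ws \<in> measurable M PiB"
  by (rule measurable_PiM_single') (auto simp: space_PiM)

lemma Ws_law: "distr M PiB Ws = PiM UNIV (\<lambda>_. \<rho>)"
proof -
  have "distr M PiB (\<lambda>\<omega>. \<lambda>i\<in>UNIV. W i \<omega>) = PiM UNIV (\<lambda>i. distr M borel (W i))"
    using indep_vars_iff_distr_eq_PiM[where I = UNIV and X = W and M' = "\<lambda>_. borel"] W_iid by simp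
  then show ?thesis by (simp add: W_law restrict_def)
qed

lemma joint_law:
  assumes g: "g \<in> measurable (PiM (UNIV :: real set) (\<lambda>_. borel)) N1"
  shows "distr M (N1 \<Otimes>\<^sub>M PiB) (\<lambda>\<omega>. (g (path \<omega>), Ws \<omega>)) = distr M N1 (\<lambda>\<omega>. g (path \<omega>)) \<Otimes>\<^sub>M PiM UNIV (\<lambda>_. \<rho>)"
proof -
  have [measurable]: "(\<lambda>\<omega>. g (path \<omega>)) \<in> measurable M N1" by (rule measurable_compose[OF path_measurable g])
  show ?thesis unfolding Ws_law[symmetric]
  proof (rule indep_pair_distr)
    fix A :: "'b set" and B :: "(nat => real) set"
    assume A: "A \<in> sets N1" and B: "B \<in> sets PiB"
    have "g -` A \<in> sets PiB" using measurable_sets[OF g A] by (simp add: space_PiM)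
    from W_indep[OF this B] show "measure M {\<omega>\<in>space M. g (path \<omega>) \<in> A \<and> Ws \<omega> \<in> B} =
      measure M {\<omega>\<in>space M. g (path \<omega>) \<in> A} * measure M {\<omega>\<in>space M. Ws \<omega> \<in> B}" by simp
  qed measurable
qed

lemma incr_joint_law:
  assumes "0 < n"
  shows "distr M (PiB \<Otimes>\<^sub>M PiB) (\<lambda>\<omega>. (incr (path \<omega>) t n, Ws \<omega>)) =
    PiM UNIV (\<lambda>_. distr M borel (X (t / real n))) \<Otimes>\<^sub>M PiM UNIV (\<lambda>_. \<rho>)"
proof -
  have "(\<lambda>f. incr f t n) \<in> measurable (PiM (UNIV :: real set) (\<lambda>_. borel)) PiB"
    unfolding incr_def[abs_def] samp_def by (rule measurable_PiM_single') (auto simp: space_PiM)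
  from joint_law[OF this] show ?thesis by (simp add: incr_law[OF assms])
qed

lemma AE_mins_unique:
  "AE \<omega> in M. \<forall>i. 0 \<le> stick_S t (Ws \<omega>) i --> 0 < stick_L t (Ws \<omega>) i -->
    (\<forall>c1 c2. c1 \<in> mins (path \<omega>) (stick_S t (Ws \<omega>) i) (stick_L t (Ws \<omega>) i) --> c2 \<in> mins (path \<omega>) (stick_S t (Ws \<omega>) i) (stick_L t (Ws \<omega>) i) -->
      c1 < c2 --> c1 = 0 \<and> c2 = stick_L t (Ws \<omega>) i)"
proof -
  have "AE \<omega> in M. ((X (of_rat q') \<omega> - X (of_rat q) \<omega>, ypath (of_rat q) (of_rat q') (path \<omega>)), Ws \<omega>) \<notin> EV t i side p p' q q'"
    if o: "p < p'" "0 \<le> q" "q < q'" for i side p p' q q'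
  proof (rule AE_diffuse_section2)
    have qq: "0 \<le> real_of_rat q" "real_of_rat q < of_rat q'" using o by (simp_all add: of_rat_less)
    show "distr M (borel \<Otimes>\<^sub>M PiB) (\<lambda>\<omega>. (X (of_rat q') \<omega> - X (of_rat q) \<omega>, ypath (of_rat q) (of_rat q') (path \<omega>))) =
      distr M borel (\<lambda>\<omega>. X (of_rat q') \<omega> - X (of_rat q) \<omega>) \<Otimes>\<^sub>M distr M PiB (\<lambda>\<omega>. ypath (of_rat q) (of_rat q') (path \<omega>))"
      by (rule gap_law[OF qq])
    show "distr M ((borel \<Otimes>\<^sub>M PiB) \<Otimes>\<^sub>M PiB)
        (\<lambda>\<omega>. ((X (of_rat q') \<omega> - X (of_rat q) \<omega>, ypath (of_rat q) (of_rat q') (path \<omega>)), Ws \<omega>)) =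
      distr M (borel \<Otimes>\<^sub>M PiB) (\<lambda>\<omega>. (X (of_rat q') \<omega> - X (of_rat q) \<omega>, ypath (of_rat q) (of_rat q') (path \<omega>))) \<Otimes>\<^sub>M
      distr M PiB Ws"
      unfolding Ws_law by (rule joint_law[where g = "\<lambda>f. (f (of_rat q') - f (of_rat q), ypath (of_rat q) (of_rat q') f)"]) measurable
    show "EV t i side p p' q q' \<in> sets ((borel \<Otimes>\<^sub>M PiB) \<Otimes>\<^sub>M PiB)" by (rule EV_sets)
    show "prob {\<omega> \<in> space M. X (of_rat q') \<omega> - X (of_rat q) \<omega> = x} = 0" for x by (rule incr_diffuse[OF qq])
    show "d = d'" if "((d, y), w) \<in> EV t i side p p' q q'" "((d', y), w) \<in> EV t i side p p' q q'" for d d' y w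
      by (rule EV_section[OF that o(1)])
  qed measurable
  then have "AE \<omega> in M. \<forall>i side p p' q q'. p < p' --> 0 \<le> q --> q < q' -->
     ((X (of_rat q') \<omega> - X (of_rat q) \<omega>, ypath (of_rat q) (of_rat q') (path \<omega>)), Ws \<omega>) \<notin> EV t i side p p' q q'"
    by (simp add: AE_all_countable)
  then show ?thesis using AE_space
  proof eventually_elim
    case (elim \<omega>)
    show ?case
    proof (intro allI impI)
      fix i c1 c2
      assume h: "0 \<le> stick_S t (Ws \<omega>) i" "0 < stick_L t (Ws \<omega>) i"
        "c1 \<in> mins (path \<omega>) (stick_S t (Ws \<omega>) i) (stick_L t (Ws \<omega>) i)" "c2 \<in> mins (path \<omega>) (stick_S t (Ws \<omega>) i) (stick_L t (Ws \<omega>) i)" "c1 < c2"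
      show "c1 = 0 \<and> c2 = stick_L t (Ws \<omega>) i"
        by (rule mins_unique[OF X_cadlag[OF elim(2)] h(1,2) _ h(3-5)]) (use elim(1) in blast)
    qed
  qed
qed

end

section \<open>Tightness of the discrete faces\<close>

lemma full_reg:
  assumes full: "full w n" and n: "0 < n" and t: "0 < t" and u: "0 \<le> u" "u < t"
  shows "\<exists>p\<in>faces w n. u \<in> reg t n p"
proof -
  define l where "l = nat \<lfloor>u * real n / t\<rfloor>"
  have l: "real l \<le> u * real n / t" "u * real n / t < real l + 1" unfolding l_def using u t by (auto simp: floor_less_iff)
  have "u * real n / t < real n" using u t n by (simp add: field_simps)
  then have "real l < real n" using l by linarith
  then have "l < n" by simp
  then obtain i k where p: "(i, k) \<in> faces w n" "i \<le> l" "l < i + k" 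
  proof -
    have "l \<in> (\<Union>(i, k)\<in>faces w n. {i..<i + k})" unfolding full_cover[OF full] using \<open>l < n\<close> by simp
    then show ?thesis using that by auto
  qed
  have "gp t n i \<le> u"
  proof -
    have "real i \<le> u * real n / t" using l p by linarith
    then have "real i * t \<le> u * real n" using t by (simp only: pos_le_divide_eq)
    then show ?thesis using n by (simp add: pos_divide_le_eq)
  qed
  moreover have "u < gp t n (i + k)"
  proof -
    have "real l + 1 \<le> real (i + k)" using p(3) by linarith
    then have "u * real n / t < real (i + k)" using l by linarith
    then have "u * real n < real (i + k) * t" using t by (simp only: pos_divide_less_eq)
    then show ?thesis using n by (simp only: pos_less_divide_eq of_nat_0_less_iff)
  qed
  ultimately show ?thesis using p(1) by (intro bexI[of _ "(i, k)"]) (auto simp: reg_def)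
qed

definition badreg :: "real => real => nat => nat \<times> nat => real set" where
  "badreg t \<epsilon> n p = {u \<in> reg t n p. \<not> (fg t n p \<le> u - \<epsilon> \<and> u + \<epsilon> \<le> fd t n p)}"

lemma badreg_sets [measurable]: "badreg t \<epsilon> n p \<in> sets borel"
proof -
  have "badreg t \<epsilon> n p = {fg t n p..<fd t n p} - {fg t n p + \<epsilon>..fd t n p - \<epsilon>}"
    by (auto simp: badreg_def reg_eq)
  then show ?thesis by simp
qed

text \<open>A region has mass \<open>k / n\<close>, and its points near an end have mass at most
  \<open>2 * \<epsilon> / t\<close>. The smaller bound is written as \<open>k\<close> times a
  function of \<open>k\<close>, the form that \<open>nn_integral_faces\<close> sums over
  faces.\<close>

lemma uniform_badreg:
  assumes t: "0 < t" and n: "0 < n" and k: "0 < k" "i + k \<le> n" and \<epsilon>: "0 < \<epsilon>"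
  shows "emeasure (unif t) (badreg t \<epsilon> n (i, k)) \<le> ennreal (real k * (min 1 (2 * \<epsilon> * real n / t / real k) / real n))"
proof -
  let ?B = "badreg t \<epsilon> n (i, k)" and ?g = "fg t n (i, k)" and ?d = "fd t n (i, k)"
  have "emeasure (unif t) ?B \<le> emeasure (unif t) (reg t n (i, k))"
    by (rule emeasure_mono) (auto simp: badreg_def reg_def)
  then have 1: "emeasure (unif t) ?B \<le> ennreal (real k / real n)"
    using emeasure_uniform_reg[OF t n k(2)] by simp
  have "emeasure lborel ({0<..<t} \<inter> ?B) \<le> emeasure lborel ({?g..?g + \<epsilon>} \<union> {?d - \<epsilon>..?d})"
    by (rule emeasure_mono) (auto simp: badreg_def reg_eq)
  also have "\<dots> \<le> emeasure lborel {?g..?g + \<epsilon>} + emeasure lborel {?d - \<epsilon>..?d}"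
    by (rule emeasure_subadditive) auto
  also have "\<dots> = ennreal (2 * \<epsilon>)" using \<epsilon> by (simp flip: ennreal_plus)
  finally have "emeasure (unif t) ?B \<le> ennreal (2 * \<epsilon>) / ennreal t"
    using t by (subst emeasure_uniform_measure) (auto simp: divide_right_mono_ennreal)
  then have 2: "emeasure (unif t) ?B \<le> ennreal (2 * \<epsilon> / t)"
    using t \<epsilon> by (simp add: divide_ennreal)
  have "emeasure (unif t) ?B \<le> ennreal (min (real k / real n) (2 * \<epsilon> / t))"
    using 1 2 by (simp add: min_def)
  also have "min (real k / real n) (2 * \<epsilon> / t) = real k * (min 1 (2 * \<epsilon> * real n / t / real k) / real n)"
  proof -
    define x where "x = 2 * \<epsilon> * real n / t / real k"
    define K where "K = real k / real n"
    have K: "0 < K" using k n by (simp add: K_def)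
    have e: "2 * \<epsilon> / t = x * K" using k n by (simp add: x_def K_def)
    have "min K (x * K) = min 1 x * K"
    proof (cases "1 \<le> x")
      case True
      then show ?thesis using K by (simp add: min_absorb1)
    next
      case False
      then show ?thesis using K by (simp add: min_absorb2)
    qed
    then show ?thesis unfolding e K_def[symmetric] x_def[symmetric] by (simp add: K_def)
  qed
  finally show ?thesis .
qed

lemma sum_inverse_sqrt_le: "(\<Sum>k=1..n. 1 / sqrt (real k)) \<le> 2 * sqrt (real n)"
proof (induction n)
  case (Suc n)
  have "1 / sqrt (real (Suc n)) \<le> 2 * sqrt (real (Suc n)) - 2 * sqrt (real n)"
  proof -
    define a b where "a = sqrt (real (Suc n))" and "b = sqrt (real n)"
    have ab: "0 < a" "0 \<le> b" "b \<le> a" "a * a = b * b + 1" by (simp_all add: a_def b_def del: of_nat_Suc)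
    have "1 = (a - b) * (a + b)" using ab(4) by (simp add: algebra_simps)
    also have "\<dots> \<le> (a - b) * (2 * a)" using ab by (intro mult_left_mono) auto
    finally show ?thesis unfolding a_def[symmetric] b_def[symmetric] using ab(1) by (simp add: field_simps)
  qed
  then show ?case using Suc by simp
qed simp

context diffuse_law begin

lemma nn_integral_xrot_const:
  assumes "0 < k" shows "(\<integral>\<^sup>+\<omega>. xrot k (\<lambda>k _. c k) \<omega> \<partial>\<mu>) = c k"
proof -
  have "AE \<omega> in \<mu>. xrot k (\<lambda>k _. c k) \<omega> = c k"
    using AE_unique_rot[OF assms]
  proof eventually_elim
    case (elim \<omega>)
    then obtain r where r: "r < k" "exc k (rot r k \<omega>)" "\<And>r'. r' < k ==> exc k (rot r' k \<omega>) ==> r' = r" by blast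
    have "xrot k (\<lambda>k _. c k) \<omega> = (\<Sum>r'<k. if r' = r then c k else 0)"
      unfolding xrot_def
    proof (intro sum.cong refl if_cong)
      fix r' assume "r' \<in> {..<k}"
      then show "exc k (rot r' k \<omega>) \<longleftrightarrow> r' = r" using r(2) r(3)[of r'] by blast
    qed
    then show ?case using r(1) by simp
  qed
  then have "(\<integral>\<^sup>+\<omega>. xrot k (\<lambda>k _. c k) \<omega> \<partial>\<mu>) = (\<integral>\<^sup>+\<omega>. c k \<partial>\<mu>)" by (rule nn_integral_cong_AE)
  then show ?thesis by simp
qed

text \<open>For every \<open>k\<close> in {1..n} the mean number of faces of length
  \<open>k\<close>, weighted by \<open>k\<close>, is 1, which leaves a deterministic sum over
  \<open>k\<close>. The estimate of \<open>min 1 x\<close> by \<open>sqrt x\<close> is crude but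
  avoids a logarithm, and its bound depends on \<open>c / n\<close> alone.\<close>

lemma faces_tight:
  assumes n: "0 < n" and c: "0 < c"
  shows "(\<integral>\<^sup>+\<omega>. (\<Sum>(i, k)\<in>faces (walk \<omega>) n. ennreal (real k * (min 1 (c / real k) / real n))) \<partial>\<mu>) \<le> ennreal (2 * sqrt (c / real n))"
proof -
  define h where "h k = min 1 (c / real k) / real n" for k :: nat
  have h0: "0 \<le> h k" for k using c by (simp add: h_def)
  have "(\<integral>\<^sup>+\<omega>. (\<Sum>(i, k)\<in>faces (walk \<omega>) n. ennreal (real k * h k)) \<partial>\<mu>) =
    (\<integral>\<^sup>+\<omega>. (\<Sum>(i, k)\<in>faces (walk \<omega>) n. of_nat k * ennreal (h k) * 1) \<partial>\<mu>)"
    by (simp add: ennreal_mult h0 flip: ennreal_of_nat_eq_real_of_nat)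
  also have "\<dots> = (\<Sum>k=1..n. (\<integral>\<^sup>+\<omega>. xrot k (\<lambda>k _. ennreal (h k)) \<omega> \<partial>\<mu>) * (\<integral>\<^sup>+\<omega>. 1 \<partial>\<mu>))"
    by (rule nn_integral_faces[of "\<lambda>k _. ennreal (h k)" "\<lambda>_ _. 1"]) (auto simp: block_fun_def dep_def)
  also have "\<dots> = (\<Sum>k=1..n. ennreal (h k))"
    by (intro sum.cong refl) (simp add: nn_integral_xrot_const)
  also have "\<dots> = ennreal (\<Sum>k=1..n. h k)" by (simp add: h0)
  also have "\<dots> \<le> ennreal (2 * sqrt (c / real n))"
  proof (rule ennreal_leI)
    have "h k \<le> sqrt c / real n * (1 / sqrt (real k))" if "k \<in> {1..n}" for k
    proof -
      have "min 1 (c / real k) \<le> sqrt (c / real k)"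
      proof (cases "c / real k \<le> 1")
        case True
        then have "sqrt (c / real k) * sqrt (c / real k) \<le> sqrt (c / real k) * 1" using c by (intro mult_left_mono) auto
        moreover have "sqrt (c / real k) * sqrt (c / real k) = c / real k" using c by simp
        ultimately show ?thesis by linarith
      next
        case False
        then show ?thesis by simp
      qed
      then have "h k \<le> sqrt (c / real k) / real n" unfolding h_def by (rule divide_right_mono) simp
      also have "\<dots> = sqrt c / real n * (1 / sqrt (real k))" by (simp add: real_sqrt_divide)
      finally show ?thesis .
    qed
    then have "(\<Sum>k=1..n. h k) \<le> (\<Sum>k=1..n. sqrt c / real n * (1 / sqrt (real k)))" by (rule sum_mono)
    also have "\<dots> = sqrt c / real n * (\<Sum>k=1..n. 1 / sqrt (real k))" by (simp add: sum_distrib_left)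
    also have "\<dots> \<le> sqrt c / real n * (2 * sqrt (real n))" using c by (intro mult_left_mono sum_inverse_sqrt_le) auto
    also have "\<dots> = 2 * sqrt (c / real n)"
      using n by (simp add: real_sqrt_divide field_simps)
    finally show "(\<Sum>k=1..n. h k) \<le> 2 * sqrt (c / real n)" .
  qed
  finally show ?thesis unfolding h_def .
qed

end

context levy_seq begin

lemma AE_incr:
  assumes "AE \<omega> in PiM UNIV (\<lambda>_. distr M borel (X (t / real (Suc n)))). P \<omega>"
  shows "AE \<omega> in M. P (incr (path \<omega>) t (Suc n))"
  using assms unfolding incr_law[OF zero_less_Suc, symmetric] by (rule AE_distrD[rotated]) measurable

text \<open>Fubini over the sampling point for a fixed walk, then \<open>faces_tight\<close> with
  \<open>c = 2 * \<epsilon> * n / t\<close>; as \<open>c / n\<close> is free of \<open>n\<close>,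
  the bound is uniform in the grid.\<close>

lemma emeasure_badreg:
  fixes j n :: nat
  assumes \<rho>: "\<rho> = unif t" and \<epsilon>: "0 < \<epsilon>"
  defines "B \<equiv> {\<omega>\<in>space M. \<exists>p\<in>faces (walk (incr (path \<omega>) t (Suc n))) (Suc n). W j \<omega> \<in> badreg t \<epsilon> (Suc n) p}"
  shows "B \<in> sets M" "emeasure M B \<le> ennreal (2 * sqrt (2 * \<epsilon> / t))"
proof -
  let ?N = "Suc n"
  interpret D: diffuse_law "distr M borel (X (t / real ?N))" by (rule diffuse_law_X) (use tpos in simp)
  interpret R: prob_space \<rho> unfolding W_law[of 0, symmetric] by (rule prob_space_distr) simp
  interpret PR: product_prob_space "\<lambda>_::nat. \<rho>" UNIV ..
  let ?P = "D.\<mu> \<Otimes>\<^sub>M PiM UNIV (\<lambda>_::nat. \<rho>)"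
  define E where "E = {z \<in> space ?P. \<exists>p\<in>{..?N}\<times>{..?N}. p \<in> faces (walk (fst z)) ?N \<and> snd z j \<in> badreg t \<epsilon> ?N p}"
  have fs: "p \<in> faces w ?N ==> p \<in> {..?N} \<times> {..?N}" for p w by (auto simp: faces_def)
  have sr: "sets \<rho> = sets borel" by (simp add: \<rho>)
  have [measurable]: "(\<lambda>z. snd z j) \<in> borel_measurable ?P"
    using measurable_component_singleton[of j UNIV "\<lambda>_. \<rho>"] sr by (intro measurable_compose[OF measurable_snd]) (simp cong: measurable_cong_sets)
  have [measurable]: "Measurable.pred ?P (\<lambda>z. p \<in> faces (walk (fst z)) ?N)" for p
    using measurable_compose[OF measurable_fst D.faces_measurable[of "fst p" "snd p" ?N]] by simp
  have E: "E \<in> sets ?P" unfolding E_def by measurable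
  have joint: "distr M (PiB \<Otimes>\<^sub>M PiB) (\<lambda>\<omega>. (incr (path \<omega>) t ?N, Ws \<omega>)) = ?P"
    by (rule incr_joint_law) simp
  have sp: "sets (PiB \<Otimes>\<^sub>M PiB) = sets ?P" using arg_cong[OF joint, of sets] by simp
  have BE: "B = (\<lambda>\<omega>. (incr (path \<omega>) t ?N, Ws \<omega>)) -` E \<inter> space M"
  proof -
    have "(\<exists>p\<in>faces w ?N. x \<in> badreg t \<epsilon> ?N p) \<longleftrightarrow> (\<exists>p\<in>{..?N}\<times>{..?N}. p \<in> faces w ?N \<and> x \<in> badreg t \<epsilon> ?N p)" for x w
      using fs by blast
    moreover have "space ?P = UNIV" by (simp add: space_pair_measure space_PiM \<rho>)
    ultimately show ?thesis by (auto simp: B_def E_def)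
  qed
  have m: "(\<lambda>\<omega>. (incr (path \<omega>) t ?N, Ws \<omega>)) \<in> measurable M (PiB \<Otimes>\<^sub>M PiB)" by measurable
  show "B \<in> sets M" unfolding BE using E by (intro measurable_sets[OF m]) (simp add: sp)
  have "emeasure M B = emeasure ?P E" unfolding joint[symmetric] BE using E by (subst emeasure_distr[OF m]) (auto simp: sp)
  also have "\<dots> = (\<integral>\<^sup>+\<omega>. emeasure (PiM UNIV (\<lambda>_. \<rho>)) (Pair \<omega> -` E) \<partial>D.\<mu>)"
    using E by (rule PR.emeasure_pair_measure_alt)
  also have "\<dots> \<le> (\<integral>\<^sup>+\<omega>. (\<Sum>(i, k)\<in>faces (walk \<omega>) ?N. ennreal (real k * (min 1 (2 * \<epsilon> * real ?N / t / real k) / real ?N))) \<partial>D.\<mu>)"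
  proof (rule nn_integral_mono)
    fix \<omega>
    have c: "emeasure (PiM UNIV (\<lambda>_. \<rho>)) {u \<in> space (PiM UNIV (\<lambda>_. \<rho>)). u j \<in> S} = emeasure \<rho> S" if "S \<in> sets borel" for S
      using PR.emeasure_PiM_Collect_single[of j S] that by (simp add: sr)
    have bs: "{u \<in> space (PiM UNIV (\<lambda>_. \<rho>)). u j \<in> badreg t \<epsilon> ?N p} \<in> sets (PiM UNIV (\<lambda>_. \<rho>))" for p
    proof -
      have "(\<lambda>u. u j) -` badreg t \<epsilon> ?N p \<inter> space (PiM UNIV (\<lambda>_. \<rho>)) \<in> sets (PiM UNIV (\<lambda>_. \<rho>))"
        by (rule measurable_sets[OF measurable_component_singleton]) (simp_all add: sr badreg_sets)
      moreover have "{u \<in> space (PiM UNIV (\<lambda>_. \<rho>)). u j \<in> badreg t \<epsilon> ?N p} = (\<lambda>u. u j) -` badreg t \<epsilon> ?N p \<inter> space (PiM UNIV (\<lambda>_. \<rho>))" by auto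
      ultimately show ?thesis by simp
    qed
    have "emeasure (PiM UNIV (\<lambda>_. \<rho>)) (Pair \<omega> -` E) \<le>
      emeasure (PiM UNIV (\<lambda>_. \<rho>)) (\<Union>p\<in>faces (walk \<omega>) ?N. {u \<in> space (PiM UNIV (\<lambda>_. \<rho>)). u j \<in> badreg t \<epsilon> ?N p})"
      by (rule emeasure_mono) (use bs in \<open>auto simp: E_def space_pair_measure intro!: sets.finite_UN\<close>)
    also have "\<dots> \<le> (\<Sum>p\<in>faces (walk \<omega>) ?N. emeasure (PiM UNIV (\<lambda>_. \<rho>)) {u \<in> space (PiM UNIV (\<lambda>_. \<rho>)). u j \<in> badreg t \<epsilon> ?N p})"
      using bs by (intro emeasure_subadditive_finite) auto
    also have "\<dots> = (\<Sum>p\<in>faces (walk \<omega>) ?N. emeasure \<rho> (badreg t \<epsilon> ?N p))" using c by (intro sum.cong) auto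
    also have "\<dots> \<le> (\<Sum>(i, k)\<in>faces (walk \<omega>) ?N. ennreal (real k * (min 1 (2 * \<epsilon> * real ?N / t / real k) / real ?N)))"
    proof (rule sum_mono, clarify)
      fix i k assume "(i, k) \<in> faces (walk \<omega>) ?N"
      then have "0 < k" "i + k \<le> ?N" by (auto simp: faces_def)
      then show "emeasure \<rho> (badreg t \<epsilon> ?N (i, k)) \<le> ennreal (real k * (min 1 (2 * \<epsilon> * real ?N / t / real k) / real ?N))"
        unfolding \<rho> by (intro uniform_badreg tpos \<epsilon>) auto
    qed
    finally show "emeasure (PiM UNIV (\<lambda>_. \<rho>)) (Pair \<omega> -` E) \<le>
      (\<Sum>(i, k)\<in>faces (walk \<omega>) ?N. ennreal (real k * (min 1 (2 * \<epsilon> * real ?N / t / real k) / real ?N)))" .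
  qed
  also have "\<dots> \<le> ennreal (2 * sqrt (2 * \<epsilon> * real ?N / t / real ?N))"
    using tpos \<epsilon> by (intro D.faces_tight) auto
  also have "2 * \<epsilon> * real ?N / t / real ?N = 2 * \<epsilon> / t" by simp
  finally show "emeasure M B \<le> ennreal (2 * sqrt (2 * \<epsilon> / t))" .
qed

lemma AE_W_range:
  assumes \<rho>: "\<rho> = unif T" and T: "0 < T"
  shows "AE \<omega> in M. \<forall>j. 0 < W j \<omega> \<and> W j \<omega> < T"
proof -
  have "AE \<omega> in M. W j \<omega> \<in> {0<..<T}" for j
  proof -
    have "AE x in \<rho>. x \<in> {0<..<T}" unfolding \<rho> by (rule AE_uniform_measureI) auto
    then show ?thesis unfolding W_law[of j, symmetric] by (rule AE_distrD[rotated]) simp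
  qed
  then show ?thesis by (simp add: AE_all_countable)
qed

lemma AE_full_incr: "AE \<omega> in M. \<forall>n. full (walk (incr (path \<omega>) t (Suc n))) (Suc n)"
proof -
  have "AE \<omega> in M. full (walk (incr (path \<omega>) t (Suc n))) (Suc n)" for n
  proof -
    interpret D: diffuse_law "distr M borel (X (t / real (Suc n)))" by (rule diffuse_law_X) (use tpos in simp)
    show ?thesis by (rule AE_incr[OF D.AE_full])
  qed
  then show ?thesis by (simp add: AE_all_countable)
qed

text \<open>With \<open>\<epsilon> = 1 / real (Suc m)\<close> the probability of being near an end
  of the face for all large \<open>n\<close> tends to 0 in \<open>m\<close>. So for some
  \<open>m\<close> the point is well inside its face for infinitely many \<open>n\<close>, and
  \<open>touchI_subseq\<close> applies.\<close>

lemma AE_touch: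
  assumes \<rho>: "\<rho> = unif t"
  shows "AE \<omega> in M. \<forall>j. \<exists>a b g d. touch (path \<omega>) t a b g d \<and> g < W j \<omega> \<and> W j \<omega> < d"
proof -
  define B where "B j m n = {\<omega>\<in>space M. \<exists>p\<in>faces (walk (incr (path \<omega>) t (Suc n))) (Suc n). W j \<omega> \<in> badreg t (1 / real (Suc m)) (Suc n) p}" for j m n
  have "AE \<omega> in M. \<exists>m. frequently (\<lambda>n. \<omega> \<notin> B j m n) sequentially" for j
  proof (rule AE_frequently_not)
    show "B j m n \<in> sets M" "emeasure M (B j m n) \<le> ennreal (2 * sqrt (2 * (1 / real (Suc m)) / t))" for m n
      unfolding B_def by (rule emeasure_badreg[OF \<rho>]; simp)+
    have "(\<lambda>m. 2 * sqrt (2 * (1 / real (Suc m)) / t)) \<longlonglongrightarrow> 2 * sqrt (2 * 0 / t)"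
      by (intro tendsto_intros LIMSEQ_inverse_real_of_nat[unfolded inverse_eq_divide]) (use tpos in simp)
    then show "(\<lambda>m. 2 * sqrt (2 * (1 / real (Suc m)) / t)) \<longlonglongrightarrow> 0" by simp
  qed
  then have "AE \<omega> in M. \<forall>j. \<exists>m. frequently (\<lambda>n. \<omega> \<notin> B j m n) sequentially" by (simp add: AE_all_countable)
  with AE_full_incr AE_W_range[OF \<rho> tpos] AE_no_three_contacts AE_space show ?thesis
  proof eventually_elim
    case (elim \<omega>)
    show ?case
    proof
      fix j
      have f0: "path \<omega> 0 = 0" by (rule X_0[OF elim(4)])
      have u: "0 < W j \<omega>" "W j \<omega> < t" using elim(2) by auto
      have "\<exists>p\<in>faces (walk (incr (path \<omega>) t (Suc n))) (Suc n). W j \<omega> \<in> reg t (Suc n) p" for n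
        by (rule full_reg) (use elim(1) u tpos in auto)
      then obtain p where p: "\<And>n. p n \<in> faces (walk (incr (path \<omega>) t (Suc n))) (Suc n)" "\<And>n. W j \<omega> \<in> reg t (Suc n) (p n)" by metis
      obtain m where m: "frequently (\<lambda>n. \<omega> \<notin> B j m n) sequentially" using elim(5) by blast
      have fr: "frequently (\<lambda>n. fg t (Suc n) (p n) \<le> W j \<omega> - 1 / real (Suc m) \<and> W j \<omega> + 1 / real (Suc m) \<le> fd t (Suc n) (p n)) sequentially"
        by (rule frequently_elim1[OF m]) (use p elim(4) in \<open>force simp: B_def badreg_def\<close>)
      show "\<exists>a b g d. touch (path \<omega>) t a b g d \<and> g < W j \<omega> \<and> W j \<omega> < d"
        by (rule touchI_subseq[OF X_cadlag[OF elim(4)] tpos u _ p(1)[unfolded faces_incr[of "path \<omega>", OF f0]] p(2) fr])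
          (simp, use elim(3)[rule_format] in blast)
    qed
  qed
qed

end

section \<open>Passage to the limit\<close>

text \<open>Terms before \<open>j\<close> vanish because those points lie outside the regions of
  \<open>S\<close>; terms after \<open>j\<close> vanish because the product contains the factor of
  \<open>u j\<close>.\<close>

lemma sval_step:
  assumes S: "disjoint_family_on Rg S0" "S \<subseteq> S0" "finite S" and P: "\<And>j. P j \<in> S0" "\<And>j. u j \<in> Rg (P j)"
    and j: "P j \<in> S" "\<And>j'. j' < j ==> P j' \<notin> S"
  shows "sval Rg (f # fs) S u = f (P j) * sval Rg fs (S - {P j}) u"
proof -
  have mem: "u i \<in> Rg p \<longleftrightarrow> p = P i" if "p \<in> S" for p i
    using S(1,2) P[of i] that by (auto simp: disjoint_family_on_def)
  have un: "u i \<in> (\<Union>q\<in>S. Rg q) \<longleftrightarrow> P i \<in> S" for i using mem[of _ i] P(2)[of i] by auto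
  define T where "T i = (\<Sum>p\<in>S. indicator (Rg p) (u i) * (\<Prod>j'<i. indicator (- (\<Union>q\<in>S. Rg q)) (u j')) * f p * sval Rg fs (S - {p}) u)" for i
  have "T i = 0" if i: "i \<noteq> j" for i
  proof (cases "i < j")
    case True
    have "u i \<notin> Rg p" if "p \<in> S" for p using mem[OF that] j(2)[OF True] that by auto
    then show ?thesis unfolding T_def by (intro sum.neutral ballI) (simp add: indicator_def)
  next
    case False
    then have "j \<in> {..<i}" using i by simp
    moreover have "indicator (- (\<Union>q\<in>S. Rg q)) (u j) = (0::ennreal)" using un[of j] j(1) by (simp add: indicator_def)
    ultimately have "(\<Prod>j'<i. indicator (- (\<Union>q\<in>S. Rg q)) (u j')) = (0::ennreal)" by (intro prod_zero) auto
    then show ?thesis unfolding T_def by (simp only: mult_zero_left mult_zero_right sum.neutral_const)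
  qed
  then have "(\<Sum>i. T i) = (\<Sum>i\<in>{j}. T i)" by (intro suminf_finite) auto
  also have "\<dots> = T j" by simp
  also have "\<dots> = (\<Sum>p\<in>S. if p = P j then f p * sval Rg fs (S - {p}) u else 0)"
  proof -
    have "(\<Prod>j'<j. indicator (- (\<Union>q\<in>S. Rg q)) (u j')) = (1::ennreal)"
    proof (intro prod.neutral ballI)
      fix j' assume "j' \<in> {..<j}"
      then have "u j' \<notin> (\<Union>q\<in>S. Rg q)" using un[of j'] j(2)[of j'] by simp
      then show "indicator (- (\<Union>q\<in>S. Rg q)) (u j') = (1::ennreal)" by (auto simp: indicator_def)
    qed
    then show ?thesis unfolding T_def by (intro sum.cong refl) (simp add: mem indicator_def)
  qed
  also have "\<dots> = f (P j) * sval Rg fs (S - {P j}) u" using j(1) S(3) by simp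
  finally show ?thesis by (simp add: T_def)
qed

text \<open>Once every point has a region, the nested sums collapse to a product. \<open>J i\<close>
  is the index of the first point whose region has not yet been selected.\<close>

lemma sval_prod:
  assumes S: "disjoint_family_on Rg S0" "finite S0" and P: "\<And>j. P j \<in> S0" "\<And>j. u j \<in> Rg (P j)"
    and J: "\<And>i. i < m ==> P (J i) \<notin> P ` J ` {..<i}" "\<And>i j'. i < m ==> j' < J i ==> P j' \<in> P ` J ` {..<i}"
    and i: "i + length fs \<le> m"
  shows "sval Rg fs (S0 - P ` J ` {..<i}) u = (\<Prod>l<length fs. (fs ! l) (P (J (i + l))))"
  using i
proof (induction fs arbitrary: i)
  case (Cons f fs)
  have i: "i < m" using Cons.prems by simp
  have "sval Rg (f # fs) (S0 - P ` J ` {..<i}) u = f (P (J i)) * sval Rg fs (S0 - P ` J ` {..<i} - {P (J i)}) u"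
    by (rule sval_step[OF S(1) _ _ P]) (use S(2) P J[OF i] in auto)
  also have "S0 - P ` J ` {..<i} - {P (J i)} = S0 - P ` J ` {..<Suc i}" by (auto simp: lessThan_Suc)
  also have "sval Rg fs \<dots> u = (\<Prod>l<length fs. (fs ! l) (P (J (Suc i + l))))" using Cons by simp
  finally show ?case by (simp add: prod.lessThan_Suc_shift del: prod.lessThan_Suc sval.simps)
qed simp

fun stq :: "(nat => real) => nat => nat => nat" where
  "stq v N 0 = 0"
| "stq v N (Suc i) = stq v N i + nat \<lceil>v i * real (N - stq v N i)\<rceil>"

abbreviation stk :: "(nat => real) => nat => nat => nat" where
  "stk v N i \<equiv> nat \<lceil>v i * real (N - stq v N i)\<rceil>"

lemma stq_le:
  assumes "\<And>i. v i < 1" shows "stq v N i \<le> N"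
proof (induction i)
  case (Suc i)
  have "v i * real (N - stq v N i) \<le> 1 * real (N - stq v N i)" using assms[of i] by (intro mult_right_mono) auto
  then have "\<lceil>v i * real (N - stq v N i)\<rceil> \<le> int (N - stq v N i)" by (simp add: ceiling_le_iff)
  then show ?case using Suc by simp
qed simp

lemma shift_shift [simp]: "shift_seq a (shift_seq b x) = shift_seq (b + a) x"
  by (rule ext) (simp add: shift_seq_def add.assoc)

lemma St_prod:
  "St \<phi>s (N - stq v N i) (shift_seq (stq v N i) \<omega>) (shift_seq i v) =
    (\<Prod>l<length \<phi>s. xrot (stk v N (i + l)) (\<phi>s ! l) (shift_seq (stq v N (i + l)) \<omega>))"
proof (induction \<phi>s arbitrary: i)
  case (Cons \<phi> \<phi>s)
  have "shift_seq i v 0 = v i" by (simp add: shift_seq_def)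
  then show ?case using Cons[of "Suc i"] by (simp add: prod.lessThan_Suc_shift Let_def del: prod.lessThan_Suc)
qed simp

text \<open>One step sends a position \<open>x\<close> to \<open>x + v (t - x)\<close> plus a
  rounding error in [0, t / n]. As \<open>v < 1\<close>, this map is increasing, so a position that
  overshoots continues to do so, and path values there converge by right continuity.\<close>

lemma stq_limit:
  assumes t: "0 < t" and v: "\<And>i. 0 < v i" "\<And>i. v i < 1"
  shows "(\<forall>n. stick_S t v i \<le> gp t (Suc n) (stq v (Suc n) i)) \<and> (\<lambda>n. gp t (Suc n) (stq v (Suc n) i)) \<longlonglongrightarrow> stick_S t v i"
proof (induction i)
  case (Suc i)
  define x where "x n = gp t (Suc n) (stq v (Suc n) i)" for n
  define \<tau> where "\<tau> n = t / real (Suc n)" for n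
  have \<tau>: "0 < \<tau> n" for n using t by (simp add: \<tau>_def)
  have IH: "stick_S t v i \<le> x n" "x \<longlonglongrightarrow> stick_S t v i" for n using conjunct1[OF Suc] conjunct2[OF Suc] unfolding x_def[abs_def] by blast+
  have y: "gp t (Suc n) (stq v (Suc n) (Suc i)) = x n + real (stk v (Suc n) i) * \<tau> n" for n
    by (simp add: x_def \<tau>_def algebra_simps add_divide_distrib)
  have sv: "v i * real (Suc n - stq v (Suc n) i) * \<tau> n = v i * (t - x n)" for n
    using stq_le[of v "Suc n" i, OF v(2)] by (simp add: x_def \<tau>_def of_nat_diff field_simps del: of_nat_Suc)
  have b: "v i * (t - x n) \<le> real (stk v (Suc n) i) * \<tau> n" "real (stk v (Suc n) i) * \<tau> n \<le> v i * (t - x n) + \<tau> n" for n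
  proof -
    have "0 \<le> v i * real (Suc n - stq v (Suc n) i)" using v(1)[of i] by simp
    then have "v i * real (Suc n - stq v (Suc n) i) \<le> real (stk v (Suc n) i)" "real (stk v (Suc n) i) \<le> v i * real (Suc n - stq v (Suc n) i) + 1" by linarith+
    then have "v i * real (Suc n - stq v (Suc n) i) * \<tau> n \<le> real (stk v (Suc n) i) * \<tau> n"
      "real (stk v (Suc n) i) * \<tau> n \<le> (v i * real (Suc n - stq v (Suc n) i) + 1) * \<tau> n" using \<tau>[of n] by (auto intro!: mult_right_mono)
    then show "v i * (t - x n) \<le> real (stk v (Suc n) i) * \<tau> n" "real (stk v (Suc n) i) * \<tau> n \<le> v i * (t - x n) + \<tau> n"
      using sv[of n] by (simp_all only: distrib_right mult_1)
  qed
  have S: "stick_S t v (Suc i) = stick_S t v i + v i * (t - stick_S t v i)" by (simp add: stick_L.simps)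
  have 1: "stick_S t v (Suc i) \<le> x n + real (stk v (Suc n) i) * \<tau> n" for n
  proof -
    have "0 \<le> (1 - v i) * (x n - stick_S t v i)" using IH(1)[of n] v(2)[of i] by simp
    then have "stick_S t v i + v i * (t - stick_S t v i) \<le> x n + v i * (t - x n)" by (simp add: algebra_simps)
    then show ?thesis using b(1)[of n] S by linarith
  qed
  have \<tau>0: "\<tau> \<longlonglongrightarrow> 0" unfolding \<tau>_def by (rule lim_t_over[OF filterlim_Suc])
  have l1: "(\<lambda>n. x n + v i * (t - x n)) \<longlonglongrightarrow> stick_S t v (Suc i)"
    unfolding S by (intro tendsto_intros IH)
  have l2: "(\<lambda>n. x n + (v i * (t - x n) + \<tau> n)) \<longlonglongrightarrow> stick_S t v i + (v i * (t - stick_S t v i) + 0)"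
    by (intro tendsto_intros IH \<tau>0)
  have 2: "(\<lambda>n. x n + real (stk v (Suc n) i) * \<tau> n) \<longlonglongrightarrow> stick_S t v (Suc i)"
    by (rule tendsto_sandwich[OF always_eventually always_eventually l1 l2[folded add.assoc, unfolded add_0_right, folded S]])
      (use b in \<open>auto simp: add.assoc\<close>)
  show ?case unfolding y using 1 2 by blast
qed simp

text \<open>Discards the value at the right end point, so that the excursions become the right
  continuous functions \<open>eF\<close> and \<open>eG\<close>.\<close>

definition clip :: "real => (real => real) => real => real" where
  "clip r e s = (if s < r then e s else 0)"

text \<open>A block is seen through its length, its increment and smoothed values of its path; the smoothing
  parameter 0 returns the path itself, up to the value at the right end point.\<close>
definition coord :: "real => real \<times> real \<times> (real => real) => bool + real => real" where
  "coord \<epsilon> z x = (case x of Inl b => if b then fst z else fst (snd z) | Inr s => \<integral>r. clip (fst z) (snd (snd z)) (s + \<epsilon> * r) \<partial>Lam)"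

definition blk :: "real => real => nat => bool + real => nat => (nat => real) => real" where
  "blk t \<epsilon> N x k y = (case x of Inl b => if b then gp t N k else walk y k | Inr s => eavg t N s \<epsilon> k y)"

text \<open>Gathers the tests of all coordinates of block \<open>i\<close>, which turns a product
  over \<open>J\<close> into the product over blocks that \<open>Sv\<close> and \<open>St\<close>
  evaluate.\<close>

definition psi :: "(nat \<times> (bool + real) => real => real) => (nat \<times> (bool + real)) set => real => real => nat => nat => nat => (nat => real) => ennreal" where
  "psi h J t \<epsilon> N i k y = ennreal (\<Prod>x\<in>J `` {i}. h (i, x) (blk t \<epsilon> N x k y))"

definition trF :: "(real => real) => real => (nat => real) => nat => real \<times> real \<times> (real => real)" where
  "trF f t u n = (sel_d f t u n - sel_g f t u n, conv_minorant f t (sel_d f t u n) - conv_minorant f t (sel_g f t u n),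
     excursion f t (sel_g f t u n) (sel_d f t u n))"

definition trG :: "(real => real) => real => (nat => real) => nat => real \<times> real \<times> (real => real)" where
  "trG f t v n = (stick_L t v n, f (stick_S t v n + stick_L t v n) - f (stick_S t v n),
     vervaat (stick_L t v n) (knight f (stick_S t v n) (stick_L t v n)))"

lemma trF_touch:
  fixes u :: "nat => real"
  assumes f: "cadlag f" "f t \<le> lft f t" and T: "\<And>j. touch f t (A j) (B j) (G j) (D j)" "\<And>j. G j < u j" "\<And>j. u j < D j"
  defines "k \<equiv> \<lambda>i. LEAST j. u j \<notin> covered f t u i"
  shows "fst (trF f t u i) = D (k i) - G (k i)" "fst (snd (trF f t u i)) = A (k i) * (D (k i) - G (k i))"
    "clip (D (k i) - G (k i)) (snd (snd (trF f t u i))) = eF f (A (k i)) (B (k i)) (G (k i)) (D (k i))"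
proof -
  let ?j = "k i"
  have gd: "G ?j < D ?j" using T(2,3)[of ?j] by simp
  have sel: "sel_g f t u i = G ?j" "sel_d f t u i = D ?j"
    using gd unfolding k_def by (simp_all add: sel_g_def sel_d_def sel_int_def exc_int_touch[OF f T])
  have C: "conv_minorant f t s = A ?j * s + B ?j" if "s \<in> {G ?j..D ?j}" for s
    by (rule conv_minorant_touch[OF f T(1) that])
  show "fst (trF f t u i) = D ?j - G ?j" by (simp add: trF_def sel)
  show "fst (snd (trF f t u i)) = A ?j * (D ?j - G ?j)" using gd by (simp add: trF_def sel C algebra_simps)
  show "clip (D ?j - G ?j) (snd (snd (trF f t u i))) = eF f (A ?j) (B ?j) (G ?j) (D ?j)"
    by (rule ext) (auto simp: trF_def sel clip_def excursion_def eF_def C)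
qed

lemma trG_mins:
  assumes f: "cadlag f" and a: "0 \<le> stick_S t v i" and l: "0 < stick_L t v i"
    and uniq: "\<And>c1 c2. c1 \<in> mins f (stick_S t v i) (stick_L t v i) ==> c2 \<in> mins f (stick_S t v i) (stick_L t v i) ==> c1 < c2 ==>
      c1 = 0 \<and> c2 = stick_L t v i"
  obtains \<rho> where "\<rho> \<in> mins f (stick_S t v i) (stick_L t v i)"
    "\<And>c. c \<in> mins f (stick_S t v i) (stick_L t v i) ==> c = \<rho> \<or> c = 0 \<and> \<rho> = stick_L t v i"
    "0 \<le> \<rho>" "clip (stick_L t v i) (snd (snd (trG f t v i))) = eG f (stick_S t v i) (stick_L t v i) \<rho>"
proof -
  let ?a = "stick_S t v i" and ?l = "stick_L t v i"
  obtain \<rho> where \<rho>: "\<rho> \<in> mins f ?a ?l" "\<And>c. c \<in> mins f ?a ?l ==> c = \<rho> \<or> c = 0 \<and> \<rho> = ?l"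
    "\<And>s. s \<noteq> ?l ==> vervaat ?l (knight f ?a ?l) s = eG f ?a ?l \<rho> s"
    by (rule vervaat_mins[OF l mins_nonempty[OF f a l]], erule (2) uniq, rule that, assumption, blast+)
  have \<rho>l: "0 \<le> \<rho>" "\<rho> \<le> ?l" using \<rho>(1) by (auto simp: mins_def)
  have "clip ?l (snd (snd (trG f t v i))) = eG f ?a ?l \<rho>"
    by (rule ext) (auto simp: trG_def clip_def \<rho>(3) eG_eq[OF \<rho>l])
  then show ?thesis using that \<rho>(1,2) \<rho>l(1) by blast
qed

lemma psi_prod_limit:
  assumes h: "tests h" and J: "finite J" "J \<subseteq> {..<m} \<times> UNIV"
    and lim: "\<And>i x. i < m ==> (\<lambda>n. blk t \<epsilon> (Suc n) x (k i n) (y i n)) \<longlonglongrightarrow> coord \<epsilon> (z i) x"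
  shows "(\<lambda>n. \<Prod>i<m. psi h J t \<epsilon> (Suc n) i (k i n) (y i n)) \<longlonglongrightarrow> ennreal (\<Prod>c\<in>J. h c (coord \<epsilon> (z (fst c)) (snd c)))"
proof -
  have h0: "0 \<le> h c x" for c x using h unfolding tests_def by blast
  have f: "finite (J `` {i})" for i using J(1) by (simp add: finite_Image)
  have e: "(\<Prod>c\<in>J. h c (coord \<epsilon> (z (fst c)) (snd c))) = (\<Prod>i<m. \<Prod>x\<in>J `` {i}. h (i, x) (coord \<epsilon> (z i) x))"
  proof -
    have "J = (SIGMA i:{..<m}. J `` {i})" using J(2) by auto
    then have "(\<Prod>c\<in>J. h c (coord \<epsilon> (z (fst c)) (snd c))) = (\<Prod>c\<in>(SIGMA i:{..<m}. J `` {i}). h c (coord \<epsilon> (z (fst c)) (snd c)))" by simp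
    also have "\<dots> = (\<Prod>i<m. \<Prod>x\<in>J `` {i}. h (i, x) (coord \<epsilon> (z i) x))"
      using f by (subst prod.Sigma) (auto intro!: prod.cong)
    finally show ?thesis .
  qed
  have "(\<lambda>n. h (i, x) (blk t \<epsilon> (Suc n) x (k i n) (y i n))) \<longlonglongrightarrow> h (i, x) (coord \<epsilon> (z i) x)" if "i < m" for i x
    using h lim[OF that, of x] by (intro continuous_on_tendsto_compose[of UNIV "h (i, x)"]) (auto simp: tests_def)
  then have "(\<lambda>n. ennreal (\<Prod>i<m. \<Prod>x\<in>J `` {i}. h (i, x) (blk t \<epsilon> (Suc n) x (k i n) (y i n)))) \<longlonglongrightarrow> ennreal (\<Prod>i<m. \<Prod>x\<in>J `` {i}. h (i, x) (coord \<epsilon> (z i) x))"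
    by (intro tendsto_ennrealI tendsto_prod) auto
  then show ?thesis unfolding e psi_def by (subst prod_ennreal) (auto intro!: prod_nonneg h0)
qed

lemma exc_int_eq: "u \<in> exc_int f t u' ==> exc_int f t u = exc_int f t u'"
  unfolding exc_int_def using connected_component_eq[of u "exc_set f t" u'] by simp

lemma covered_Union: "covered f t u i = (\<Union>l<i. exc_int f t (u (LEAST j. u j \<notin> covered f t u l)))"
  by (induction i) (auto simp: lessThan_Suc)

text \<open>For large \<open>n\<close> two points share a face exactly when they share an excursion
  interval: the ends of the faces converge and the intervals are open. Only points up to the largest
  selected index matter, so eventually the discrete selection picks the same points as the
  continuous one.\<close>

lemma Sv_limit:
  assumes f: "cadlag f" "f 0 = 0" "lft f t = f t" and t: "0 < t"
    and T: "\<And>j. touch f t (A j) (B j) (G j) (D j)" "\<And>j. G j < u j" "\<And>j. u j < D j"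
    and full: "\<And>n. full (walk (incr f t (Suc n))) (Suc n)"
    and pick: "\<And>i. i < m ==> \<exists>j. u j \<notin> covered f t u i"
    and h: "tests h" and J: "finite J" "J \<subseteq> {..<m} \<times> UNIV" and \<epsilon>: "\<epsilon> \<noteq> 0"
  shows "(\<lambda>n. Sv t (map (psi h J t \<epsilon> (Suc n)) [0..<m]) (Suc n) (incr f t (Suc n)) u) \<longlonglongrightarrow>
     ennreal (\<Prod>c\<in>J. h c (coord \<epsilon> (trF f t u (fst c)) (snd c)))"
proof -
  have ft: "f t \<le> lft f t" using f(3) by simp
  have GD: "0 \<le> G j" "D j \<le> t" for j using T(1)[of j] by (auto simp: touch_def)
  have E: "exc_int f t (u j) = {G j<..<D j}" for j by (rule exc_int_touch[OF f(1) ft T])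
  have "\<exists>p\<in>faces (walk (incr f t (Suc n))) (Suc n). u j \<in> reg t (Suc n) p" for n j
    by (rule full_reg[OF full]) (use GD[of j] T(2,3)[of j] t in auto)
  then obtain p where p: "\<And>n j. p n j \<in> faces (walk (incr f t (Suc n))) (Suc n)" "\<And>n j. u j \<in> reg t (Suc n) (p n j)" by metis
  note pf = p(1)[unfolded faces_incr[of f, OF f(2)]]
  note lims = faces_limit[OF f(1) t T(1) T(2) T(3) pf p(2)]
  have dj: "disjoint_family_on (reg t (Suc n)) (faces (walk (incr f t (Suc n))) (Suc n))" for n by (rule reg_disjoint[OF t]) simp
  have eqv: "eventually (\<lambda>n. p n j = p n j' \<longleftrightarrow> exc_int f t (u j) = exc_int f t (u j')) sequentially" for j j'
  proof (cases "exc_int f t (u j) = exc_int f t (u j')")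
    case True
    have "u j' \<in> exc_int f t (u j')" using E T by simp
    then have "u j' \<in> exc_int f t (u j)" using True by simp
    then have u: "G j < u j'" "u j' < D j" unfolding E by auto
    from order_tendstoD(2)[OF lims(1)[of j] u(1)] order_tendstoD(1)[OF lims(2)[of j] u(2)]
    show ?thesis
    proof eventually_elim
      case (elim n)
      then have "u j' \<in> reg t (Suc n) (p n j)" by (simp add: reg_eq)
      then have "p n j = p n j'" using dj[of n] p(1)[of n j] p(1)[of n j'] p(2)[where n=n and j=j'] unfolding disjoint_family_on_def by blast
      then show ?case using True by simp
    qed
  next
    case False
    have ne: "eventually (\<lambda>n. x n \<noteq> y n) sequentially" if "x \<longlonglongrightarrow> a" "y \<longlonglongrightarrow> b" "a \<noteq> b" for x y :: "nat => real" and a b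
      using order_tendsto_less[OF that(1,2)] order_tendsto_less[OF that(2,1)] that(3)
      by (cases "a < b") (auto elim!: eventually_mono)
    from False E have "G j \<noteq> G j' \<or> D j \<noteq> D j'" by auto
    then have "eventually (\<lambda>n. p n j \<noteq> p n j') sequentially"
      using ne[OF lims(1)[of j] lims(1)[of j']] ne[OF lims(2)[of j] lims(2)[of j']]
      by (auto elim!: eventually_mono)
    then show ?thesis by (rule eventually_mono) (use False in simp)
  qed
  define Jx where "Jx i = (LEAST j. u j \<notin> covered f t u i)" for i
  have cov: "covered f t u i = (\<Union>l<i. exc_int f t (u (Jx l)))" for i
    unfolding Jx_def by (rule covered_Union)
  have J1: "u (Jx i) \<notin> covered f t u i" if "i < m" for i unfolding Jx_def by (rule LeastI_ex[OF pick[OF that]])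
  have J2: "u j \<in> covered f t u i" if "j < Jx i" for i j using not_less_Least[OF that[unfolded Jx_def]] by blast
  \<comment> \<open>Any common bound of the selected indices serves; finitely many pairs of points
    then need to be compared.\<close>
  define K where "K = (\<Sum>i<m. Jx i)"
  have K: "Jx i \<le> K" if "i < m" for i unfolding K_def using that by (intro member_le_sum) auto
  have "eventually (\<lambda>n. \<forall>j\<in>{..K}. \<forall>j'\<in>{..K}. p n j = p n j' \<longleftrightarrow> exc_int f t (u j) = exc_int f t (u j')) sequentially"
    by (intro eventually_ball_finite finite_atMost ballI eqv)
  then have ev: "eventually (\<lambda>n. (\<Prod>i<m. psi h J t \<epsilon> (Suc n) i (snd (p n (Jx i))) (shift_seq (fst (p n (Jx i))) (incr f t (Suc n)))) =
    Sv t (map (psi h J t \<epsilon> (Suc n)) [0..<m]) (Suc n) (incr f t (Suc n)) u) sequentially"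
  proof eventually_elim
    case (elim n)
    have c1: "p n (Jx i) \<notin> p n ` Jx ` {..<i}" if i: "i < m" for i
    proof
      assume "p n (Jx i) \<in> p n ` Jx ` {..<i}"
      then obtain l where l: "l < i" "p n (Jx i) = p n (Jx l)" by auto
      have "Jx i \<in> {..K}" "Jx l \<in> {..K}" using K[OF i] K[of l] i l(1) by auto
      then have "exc_int f t (u (Jx i)) = exc_int f t (u (Jx l))" using elim l(2) by blast
      then have "u (Jx i) \<in> exc_int f t (u (Jx l))" using E[of "Jx i"] T[of "Jx i"] by auto
      then show False using J1[OF i] l(1) unfolding cov by blast
    qed
    have c2: "p n j \<in> p n ` Jx ` {..<i}" if i: "i < m" and j: "j < Jx i" for i j
    proof -
      obtain l where l: "l < i" "u j \<in> exc_int f t (u (Jx l))" using J2[OF j] unfolding cov by blast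
      have "j \<in> {..K}" "Jx l \<in> {..K}" using K[OF i] K[of l] i l(1) j by auto
      then have "p n j = p n (Jx l)" using elim exc_int_eq[OF l(2)] by blast
      then show ?thesis using l(1) by blast
    qed
    show ?case
      unfolding Sv_def
      using sval_prod[where P = "p n" and u = u and m = m and J = Jx and i = 0 and
        fs = "map (\<lambda>\<phi> p. \<phi> (snd p) (shift_seq (fst p) (incr f t (Suc n)))) (map (psi h J t \<epsilon> (Suc n)) [0..<m])",
        OF dj[of n] finite_faces p(1)[of n] p(2)[where n = n] c1 c2]
      by simp
  qed
  have "(\<lambda>n. \<Prod>i<m. psi h J t \<epsilon> (Suc n) i (snd (p n (Jx i))) (shift_seq (fst (p n (Jx i))) (incr f t (Suc n)))) \<longlonglongrightarrow>
     ennreal (\<Prod>c\<in>J. h c (coord \<epsilon> (trF f t u (fst c)) (snd c)))"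
  proof (rule psi_prod_limit[OF h J])
    fix i x assume "i < m"
    let ?j = "Jx i"
    note tr = trF_touch[where A = A and B = B and G = G and D = D and u = u, OF f(1) ft T, folded Jx_def]
    show "(\<lambda>n. blk t \<epsilon> (Suc n) x (snd (p n ?j)) (shift_seq (fst (p n ?j)) (incr f t (Suc n)))) \<longlonglongrightarrow> coord \<epsilon> (trF f t u i) x"
      using face_block_limit[OF f(1) t T(1)[of ?j] T(2)[of ?j] T(3)[of ?j] pf[where j = ?j] p(2)[where j = ?j]] \<epsilon>
      by (auto simp: blk_def coord_def tr split: sum.split)
  qed
  then show ?thesis by (rule Lim_transform_eventually[OF _ ev])
qed

text \<open>Uniqueness of the excursion rotation reduces \<open>xrot\<close> to a single evaluation,
  and \<open>rot_block_limit\<close> applies to each stick.\<close>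

lemma St_limit:
  assumes f: "cadlag f" and t: "0 < t" and v: "\<And>i. 0 < v i" "\<And>i. v i < 1"
    and uniq: "\<And>i c1 c2. c1 \<in> mins f (stick_S t v i) (stick_L t v i) ==> c2 \<in> mins f (stick_S t v i) (stick_L t v i) ==> c1 < c2 ==>
      c1 = 0 \<and> c2 = stick_L t v i"
    and rot: "\<And>n q k. 0 < k ==> \<exists>!r. r < k \<and> exc k (rot r k (shift_seq q (incr f t (Suc n))))"
    and h: "tests h" and J: "finite J" "J \<subseteq> {..<m} \<times> UNIV" and \<epsilon>: "\<epsilon> \<noteq> 0"
  shows "(\<lambda>n. St (map (psi h J t \<epsilon> (Suc n)) [0..<m]) (Suc n) (incr f t (Suc n)) v) \<longlonglongrightarrow>
     ennreal (\<Prod>c\<in>J. h c (coord \<epsilon> (trG f t v (fst c)) (snd c)))"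
proof -
  define R where "R i n = (THE r. r < stk v (Suc n) i \<and> exc (stk v (Suc n) i) (rot r (stk v (Suc n) i) (shift_seq (stq v (Suc n) i) (incr f t (Suc n)))))" for i n
  define y where "y i n = rot (R i n) (stk v (Suc n) i) (shift_seq (stq v (Suc n) i) (incr f t (Suc n)))" for i n
  have R: "R i n < stk v (Suc n) i" "exc (stk v (Suc n) i) (y i n)" if "0 < stk v (Suc n) i" for i n
    using theI'[OF rot[OF that, of "stq v (Suc n) i" n]] unfolding R_def y_def by auto
  have xr: "xrot (stk v (Suc n) i) \<phi> (shift_seq (stq v (Suc n) i) (incr f t (Suc n))) = \<phi> (stk v (Suc n) i) (y i n)"
    if k: "0 < stk v (Suc n) i" for i n \<phi>
  proof -
    let ?k = "stk v (Suc n) i" and ?w = "shift_seq (stq v (Suc n) i) (incr f t (Suc n))"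
    have "xrot ?k \<phi> ?w = (\<Sum>r<?k. if r = R i n then \<phi> ?k (y i n) else 0)"
      unfolding xrot_def
    proof (intro sum.cong refl)
      fix r assume r: "r \<in> {..<?k}"
      have "exc ?k (rot r ?k ?w) \<longleftrightarrow> r = R i n" using rot[OF k, of "stq v (Suc n) i" n] R[OF k] r unfolding y_def by blast
      then show "(if exc ?k (rot r ?k ?w) then \<phi> ?k (rot r ?k ?w) else 0) = (if r = R i n then \<phi> ?k (y i n) else 0)" by (simp add: y_def)
    qed
    then show ?thesis using R(1)[OF k] by simp
  qed
  note sp = stick_pos[of t v, OF t v] and sq = stq_limit[of t v, OF t v]
  have Ssuc: "stick_S t v (Suc i) = stick_S t v i + stick_L t v i" for i by simp
  have blim: "(\<lambda>n. gp t (Suc n) (stk v (Suc n) i)) \<longlonglongrightarrow> stick_L t v i \<and>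
      (\<forall>x. (\<lambda>n. blk t \<epsilon> (Suc n) x (stk v (Suc n) i) (y i n)) \<longlonglongrightarrow> coord \<epsilon> (trG f t v i) x)" for i
  proof -
    let ?a = "stick_S t v i" and ?l = "stick_L t v i"
    obtain \<rho> where \<rho>: "\<rho> \<in> mins f ?a ?l" "\<And>c. c \<in> mins f ?a ?l ==> c = \<rho> \<or> c = 0 \<and> \<rho> = ?l"
      "clip ?l (snd (snd (trG f t v i))) = eG f ?a ?l \<rho>"
      by (rule trG_mins[OF f sp(1) sp(3)], erule (2) uniq, rule that, assumption, blast+)
    have G12: "fst (trG f t v i) = ?l" "fst (snd (trG f t v i)) = f (?a + ?l) - f ?a" by (simp_all add: trG_def)
    have qk: "stq v (Suc n) i + stk v (Suc n) i \<le> Suc n" for n using stq_le[of v "Suc n" "Suc i", OF v(2)] by (simp only: stq.simps)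
    note base = rot_block_limit[where q = "\<lambda>n. stq v (Suc n) i" and k = "\<lambda>n. stk v (Suc n) i" and r = "R i",
      OF f t sp(1) sp(3) qk sq[of i, THEN conjunct1, rule_format] sq[of i, THEN conjunct2]
        sq[of "Suc i", THEN conjunct1, rule_format, unfolded stq.simps Ssuc] sq[of "Suc i", THEN conjunct2, unfolded stq.simps Ssuc], folded y_def]
    have L1: "(\<lambda>n. gp t (Suc n) (stk v (Suc n) i)) \<longlonglongrightarrow> ?l"
      by (rule base(1), erule R(1), erule R(2), rule \<rho>(1), erule \<rho>(2))
    have L2: "(\<lambda>n. walk (y i n) (stk v (Suc n) i)) \<longlonglongrightarrow> f (?a + ?l) - f ?a"
      by (rule base(2), erule R(1), erule R(2), rule \<rho>(1), erule \<rho>(2))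
    have L3: "(\<lambda>n. eavg t (Suc n) s \<epsilon> (stk v (Suc n) i) (y i n)) \<longlonglongrightarrow> (\<integral>x. eG f ?a ?l \<rho> (s + \<epsilon> * x) \<partial>Lam)" for s
      by (rule base(3), erule R(1), erule R(2), rule \<rho>(1), erule \<rho>(2), rule \<epsilon>)
    have "(\<lambda>n. blk t \<epsilon> (Suc n) x (stk v (Suc n) i) (y i n)) \<longlonglongrightarrow> coord \<epsilon> (trG f t v i) x" for x
    proof (cases x)
      case (Inl b)
      then show ?thesis using L1 L2 by (cases b) (simp_all add: blk_def coord_def G12 del: of_nat_Suc)
    next
      case (Inr s)
      then show ?thesis using L3[of s] by (simp add: blk_def coord_def G12 \<rho>(3))
    qed
    then show ?thesis using L1 by blast
  qed
  \<comment> \<open>For an empty block \<open>xrot\<close> is an empty sum and not the value of the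
    test, so the product formula holds only once all \<open>m\<close> blocks are nonempty.\<close>
  have "eventually (\<lambda>n. \<forall>i\<in>{..<m}. 0 < stk v (Suc n) i) sequentially"
  proof (intro eventually_ball_finite finite_lessThan ballI)
    fix i
    show "eventually (\<lambda>n. 0 < stk v (Suc n) i) sequentially"
      using order_tendstoD(1)[OF blim[THEN conjunct1] sp(3), of i]
    proof eventually_elim
      case (elim n)
      then show ?case by (intro Nat.gr0I) simp
    qed
  qed
  then have ev: "eventually (\<lambda>n. (\<Prod>i<m. psi h J t \<epsilon> (Suc n) i (stk v (Suc n) i) (y i n)) =
    St (map (psi h J t \<epsilon> (Suc n)) [0..<m]) (Suc n) (incr f t (Suc n)) v) sequentially"
  proof eventually_elim
    case (elim n)
    have s0: "shift_seq 0 x = x" for x :: "nat => real" by (rule ext) (simp add: shift_seq_def)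
    show ?case
      using St_prod[of "map (psi h J t \<epsilon> (Suc n)) [0..<m]" "Suc n" v 0 "incr f t (Suc n)"] elim
      by (auto simp: s0 xr intro!: prod.cong)
  qed
  have "(\<lambda>n. \<Prod>i<m. psi h J t \<epsilon> (Suc n) i (stk v (Suc n) i) (y i n)) \<longlonglongrightarrow> ennreal (\<Prod>c\<in>J. h c (coord \<epsilon> (trG f t v (fst c)) (snd c)))"
    by (rule psi_prod_limit[OF h J]) (use blim in blast)
  then show ?thesis by (rule Lim_transform_eventually[OF _ ev])
qed

section \<open>Measurability on the completion and equality of joint laws\<close>

lemma measurable_completion_AE_cong:
  assumes f: "f \<in> borel_measurable (completion M)" and eq: "AE \<omega> in M. f \<omega> = g \<omega>"
  shows "g \<in> borel_measurable (completion M)"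
proof (rule measurableI)
  fix A :: "'b set" assume A: "A \<in> sets borel"
  have 1: "Measurable.pred (completion M) (\<lambda>\<omega>. f \<omega> \<noteq> g \<omega>)" "Measurable.pred (completion M) (\<lambda>\<omega>. f \<omega> \<noteq> g \<omega> \<and> g \<omega> \<in> A)"
    by (rule sets_completion_AE, rule eventually_mono[OF eq], simp)+
  have 2: "Measurable.pred (completion M) (\<lambda>\<omega>. f \<omega> \<in> A)" using f A by measurable
  have "Measurable.pred (completion M) (\<lambda>\<omega>. (\<not> f \<omega> \<noteq> g \<omega> \<and> f \<omega> \<in> A) \<or> (f \<omega> \<noteq> g \<omega> \<and> g \<omega> \<in> A))"
    by (intro pred_intros_logic 1 2)
  then have "{\<omega>\<in>space (completion M). (\<not> f \<omega> \<noteq> g \<omega> \<and> f \<omega> \<in> A) \<or> (f \<omega> \<noteq> g \<omega> \<and> g \<omega> \<in> A)} \<in> sets (completion M)"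
    by (simp add: pred_def)
  moreover have "g -` A \<inter> space (completion M) = {\<omega>\<in>space (completion M). (\<not> f \<omega> \<noteq> g \<omega> \<and> f \<omega> \<in> A) \<or> (f \<omega> \<noteq> g \<omega> \<and> g \<omega> \<in> A)}" by auto
  ultimately show "g -` A \<inter> space (completion M) \<in> sets (completion M)" by simp
qed simp

text \<open>The source of measurability for everything built from the convex minorant or the Vervaat
  transform: an almost sure limit of measurable functions agrees with a measurable
  \<open>liminf\<close> off a null set.\<close>

lemma measurable_completion_ennreal_limit:
  fixes f :: "nat => 'a => ennreal"
  assumes f: "\<And>n. f n \<in> borel_measurable (completion M)" and lim: "AE \<omega> in M. (\<lambda>n. f n \<omega>) \<longlonglongrightarrow> g \<omega>"
  shows "g \<in> borel_measurable (completion M)"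
proof (rule measurable_completion_AE_cong)
  show "(\<lambda>\<omega>. liminf (\<lambda>n. f n \<omega>)) \<in> borel_measurable (completion M)" using f by measurable
  show "AE \<omega> in M. liminf (\<lambda>n. f n \<omega>) = g \<omega>"
    using lim by eventually_elim (simp add: lim_imp_Liminf)
qed

lemma (in prob_space) eq_law_PiM:
  fixes F G :: "'c => 'a => real"
  assumes F: "\<And>c. c \<in> I ==> F c \<in> borel_measurable M" and G: "\<And>c. c \<in> I ==> G c \<in> borel_measurable M"
    and eq: "\<And>J A. finite J ==> J \<subseteq> I ==> (\<And>c. c \<in> J ==> A c \<in> sets borel) ==>
      emeasure M {\<omega>\<in>space M. \<forall>c\<in>J. F c \<omega> \<in> A c} = emeasure M {\<omega>\<in>space M. \<forall>c\<in>J. G c \<omega> \<in> A c}"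
  shows "distr M (PiM I (\<lambda>_. borel)) (\<lambda>\<omega>. \<lambda>c\<in>I. F c \<omega>) = distr M (PiM I (\<lambda>_. borel)) (\<lambda>\<omega>. \<lambda>c\<in>I. G c \<omega>)"
proof (rule measure_eqI_PiM_infinite)
  have m: "(\<lambda>\<omega>. \<lambda>c\<in>I. F c \<omega>) \<in> measurable M (PiM I (\<lambda>_. borel))" if "\<And>c. c \<in> I ==> F c \<in> borel_measurable M" for F :: "'c => 'a => real"
    by (rule measurable_restrict) (rule that)
  show "finite_measure (distr M (PiM I (\<lambda>_. borel)) (\<lambda>\<omega>. \<lambda>c\<in>I. F c \<omega>))"
    using prob_space_distr[OF m[of F, OF F]] by (simp add: prob_space_def)
  fix A and J :: "'c set"
  assume J: "finite J" "J \<subseteq> I" and A: "\<And>i. i \<in> J ==> A i \<in> sets (borel :: real measure)"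
  have p: "emeasure (distr M (PiM I (\<lambda>_. borel)) (\<lambda>\<omega>. \<lambda>c\<in>I. F c \<omega>)) (prod_emb I (\<lambda>_. borel) J (Pi\<^sub>E J A)) = emeasure M {\<omega>\<in>space M. \<forall>c\<in>J. F c \<omega> \<in> A c}"
    if F: "\<And>c. c \<in> I ==> F c \<in> borel_measurable M" for F :: "'c => 'a => real"
  proof -
    have "(\<lambda>\<omega>. \<lambda>c\<in>I. F c \<omega>) -` prod_emb I (\<lambda>_. borel) J (Pi\<^sub>E J A) \<inter> space M = {\<omega>\<in>space M. \<forall>c\<in>J. F c \<omega> \<in> A c}"
      using J(2) by (auto simp: prod_emb_def PiE_iff subset_eq)
    then show ?thesis using J A by (subst emeasure_distr[OF m[of F, OF F]]) (auto intro!: sets_PiM_I)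
  qed
  show "emeasure (distr M (PiM I (\<lambda>_. borel)) (\<lambda>\<omega>. \<lambda>c\<in>I. F c \<omega>)) (prod_emb I (\<lambda>_. borel) J (Pi\<^sub>E J A)) =
    emeasure (distr M (PiM I (\<lambda>_. borel)) (\<lambda>\<omega>. \<lambda>c\<in>I. G c \<omega>)) (prod_emb I (\<lambda>_. borel) J (Pi\<^sub>E J A))"
    by (subst p, erule F, subst p, erule G, rule eq[OF J], erule A)
qed simp_all

lemma coord_smooth:
  assumes e: "clip (fst z) (snd (snd z)) \<in> borel_measurable borel" "\<And>r. \<bar>clip (fst z) (snd (snd z)) r\<bar> \<le> B"
    "\<And>s. (clip (fst z) (snd (snd z)) \<longlongrightarrow> clip (fst z) (snd (snd z)) s) (at_right s)"
  shows "(\<lambda>p. coord (1 / real (Suc p)) z x) \<longlonglongrightarrow> coord 0 z x"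
proof (cases x)
  case (Inr s)
  show ?thesis unfolding Inr coord_def using smooth_limit[OF e(1,2) e(3)[of s]] by (simp del: of_nat_Suc add: Lam.prob_space[simplified])
qed (simp add: coord_def)

context diffuse_law begin

lemma block_fun_psi:
  assumes h: "tests h" shows "block_fun (psi h J t \<epsilon> N i)"
  unfolding block_fun_def
proof (intro allI conjI)
  fix k
  have [measurable]: "h c \<in> borel_measurable borel" for c by (rule tests_measurable[OF h])
  have [measurable]: "(\<lambda>y. blk t \<epsilon> N x k y) \<in> borel_measurable \<mu>" for x
    by (cases x) (auto simp: blk_def eavg_sum)
  show "psi h J t \<epsilon> N i k \<in> borel_measurable \<mu>" unfolding psi_def[abs_def] by measurable
  have "blk t \<epsilon> N x k \<omega> = blk t \<epsilon> N x k \<omega>'" if "\<forall>m<k. \<omega> m = \<omega>' m" for x \<omega> \<omega>'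
  proof -
    have "walk \<omega> j = walk \<omega>' j" if "j \<le> k" for j using \<open>\<forall>m<k. \<omega> m = \<omega>' m\<close> that by (intro walk_cong) auto
    then show ?thesis by (auto simp: blk_def eavg_sum split: sum.split intro!: sum.cong)
  qed
  note b = this
  show "dep k (psi h J t \<epsilon> N i k)" unfolding dep_def psi_def
  proof (intro allI impI)
    fix \<omega> \<omega>' :: "nat => real" assume "\<forall>m<k. \<omega> m = \<omega>' m"
    then have "blk t \<epsilon> N x k \<omega> = blk t \<epsilon> N x k \<omega>'" for x by (rule b)
    then show "ennreal (\<Prod>x\<in>J `` {i}. h (i, x) (blk t \<epsilon> N x k \<omega>)) = ennreal (\<Prod>x\<in>J `` {i}. h (i, x) (blk t \<epsilon> N x k \<omega>'))" by simp
  qed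
qed

end

lemma psi_le_1: "tests h ==> psi h J t \<epsilon> N i k y \<le> 1"
  unfolding psi_def tests_def by (subst ennreal_le_1) (auto intro!: prod_le_1)

section \<open>The excursion side and the stick side over one probability space\<close>

locale pitman = levy_setup M X t for M :: "'a measure" and X t +
  fixes U V :: "nat => 'a => real"
  assumes LU: "levy_seq M X t U (unif t)"
    and LV: "levy_seq M X t V (unif 1)"
begin

sublocale U: levy_seq M X t U "unif t" by (rule LU)
sublocale V: levy_seq M X t V "unif 1" by (rule LV)
sublocale C: prob_space "completion M" by (rule prob_space_completion)

abbreviation Mc where "Mc \<equiv> completion M"

definition Fc :: "real => nat \<times> (bool + real) => 'a => real" where
  "Fc \<epsilon> c \<omega> = coord \<epsilon> (trF (path \<omega>) t (U.Ws \<omega>) (fst c)) (snd c)"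

definition Gc :: "real => nat \<times> (bool + real) => 'a => real" where
  "Gc \<epsilon> c \<omega> = coord \<epsilon> (trG (path \<omega>) t (V.Ws \<omega>) (fst c)) (snd c)"

definition SvM :: "(nat \<times> (bool + real) => real => real) => (nat \<times> (bool + real)) set => nat => real => nat => 'a => ennreal" where
  "SvM h J m \<epsilon> n \<omega> = Sv t (map (psi h J t \<epsilon> (Suc n)) [0..<m]) (Suc n) (incr (path \<omega>) t (Suc n)) (U.Ws \<omega>)"

definition StM :: "(nat \<times> (bool + real) => real => real) => (nat \<times> (bool + real)) set => nat => real => nat => 'a => ennreal" where
  "StM h J m \<epsilon> n \<omega> = St (map (psi h J t \<epsilon> (Suc n)) [0..<m]) (Suc n) (incr (path \<omega>) t (Suc n)) (V.Ws \<omega>)"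

lemma SvM_StM:
  assumes h: "tests h"
  shows "SvM h J m \<epsilon> n \<in> borel_measurable M" "StM h J m \<epsilon> n \<in> borel_measurable M" "(\<integral>\<^sup>+\<omega>. SvM h J m \<epsilon> n \<omega> \<partial>M) = (\<integral>\<^sup>+\<omega>. StM h J m \<epsilon> n \<omega> \<partial>M)"
proof -
  interpret D: diffuse_law "distr M borel (X (t / real (Suc n)))" by (rule diffuse_law_X) (use tpos in simp)
  let ?\<phi>s = "map (psi h J t \<epsilon> (Suc n)) [0..<m]"
  let ?P = "PiM (UNIV :: nat set) (\<lambda>_. borel :: real measure) \<Otimes>\<^sub>M PiM (UNIV :: nat set) (\<lambda>_. borel :: real measure)"
  have bf: "\<forall>\<phi>\<in>set ?\<phi>s. D.block_fun \<phi>" using D.block_fun_psi[OF h] by auto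
  have b1: "\<phi> k \<omega> \<le> 1" if "\<phi> \<in> set ?\<phi>s" for \<phi> k \<omega> using that psi_le_1[OF h] by auto
  have s: "sets D.\<mu> = sets PiB" by (rule D.sets_mu)
  have f: "fst \<in> measurable ?P D.\<mu>" "snd \<in> measurable ?P PiB"
    by (simp_all cong: measurable_cong_sets add: measurable_cong_sets[OF refl s])
  have mv: "(\<lambda>z. Sv t ?\<phi>s (Suc n) (fst z) (snd z)) \<in> borel_measurable ?P" by (rule D.Sv_measurable[OF f bf])
  have mt: "(\<lambda>z. St ?\<phi>s (Suc n) (fst z) (snd z)) \<in> borel_measurable ?P" by (rule D.St_measurable[OF f bf])
  have zU: "(\<lambda>\<omega>. (incr (path \<omega>) t (Suc n), U.Ws \<omega>)) \<in> measurable M ?P" by measurable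
  have zV: "(\<lambda>\<omega>. (incr (path \<omega>) t (Suc n), V.Ws \<omega>)) \<in> measurable M ?P" by measurable
  show "SvM h J m \<epsilon> n \<in> borel_measurable M" using measurable_compose[OF zU mv] by (simp add: SvM_def[abs_def])
  show "StM h J m \<epsilon> n \<in> borel_measurable M" using measurable_compose[OF zV mt] by (simp add: StM_def[abs_def])
  have "(\<integral>\<^sup>+\<omega>. SvM h J m \<epsilon> n \<omega> \<partial>M) = (\<integral>\<^sup>+z. Sv t ?\<phi>s (Suc n) (fst z) (snd z) \<partial>distr M ?P (\<lambda>\<omega>. (incr (path \<omega>) t (Suc n), U.Ws \<omega>)))"
    by (subst nn_integral_distr[OF zU]) (simp_all add: mv SvM_def[abs_def])
  also have "\<dots> = (\<integral>\<^sup>+z. St ?\<phi>s (Suc n) (fst z) (snd z) \<partial>distr M ?P (\<lambda>\<omega>. (incr (path \<omega>) t (Suc n), V.Ws \<omega>)))"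
    unfolding U.incr_joint_law[OF zero_less_Suc] V.incr_joint_law[OF zero_less_Suc] by (rule D.discrete_identity[OF tpos zero_less_Suc bf], erule b1)
  also have "\<dots> = (\<integral>\<^sup>+\<omega>. StM h J m \<epsilon> n \<omega> \<partial>M)"
    by (subst nn_integral_distr[OF zV]) (simp_all add: mt StM_def[abs_def])
  finally show "(\<integral>\<^sup>+\<omega>. SvM h J m \<epsilon> n \<omega> \<partial>M) = (\<integral>\<^sup>+\<omega>. StM h J m \<epsilon> n \<omega> \<partial>M)" .
qed

lemma AE_U_good:
  "AE \<omega> in M. \<exists>A B G D. \<forall>j. touch (path \<omega>) t (A j) (B j) (G j) (D j) \<and> G j < U j \<omega> \<and> U j \<omega> < D j"
  using U.AE_touch[OF refl] by eventually_elim metis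

text \<open>Guards the \<open>LEAST\<close> in \<open>covered\<close>, which has no meaning when all
  points are covered. The convergence of the first \<open>m\<close> selections is stated relative to
  it, so that it can be proved by induction from the law of those selections.\<close>

definition picks :: "nat => bool" where
  "picks m \<longleftrightarrow> (AE \<omega> in M. \<forall>i<m. \<exists>j. U j \<omega> \<notin> covered (path \<omega>) t (U.Ws \<omega>) i)"

lemma AE_SvM_limit:
  assumes pk: "picks m" and h: "tests h" and J: "finite J" "J \<subseteq> {..<m} \<times> UNIV" and \<epsilon>: "\<epsilon> \<noteq> 0"
  shows "AE \<omega> in M. (\<lambda>n. SvM h J m \<epsilon> n \<omega>) \<longlonglongrightarrow> ennreal (\<Prod>c\<in>J. h c (Fc \<epsilon> c \<omega>))"
  using AE_U_good pk[unfolded picks_def] U.AE_full_incr AE_left_cont[OF tpos] AE_space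
proof eventually_elim
  case (elim \<omega>)
  then obtain A B G D where T: "\<And>j. touch (path \<omega>) t (A j) (B j) (G j) (D j)" "\<And>j. G j < U j \<omega>" "\<And>j. U j \<omega> < D j" by metis
  show ?case
    unfolding SvM_def Fc_def
    by (rule Sv_limit[OF X_cadlag[OF elim(5)] X_0[OF elim(5)] elim(4) tpos T elim(3)[rule_format] elim(2)[rule_format] h J \<epsilon>])
qed

lemma AE_V_good:
  "AE \<omega> in M. (\<forall>i. 0 < V i \<omega> \<and> V i \<omega> < 1) \<and> (\<forall>i c1 c2. c1 \<in> mins (path \<omega>) (stick_S t (V.Ws \<omega>) i) (stick_L t (V.Ws \<omega>) i) -->
     c2 \<in> mins (path \<omega>) (stick_S t (V.Ws \<omega>) i) (stick_L t (V.Ws \<omega>) i) --> c1 < c2 --> c1 = 0 \<and> c2 = stick_L t (V.Ws \<omega>) i)"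
  using V.AE_W_range[OF refl zero_less_one] V.AE_mins_unique
proof eventually_elim
  case (elim \<omega>)
  have "0 \<le> stick_S t (V.Ws \<omega>) i \<and> 0 < stick_L t (V.Ws \<omega>) i" for i
    using stick_pos(1,3)[of t "V.Ws \<omega>" i] tpos elim(1) by blast
  then show ?case using elim by blast
qed

lemma AE_rot_unique:
  "AE \<omega> in M. \<forall>n q k. 0 < k --> (\<exists>!r. r < k \<and> exc k (rot r k (shift_seq q (incr (path \<omega>) t (Suc n)))))"
proof -
  have "AE \<omega> in M. \<exists>!r. r < k \<and> exc k (rot r k (shift_seq q (incr (path \<omega>) t (Suc n))))" if k: "0 < k" for n q k
  proof -
    interpret D: diffuse_law "distr M borel (X (t / real (Suc n)))" by (rule diffuse_law_X) (use tpos in simp)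
    \<comment> \<open>The cycle lemma is stated for blocks at the front; a shift of an i.i.d.
      sequence preserves its law.\<close>
    have "distr D.\<mu> D.\<mu> (shift_seq q) = D.\<mu>"
    proof (rule measure_eqI)
      fix A assume "A \<in> sets (distr D.\<mu> D.\<mu> (shift_seq q))"
      then have A [measurable]: "A \<in> sets D.\<mu>" by simp
      have i: "inj (\<lambda>m. q + m)" by (simp add: inj_on_def)
      have "emeasure (distr D.\<mu> D.\<mu> (shift_seq q)) A = (\<integral>\<^sup>+\<omega>. indicator A \<omega> \<partial>distr D.\<mu> D.\<mu> (shift_seq q))" by (simp del: of_nat_Suc)
      also have "\<dots> = (\<integral>\<^sup>+\<omega>. indicator A (shift_seq q \<omega>) \<partial>D.\<mu>)" by (rule nn_integral_distr) measurable
      also have "\<dots> = (\<integral>\<^sup>+\<omega>. indicator A \<omega> \<partial>D.\<mu>)"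
        using D.nn_integral_reindex[OF i, of "indicator A"] by (simp add: shift_seq_def[abs_def])
      finally show "emeasure (distr D.\<mu> D.\<mu> (shift_seq q)) A = emeasure D.\<mu> A" by (simp del: of_nat_Suc)
    qed simp
    then have "AE \<omega> in distr D.\<mu> D.\<mu> (shift_seq q). \<exists>!r. r < k \<and> exc k (rot r k \<omega>)" using D.AE_unique_rot[OF k] by (simp only:)
    then have "AE \<omega> in D.\<mu>. \<exists>!r. r < k \<and> exc k (rot r k (shift_seq q \<omega>))" by (rule AE_distrD[OF D.shift_measurable])
    then show ?thesis by (rule U.AE_incr)
  qed
  then show ?thesis by (simp add: AE_all_countable)
qed

lemma AE_StM_limit:
  assumes h: "tests h" and J: "finite J" "J \<subseteq> {..<m} \<times> UNIV" and \<epsilon>: "\<epsilon> \<noteq> 0"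
  shows "AE \<omega> in M. (\<lambda>n. StM h J m \<epsilon> n \<omega>) \<longlonglongrightarrow> ennreal (\<Prod>c\<in>J. h c (Gc \<epsilon> c \<omega>))"
  using AE_V_good AE_rot_unique AE_space
proof eventually_elim
  case (elim \<omega>)
  show ?case
    unfolding StM_def Gc_def
    by (rule St_limit[OF X_cadlag[OF elim(3)] tpos _ _ _ _ h J \<epsilon>]) (use elim(1,2) in blast)+
qed

lemma AE_Fc_smooth: "AE \<omega> in M. \<forall>c. (\<lambda>p. Fc (1 / real (Suc p)) c \<omega>) \<longlonglongrightarrow> Fc 0 c \<omega>"
  using AE_U_good AE_left_cont[OF tpos] AE_space
proof eventually_elim
  case (elim \<omega>)
  then obtain A B G D where T: "\<And>j. touch (path \<omega>) t (A j) (B j) (G j) (D j)" "\<And>j. G j < U j \<omega>" "\<And>j. U j \<omega> < D j" by metis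
  have f: "cadlag (path \<omega>)" by (rule X_cadlag[OF elim(3)])
  have ft: "path \<omega> t \<le> lft (path \<omega>) t" using elim(2) by simp
  show ?case
  proof
    fix c :: "nat \<times> (bool + real)"
    obtain k where k: "clip (fst (trF (path \<omega>) t (U.Ws \<omega>) (fst c))) (snd (snd (trF (path \<omega>) t (U.Ws \<omega>) (fst c)))) = eF (path \<omega>) (A k) (B k) (G k) (D k)"
      using trF_touch(1,3)[where A = A and B = B and G = G and D = D and u = "U.Ws \<omega>" and i = "fst c", OF f ft T] by metis
    have g: "0 \<le> G k" using T(1)[of k] by (simp add: touch_def)
    obtain b where b: "\<And>r. \<bar>eF (path \<omega>) (A k) (B k) (G k) (D k) r\<bar> \<le> b" using eF_bounded[OF f g] by metis
    show "(\<lambda>p. Fc (1 / real (Suc p)) c \<omega>) \<longlonglongrightarrow> Fc 0 c \<omega>"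
      unfolding Fc_def by (rule coord_smooth; unfold k) (rule eF_borel[OF f g] b eF_right[OF f g])+
  qed
qed

lemma AE_Gc_smooth: "AE \<omega> in M. \<forall>c. (\<lambda>p. Gc (1 / real (Suc p)) c \<omega>) \<longlonglongrightarrow> Gc 0 c \<omega>"
  using AE_V_good AE_space
proof eventually_elim
  case (elim \<omega>)
  have f: "cadlag (path \<omega>)" by (rule X_cadlag[OF elim(2)])
  show ?case
  proof
    fix c :: "nat \<times> (bool + real)"
    let ?i = "fst c" and ?v = "V.Ws \<omega>"
    have a: "0 \<le> stick_S t ?v ?i" and l: "0 < stick_L t ?v ?i"
      using stick_pos(1,3)[of t ?v ?i] tpos elim(1) by blast+
    obtain \<rho> where \<rho>: "0 \<le> \<rho>" "clip (stick_L t ?v ?i) (snd (snd (trG (path \<omega>) t ?v ?i))) = eG (path \<omega>) (stick_S t ?v ?i) (stick_L t ?v ?i) \<rho>"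
      by (rule trG_mins[OF f a l]) (use elim(1) in blast)+
    have k: "clip (fst (trG (path \<omega>) t ?v ?i)) (snd (snd (trG (path \<omega>) t ?v ?i))) = eG (path \<omega>) (stick_S t ?v ?i) (stick_L t ?v ?i) \<rho>"
      using \<rho>(2) by (simp add: trG_def)
    obtain b where b: "\<And>r. \<bar>eG (path \<omega>) (stick_S t ?v ?i) (stick_L t ?v ?i) \<rho> r\<bar> \<le> b" using eG_bounded[OF f a \<rho>(1)] by metis
    show "(\<lambda>p. Gc (1 / real (Suc p)) c \<omega>) \<longlonglongrightarrow> Gc 0 c \<omega>"
      unfolding Gc_def by (rule coord_smooth; unfold k) (rule eG_borel[OF f a \<rho>(1)] b eG_right[OF f a \<rho>(1)])+
  qed
qed

end

section \<open>Recovering coordinates, uncovered points and diffuse stick lengths\<close>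

lemma coord_0: "coord 0 z x = (case x of Inl b => if b then fst z else fst (snd z) | Inr s => clip (fst z) (snd (snd z)) s)"
  by (auto simp: coord_def Lam.prob_space[simplified] split: sum.split)

text \<open>So far only tests of the limit coordinates are known to be measurable. This test is
  injective, and the coordinate is recovered from it through the tangent.\<close>

lemma measurable_arctan_test:
  assumes "(\<lambda>\<omega>. ennreal (1 / 2 + arctan (F \<omega>) / pi)) \<in> borel_measurable N"
  shows "F \<in> borel_measurable N"
proof -
  have b: "0 \<le> 1 / 2 + arctan x / pi" for x
    using arctan_lbound[of x] pi_gt_zero by (simp add: field_simps)
  have [measurable]: "(\<lambda>\<omega>. enn2real (ennreal (1 / 2 + arctan (F \<omega>) / pi))) \<in> borel_measurable N"
    using assms by (rule borel_measurable_enn2real)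
  have sc [measurable]: "(sin :: real => real) \<in> borel_measurable borel" "(cos :: real => real) \<in> borel_measurable borel"
    by (intro borel_measurable_continuous_onI continuous_intros)+
  have "(\<lambda>\<omega>. sin (pi * (enn2real (ennreal (1 / 2 + arctan (F \<omega>) / pi)) - 1 / 2)) / cos (pi * (enn2real (ennreal (1 / 2 + arctan (F \<omega>) / pi)) - 1 / 2))) \<in> borel_measurable N"
    by measurable
  moreover have "sin (pi * (enn2real (ennreal (1 / 2 + arctan x / pi)) - 1 / 2)) / cos (pi * (enn2real (ennreal (1 / 2 + arctan x / pi)) - 1 / 2)) = x" for x
    unfolding enn2real_ennreal[OF b] using tan_arctan[of x] by (simp add: tan_def)
  ultimately show ?thesis by simp
qed

lemma tests_arctan: "tests (\<lambda>_ x. 1 / 2 + arctan x / pi)"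
  unfolding tests_def
proof (intro allI conjI)
  fix x :: real
  show "continuous_on UNIV (\<lambda>x. 1 / 2 + arctan x / pi)" by (intro continuous_intros) auto
  show "0 \<le> 1 / 2 + arctan x / pi" "1 / 2 + arctan x / pi \<le> 1"
    using arctan_lbound[of x] arctan_ubound[of x] pi_gt_zero by (simp_all add: field_simps)
qed

lemma xrot_le_1:
  assumes "0 < k ==> \<exists>!r. r < k \<and> exc k (rot r k w)" "\<And>k y. \<phi> k y \<le> 1"
  shows "xrot k \<phi> w \<le> 1"
proof (cases "0 < k")
  case True
  then obtain r where r: "r < k \<and> exc k (rot r k w)" "\<And>r'. r' < k \<and> exc k (rot r' k w) ==> r' = r" using assms(1) by blast
  have "xrot k \<phi> w \<le> (\<Sum>r'<k. if r' = r then 1 else 0)"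
    unfolding xrot_def
  proof (rule sum_mono)
    fix r' assume "r' \<in> {..<k}"
    then show "(if exc k (rot r' k w) then \<phi> k (rot r' k w) else 0) \<le> (if r' = r then 1 else 0)"
      using r(2)[of r'] assms(2)[of k "rot r' k w"] by (cases "exc k (rot r' k w)") simp_all
  qed
  then show ?thesis using r(1) by simp
qed (simp add: xrot_def)

text \<open>If all points were covered, the finitely many closed selected intervals would contain a
  dense subset of (0, t), hence all of it, and their lengths would add up to at least
  \<open>t\<close>.\<close>

lemma uncovered_ex:
  fixes u :: "nat => real"
  assumes f: "cadlag f" "f t \<le> lft f t" and T: "\<And>j. touch f t (A j) (B j) (G j) (D j)" "\<And>j. G j < u j" "\<And>j. u j < D j"
    and t: "0 < t" and len: "(\<Sum>i<m. fst (trF f t u i)) < t"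
    and dense: "\<And>p q. 0 \<le> p ==> p < q ==> q \<le> t ==> \<exists>j. p < u j \<and> u j < q"
  shows "\<exists>j. u j \<notin> covered f t u m"
proof (rule ccontr)
  assume "\<not> ?thesis"
  then have all: "u j \<in> covered f t u m" for j by blast
  define k where "k i = (LEAST j. u j \<notin> covered f t u i)" for i
  have tr: "fst (trF f t u i) = D (k i) - G (k i)" for i
    using trF_touch(1)[where A = A and B = B and G = G and D = D and u = u and i = i, OF f T] by (simp add: k_def)
  have GD: "G j < D j" for j using T(2,3)[of j] by simp
  define K where "K = (\<Union>i<m. {G (k i)..D (k i)})"
  have cov: "covered f t u m \<subseteq> K"
    unfolding covered_Union[of f t u m] K_def k_def[symmetric] exc_int_touch[OF f T] by force
  have K: "closed K" unfolding K_def by auto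
  have "{0<..<t} \<subseteq> K"
  proof
    fix x assume x: "x \<in> {0<..<t}"
    show "x \<in> K"
    proof (rule ccontr)
      assume "x \<notin> K"
      then obtain e where e: "0 < e" "ball x e \<subseteq> - K" using K open_contains_ball[of "- K"] by (auto simp: open_Compl)
      obtain j where j: "x < u j" "u j < min t (x + e)" using dense[of x "min t (x + e)"] x e by auto
      then have "u j \<in> ball x e" by (simp add: dist_real_def)
      then show False using e(2) all[of j] cov by auto
    qed
  qed
  then have "emeasure lborel {0<..<t} \<le> emeasure lborel K" using K by (intro emeasure_mono) auto
  also have "\<dots> \<le> (\<Sum>i<m. emeasure lborel {G (k i)..D (k i)})"
    unfolding K_def by (rule emeasure_subadditive_finite) auto
  also have "\<dots> = ennreal (\<Sum>i<m. fst (trF f t u i))" using GD by (simp add: tr less_imp_le)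
  finally have "ennreal t \<le> ennreal (\<Sum>i<m. fst (trF f t u i))" using t by simp
  moreover have "0 \<le> (\<Sum>i<m. fst (trF f t u i))" using GD by (intro sum_nonneg) (simp add: tr less_imp_le)
  ultimately show False using len t by (simp add: ennreal_le_iff)
qed

text \<open>The probability of never hitting \<open>B\<close> satisfies
  \<open>p = (1 - b) * p\<close> with \<open>b\<close> the mass of \<open>B\<close>, by conditioning
  on the first entry.\<close>

lemma AE_seq_hits:
  assumes \<rho>: "prob_space \<rho>" "sets \<rho> = sets borel" and B: "B \<in> sets borel" "emeasure \<rho> B \<noteq> 0"
  shows "AE x in PiM (UNIV :: nat set) (\<lambda>_. \<rho>). \<exists>j. x j \<in> (B :: real set)"
proof -
  interpret R: prob_space \<rho> by fact
  let ?P = "PiM (UNIV :: nat set) (\<lambda>_. \<rho>)"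
  interpret P: prob_space ?P by (rule prob_space_PiM) (rule \<rho>)
  have sp: "space \<rho> = UNIV" using sets_eq_imp_space_eq[OF \<rho>(2)] by simp
  have [measurable]: "B \<in> sets \<rho>" using B \<rho>(2) by simp
  define E where "E = {x \<in> space ?P. \<forall>j. x j \<notin> B}"
  have E [measurable]: "E \<in> sets ?P" unfolding E_def by measurable
  have spP: "space ?P = UNIV" by (simp add: space_PiM sp)
  have "emeasure ?P E = (\<integral>\<^sup>+s. \<integral>\<^sup>+x. indicator E (case_nat s x) \<partial>?P \<partial>\<rho>)"
    using iter_nn_integral[OF \<rho>(1), of "indicator E"] by simp
  also have "\<dots> = (\<integral>\<^sup>+s. indicator (- B) s * emeasure ?P E \<partial>\<rho>)"
  proof (intro nn_integral_cong)
    fix s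
    have "indicator E (case_nat s x) = indicator (- B) s * (indicator E x :: ennreal)" for x
    proof -
      have "(\<forall>j. case_nat s x j \<notin> B) \<longleftrightarrow> s \<notin> B \<and> (\<forall>j. x j \<notin> B)" by (auto split: nat.split)
      then show ?thesis by (auto simp: E_def spP indicator_def)
    qed
    then show "(\<integral>\<^sup>+x. indicator E (case_nat s x) \<partial>?P) = indicator (- B) s * emeasure ?P E" by (simp add: nn_integral_cmult)
  qed
  also have "\<dots> = emeasure \<rho> (- B) * emeasure ?P E"
  proof -
    have "- B \<in> sets \<rho>" using B \<rho>(2) by (simp add: borel_comp)
    then show ?thesis by (subst nn_integral_multc) auto
  qed
  finally have e: "emeasure ?P E = emeasure \<rho> (- B) * emeasure ?P E" .
  have "measure \<rho> (- B) = 1 - measure \<rho> B"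
    using R.prob_compl[of B] sp by (simp add: Compl_eq_Diff_UNIV)
  moreover have "measure \<rho> B \<noteq> 0" using B(2) by (simp add: R.emeasure_eq_measure)
  moreover have "measure ?P E = measure \<rho> (- B) * measure ?P E"
    using arg_cong[OF e, of enn2real] by (simp add: enn2real_mult measure_def)
  ultimately have "measure ?P E = 0" by (simp add: algebra_simps)
  then have "emeasure ?P E = 0" by (simp add: P.emeasure_eq_measure)
  then have "AE x in ?P. x \<notin> E" using E by (intro AE_not_in null_setsI)
  then show ?thesis using AE_space by eventually_elim (auto simp: E_def)
qed

text \<open>After the first stick the process restarts on the remaining length
  \<open>T * (1 - s)\<close>; this is what the induction over an arbitrary \<open>T\<close> in
  \<open>AE_stick_L_ne\<close> uses.\<close>

lemma stick_shift:
  "stick_S T (case_nat s v) (Suc i) = T * s + stick_S (T * (1 - s)) v i"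
  "stick_L T (case_nat s v) (Suc i) = stick_L (T * (1 - s)) v i"
proof -
  have S: "stick_S T (case_nat s v) (Suc i) = T * s + stick_S (T * (1 - s)) v i" for i
  proof (induction i)
    case (Suc i)
    have "stick_S T (case_nat s v) (Suc (Suc i)) = stick_S T (case_nat s v) (Suc i) + v i * (T - stick_S T (case_nat s v) (Suc i))"
      by (simp add: stick_L.simps)
    also have "\<dots> = T * s + stick_S (T * (1 - s)) v (Suc i)"
      unfolding Suc by (simp add: stick_L.simps algebra_simps)
    finally show ?case .
  qed (simp add: stick_L.simps)
  show "stick_S T (case_nat s v) (Suc i) = T * s + stick_S (T * (1 - s)) v i" by (rule S)
  show "stick_L T (case_nat s v) (Suc i) = stick_L (T * (1 - s)) v i"
    unfolding stick_L.simps S by (simp add: algebra_simps)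
qed

lemma AE_stick_L_ne:
  assumes T: "0 < T"
  shows "AE v in PiM UNIV (\<lambda>_. unif 1). stick_L T v i \<noteq> s"
proof -
  let ?\<rho> = "uniform_measure lborel {0<..<1::real}"
  let ?P = "PiM (UNIV :: nat set) (\<lambda>_. ?\<rho>)"
  have \<rho>: "prob_space ?\<rho>" by (intro prob_space_uniform_measure) auto
  have sP: "sets ?P = sets PiB" by (intro sets_PiM_cong) auto
  have spP: "space ?P = UNIV" by (simp add: space_PiM)
  have E: "{v. stick_L T v i = s} \<in> sets ?P" for T i
  proof -
    have "(\<lambda>v. stick_L T v i) -` {s} \<inter> space ?P \<in> sets ?P"
      using stick_L_measurable[of T i] by (intro measurable_sets[of _ _ borel]) (simp_all add: measurable_cong_sets[OF sP refl])
    then show ?thesis by (simp add: spP vimage_def)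
  qed
  have "emeasure ?P {v. stick_L T v i = s} = 0"
    using T
  proof (induction i arbitrary: T)
    case 0
    have "emeasure ?P {v. stick_L T v 0 = s} = (\<integral>\<^sup>+x. \<integral>\<^sup>+v. indicator {v. stick_L T v 0 = s} (case_nat x v) \<partial>?P \<partial>?\<rho>)"
      using iter_nn_integral[OF \<rho>, of "indicator {v. stick_L T v 0 = s}"] E[of T 0] by simp
    also have "\<dots> = (\<integral>\<^sup>+x. \<integral>\<^sup>+v. indicator {s / T} x \<partial>?P \<partial>?\<rho>)"
      using 0 by (intro nn_integral_cong) (auto simp: stick_L.simps indicator_def field_simps)
    also have "\<dots> = emeasure ?\<rho> {s / T}"
      by (simp add: prob_space.emeasure_space_1[OF prob_space_PiM[OF \<rho>]])
    also have "\<dots> = 0"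
    proof -
      have "emeasure lborel ({0<..<1} \<inter> {s / T}) \<le> emeasure lborel {s / T}" by (intro emeasure_mono) auto
      then show ?thesis by (subst emeasure_uniform_measure) auto
    qed
    finally show ?case .
  next
    case (Suc i)
    have "emeasure ?P {v. stick_L T v (Suc i) = s} = (\<integral>\<^sup>+x. \<integral>\<^sup>+v. indicator {v. stick_L T v (Suc i) = s} (case_nat x v) \<partial>?P \<partial>?\<rho>)"
      using iter_nn_integral[OF \<rho>, of "indicator {v. stick_L T v (Suc i) = s}"] E[of T "Suc i"] by simp
    also have "\<dots> = (\<integral>\<^sup>+x. \<integral>\<^sup>+v. indicator {v. stick_L (T * (1 - x)) v i = s} v \<partial>?P \<partial>?\<rho>)"
      by (intro nn_integral_cong) (simp add: indicator_def stick_shift)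
    also have "\<dots> = (\<integral>\<^sup>+x. 0 \<partial>?\<rho>)"
    proof (rule nn_integral_cong_AE)
      have "AE x in ?\<rho>. x \<in> {0<..<1}" by (rule AE_uniform_measureI) auto
      then show "AE x in ?\<rho>. (\<integral>\<^sup>+v. indicator {v. stick_L (T * (1 - x)) v i = s} v \<partial>?P) = 0"
      proof eventually_elim
        case (elim x)
        then have "0 < T * (1 - x)" using Suc.prems by simp
        then show ?case using Suc.IH E by simp
      qed
    qed
    finally show ?case by simp
  qed
  then have "AE v in ?P. v \<notin> {v. stick_L T v i = s}" using E by (intro AE_not_in null_setsI)
  then show ?thesis by simp
qed

section \<open>Equality of the limit laws\<close>

context pitman begin

abbreviation tF :: "(nat \<times> (bool + real) => real => real) => (nat \<times> (bool + real)) set => real => 'a => ennreal" where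
  "tF h J \<epsilon> \<omega> \<equiv> ennreal (\<Prod>c\<in>J. h c (Fc \<epsilon> c \<omega>))"

abbreviation tG :: "(nat \<times> (bool + real) => real => real) => (nat \<times> (bool + real)) set => real => 'a => ennreal" where
  "tG h J \<epsilon> \<omega> \<equiv> ennreal (\<Prod>c\<in>J. h c (Gc \<epsilon> c \<omega>))"

lemma SvM_le_1:
  assumes h: "tests h" shows "SvM h J m \<epsilon> n \<omega> \<le> 1"
  unfolding SvM_def Sv_def
proof (rule sval_le_1[OF finite_faces reg_disjoint[OF tpos zero_less_Suc]])
  fix f and p :: "nat \<times> nat"
  assume "f \<in> set (map (\<lambda>\<phi> p. \<phi> (snd p) (shift_seq (fst p) (incr (path \<omega>) t (Suc n)))) (map (psi h J t \<epsilon> (Suc n)) [0..<m]))"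
  then obtain i where "f = (\<lambda>p. psi h J t \<epsilon> (Suc n) i (snd p) (shift_seq (fst p) (incr (path \<omega>) t (Suc n))))" by auto
  then show "f p \<le> 1" by (simp only: psi_le_1[OF h])
qed

lemma AE_StM_le_1:
  assumes h: "tests h" shows "AE \<omega> in M. StM h J m \<epsilon> n \<omega> \<le> 1"
  using AE_rot_unique
proof eventually_elim
  case (elim \<omega>)
  let ?\<phi>s = "map (psi h J t \<epsilon> (Suc n)) [0..<m]" and ?w = "incr (path \<omega>) t (Suc n)"
  have s0: "shift_seq 0 x = x" for x :: "nat => real" by (rule ext) (simp add: shift_seq_def)
  have "StM h J m \<epsilon> n \<omega> = (\<Prod>l<length ?\<phi>s. xrot (stk (V.Ws \<omega>) (Suc n) l) (?\<phi>s ! l) (shift_seq (stq (V.Ws \<omega>) (Suc n) l) ?w))"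
    unfolding StM_def using St_prod[of ?\<phi>s "Suc n" "V.Ws \<omega>" 0 ?w] by (simp add: s0)
  also have "\<dots> \<le> 1"
  proof (rule prod_ennreal_le_1)
    fix l assume l: "l \<in> {..<length ?\<phi>s}"
    show "xrot (stk (V.Ws \<omega>) (Suc n) l) (?\<phi>s ! l) (shift_seq (stq (V.Ws \<omega>) (Suc n) l) ?w) \<le> 1"
    proof (rule xrot_le_1)
      show "\<exists>!r. r < stk (V.Ws \<omega>) (Suc n) l \<and> exc (stk (V.Ws \<omega>) (Suc n) l) (rot r (stk (V.Ws \<omega>) (Suc n) l) (shift_seq (stq (V.Ws \<omega>) (Suc n) l) ?w))"
        if "0 < stk (V.Ws \<omega>) (Suc n) l" using elim that by blast
      show "(?\<phi>s ! l) k y \<le> 1" for k y using l psi_le_1[OF h] by simp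
    qed
  qed
  finally show ?case .
qed

lemma tFG_measurable:
  assumes pk: "picks m" and h: "tests h" and J: "finite J" "J \<subseteq> {..<m} \<times> UNIV" and \<epsilon>: "\<epsilon> \<noteq> 0"
  shows "tF h J \<epsilon> \<in> borel_measurable Mc" "tG h J \<epsilon> \<in> borel_measurable Mc"
  by (rule measurable_completion_ennreal_limit[OF measurable_completion[OF SvM_StM(1)[OF h]] AE_SvM_limit[OF pk h J \<epsilon>]],
      rule measurable_completion_ennreal_limit[OF measurable_completion[OF SvM_StM(2)[OF h]] AE_StM_limit[OF h J \<epsilon>]])

lemma law_eps:
  assumes pk: "picks m" and h: "tests h" and J: "finite J" "J \<subseteq> {..<m} \<times> UNIV" and \<epsilon>: "\<epsilon> \<noteq> 0"
  shows "(\<integral>\<^sup>+\<omega>. tF h J \<epsilon> \<omega> \<partial>Mc) = (\<integral>\<^sup>+\<omega>. tG h J \<epsilon> \<omega> \<partial>Mc)"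
proof -
  have one: "(\<integral>\<^sup>+\<omega>. 1 \<partial>Mc) < \<infinity>" using C.emeasure_space_1 by simp
  have "(\<lambda>n. \<integral>\<^sup>+\<omega>. SvM h J m \<epsilon> n \<omega> \<partial>Mc) \<longlonglongrightarrow> (\<integral>\<^sup>+\<omega>. tF h J \<epsilon> \<omega> \<partial>Mc)"
    by (rule nn_integral_dominated_convergence[OF measurable_completion[OF SvM_StM(1)[OF h]] tFG_measurable(1)[OF pk h J \<epsilon>] _ _ one AE_completion[OF AE_SvM_limit[OF pk h J \<epsilon>]]])
       (simp_all add: SvM_le_1[OF h])
  moreover have "(\<lambda>n. \<integral>\<^sup>+\<omega>. StM h J m \<epsilon> n \<omega> \<partial>Mc) \<longlonglongrightarrow> (\<integral>\<^sup>+\<omega>. tG h J \<epsilon> \<omega> \<partial>Mc)"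
    by (rule nn_integral_dominated_convergence[OF measurable_completion[OF SvM_StM(2)[OF h]] tFG_measurable(2)[OF pk h J \<epsilon>] _ AE_completion[OF AE_StM_le_1[OF h]] one AE_completion[OF AE_StM_limit[OF h J \<epsilon>]]])
       simp
  ultimately show ?thesis unfolding nn_integral_completion SvM_StM(3)[OF h] by (rule LIMSEQ_unique)
qed

lemma AE_tFG_smooth:
  assumes h: "tests h"
  shows "AE \<omega> in M. (\<lambda>p. tF h J (1 / real (Suc p)) \<omega>) \<longlonglongrightarrow> tF h J 0 \<omega>" "AE \<omega> in M. (\<lambda>p. tG h J (1 / real (Suc p)) \<omega>) \<longlonglongrightarrow> tG h J 0 \<omega>"
proof -
  have l: "(\<lambda>p. ennreal (\<Prod>c\<in>J. h c (y p c))) \<longlonglongrightarrow> ennreal (\<Prod>c\<in>J. h c (z c))" if "\<And>c. (\<lambda>p. y p c) \<longlonglongrightarrow> z c" for y z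
  proof (intro tendsto_ennrealI tendsto_prod)
    fix c
    have "continuous_on UNIV (h c)" using h unfolding tests_def by blast
    then show "(\<lambda>p. h c (y p c)) \<longlonglongrightarrow> h c (z c)" by (rule continuous_on_tendsto_compose[OF _ that]) simp_all
  qed
  show "AE \<omega> in M. (\<lambda>p. tF h J (1 / real (Suc p)) \<omega>) \<longlonglongrightarrow> tF h J 0 \<omega>"
    by (rule eventually_mono[OF AE_Fc_smooth], rule l, erule spec)
  show "AE \<omega> in M. (\<lambda>p. tG h J (1 / real (Suc p)) \<omega>) \<longlonglongrightarrow> tG h J 0 \<omega>"
    by (rule eventually_mono[OF AE_Gc_smooth], rule l, erule spec)
qed

lemma tFG_0_measurable:
  assumes pk: "picks m" and h: "tests h" and J: "finite J" "J \<subseteq> {..<m} \<times> UNIV"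
  shows "tF h J 0 \<in> borel_measurable Mc" "tG h J 0 \<in> borel_measurable Mc"
  by (rule measurable_completion_ennreal_limit[OF tFG_measurable(1)[OF pk h J] AE_tFG_smooth(1)[OF h]], simp,
      rule measurable_completion_ennreal_limit[OF tFG_measurable(2)[OF pk h J] AE_tFG_smooth(2)[OF h]], simp)

lemma tFG_le_1:
  assumes "tests h" shows "tF h J \<epsilon> \<omega> \<le> 1" "tG h J \<epsilon> \<omega> \<le> 1"
proof -
  have b: "0 \<le> h c x \<and> h c x \<le> 1" for c x using assms unfolding tests_def by blast
  show "tF h J \<epsilon> \<omega> \<le> 1" "tG h J \<epsilon> \<omega> \<le> 1" unfolding ennreal_le_1 by (intro prod_le_1 b)+
qed

lemma law_0:
  assumes pk: "picks m" and h: "tests h" and J: "finite J" "J \<subseteq> {..<m} \<times> UNIV"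
  shows "(\<integral>\<^sup>+\<omega>. tF h J 0 \<omega> \<partial>Mc) = (\<integral>\<^sup>+\<omega>. tG h J 0 \<omega> \<partial>Mc)"
proof -
  have one: "(\<integral>\<^sup>+\<omega>. 1 \<partial>Mc) < \<infinity>" using C.emeasure_space_1 by simp
  have p: "1 / real (Suc p) \<noteq> 0" for p by simp
  have "(\<lambda>p. \<integral>\<^sup>+\<omega>. tF h J (1 / real (Suc p)) \<omega> \<partial>Mc) \<longlonglongrightarrow> (\<integral>\<^sup>+\<omega>. tF h J 0 \<omega> \<partial>Mc)"
    by (rule nn_integral_dominated_convergence[OF tFG_measurable(1)[OF pk h J p] tFG_0_measurable(1)[OF pk h J] _ _ one AE_completion[OF AE_tFG_smooth(1)[OF h]]])
       (simp_all add: tFG_le_1[OF h] del: of_nat_Suc ennreal_le_1)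
  moreover have "(\<lambda>p. \<integral>\<^sup>+\<omega>. tG h J (1 / real (Suc p)) \<omega> \<partial>Mc) \<longlonglongrightarrow> (\<integral>\<^sup>+\<omega>. tG h J 0 \<omega> \<partial>Mc)"
    by (rule nn_integral_dominated_convergence[OF tFG_measurable(2)[OF pk h J p] tFG_0_measurable(2)[OF pk h J] _ _ one AE_completion[OF AE_tFG_smooth(2)[OF h]]])
       (simp_all add: tFG_le_1[OF h] del: of_nat_Suc ennreal_le_1)
  ultimately show ?thesis unfolding law_eps[OF pk h J p] by (rule LIMSEQ_unique)
qed

lemma FGc_measurable:
  assumes pk: "picks m" and c: "fst c < m"
  shows "Fc 0 c \<in> borel_measurable Mc" "Gc 0 c \<in> borel_measurable Mc"
proof -
  have J: "finite {c}" "{c} \<subseteq> {..<m} \<times> UNIV" using c by (auto simp: mem_Times_iff)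
  note m = tFG_0_measurable[OF pk tests_arctan J]
  show "Fc 0 c \<in> borel_measurable Mc" by (rule measurable_arctan_test) (use m(1) in simp)
  show "Gc 0 c \<in> borel_measurable Mc" by (rule measurable_arctan_test) (use m(2) in simp)
qed

text \<open>The bound \<open>m\<close> on the block indices is explicit, so that the law of the
  first \<open>m\<close> blocks is available before later selections are known to succeed.\<close>

lemma box_law:
  assumes pk: "picks m" and J: "finite J" "J \<subseteq> {..<m} \<times> UNIV" and A: "\<And>c. c \<in> J ==> A c \<in> sets borel"
  shows "emeasure Mc {\<omega>\<in>space Mc. \<forall>c\<in>J. Fc 0 c \<omega> \<in> A c} = emeasure Mc {\<omega>\<in>space Mc. \<forall>c\<in>J. Gc 0 c \<omega> \<in> A c}"
proof (rule C.eq_law_tests[OF _ _ J(1) _ A])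
  have c: "fst c < m" if "c \<in> J" for c using that J(2) by auto
  show "Fc 0 c \<in> borel_measurable Mc" "Gc 0 c \<in> borel_measurable Mc" if "c \<in> J" for c
    using FGc_measurable[OF pk c[OF that]] by auto
  fix h :: "nat \<times> (bool + real) => real => real" assume h: "tests h"
  then have h0: "0 \<le> h c x" for c x unfolding tests_def by blast
  show "(\<integral>\<^sup>+\<omega>. (\<Prod>c\<in>J. ennreal (h c (Fc 0 c \<omega>))) \<partial>Mc) = (\<integral>\<^sup>+\<omega>. (\<Prod>c\<in>J. ennreal (h c (Gc 0 c \<omega>))) \<partial>Mc)"
    using law_0[OF pk h J] by (simp add: prod_ennreal h0)
qed

lemma AE_U_dense: "AE \<omega> in M. \<forall>p q. 0 \<le> p --> p < q --> q \<le> t --> (\<exists>j. p < U j \<omega> \<and> U j \<omega> < q)"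
proof -
  have "AE \<omega> in M. \<exists>j. U j \<omega> \<in> {of_rat p<..<of_rat q}" if pq: "0 \<le> real_of_rat p" "real_of_rat p < of_rat q" "of_rat q \<le> t" for p q
  proof -
    let ?\<rho> = "unif t"
    have "{0<..<t} \<inter> {of_rat p<..<of_rat q} = {real_of_rat p<..<of_rat q}" using pq by auto
    then have "emeasure ?\<rho> {of_rat p<..<of_rat q} = emeasure lborel {real_of_rat p<..<of_rat q} / ennreal t"
      using tpos by (subst emeasure_uniform_measure) simp_all
    then have "emeasure ?\<rho> {of_rat p<..<of_rat q} \<noteq> 0" using pq tpos by (auto simp: divide_ennreal)
    moreover have "prob_space ?\<rho>" using tpos by (intro prob_space_uniform_measure) auto
    ultimately have "AE x in PiM UNIV (\<lambda>_::nat. ?\<rho>). \<exists>j. x j \<in> {of_rat p<..<of_rat q}" by (intro AE_seq_hits) auto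
    then show ?thesis unfolding U.Ws_law[symmetric] by (rule AE_distrD[OF U.Ws_measurable])
  qed
  then have "AE \<omega> in M. \<forall>p q. 0 \<le> real_of_rat p --> real_of_rat p < of_rat q --> of_rat q \<le> t --> (\<exists>j. U j \<omega> \<in> {of_rat p<..<of_rat q})"
    by (simp add: AE_all_countable)
  then show ?thesis
  proof eventually_elim
    case (elim \<omega>)
    show ?case
    proof (intro allI impI)
      fix p q :: real assume pq: "0 \<le> p" "p < q" "q \<le> t"
      obtain p' where p': "p < of_rat p'" "of_rat p' < q" using of_rat_dense[OF pq(2)] by blast
      obtain q' where q': "of_rat p' < real_of_rat q'" "of_rat q' < q" using of_rat_dense[OF p'(2)] by blast
      have "0 \<le> real_of_rat p'" "of_rat q' \<le> t" using pq p' q' by linarith+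
      then obtain j where "U j \<omega> \<in> {of_rat p'<..<of_rat q'}" using elim q'(1) by blast
      then have "p < U j \<omega>" "U j \<omega> < q" using p' q' by auto
      then show "\<exists>j. p < U j \<omega> \<and> U j \<omega> < q" by blast
    qed
  qed
qed

text \<open>There is no circularity: the step uses \<open>box_law\<close> for the first
  \<open>m\<close> blocks only. Their lengths then sum to less than \<open>t\<close> almost surely,
  as the sticks do, and \<open>uncovered_ex\<close> provides the next point.\<close>

lemma picks_all: "picks m"
proof (induction m)
  case (Suc m)
  \<comment> \<open>The index set of the first \<open>m\<close> lengths; only these enter the
    comparison with the sticks.\<close>
  define I where "I = {..<m} \<times> {Inl True :: bool + real}"
  define P where "P x \<longleftrightarrow> (\<Sum>i<m. x (i, Inl True)) < t" for x :: "nat \<times> (bool + real) => real"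
  have mem: "(i, Inl True) \<in> I" if "i < m" for i using that by (simp add: I_def)
  have fm: "Fc 0 c \<in> borel_measurable Mc" "Gc 0 c \<in> borel_measurable Mc" if "c \<in> I" for c
    using FGc_measurable[OF Suc, of c] that by (auto simp: I_def)
  have m: "(\<lambda>\<omega>. \<lambda>c\<in>I. Fc 0 c \<omega>) \<in> measurable Mc (PiM I (\<lambda>_. borel))" "(\<lambda>\<omega>. \<lambda>c\<in>I. Gc 0 c \<omega>) \<in> measurable Mc (PiM I (\<lambda>_. borel))"
    by (rule measurable_restrict, erule fm)+
  have "distr Mc (PiM I (\<lambda>_. borel)) (\<lambda>\<omega>. \<lambda>c\<in>I. Fc 0 c \<omega>) = distr Mc (PiM I (\<lambda>_. borel)) (\<lambda>\<omega>. \<lambda>c\<in>I. Gc 0 c \<omega>)"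
  proof (rule C.eq_law_PiM)
    fix J A assume J: "finite J" "J \<subseteq> I" and A: "\<And>c. c \<in> J ==> A c \<in> sets (borel :: real measure)"
    have "J \<subseteq> {..<m} \<times> UNIV" using J(2) by (auto simp: I_def)
    from box_law[OF Suc J(1) this A] show "emeasure Mc {\<omega> \<in> space Mc. \<forall>c\<in>J. Fc 0 c \<omega> \<in> A c} =
      emeasure Mc {\<omega> \<in> space Mc. \<forall>c\<in>J. Gc 0 c \<omega> \<in> A c}" by simp
  qed (erule fm)+
  note law = this
  have pm: "{x \<in> space (PiM I (\<lambda>_. borel)). P x} \<in> sets (PiM I (\<lambda>_. borel))"
  proof -
    have [measurable]: "(\<lambda>x. \<Sum>i<m. x (i, Inl True)) \<in> borel_measurable (PiM I (\<lambda>_. borel :: real measure))"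
      using mem by (intro borel_measurable_sum measurable_component_singleton) auto
    show ?thesis unfolding P_def by measurable
  qed
  have "AE \<omega> in Mc. P (\<lambda>c\<in>I. Gc 0 c \<omega>)"
    using AE_completion[OF AE_V_good]
  proof eventually_elim
    case (elim \<omega>)
    have "(\<Sum>i<l. stick_L t (V.Ws \<omega>) i) = stick_S t (V.Ws \<omega>) l" for l by (induction l) auto
    moreover have "stick_S t (V.Ws \<omega>) m < t" using stick_pos(2)[of t "V.Ws \<omega>" m] tpos elim by blast
    ultimately show ?case using mem by (simp add: P_def Gc_def coord_0 trG_def)
  qed
  then have "AE x in distr Mc (PiM I (\<lambda>_. borel)) (\<lambda>\<omega>. \<lambda>c\<in>I. Fc 0 c \<omega>). P x"
    unfolding law using AE_distr_iff[OF m(2) pm] by simp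
  then have "AE \<omega> in Mc. P (\<lambda>c\<in>I. Fc 0 c \<omega>)" by (rule AE_distrD[OF m(1)])
  then have "AE \<omega> in M. P (\<lambda>c\<in>I. Fc 0 c \<omega>)" by (simp add: AE_completion_iff)
  with AE_U_good AE_left_cont[OF tpos] AE_space AE_U_dense Suc[unfolded picks_def] show ?case unfolding picks_def
  proof eventually_elim
    case (elim \<omega>)
    then obtain A B G D where T: "\<And>j. touch (path \<omega>) t (A j) (B j) (G j) (D j)" "\<And>j. G j < U j \<omega>" "\<And>j. U j \<omega> < D j" by metis
    have ft: "path \<omega> t \<le> lft (path \<omega>) t" using elim(2) by simp
    have len: "(\<Sum>i<m. fst (trF (path \<omega>) t (U.Ws \<omega>) i)) < t" using elim(6) mem by (simp add: P_def Fc_def coord_0)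
    have "\<exists>j. U j \<omega> \<notin> covered (path \<omega>) t (U.Ws \<omega>) m"
      by (rule uncovered_ex[OF X_cadlag[OF elim(3)] ft T tpos len]) (use elim(4) in blast)
    then show ?case using elim(5) by (metis less_SucE)
  qed
qed (simp add: picks_def)

text \<open>The coordinates exactly as they stand in the theorem. They differ from
  \<open>Fc 0\<close> only when the time \<open>s\<close> equals the length of the block.\<close>

definition Fa :: "nat \<times> (bool + real) => 'a => real" where
  "Fa c \<omega> = (case snd c of Inl b => if b then fst (trF (path \<omega>) t (U.Ws \<omega>) (fst c)) else fst (snd (trF (path \<omega>) t (U.Ws \<omega>) (fst c)))
     | Inr s => snd (snd (trF (path \<omega>) t (U.Ws \<omega>) (fst c))) s)"

definition Ga :: "nat \<times> (bool + real) => 'a => real" where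
  "Ga c \<omega> = (case snd c of Inl b => if b then fst (trG (path \<omega>) t (V.Ws \<omega>) (fst c)) else fst (snd (trG (path \<omega>) t (V.Ws \<omega>) (fst c)))
     | Inr s => snd (snd (trG (path \<omega>) t (V.Ws \<omega>) (fst c))) s)"

text \<open>Stick lengths have no atoms by direct computation. For excursion intervals this follows
  from \<open>box_law\<close> with a singleton, so the right end point is almost surely not at a
  prescribed time.\<close>

lemma AE_length_ne:
  "AE \<omega> in M. fst (trF (path \<omega>) t (U.Ws \<omega>) i) \<noteq> s" "AE \<omega> in M. fst (trG (path \<omega>) t (V.Ws \<omega>) i) \<noteq> s"
proof -
  have "AE \<omega> in M. stick_L t (V.Ws \<omega>) i \<noteq> s"
    using AE_stick_L_ne[OF tpos, of i s] unfolding V.Ws_law[symmetric] by (rule AE_distrD[OF V.Ws_measurable])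
  then show 2: "AE \<omega> in M. fst (trG (path \<omega>) t (V.Ws \<omega>) i) \<noteq> s" by (simp add: trG_def)
  let ?c = "(i, Inl True :: bool + real)"
  have eq: "Fc 0 ?c \<omega> = fst (trF (path \<omega>) t (U.Ws \<omega>) i)" "Gc 0 ?c \<omega> = fst (trG (path \<omega>) t (V.Ws \<omega>) i)" for \<omega>
    by (simp_all add: Fc_def Gc_def coord_0)
  have m: "Fc 0 ?c \<in> borel_measurable Mc" "Gc 0 ?c \<in> borel_measurable Mc"
    using FGc_measurable[OF picks_all, of ?c "Suc i"] by auto
  have z: "(AE \<omega> in Mc. Z \<omega> \<noteq> s) \<longleftrightarrow> emeasure Mc {\<omega>\<in>space Mc. Z \<omega> = s} = 0"
    if Z: "Z \<in> borel_measurable Mc" for Z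
  proof (subst AE_iff_measurable[OF _ refl])
    have "{\<omega>\<in>space Mc. \<not> Z \<omega> \<noteq> s} = Z -` {s} \<inter> space Mc" by auto
    then show "{\<omega>\<in>space Mc. \<not> Z \<omega> \<noteq> s} \<in> sets Mc" using measurable_sets[OF Z, of "{s}"] by simp
  qed simp
  have "emeasure Mc {\<omega>\<in>space Mc. Fc 0 ?c \<omega> = s} = emeasure Mc {\<omega>\<in>space Mc. Gc 0 ?c \<omega> = s}"
    using box_law[OF picks_all, of "{?c}" "Suc i" "\<lambda>_. {s}"] by simp
  also have "\<dots> = 0" using z[OF m(2)] 2 by (simp add: eq AE_completion_iff)
  finally show "AE \<omega> in M. fst (trF (path \<omega>) t (U.Ws \<omega>) i) \<noteq> s"
    using z[OF m(1)] by (simp add: eq AE_completion_iff)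
qed

lemma AE_Fa: "AE \<omega> in M. Fa c \<omega> = Fc 0 c \<omega>" and AE_Ga: "AE \<omega> in M. Ga c \<omega> = Gc 0 c \<omega>"
proof -
  obtain i x where c: "c = (i, x)" by (cases c)
  have "AE \<omega> in M. (\<forall>s. x = Inr s --> fst (trF (path \<omega>) t (U.Ws \<omega>) i) \<noteq> s)" by (cases x) (auto simp: AE_length_ne)
  then show "AE \<omega> in M. Fa c \<omega> = Fc 0 c \<omega>"
  proof eventually_elim
    case (elim \<omega>)
    then show ?case unfolding c Fa_def Fc_def coord_0 by (auto simp: clip_def trF_def excursion_def split: sum.split)
  qed
  have "AE \<omega> in M. (\<forall>s. x = Inr s --> fst (trG (path \<omega>) t (V.Ws \<omega>) i) \<noteq> s)" by (cases x) (auto simp: AE_length_ne)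
  then show "AE \<omega> in M. Ga c \<omega> = Gc 0 c \<omega>"
  proof eventually_elim
    case (elim \<omega>)
    then show ?case unfolding c Ga_def Gc_def coord_0 by (auto simp: clip_def trG_def vervaat_def split: sum.split)
  qed
qed

lemma FGa_measurable: "Fa c \<in> borel_measurable Mc" "Ga c \<in> borel_measurable Mc"
proof -
  note m = FGc_measurable[OF picks_all lessI[of "fst c"]]
  show "Fa c \<in> borel_measurable Mc"
    by (rule measurable_completion_AE_cong[OF m(1)], rule eventually_mono[OF AE_Fa[of c]]) simp
  show "Ga c \<in> borel_measurable Mc"
    by (rule measurable_completion_AE_cong[OF m(2)], rule eventually_mono[OF AE_Ga[of c]]) simp
qed

text \<open>Clipping is undone one coordinate at a time. The exceptional null set depends on the
  coordinate, but finitely many coordinates at once determine the joint law.\<close>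

lemma coordinate_law:
  "distr Mc PiB (\<lambda>\<omega>. \<lambda>c\<in>UNIV. Fa c \<omega>) = distr Mc PiB (\<lambda>\<omega>. \<lambda>c\<in>UNIV. Ga c \<omega>)"
proof (rule C.eq_law_PiM)
  fix J :: "(nat \<times> (bool + real)) set" and A
  assume J: "finite J" "J \<subseteq> UNIV" and A: "\<And>c. c \<in> J ==> A c \<in> sets (borel :: real measure)"
  obtain m where m: "\<forall>i\<in>fst ` J. i < m" using finite_imageI[OF J(1), of fst] unfolding finite_nat_set_iff_bounded by blast
  then have Jm: "J \<subseteq> {..<m} \<times> UNIV" by (auto simp: mem_Times_iff)
  have mm: "{\<omega>\<in>space Mc. \<forall>c\<in>J. Z c \<omega> \<in> A c} \<in> sets Mc"
    if Z: "\<And>c. c \<in> J ==> Z c \<in> borel_measurable Mc" for Z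
  proof -
    have "{\<omega>\<in>space Mc. Z c \<omega> \<in> A c} \<in> sets Mc" if "c \<in> J" for c
    proof -
      have "{\<omega>\<in>space Mc. Z c \<omega> \<in> A c} = Z c -` A c \<inter> space Mc" by auto
      then show ?thesis using measurable_sets[OF Z[OF that] A[OF that]] by simp
    qed
    then show ?thesis using J(1) by (rule sets.sets_Collect_finite_All)
  qed
  have c: "fst c < m" if "c \<in> J" for c using that m by auto
  have aF: "AE \<omega> in Mc. \<forall>c\<in>J. Fa c \<omega> = Fc 0 c \<omega>" using J(1) AE_Fa by (intro AE_completion AE_finite_allI)
  have aG: "AE \<omega> in Mc. \<forall>c\<in>J. Ga c \<omega> = Gc 0 c \<omega>" using J(1) AE_Ga by (intro AE_completion AE_finite_allI)
  have "emeasure Mc {\<omega>\<in>space Mc. \<forall>c\<in>J. Fa c \<omega> \<in> A c} = emeasure Mc {\<omega>\<in>space Mc. \<forall>c\<in>J. Fc 0 c \<omega> \<in> A c}"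
    by (rule emeasure_eq_AE, rule eventually_mono[OF aF], simp, rule mm, rule FGa_measurable, rule mm, rule FGc_measurable[OF picks_all], erule c)
  also have "\<dots> = emeasure Mc {\<omega>\<in>space Mc. \<forall>c\<in>J. Gc 0 c \<omega> \<in> A c}"
    by (rule box_law[OF picks_all J(1) Jm A])
  also have "\<dots> = emeasure Mc {\<omega>\<in>space Mc. \<forall>c\<in>J. Ga c \<omega> \<in> A c}"
    by (rule emeasure_eq_AE, rule eventually_mono[OF aG], simp, rule mm, rule FGc_measurable[OF picks_all], erule c, rule mm, rule FGa_measurable)
  finally show "emeasure Mc {\<omega>\<in>space Mc. \<forall>c\<in>J. Fa c \<omega> \<in> A c} = emeasure Mc {\<omega>\<in>space Mc. \<forall>c\<in>J. Ga c \<omega> \<in> A c}" .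
qed (rule FGa_measurable)+

lemma main:
  defines "N \<equiv> PiM (UNIV :: nat set) (\<lambda>_. borel \<Otimes>\<^sub>M borel \<Otimes>\<^sub>M PiM (UNIV :: real set) (\<lambda>_. borel))"
    and "F \<equiv> \<lambda>\<omega>. trF (path \<omega>) t (U.Ws \<omega>)" and "G \<equiv> \<lambda>\<omega>. trG (path \<omega>) t (V.Ws \<omega>)"
  shows "F \<in> measurable Mc N \<and> G \<in> measurable Mc N \<and> distr Mc N F = distr Mc N G"
proof -
  let ?P = "PiM (UNIV :: (nat \<times> (bool + real)) set) (\<lambda>_. borel :: real measure)"
  define \<Phi> :: "(nat \<times> (bool + real) => real) => nat => real \<times> real \<times> (real => real)"
    where "\<Phi> x n = (x (n, Inl True), x (n, Inl False), \<lambda>s. x (n, Inr s))" for x n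
  have c: "(\<lambda>x. x c) \<in> borel_measurable ?P" for c by (rule measurable_component_singleton) simp
  have "(\<lambda>x s. x (n, Inr s)) \<in> measurable ?P (PiM (UNIV :: real set) (\<lambda>_. borel))" for n
    by (rule measurable_PiM_single') (auto simp: space_PiM c)
  then have "(\<lambda>x. \<Phi> x n) \<in> measurable ?P (borel \<Otimes>\<^sub>M borel \<Otimes>\<^sub>M PiM (UNIV :: real set) (\<lambda>_. borel))" for n
    unfolding \<Phi>_def by (intro measurable_Pair c)
  then have \<Phi>: "\<Phi> \<in> measurable ?P N"
    unfolding N_def by (intro measurable_PiM_single') (auto simp: space_PiM space_pair_measure)
  have mF: "(\<lambda>\<omega>. \<lambda>c\<in>UNIV. Fa c \<omega>) \<in> measurable Mc ?P" by (rule measurable_restrict) (rule FGa_measurable)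
  have mG: "(\<lambda>\<omega>. \<lambda>c\<in>UNIV. Ga c \<omega>) \<in> measurable Mc ?P" by (rule measurable_restrict) (rule FGa_measurable)
  have F: "F = \<Phi> \<circ> (\<lambda>\<omega>. \<lambda>c\<in>UNIV. Fa c \<omega>)" by (intro ext) (simp add: F_def \<Phi>_def Fa_def)
  have G: "G = \<Phi> \<circ> (\<lambda>\<omega>. \<lambda>c\<in>UNIV. Ga c \<omega>)" by (intro ext) (simp add: G_def \<Phi>_def Ga_def)
  show ?thesis
    unfolding F G using measurable_comp[OF mF \<Phi>] measurable_comp[OF mG \<Phi>]
    by (simp add: distr_distr[OF \<Phi> mF, symmetric] distr_distr[OF \<Phi> mG, symmetric] coordinate_law)
qed

end

theorem theorem4:
  fixes M :: "'a measure" and X :: "real \<Rightarrow> 'a \<Rightarrow> real" and t :: real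
    and U :: "nat \<Rightarrow> 'a \<Rightarrow> real" and V :: "nat \<Rightarrow> 'a \<Rightarrow> real"
  assumes levy: "levy_process M X"
    and CD: "hyp_CD M X"
    and tpos: "t > 0"
    and U_meas: "\<And>i. U i \<in> borel_measurable M"
    and U_iid: "prob_space.indep_vars M (\<lambda>_. borel) U UNIV"
    and U_unif: "\<And>i. distr M borel (U i) = uniform_measure lborel {0<..<t}"
    and U_indep: "\<And>A B. A \<in> sets (PiM (UNIV :: real set) (\<lambda>_. borel)) \<Longrightarrow>
                 B \<in> sets (PiM (UNIV :: nat set) (\<lambda>_. borel)) \<Longrightarrow>
                 measure M {\<omega> \<in> space M. (\<lambda>s. X s \<omega>) \<in> A \<and> (\<lambda>n. U n \<omega>) \<in> B} =
                 measure M {\<omega> \<in> space M. (\<lambda>s. X s \<omega>) \<in> A} *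
                 measure M {\<omega> \<in> space M. (\<lambda>n. U n \<omega>) \<in> B}"
    and V_meas: "\<And>i. V i \<in> borel_measurable M"
    and V_iid: "prob_space.indep_vars M (\<lambda>_. borel) V UNIV"
    and V_unif: "\<And>i. distr M borel (V i) = uniform_measure lborel {0<..<1}"
    and V_indep: "\<And>A B. A \<in> sets (PiM (UNIV :: real set) (\<lambda>_. borel)) \<Longrightarrow>
                 B \<in> sets (PiM (UNIV :: nat set) (\<lambda>_. borel)) \<Longrightarrow>
                 measure M {\<omega> \<in> space M. (\<lambda>s. X s \<omega>) \<in> A \<and> (\<lambda>n. V n \<omega>) \<in> B} =
                 measure M {\<omega> \<in> space M. (\<lambda>s. X s \<omega>) \<in> A} *
                 measure M {\<omega> \<in> space M. (\<lambda>n. V n \<omega>) \<in> B}"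
  defines "N \<equiv> PiM (UNIV :: nat set)
                  (\<lambda>_. borel \<Otimes>\<^sub>M borel \<Otimes>\<^sub>M PiM (UNIV :: real set) (\<lambda>_. borel))"
    and "F \<equiv> (\<lambda>\<omega> (n::nat).
            (let f = (\<lambda>s. X s \<omega>); u = (\<lambda>j. U j \<omega>);
                 g = sel_g f t u n; d = sel_d f t u n
             in (d - g, conv_minorant f t d - conv_minorant f t g, excursion f t g d)))"
    and "G \<equiv> (\<lambda>\<omega> (n::nat).
            (let f = (\<lambda>s. X s \<omega>); v = (\<lambda>j. V j \<omega>);
                 a = stick_S t v n; l = stick_L t v n
             in (l, f (a + l) - f a, vervaat l (knight f a l))))"
  shows "F \<in> measurable (completion M) N \<and> G \<in> measurable (completion M) N \<and>
         distr (completion M) N F = distr (completion M) N G"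
proof -
  interpret prob_space M using levy by (simp add: levy_process_def)
  interpret levy_setup M X t by unfold_locales (fact levy CD tpos)+
  have LU: "levy_seq M X t U (uniform_measure lborel {0<..<t})"
    by unfold_locales (fact U_meas U_iid U_unif | rule U_indep; assumption)+
  have LV: "levy_seq M X t V (uniform_measure lborel {0<..<1})"
    by unfold_locales (fact V_meas V_iid V_unif | rule V_indep; assumption)+
  interpret pitman M X t U V by (intro pitman.intro pitman_axioms.intro levy_setup_axioms LU LV)
  show ?thesis using main unfolding N_def F_def G_def trF_def[abs_def] trG_def[abs_def] Let_def .
qed

end
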